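(* Let $G=(V,E,F)$ be a simple planar graph that is connected, locally finite and satisfies $\kappa_V(G)\le0$. Then: (1) if $\kappa_V^G(v_n)\to-\infty$ for every sequence $(v_n)$ in $V$ with $v_n\to\infty$, then $\sigma_{\mathrm{ess}}(\tilde\Delta)=\{1\}$; (2) $\sigma_{\mathrm{ess}}(\Delta)=\emptyset$ if and only if $\kappa_V^G(v_n)\to-\infty$ for every sequence $(v_n)$ in $V$ with $v_n\to\infty$. Here $v_n\to\infty$ means that the sequence eventually leaves every finite subset of $V$.
   Context: Setting: $G=(V,E)$ is a connected graph embedded in $\mathbb R^2$, identified with its image; faces $F$ are the closures of the connected components of $\mathbb R^2\setminus\bigcup E$. Locally finite: every point has a neighbourhood meeting only finitely many edges; simple: no loops, no multiple edges. A walk is a finite or infinite sequence of edges whose curves can be concatenated to a curve; its length is its number of edges; a boundary walk of a face $f$ is a walk meeting all vertices of $f$ that is closed if finite. $|f|$ is the length of a shortest boundary walk if a finite one exists, else $\infty$ ($1/\infty=0$); $|v|$ is the number of edges at $v$. Corners are pairs $(v,f)$ with $v\in f$; $C_v(G)$ the corners at $v$; multiplicity $|(v,f)|$ is the minimal number of times a boundary walk of $f$ visits $v$. $\kappa_V^G(v)=1-\frac{|v|}{2}+\sum_{(v,f)\in C_v(G)}\frac{|(v,f)|}{|f|}$, $\kappa_V(G)=\sup_V\kappa_V^G$. Operators: $\Delta$ is the self-adjoint operator on $\ell^2(V)$ obtained as the (unique) self-adjoint extension of $(\Delta\varphi)(v)=\sum_{w\sim v}(\varphi(v)-\varphi(w))$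 defined on finitely supported functions; $\tilde\Delta$ is the bounded self-adjoint operator on $\ell^2(V,|\cdot|)=\{\varphi:\sum_v|v||\varphi(v)|^2<\infty\}$ given by $(\tilde\Delta\varphi)(v)=\frac1{|v|}\sum_{w\sim v}(\varphi(v)-\varphi(w))$. $\sigma_{\mathrm{ess}}$ denotes the essential spectrum. *)

theory Defs
  imports "HOL-Analysis.Analysis"
begin

(* The plane R^2 is represented by the type complex.  Vertices are points,
   edges are arcs (injective paths on [0,1]) between two distinct vertices. *)

type_synonym curve = "real \<Rightarrow> complex"

definition ends :: "curve \<Rightarrow> complex set" where
  "ends e = {pathstart e, pathfinish e}"

(* G = (V,E) embedded in the plane: edges are arcs joining vertices, an edge
   meets V only in its endpoints, distinct edges meet only in common endpoints *)
definition plane_graph :: "complex set \<Rightarrow> curve set \<Rightarrow> bool" where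
  "plane_graph V E \<longleftrightarrow>
     (\<forall>e\<in>E. arc e \<and> pathstart e \<in> V \<and> pathfinish e \<in> V) \<and>
     (\<forall>e\<in>E. \<forall>v\<in>V. v \<in> path_image e \<longrightarrow> v \<in> ends e) \<and>
     (\<forall>e\<in>E. \<forall>e'\<in>E. e \<noteq> e' \<longrightarrow> path_image e \<inter> path_image e' \<subseteq> ends e \<inter> ends e')"

(* simple: no loops, no multiple edges *)
definition simple_pg :: "curve set \<Rightarrow> bool" where
  "simple_pg E \<longleftrightarrow> (\<forall>e\<in>E. pathstart e \<noteq> pathfinish e) \<and>
     (\<forall>e\<in>E. \<forall>e'\<in>E. e \<noteq> e' \<longrightarrow> ends e \<noteq> ends e')"

(* locally finite: every point of the plane has a neighbourhood meeting only finitely many edges *)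
definition locally_finite_pg :: "curve set \<Rightarrow> bool" where
  "locally_finite_pg E \<longleftrightarrow>
     (\<forall>x::complex. \<exists>U. open U \<and> x \<in> U \<and> finite {e\<in>E. path_image e \<inter> U \<noteq> {}})"

definition adj :: "curve set \<Rightarrow> complex \<Rightarrow> complex \<Rightarrow> bool" where
  "adj E u w \<longleftrightarrow> (\<exists>e\<in>E. ends e = {u, w} \<and> u \<noteq> w)"

definition connected_graph :: "complex set \<Rightarrow> curve set \<Rightarrow> bool" where
  "connected_graph V E \<longleftrightarrow> V \<noteq> {} \<and>
     (\<forall>u\<in>V. \<forall>w\<in>V. (u, w) \<in> {(a, b). adj E a b}\<^sup>*)"

(* |v| : number of edges at v *)
definition deg :: "curve set \<Rightarrow> complex \<Rightarrow> nat" where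
  "deg E v = card {e\<in>E. v \<in> ends e}"

(* faces: closures of the connected components of R^2 minus the union of the edges *)
definition faces :: "curve set \<Rightarrow> complex set set" where
  "faces E = closure ` components (- (\<Union>e\<in>E. path_image e))"

(* finite closed boundary walk of face f, given by its vertex sequence
   xs = [x0, x1, ..., xn] with xn = x0 (n = number of edges >= 1); every
   edge of the walk is contained in f and the walk meets all vertices of f *)
definition fin_bwalk :: "complex set \<Rightarrow> curve set \<Rightarrow> complex set \<Rightarrow> complex list \<Rightarrow> bool" where
  "fin_bwalk V E f xs \<longleftrightarrow> length xs \<ge> 2 \<and> hd xs = last xs \<and>
     (\<forall>i < length xs - 1. \<exists>e\<in>E. ends e = {xs ! i, xs ! Suc i} \<and> path_image e \<subseteq> f) \<and>
     V \<inter> f \<subseteq> set xs"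

(* |f| when finite: length of a shortest finite boundary walk *)
definition face_len :: "complex set \<Rightarrow> curve set \<Rightarrow> complex set \<Rightarrow> nat" where
  "face_len V E f = (LEAST n. \<exists>xs. fin_bwalk V E f xs \<and> length xs = Suc n)"

(* |(v,f)| : minimal number of visits of v by a (finite closed) boundary walk *)
definition corner_mult :: "complex set \<Rightarrow> curve set \<Rightarrow> complex \<Rightarrow> complex set \<Rightarrow> nat" where
  "corner_mult V E v f = (LEAST k. \<exists>xs. fin_bwalk V E f xs \<and> count_list (tl xs) v = k)"

(* |(v,f)| / |f|, with 1/\<infinity> = 0 when f has no finite boundary walk *)
definition corner_term :: "complex set \<Rightarrow> curve set \<Rightarrow> complex \<Rightarrow> complex set \<Rightarrow> real" where
  "corner_term V E v f =
     (if \<exists>xs. fin_bwalk V E f xs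
      then real (corner_mult V E v f) / real (face_len V E f) else 0)"

(* vertex curvature kappa_V^G(v) *)
definition kappaV :: "complex set \<Rightarrow> curve set \<Rightarrow> complex \<Rightarrow> real" where
  "kappaV V E v = 1 - real (deg E v) / 2 +
     (\<Sum>f\<in>{f\<in>faces E. v \<in> f}. corner_term V E v f)"

(* ---------- weighted l^2 spaces over V and operators ---------- *)

(* l^2(V,m): functions vanishing outside V with sum_v m(v)|phi(v)|^2 < \<infinity> *)
definition ell2 :: "(complex \<Rightarrow> real) \<Rightarrow> complex set \<Rightarrow> (complex \<Rightarrow> complex) set" where
  "ell2 m V = {\<phi>. (\<forall>x. x \<notin> V \<longrightarrow> \<phi> x = 0) \<and> (\<lambda>x. m x * (cmod (\<phi> x))\<^sup>2) summable_on V}"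

definition ip :: "(complex \<Rightarrow> real) \<Rightarrow> complex set \<Rightarrow> (complex \<Rightarrow> complex) \<Rightarrow> (complex \<Rightarrow> complex) \<Rightarrow> complex" where
  "ip m V \<phi> \<psi> = infsum (\<lambda>x. complex_of_real (m x) * cnj (\<phi> x) * \<psi> x) V"

definition nrm :: "(complex \<Rightarrow> real) \<Rightarrow> complex set \<Rightarrow> (complex \<Rightarrow> complex) \<Rightarrow> real" where
  "nrm m V \<phi> = sqrt (infsum (\<lambda>x. m x * (cmod (\<phi> x))\<^sup>2) V)"

(* (D, A) is a (possibly unbounded) self-adjoint operator on l^2(V,m):
   D a dense linear subspace, A linear on D with values in l^2, A symmetric,
   and the domain of the adjoint is contained in D (so A* = A). *)
definition self_adjoint_op :: "(complex \<Rightarrow> real) \<Rightarrow> complex set \<Rightarrow> (complex \<Rightarrow> complex) set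
     \<Rightarrow> ((complex \<Rightarrow> complex) \<Rightarrow> (complex \<Rightarrow> complex)) \<Rightarrow> bool" where
  "self_adjoint_op m V D A \<longleftrightarrow>
     D \<subseteq> ell2 m V \<and> (\<lambda>_. 0) \<in> D \<and>
     (\<forall>\<phi>\<in>D. \<forall>\<psi>\<in>D. \<forall>c::complex. (\<lambda>x. \<phi> x + c * \<psi> x) \<in> D \<and>
         A (\<lambda>x. \<phi> x + c * \<psi> x) = (\<lambda>x. A \<phi> x + c * A \<psi> x)) \<and>
     (\<forall>\<phi>\<in>D. A \<phi> \<in> ell2 m V) \<and>
     (\<forall>\<phi>\<in>ell2 m V. \<forall>\<epsilon>>0. \<exists>\<psi>\<in>D. nrm m V (\<lambda>x. \<phi> x - \<psi> x) < \<epsilon>) \<and>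
     (\<forall>\<phi>\<in>D. \<forall>\<psi>\<in>D. ip m V (A \<phi>) \<psi> = ip m V \<phi> (A \<psi>)) \<and>
     (\<forall>\<psi>\<in>ell2 m V. (\<exists>\<eta>\<in>ell2 m V. \<forall>\<phi>\<in>D. ip m V (A \<phi>) \<psi> = ip m V \<phi> \<eta>) \<longrightarrow> \<psi> \<in> D)"

(* resolvent set: A - z is a bijection from D onto l^2 with bounded inverse *)
definition resolvent_set :: "(complex \<Rightarrow> real) \<Rightarrow> complex set \<Rightarrow> (complex \<Rightarrow> complex) set
     \<Rightarrow> ((complex \<Rightarrow> complex) \<Rightarrow> (complex \<Rightarrow> complex)) \<Rightarrow> complex set" where
  "resolvent_set m V D A = {z.
     (\<forall>\<phi>\<in>D. (\<lambda>x. A \<phi> x - z * \<phi> x) = (\<lambda>_. 0) \<longrightarrow> \<phi> = (\<lambda>_. 0)) \<and>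
     (\<forall>\<eta>\<in>ell2 m V. \<exists>\<phi>\<in>D. (\<lambda>x. A \<phi> x - z * \<phi> x) = \<eta>) \<and>
     (\<exists>C. \<forall>\<phi>\<in>D. nrm m V \<phi> \<le> C * nrm m V (\<lambda>x. A \<phi> x - z * \<phi> x))}"

definition spectrum_op where
  "spectrum_op m V D A = - resolvent_set m V D A"

definition eigenspace_op where
  "eigenspace_op m V D A z = {\<phi>\<in>D. A \<phi> = (\<lambda>x. z * \<phi> x)}"

definition finite_dim_fs :: "(complex \<Rightarrow> complex) set \<Rightarrow> bool" where
  "finite_dim_fs S \<longleftrightarrow> (\<exists>B. finite B \<and> B \<subseteq> S \<and>
      (\<forall>\<phi>\<in>S. \<exists>c. \<phi> = (\<lambda>x. \<Sum>b\<in>B. c b * b x)))"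

(* discrete spectrum: isolated points of the spectrum that are eigenvalues of finite multiplicity *)
definition discrete_spectrum where
  "discrete_spectrum m V D A = {z\<in>spectrum_op m V D A.
      \<not> z islimpt spectrum_op m V D A \<and>
      eigenspace_op m V D A z \<noteq> {(\<lambda>_. 0)} \<and> finite_dim_fs (eigenspace_op m V D A z)}"

definition ess_spectrum where
  "ess_spectrum m V D A = spectrum_op m V D A - discrete_spectrum m V D A"

(* formal Laplacian and normalized Laplacian *)
definition lap :: "complex set \<Rightarrow> curve set \<Rightarrow> (complex \<Rightarrow> complex) \<Rightarrow> complex \<Rightarrow> complex" where
  "lap V E \<phi> = (\<lambda>v. if v \<in> V then (\<Sum>w\<in>{w. adj E v w}. \<phi> v - \<phi> w) else 0)"

definition nlap :: "complex set \<Rightarrow> curve set \<Rightarrow> (complex \<Rightarrow> complex) \<Rightarrow> complex \<Rightarrow> complex" where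
  "nlap V E \<phi> = (\<lambda>v. if v \<in> V then (\<Sum>w\<in>{w. adj E v w}. \<phi> v - \<phi> w) / of_nat (deg E v) else 0)"

definition fin_supp :: "complex set \<Rightarrow> (complex \<Rightarrow> complex) set" where
  "fin_supp V = {\<phi>. finite {x. \<phi> x \<noteq> 0} \<and> {x. \<phi> x \<noteq> 0} \<subseteq> V}"

(* (D,A) is the self-adjoint extension of the Laplacian defined on finitely supported functions *)
definition laplacian_sa :: "complex set \<Rightarrow> curve set \<Rightarrow> (complex \<Rightarrow> complex) set
     \<Rightarrow> ((complex \<Rightarrow> complex) \<Rightarrow> (complex \<Rightarrow> complex)) \<Rightarrow> bool" where
  "laplacian_sa V E D A \<longleftrightarrow> self_adjoint_op (\<lambda>_. 1) V D A \<and> fin_supp V \<subseteq> D \<and>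
      (\<forall>\<phi>\<in>fin_supp V. A \<phi> = lap V E \<phi>)"

(* v_n \<rightarrow> \<infinity>: eventually leaves every finite subset of V *)
definition tends_to_infty :: "complex set \<Rightarrow> (nat \<Rightarrow> complex) \<Rightarrow> bool" where
  "tends_to_infty V vs \<longleftrightarrow> (\<forall>n. vs n \<in> V) \<and>
     (\<forall>K. finite K \<longrightarrow> (\<forall>\<^sub>F n in sequentially. vs n \<notin> K))"

end

theory Submission
  imports Defs "HOL-Complex_Analysis.Great_Picard"
begin

text \<open>
  A boundary walk of a face \<open>f\<close> must visit \<open>v\<close> at least once for every component of the boundary graph
  of \<open>f\<close> minus \<open>v\<close>, and since no face touches all three arcs of a theta graph this bound is attained
  by one optimal walk. Hence the multiplicities of the corners at \<open>v\<close> add up to at most \<open>|v|\<close>, all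
  faces have length at least three, and \<open>1 - |v|/2 \<le> \<kappa>(v) \<le> 1 - |v|/6\<close>. So \<open>\<kappa> \<rightarrow> -\<infinity>\<close> means that the degrees
  tend to infinity. Euler's inequality gives finite graphs positive total curvature, so \<open>V\<close> is infinite,
  and it gives every finite \<open>W \<subseteq> V\<close> a vertex with at most five neighbours in \<open>W\<close>. Removing such
  vertices one by one shows, for every \<open>\<lambda> > 0\<close>, that the adjacency form on \<open>W\<close> is bounded by
  \<open>5 \<lambda> \<Sum>|\<phi>|\<^sup>2 + (1/\<lambda>) \<Sum> deg |\<phi>|\<^sup>2\<close>.

  If the degrees tend to infinity, this makes the averaging operator, which is one minus the normalized
  Laplacian, compact, and it bounds \<open>\<Sum> deg |\<phi>|\<^sup>2\<close> by the form of the Laplacian, whose domain therefore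
  embeds compactly. If infinitely many vertices have bounded degree, their delta functions form
  a weakly null sequence with bounded images, which is impossible for an operator with discrete spectrum.
\<close>

section \<open>Arcs and faces in the plane\<close>

text \<open>Multiplicities and the length of a face are separate minima over walks. A walk that is
  minimal at all vertices at once makes the multiplicities around a face add up to its length; then
  every face contributes exactly 1 to the total curvature of a finite graph, and Euler's inequality
  applies. Besides that inequality, planarity enters through three facts: no face touches all three
  arcs of a theta, no edge borders three faces, and an edge that alone attaches a piece of a face
  boundary borders only one face. The last two give the bound by \<open>|v|\<close>: each component
  at \<open>v\<close> receives at least two half edges or one undivided edge. Faces of length at
  least 3 then give \<open>1 - d/2 + d/3\<close>, so positive curvature forces \<open>d < 6\<close>,
  hence the 5. On the analytic side \<open>(D, A)\<close> may be any self-adjoint extension, while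
  the form bound is computed on finitely supported functions. It reaches \<open>D\<close> because
  these form a core. Spectra are handled by approximate eigenvectors and by extremal values of
  \<open>norm (T x)\<close>, in place of a spectral theorem.\<close>

lemma connected_subset_disjoint_opens:
  "connected U \<Longrightarrow> open A \<Longrightarrow> open B \<Longrightarrow> A \<inter> B = {} \<Longrightarrow> U \<subseteq> A \<union> B \<Longrightarrow> U \<subseteq> A \<or> U \<subseteq> B"
  using connectedD[of U A B] by blast

text \<open>The Jordan curve theorem for the loop along \<open>c\<close> and back along
  \<open>d\<close>.\<close>

lemma jordan_two_arcs:
  fixes c d :: "real \<Rightarrow> complex"
  assumes "arc c" "arc d" "pathstart c = a" "pathfinish c = b" "pathstart d = a" "pathfinish d = b"
    and "path_image c \<inter> path_image d = {a,b}"
  shows "open (inside (path_image c \<union> path_image d))"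
    "connected (inside (path_image c \<union> path_image d))"
    "inside (path_image c \<union> path_image d) \<noteq> {}"
    "open (outside (path_image c \<union> path_image d))"
    "connected (outside (path_image c \<union> path_image d))"
    "\<not> bounded (outside (path_image c \<union> path_image d))"
    "frontier (inside (path_image c \<union> path_image d)) = path_image c \<union> path_image d"
    "frontier (outside (path_image c \<union> path_image d)) = path_image c \<union> path_image d"
    "inside (path_image c \<union> path_image d) \<union> outside (path_image c \<union> path_image d) = - (path_image c \<union> path_image d)"
    "inside (path_image c \<union> path_image d) \<inter> outside (path_image c \<union> path_image d) = {}"
proof -
  let ?g = "c +++ reversepath d"
  have "simple_path ?g"
    using assms by (subst simple_path_join_loop_eq) (auto simp: arc_reversepath)
  moreover have "pathfinish ?g = pathstart ?g" using assms by simp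
  moreover have "path_image ?g = path_image c \<union> path_image d" using assms by (simp add: path_image_join)
  ultimately show "open (inside (path_image c \<union> path_image d))"
    "connected (inside (path_image c \<union> path_image d))"
    "inside (path_image c \<union> path_image d) \<noteq> {}"
    "open (outside (path_image c \<union> path_image d))"
    "connected (outside (path_image c \<union> path_image d))"
    "\<not> bounded (outside (path_image c \<union> path_image d))"
    "frontier (inside (path_image c \<union> path_image d)) = path_image c \<union> path_image d"
    "frontier (outside (path_image c \<union> path_image d)) = path_image c \<union> path_image d"
    "inside (path_image c \<union> path_image d) \<union> outside (path_image c \<union> path_image d) = - (path_image c \<union> path_image d)"
    "inside (path_image c \<union> path_image d) \<inter> outside (path_image c \<union> path_image d) = {}"
    using Jordan_inside_outside[of ?g] by auto
qed

lemma arc_endless_connected: "arc c \<Longrightarrow> connected (path_image c - {pathstart c, pathfinish c})"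
  by (simp add: arc_imp_simple_path connected_simple_path_endless)

lemma arc_endless_nonempty: "arc c \<Longrightarrow> path_image c - {pathstart c, pathfinish c} \<noteq> {}"
  by (meson arc_imp_simple_path nonempty_simple_path_endless)

section \<open>Plane theta graphs and their faces\<close>

definition theta :: "complex \<Rightarrow> complex \<Rightarrow> (real \<Rightarrow> complex) \<Rightarrow> (real \<Rightarrow> complex) \<Rightarrow> (real \<Rightarrow> complex) \<Rightarrow> bool" where
  "theta a b c1 c2 c3 \<longleftrightarrow> arc c1 \<and> arc c2 \<and> arc c3 \<and>
     pathstart c1 = a \<and> pathfinish c1 = b \<and> pathstart c2 = a \<and> pathfinish c2 = b \<and>
     pathstart c3 = a \<and> pathfinish c3 = b \<and>
     path_image c1 \<inter> path_image c2 = {a,b} \<and> path_image c1 \<inter> path_image c3 = {a,b} \<and>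
     path_image c2 \<inter> path_image c3 = {a,b}"

lemma theta_perm: "theta a b c1 c2 c3 \<Longrightarrow> theta a b c2 c3 c1" "theta a b c1 c2 c3 \<Longrightarrow> theta a b c1 c3 c2"
  by (auto simp: theta_def)

text \<open>The third arc cuts the inside of the circle formed by the first two into the insides of
  the two smaller circles. A connected set that avoids the theta lies in one half, whose closure
  misses the interior of the opposite arc, or outside the big circle, where its closure misses the
  interior of the third arc.\<close>

lemma theta_face_inside:
  assumes th: "theta a b c1 c2 c3"
    and ins: "path_image c3 \<inter> inside (path_image c1 \<union> path_image c2) \<noteq> {}"
    and U: "connected U" "U \<inter> (path_image c1 \<union> path_image c2 \<union> path_image c3) = {}"
    and cl: "closure U \<inter> (path_image c1 - {a,b}) \<noteq> {}" "closure U \<inter> (path_image c2 - {a,b}) \<noteq> {}"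
      "closure U \<inter> (path_image c3 - {a,b}) \<noteq> {}"
  shows False
proof -
  let ?C1 = "path_image c1" and ?C2 = "path_image c2" and ?C3 = "path_image c3"
  note t = th[unfolded theta_def]
  have ab: "a \<noteq> b" using t arc_distinct_ends by metis
  obtain e: "inside (?C1 \<union> ?C3) \<inter> inside (?C2 \<union> ?C3) = {}"
     and s: "inside (?C1 \<union> ?C3) \<union> inside (?C2 \<union> ?C3) \<union> (?C3 - {a,b}) = inside (?C1 \<union> ?C2)"
    by (rule split_inside_simple_closed_curve[of c1 a b c2 c3]) (use t ab ins arc_imp_simple_path in auto)
  have arcs: "arc c1" "arc c2" "arc c3" and ps: "pathstart c1 = a" "pathstart c2 = a" "pathstart c3 = a"
    and pf: "pathfinish c1 = b" "pathfinish c2 = b" "pathfinish c3 = b"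
    and i12: "?C1 \<inter> ?C2 = {a,b}" and i13: "?C1 \<inter> ?C3 = {a,b}" and i23: "?C2 \<inter> ?C3 = {a,b}"
    using th by (simp_all add: theta_def)
  note j12 = jordan_two_arcs[OF arcs(1,2) ps(1) pf(1) ps(2) pf(2) i12]
    and j13 = jordan_two_arcs[OF arcs(1,3) ps(1) pf(1) ps(3) pf(3) i13]
    and j23 = jordan_two_arcs[OF arcs(2,3) ps(2) pf(2) ps(3) pf(3) i23]
  have "U \<subseteq> inside (?C1 \<union> ?C2) \<or> U \<subseteq> outside (?C1 \<union> ?C2)"
    by (rule connected_subset_disjoint_opens[OF U(1)]) (use j12 t U(2) in auto)
  then show False
  proof
    assume "U \<subseteq> outside (?C1 \<union> ?C2)"
    then have "closure U \<inter> inside (?C1 \<union> ?C2) = {}"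
      using j12(1,10) t by (metis (no_types, lifting) Int_commute disjoint_iff open_Int_closure_eq_empty subset_iff)
    then show False using cl(3) s by blast
  next
    assume *: "U \<subseteq> inside (?C1 \<union> ?C2)"
    then have "U \<subseteq> inside (?C1 \<union> ?C3) \<union> inside (?C2 \<union> ?C3)" using s U(2) by blast
    then have "U \<subseteq> inside (?C1 \<union> ?C3) \<or> U \<subseteq> inside (?C2 \<union> ?C3)"
      by (intro connected_subset_disjoint_opens[OF U(1)]) (use j13(1) j23(1) t e in auto)
    then show False
    proof
      assume "U \<subseteq> inside (?C1 \<union> ?C3)"
      then have "closure U \<subseteq> inside (?C1 \<union> ?C3) \<union> (?C1 \<union> ?C3)"
        using j13(7) t by (metis closure_Un_frontier closure_mono)
      moreover have "inside (?C1 \<union> ?C3) \<inter> ?C2 = {}"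
        using s inside_no_overlap[of "?C1 \<union> ?C2"] by blast
      ultimately show False using cl(2) t by auto
    next
      assume "U \<subseteq> inside (?C2 \<union> ?C3)"
      then have "closure U \<subseteq> inside (?C2 \<union> ?C3) \<union> (?C2 \<union> ?C3)"
        using j23(7) t by (metis closure_Un_frontier closure_mono)
      moreover have "inside (?C2 \<union> ?C3) \<inter> ?C1 = {}"
        using s inside_no_overlap[of "?C1 \<union> ?C2"] by blast
      ultimately show False using cl(1) t by auto
    qed
  qed
qed

text \<open>Otherwise the inside of \<open>c2\<close> and \<open>c3\<close> is disjoint from the two
  other insides, so a point of it can escape to infinity past each of the two circles through
  \<open>c1\<close>. These circles meet in the connected set \<open>c1\<close>, so by Janiszewski's
  theorem the point escapes past the whole theta, which is absurd.\<close>

lemma theta_some_inside: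
  assumes th: "theta a b c1 c2 c3"
  shows "path_image c3 \<inter> inside (path_image c1 \<union> path_image c2) \<noteq> {} \<or>
         path_image c1 \<inter> inside (path_image c2 \<union> path_image c3) \<noteq> {} \<or>
         path_image c2 \<inter> inside (path_image c1 \<union> path_image c3) \<noteq> {}"
proof (rule ccontr)
  let ?C1 = "path_image c1" and ?C2 = "path_image c2" and ?C3 = "path_image c3"
  assume "\<not> ?thesis"
  then have n: "?C3 \<inter> inside (?C1 \<union> ?C2) = {}" "?C1 \<inter> inside (?C2 \<union> ?C3) = {}" "?C2 \<inter> inside (?C1 \<union> ?C3) = {}"
    by auto
  note t = th[unfolded theta_def]
  have arcs: "arc c1" "arc c2" "arc c3" and ps: "pathstart c1 = a" "pathstart c2 = a" "pathstart c3 = a"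
    and pf: "pathfinish c1 = b" "pathfinish c2 = b" "pathfinish c3 = b"
    and i12: "?C1 \<inter> ?C2 = {a,b}" and i13: "?C1 \<inter> ?C3 = {a,b}" and i23: "?C2 \<inter> ?C3 = {a,b}"
    using th by (simp_all add: theta_def)
  note j12 = jordan_two_arcs[OF arcs(1,2) ps(1) pf(1) ps(2) pf(2) i12]
    and j13 = jordan_two_arcs[OF arcs(1,3) ps(1) pf(1) ps(3) pf(3) i13]
    and j23 = jordan_two_arcs[OF arcs(2,3) ps(2) pf(2) ps(3) pf(3) i23]
  have ne1: "?C1 - {a,b} \<noteq> {}" "?C2 - {a,b} \<noteq> {}" "?C3 - {a,b} \<noteq> {}"
    using arc_endless_nonempty[OF arcs(1)] arc_endless_nonempty[OF arcs(2)] arc_endless_nonempty[OF arcs(3)]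
    unfolding ps pf .
  \<comment> \<open>Two connected regions that overlap, neither meeting the frontier of the other,
    contain each other; equal regions have equal frontiers.\<close>
  have key: "inside P \<inter> inside Q = {}" if "connected (inside P)" "connected (inside Q)"
      "frontier (inside P) = P" "frontier (inside Q) = Q" "P \<noteq> Q" "inside P \<inter> Q = {}" "inside Q \<inter> P = {}" for P Q :: "complex set"
  proof (rule ccontr)
    assume ne: "inside P \<inter> inside Q \<noteq> {}"
    have "inside P - inside Q = {}"
      using connected_Int_frontier[of "inside P" "inside Q"] that ne by metis
    moreover have "inside Q - inside P = {}"
      using connected_Int_frontier[of "inside Q" "inside P"] that ne by (metis Int_commute)
    ultimately have "inside P = inside Q" by blast
    then show False using that by metis
  qed
  note io = inside_no_overlap[of "?C1 \<union> ?C2"] inside_no_overlap[of "?C2 \<union> ?C3"] inside_no_overlap[of "?C1 \<union> ?C3"]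
  have neq12: "?C2 \<union> ?C3 \<noteq> ?C1 \<union> ?C2" and neq13: "?C2 \<union> ?C3 \<noteq> ?C1 \<union> ?C3" using ne1 i12 i13 by blast+
  obtain x where x: "x \<in> inside (?C2 \<union> ?C3)" using j23(3) by blast
  have d12: "inside (?C2 \<union> ?C3) \<inter> inside (?C1 \<union> ?C2) = {}"
  proof (rule key[OF _ _ _ _ neq12])
    show "inside (?C2 \<union> ?C3) \<inter> (?C1 \<union> ?C2) = {}" "inside (?C1 \<union> ?C2) \<inter> (?C2 \<union> ?C3) = {}"
      using n io by blast+
  qed (use j12(2,7) j23(2,7) in simp_all)
  have d13: "inside (?C2 \<union> ?C3) \<inter> inside (?C1 \<union> ?C3) = {}"
  proof (rule key[OF _ _ _ _ neq13])
    show "inside (?C2 \<union> ?C3) \<inter> (?C1 \<union> ?C3) = {}" "inside (?C1 \<union> ?C3) \<inter> (?C2 \<union> ?C3) = {}"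
      using n io by blast+
  qed (use j13(2,7) j23(2,7) in simp_all)
  have "bounded (?C1 \<union> ?C2 \<union> ?C3)" using arcs by (simp add: bounded_arc_image)
  then obtain r where r: "?C1 \<union> ?C2 \<union> ?C3 \<subseteq> ball 0 r" using bounded_subset_ballD by blast
  have far: "y \<in> outside P" if "P \<subseteq> ?C1 \<union> ?C2 \<union> ?C3" "y \<notin> ball 0 r" for P y
  proof -
    have "y \<in> outside (ball 0 r)" using that by (simp add: outside_convex)
    then show ?thesis using that r outside_mono[of P "ball 0 r"] by blast
  qed
  define y where "y = complex_of_real \<bar>r\<bar>"
  have y: "y \<notin> ball 0 r" by (simp add: y_def)
  have x12: "x \<in> outside (?C1 \<union> ?C2)"
    using x d12 n inside_no_overlap[of "?C2 \<union> ?C3"] inside_Un_outside[of "?C1 \<union> ?C2"] by blast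
  have x13: "x \<in> outside (?C1 \<union> ?C3)"
    using x d13 n inside_no_overlap[of "?C2 \<union> ?C3"] inside_Un_outside[of "?C1 \<union> ?C3"] by blast
  have cc: "connected_component (- P) x y" if "x \<in> outside P" "y \<in> outside P" "connected (outside P)" for P
    using that outside_no_overlap[of P] unfolding connected_component_def by blast
  have "connected_component (- ((?C1 \<union> ?C2) \<union> (?C1 \<union> ?C3))) x y"
  proof (rule Janiszewski)
    show "compact (?C1 \<union> ?C2)" "closed (?C1 \<union> ?C3)" using arcs by (simp_all add: compact_Un closed_Un compact_arc_image closed_arc_image)
    have "(?C1 \<union> ?C2) \<inter> (?C1 \<union> ?C3) = ?C1" using i12 i23 by blast
    then show "connected ((?C1 \<union> ?C2) \<inter> (?C1 \<union> ?C3))" using arcs by (simp add: connected_arc_image)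
    show "connected_component (- (?C1 \<union> ?C2)) x y" using cc[OF x12 far[OF _ y]] j12(5) by blast
    show "connected_component (- (?C1 \<union> ?C3)) x y" using cc[OF x13 far[OF _ y]] j13(5) by blast
  qed
  then have "connected_component (- (?C2 \<union> ?C3)) x y"
    by (rule connected_component_of_subset) auto
  then obtain Z where Z: "connected Z" "Z \<subseteq> - (?C2 \<union> ?C3)" "x \<in> Z" "y \<in> Z" unfolding connected_component_def by blast
  have yo: "y \<in> outside (?C2 \<union> ?C3)" by (rule far[OF _ y]) auto
  show False
  proof -
    have "Z \<subseteq> inside (?C2 \<union> ?C3) \<or> Z \<subseteq> outside (?C2 \<union> ?C3)"
      by (rule connected_subset_disjoint_opens[OF Z(1)]) (use j23(1,4,9,10) Z(2) in auto)
    then show False using x yo Z(3,4) j23(10) by blast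
  qed
qed

text \<open>Some arc runs inside the circle of the other two, and a permutation makes it the third.
  The lemma serves twice: to bound the number of faces along an edge, and to exclude theta subgraphs
  in face boundaries.\<close>

lemma theta_face:
  assumes th: "theta a b c1 c2 c3"
    and U: "connected U" "U \<inter> (path_image c1 \<union> path_image c2 \<union> path_image c3) = {}"
    and cl: "closure U \<inter> (path_image c1 - {a,b}) \<noteq> {}" "closure U \<inter> (path_image c2 - {a,b}) \<noteq> {}"
      "closure U \<inter> (path_image c3 - {a,b}) \<noteq> {}"
  shows False
proof -
  have U': "U \<inter> (path_image c2 \<union> path_image c3 \<union> path_image c1) = {}" "U \<inter> (path_image c1 \<union> path_image c3 \<union> path_image c2) = {}"
    using U(2) by auto
  show False
    using theta_some_inside[OF th] theta_face_inside[OF th _ U cl]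
      theta_face_inside[OF theta_perm(1)[OF th] _ U(1) U'(1) cl(2,3,1)]
      theta_face_inside[OF theta_perm(2)[OF th] _ U(1) U'(2) cl(1,3,2)] by blast
qed

section \<open>How faces touch an edge\<close>

lemma interior_arc_image:
  fixes g :: "real \<Rightarrow> complex"
  assumes g: "arc g"
  shows "interior (path_image g) = {}"
proof (rule ccontr)
  assume ne: "interior (path_image g) \<noteq> {}"
  obtain h where h: "homeomorphism {0..1} (path_image g) g h"
    using g homeomorphism_arc by blast
  \<comment> \<open>The inverse of \<open>g\<close> would embed an open set of the plane into the
    line.\<close>
  have "DIM(complex) \<le> DIM(real)"
  proof (rule invariance_of_dimension)
    show "continuous_on (interior (path_image g)) h"
      using h interior_subset continuous_on_subset unfolding homeomorphism_def by blast
    show "inj_on h (interior (path_image g))"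
      using h interior_subset[of "path_image g"] unfolding homeomorphism_def inj_on_def by (metis subsetD)
  qed (use ne in auto)
  then show False by simp
qed

text \<open>Suppose the face misses a point of the edge, hence a whole stretch of it. Each of the
  two remaining end pieces meets \<open>X\<close> in at most one point, so by Janiszewski's theorem
  adding them to \<open>X\<close> does not separate \<open>U\<close> from a point beside the bare
  stretch. A connected set joining the two meets the frontier of \<open>U\<close>, and this can only
  happen on the stretch, which \<open>U\<close> does not touch.\<close>

lemma edge_subset_closure:
  fixes g :: "real \<Rightarrow> complex"
  assumes X: "closed X" and g: "arc g" and Xg: "path_image g \<inter> X \<subseteq> {pathstart g, pathfinish g}"
    and U: "U \<in> components (- (X \<union> path_image g))"
    and p: "p \<in> path_image g" "p \<noteq> pathstart g" "p \<noteq> pathfinish g" "p \<in> closure U"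
  shows "path_image g \<subseteq> closure U"
proof (rule ccontr)
  assume "\<not> ?thesis"
  then obtain s where s: "s \<in> {0..1}" "g s \<notin> closure U" unfolding path_image_def by blast
  have cg: "continuous_on {0..1} g" and inj: "inj_on g {0..1}" using g by (auto simp: arc_def path_def)
  have "\<exists>e>0. ball (g s) e \<inter> closure U = {}"
    using s(2) closed_closure[of U] by (metis Compl_iff closed_def disjoint_eq_subset_Compl open_contains_ball)
  then obtain e where e: "e > 0" "ball (g s) e \<inter> closure U = {}" by blast
  obtain d where d: "d > 0" "\<And>r. r \<in> {0..1} \<Longrightarrow> dist r s < d \<Longrightarrow> dist (g r) (g s) < e"
    using cg s(1) e(1) unfolding continuous_on_iff by meson
  have d': "g r \<notin> closure U" if "r \<in> {0..1}" "\<bar>r - s\<bar> < d" for r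
    using d(2)[OF that(1)] that(2) e(2) by (force simp: dist_commute dist_real_def)
  define h where "h = min d (1/2)"
  have h: "0 < h" "h \<le> d" "h \<le> 1/2" using d(1) by (auto simp: h_def)
  \<comment> \<open>The stretch has to avoid both ends of the parameter interval; as
    \<open>s\<close> may be 0 or 1, it is placed to the right or to the left of
    \<open>s\<close>.\<close>
  obtain q1 q2 where q: "0 < q1" "q1 < q2" "q2 < 1" and sq: "\<And>r. q1 \<le> r \<Longrightarrow> r \<le> q2 \<Longrightarrow> g r \<notin> closure U"
  proof (cases "s \<le> 1/2")
    case True
    show ?thesis
    proof (rule that[of "s + h/4" "s + h/2"])
      show "g r \<notin> closure U" if "s + h/4 \<le> r" "r \<le> s + h/2" for r
        by (rule d') (use that True s h in auto)
    qed (use True s h in auto)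
  next
    case False
    show ?thesis
    proof (rule that[of "s - h/2" "s - h/4"])
      show "g r \<notin> closure U" if "s - h/2 \<le> r" "r \<le> s - h/4" for r
        by (rule d') (use that False s h in auto)
    qed (use False s h in auto)
  qed
  define A1 where "A1 = g ` {0..q1}"
  define A2 where "A2 = g ` {q2..1}"
  have A1: "A1 = path_image (subpath 0 q1 g)" and A2: "A2 = path_image (subpath q2 1 g)"
    using q by (auto simp: A1_def A2_def path_image_subpath)
  have arcs: "arc (subpath 0 q1 g)" "arc (subpath q2 1 g)"
    using q by (auto intro!: arc_subpath_arc g)
  have cA: "compact A1" "compact A2" "closed A1" "closed A2" using arcs by (simp_all add: A1 A2 compact_arc_image closed_arc_image)
  have g0: "g 0 = pathstart g" and g1: "g 1 = pathfinish g" by (auto simp: pathstart_def pathfinish_def)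
  have gi: "u = v" if "g u = g v" "0 \<le> u" "u \<le> 1" "0 \<le> v" "v \<le> 1" for u v
    using inj_onD[OF inj that(1)] that by simp
  have gX: "g u \<notin> X" if "0 < u" "u < 1" for u
  proof
    assume "g u \<in> X"
    moreover have "g u \<in> path_image g" using that by (simp add: path_image_def)
    ultimately have "g u = g 0 \<or> g u = g 1" using Xg by (auto simp: g0 g1)
    then show False using gi[of u 0] gi[of u 1] that by auto
  qed
  have iA: "A1 \<inter> A2 = {}"
  proof -
    have "g u \<noteq> g v" if "u \<in> {0..q1}" "v \<in> {q2..1}" for u v using gi[of u v] q that by auto
    then show ?thesis unfolding A1_def A2_def by blast
  qed
  have A1X: "A1 \<inter> X \<subseteq> {g 0}"
  proof -
    have "u = 0" if "u \<in> {0..q1}" "g u \<in> X" for u using gX[of u] q that by force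
    then show ?thesis unfolding A1_def by blast
  qed
  have A2X: "A2 \<inter> X \<subseteq> {g 1}"
  proof -
    have "u = 1" if "u \<in> {q2..1}" "g u \<in> X" for u using gX[of u] q that by force
    then show ?thesis unfolding A2_def by blast
  qed
  have con1: "connected (S \<inter> T)" if "S \<inter> T \<subseteq> {x}" for S T :: "complex set" and x
    using that by (metis connected_empty connected_sing subset_singletonD)
  define q where "q = (q1+q2)/2"
  have q': "q1 < q" "q < q2" using \<open>q1 < q2\<close> by (auto simp: q_def)
  have gq: "g q \<notin> X \<union> A1 \<union> A2 \<union> closure U"
  proof -
    have "g q \<noteq> g u" if "u \<in> {0..q1} \<union> {q2..1}" for u using gi[of q u] \<open>0 < q1\<close> \<open>q2 < 1\<close> q' that by auto
    then have "g q \<notin> A1" "g q \<notin> A2" unfolding A1_def A2_def by blast+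
    moreover have "g q \<notin> X" using gX[of q] \<open>0 < q1\<close> \<open>q2 < 1\<close> q' by simp
    ultimately show ?thesis using sq[of q] q' by auto
  qed
  have "open (- (X \<union> A1 \<union> A2 \<union> closure U))" using X cA by auto
  then obtain r where r: "r > 0" "ball (g q) r \<subseteq> - (X \<union> A1 \<union> A2 \<union> closure U)"
    using gq open_contains_ball by (metis ComplI)
  define B where "B = ball (g q) r"
  define Y where "Y = path_image g - {pathstart g, pathfinish g}"
  have qY: "g q \<in> Y" using gi[of q 0] gi[of q 1] \<open>0 < q1\<close> \<open>q2 < 1\<close> q' unfolding Y_def path_image_def g0[symmetric] g1[symmetric] by auto
  \<comment> \<open>An arc has no interior, so the ball around a point of the bare stretch contains
    a point \<open>b\<close> off the edge, and \<open>b\<close> is outside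
    \<open>closure U\<close>.\<close>
  have "interior (path_image g) = {}" using interior_arc_image[OF g] by simp
  then have "\<not> B \<subseteq> path_image g"
    using r(1) interior_maximal[of B "path_image g"] by (auto simp: B_def)
  then obtain b where b: "b \<in> B" "b \<notin> path_image g" by blast
  obtain a where a: "a \<in> U" using U in_components_nonempty by blast
  have Usub: "U \<subseteq> - (X \<union> path_image g)" using U by (rule in_components_subset)
  have cU: "connected U" using U by (rule in_components_connected)
  have cUp: "connected (insert p U)"
    by (rule connected_intermediate_closure[OF cU]) (use p closure_subset in auto)
  have cUY: "connected (insert p U \<union> Y)"
    by (rule connected_Un[OF cUp]) (use p arc_endless_connected[OF g] in \<open>auto simp: Y_def\<close>)
  have cUYB: "connected ((insert p U \<union> Y) \<union> B)"
    by (rule connected_Un[OF cUY]) (use qY r(1) in \<open>auto simp: B_def\<close>)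
  have "(insert p U \<union> Y) \<union> B \<subseteq> - X" using Usub p Xg r(2) by (auto simp: Y_def B_def)
  then have ccX: "connected_component (- X) a b"
    unfolding connected_component_def using cUYB a b by blast
  have ab: "a \<notin> path_image g" "b \<notin> path_image g" using a b Usub by auto
  have A12: "A1 \<subseteq> path_image g" "A2 \<subseteq> path_image g" using q \<open>q1 < q2\<close> \<open>0 < q1\<close> \<open>q2 < 1\<close> unfolding A1_def A2_def path_image_def by (intro image_mono; auto)+
  have ccA: "connected_component (- A1) a b" "connected_component (- A2) a b"
    unfolding connected_component_def
    using connected_arc_complement[OF arcs(1)] connected_arc_complement[OF arcs(2)] ab A12 A1 A2 by auto
  have "connected_component (- (A1 \<union> X)) a b"
    by (rule Janiszewski[OF cA(1) X con1[OF A1X] ccA(1) ccX])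
  then have "connected_component (- (A2 \<union> (A1 \<union> X))) a b"
    using cA X A2X iA by (intro Janiszewski[OF _ _ con1[of _ _ "g 1"] ccA(2)]) auto
  then obtain Z where Z: "connected Z" "Z \<subseteq> - (A2 \<union> (A1 \<union> X))" "a \<in> Z" "b \<in> Z"
    unfolding connected_component_def by blast
  have "b \<notin> U" using b(1) r(2) closure_subset[of U] unfolding B_def by blast
  then have "Z \<inter> frontier U \<noteq> {}" using connected_Int_frontier[OF Z(1)] Z a by blast
  then obtain z where z: "z \<in> Z" "z \<in> frontier U" by blast
  have "closed (X \<union> path_image g)" using X g by (simp add: closed_Un closed_arc_image)
  then have "frontier U \<subseteq> X \<union> path_image g" using U frontier_of_components_closed_complement by blast
  then obtain t where t: "t \<in> {0..1}" "z = g t" using z Z(2) unfolding path_image_def by blast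
  then have "q1 \<le> t" "t \<le> q2" using z Z(2) by (force simp: A1_def A2_def)+
  then show False using sq[of t] t z by (auto simp: frontier_def)
qed

text \<open>Move straight from a point of \<open>W\<close> near \<open>g t\<close> towards
  \<open>g t\<close> and stop at the first point of the closed set. The ball excludes
  \<open>X\<close> and the distant part of the edge, so this point is on the edge with a parameter
  near \<open>t\<close>; which one it is cannot be prescribed.\<close>

lemma access_arc:
  fixes g :: "real \<Rightarrow> complex"
  assumes X: "closed X" and g: "arc g" and Xg: "path_image g \<inter> X \<subseteq> {pathstart g, pathfinish g}"
    and W: "W \<in> components (- (X \<union> path_image g))"
    and t: "0 < t" "t < 1" "g t \<in> closure W" and e: "e > 0"
  obtains t' w where "\<bar>t' - t\<bar> < e" "0 < t'" "t' < 1" "w \<in> W" "closed_segment w (g t') - {g t'} \<subseteq> W"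
proof -
  have cg: "continuous_on {0..1} g" and inj: "inj_on g {0..1}" using g by (auto simp: arc_def path_def)
  have g0: "g 0 = pathstart g" and g1: "g 1 = pathfinish g" by (auto simp: pathstart_def pathfinish_def)
  have gi: "u = v" if "g u = g v" "0 \<le> u" "u \<le> 1" "0 \<le> v" "v \<le> 1" for u v
    using inj_onD[OF inj that(1)] that by simp
  define d where "d = min e (min t (1 - t))"
  have d: "0 < d" "d \<le> e" "d \<le> t" "d \<le> 1 - t" using t e by (auto simp: d_def)
  define R where "R = {0..t-d} \<union> {t+d..1}"
  define T where "T = g ` R"
  have "compact T" unfolding T_def R_def
    by (rule compact_continuous_image) (use d in \<open>auto intro!: continuous_on_subset[OF cg]\<close>)
  then have cT: "closed T" by (rule compact_imp_closed)
  have gtT: "g t \<notin> T"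
  proof
    assume "g t \<in> T"
    then obtain u where "u \<in> R" "g t = g u" unfolding T_def by blast
    with gi[of t u] t d show False unfolding R_def by auto
  qed
  have gtX: "g t \<notin> X"
  proof
    assume "g t \<in> X"
    moreover have "g t \<in> path_image g" using t by (simp add: path_image_def)
    ultimately have "g t = g 0 \<or> g t = g 1" using Xg by (auto simp: g0 g1)
    then show False using gi[of t 0] gi[of t 1] t by auto
  qed
  have "open (- (X \<union> T))" using X cT by auto
  then obtain r where r: "r > 0" "ball (g t) r \<subseteq> - (X \<union> T)"
    using gtT gtX open_contains_ball by (metis ComplI UnE)
  obtain w where w: "w \<in> W" "dist w (g t) < r" using t(3) r(1) closure_approachable by metis
  define K where "K = X \<union> path_image g"
  have cK: "closed K" using X g by (simp add: K_def closed_Un closed_arc_image)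
  have seg: "closed_segment w (g t) \<subseteq> ball (g t) r"
    by (rule closed_segment_subset) (use w r in \<open>auto simp: dist_commute\<close>)
  have "g t \<in> closed_segment w (g t) \<inter> K" using t by (simp add: K_def path_image_def)
  then obtain a where a: "a \<in> closed_segment w (g t) \<inter> K" "\<And>y. y \<in> closed_segment w (g t) \<inter> K \<Longrightarrow> dist w a \<le> dist w y"
    using distance_attains_inf[of "closed_segment w (g t) \<inter> K" w] cK by (metis closed_Int closed_segment empty_iff)
  have WK: "W \<subseteq> - K" using W in_components_subset unfolding K_def by blast
  have wa: "w \<noteq> a" using a(1) w(1) WK by blast
  have sub: "closed_segment w a - {a} \<subseteq> - K"
  proof
    fix y assume y: "y \<in> closed_segment w a - {a}"
    have "closed_segment w a \<subseteq> closed_segment w (g t)" using a(1) by (simp add: subset_closed_segment)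
    moreover have "dist w y < dist w a"
      using y wa dist_in_open_segment[of y w a] by (cases "y = w") (auto simp: open_segment_def dist_commute)
    ultimately show "y \<in> - K" using a(2)[of y] y by auto
  qed
  have "connected (closed_segment w a - {a})"
  proof (rule connected_intermediate_closure)
    show "connected (open_segment w a)" by (simp add: convex_connected)
    show "closed_segment w a - {a} \<subseteq> closure (open_segment w a)" using wa by auto
  qed (auto simp: open_segment_def)
  moreover have "w \<in> W \<inter> (closed_segment w a - {a})" using w(1) wa by simp
  ultimately have inW: "closed_segment w a - {a} \<subseteq> W"
    using components_maximal[OF W[folded K_def] _ sub] by blast
  have "a \<notin> X" "a \<notin> T" using a(1) seg r(2) by auto
  then have "a \<in> path_image g" using a(1) by (auto simp: K_def)
  then obtain t' where t': "0 \<le> t'" "t' \<le> 1" "a = g t'" unfolding path_image_def by auto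
  have "t' \<notin> R" using \<open>a \<notin> T\<close> t'(3) unfolding T_def by blast
  then have "\<bar>t' - t\<bar> < d" using t' unfolding R_def by auto
  then show ?thesis using that[of t' w] d t t' w(1) inW by auto
qed

text \<open>A crosscut of the face with both ends on the edge. The end parameters are controlled
  only up to \<open>e\<close>, and the distance of \<open>t1\<close> and \<open>t2\<close> keeps
  them apart.\<close>

lemma chord_in_face:
  fixes g :: "real \<Rightarrow> complex"
  assumes X: "closed X" and g: "arc g" and Xg: "path_image g \<inter> X \<subseteq> {pathstart g, pathfinish g}"
    and W: "W \<in> components (- (X \<union> path_image g))" and cl: "path_image g \<subseteq> closure W"
    and t: "0 < t1" "t1 + 2 * e \<le> t2" "t2 < 1" and e: "e > 0"
  obtains s1 s2 c where "\<bar>s1 - t1\<bar> < e" "\<bar>s2 - t2\<bar> < e" "arc c" "pathstart c = g s1" "pathfinish c = g s2"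
     "path_image c - {g s1, g s2} \<subseteq> W" "0 < s1" "s2 < 1"
proof -
  have gcl: "g t \<in> closure W" if "0 \<le> t" "t \<le> 1" for t using cl that by (auto simp: path_image_def)
  obtain s1 w1 where s1: "\<bar>s1 - t1\<bar> < e" "0 < s1" "s1 < 1" "w1 \<in> W" "closed_segment w1 (g s1) - {g s1} \<subseteq> W"
  proof (rule access_arc[OF X g Xg W, of t1 e])
    show "g t1 \<in> closure W" by (rule gcl) (use t e in auto)
  qed (use t e in auto)
  obtain s2 w2 where s2: "\<bar>s2 - t2\<bar> < e" "0 < s2" "s2 < 1" "w2 \<in> W" "closed_segment w2 (g s2) - {g s2} \<subseteq> W"
  proof (rule access_arc[OF X g Xg W, of t2 e])
    show "g t2 \<in> closure W" by (rule gcl) (use t e in auto)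
  qed (use t e in auto)
  have "closed (X \<union> path_image g)" using X g by (simp add: closed_Un closed_arc_image)
  then have "open W" using W open_components open_Compl by blast
  moreover have "connected W" using W in_components_connected by blast
  ultimately have "path_connected W" by (simp add: connected_open_path_connected)
  then obtain p where p: "path p" "path_image p \<subseteq> W" "pathstart p = w1" "pathfinish p = w2"
    using s1(4) s2(4) unfolding path_connected_def by blast
  define q where "q = linepath (g s1) w1 +++ p +++ linepath w2 (g s2)"
  have q: "path q" "pathstart q = g s1" "pathfinish q = g s2" using p by (simp_all add: q_def)
  have "s1 < s2" using s1(1) s2(1) t by linarith
  then have "g s1 \<noteq> g s2" using g s1(2) s2(3) s2(2) s1(3) unfolding arc_def inj_on_def by (metis atLeastAtMost_iff less_eq_real_def less_irrefl)
  then obtain c where c: "arc c" "path_image c \<subseteq> path_image q" "pathstart c = g s1" "pathfinish c = g s2"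
    using path_contains_arc[OF q] by blast
  have "path_image q \<subseteq> W \<union> {g s1, g s2}"
    using p s1(5) s2(5) by (auto simp: q_def path_image_join closed_segment_commute)
  then have "path_image c - {g s1, g s2} \<subseteq> W" using c(2) by blast
  then show ?thesis using that[of s1 s2 c] s1 s2 c by blast
qed

text \<open>A chord \<open>c\<close> in \<open>W1\<close> over a long stretch of the edge and a
  chord \<open>d\<close> in \<open>W2\<close> over a shorter stretch inside it yield a theta with
  poles \<open>g t2\<close> and \<open>g t3\<close>: the short stretch, \<open>d\<close>, and the
  detour along the edge and \<open>c\<close>. The complementary region around \<open>W3\<close>
  touches both stretches, and it touches \<open>d\<close> since it reaches \<open>W2\<close> through
  the free end of the edge. That contradicts \<open>theta_face\<close>.\<close>

lemma edge_two_faces: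
  fixes g :: "real \<Rightarrow> complex"
  assumes X: "closed X" and g: "arc g" and Xg: "path_image g \<inter> X \<subseteq> {pathstart g, pathfinish g}"
    and W: "W1 \<in> components (- (X \<union> path_image g))" "W2 \<in> components (- (X \<union> path_image g))" "W3 \<in> components (- (X \<union> path_image g))"
    and ne: "W1 \<noteq> W2" "W1 \<noteq> W3" "W2 \<noteq> W3"
    and cl: "path_image g \<subseteq> closure W1" "path_image g \<subseteq> closure W2" "path_image g \<subseteq> closure W3"
  shows False
proof -
  have inj: "inj_on g {0..1}" using g by (auto simp: arc_def)
  have gi: "u = v" if "g u = g v" "0 \<le> u" "u \<le> 1" "0 \<le> v" "v \<le> 1" for u v
    using inj_onD[OF inj that(1)] that by simp
  \<comment> \<open>The nested parameters 2/10, 4/10, 6/10, 8/10 keep their order under errors below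
    1/20 and leave \<open>g (1/10)\<close> off the theta.\<close>
  have num: "0 < (2/10::real)" "2/10 + 2 * (1/20) \<le> (8/10::real)" "8/10 < (1::real)" "0 < (1/20::real)"
    "0 < (4/10::real)" "4/10 + 2 * (1/20) \<le> (6/10::real)" "6/10 < (1::real)" by simp_all
  obtain t1 t4 c where c: "\<bar>t1 - 2/10\<bar> < 1/20" "\<bar>t4 - 8/10\<bar> < 1/20" "arc c" "pathstart c = g t1" "pathfinish c = g t4"
     "path_image c - {g t1, g t4} \<subseteq> W1"
    by (rule chord_in_face[OF X g Xg W(1) cl(1) num(1-4)], rule that)
  obtain t2 t3 d where d: "\<bar>t2 - 4/10\<bar> < 1/20" "\<bar>t3 - 6/10\<bar> < 1/20" "arc d" "pathstart d = g t2" "pathfinish d = g t3"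
     "path_image d - {g t2, g t3} \<subseteq> W2"
    by (rule chord_in_face[OF X g Xg W(2) cl(2) num(5-7,4)], rule that)
  have o: "1/10 < t1" "t1 < 3/10" "3/10 < t2" "t2 < 1/2" "1/2 < t3" "t3 < t4" "t4 < 1" using c(1,2) d(1,2) unfolding abs_less_iff by linarith+
  have Wg: "W1 \<inter> path_image g = {}" "W2 \<inter> path_image g = {}" "W3 \<inter> path_image g = {}"
    using in_components_subset[OF W(1)] in_components_subset[OF W(2)] in_components_subset[OF W(3)] by blast+
  have W12: "W1 \<inter> W2 = {}" "W1 \<inter> W3 = {}" "W2 \<inter> W3 = {}"
    using components_nonoverlap[OF W(1,2)] components_nonoverlap[OF W(1,3)] components_nonoverlap[OF W(2,3)] ne by simp_all
  have gin: "g t \<in> path_image g" if "0 \<le> t" "t \<le> 1" for t using that by (simp add: path_image_def)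
  let ?c1 = "subpath t2 t3 g"
  let ?l = "subpath t2 t1 g" and ?r = "subpath t4 t3 g"
  have img: "path_image ?c1 = g ` {t2..t3}" "path_image ?l = g ` {t1..t2}" "path_image ?r = g ` {t3..t4}"
    using o by (auto simp: path_image_subpath)
  have arcs: "arc ?c1" "arc ?l" "arc ?r" using o by (auto intro!: arc_subpath_arc g)
  have cim: "path_image c \<subseteq> W1 \<union> {g t1, g t4}" "g t1 \<in> path_image c" "g t4 \<in> path_image c"
    using c(6) pathstart_in_path_image[of c] pathfinish_in_path_image[of c] unfolding c(4,5) by blast+
  have dim: "path_image d \<subseteq> W2 \<union> {g t2, g t3}" "g t2 \<in> path_image d" "g t3 \<in> path_image d"
    using d(6) pathstart_in_path_image[of d] pathfinish_in_path_image[of d] unfolding d(4,5) by blast+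
  have gW: "g u \<notin> W1" "g u \<notin> W2" "g u \<notin> W3" if "0 \<le> u" "u \<le> 1" for u using Wg gin[OF that] by blast+
  have cr: "arc (c +++ ?r)"
  proof (rule arc_join[OF c(3) arcs(3)])
    show "path_image c \<inter> path_image ?r \<subseteq> {pathstart ?r}"
    proof
      fix z assume "z \<in> path_image c \<inter> path_image ?r"
      then have "z \<in> g ` {t3..t4}" and zc: "z \<in> W1 \<union> {g t1, g t4}" unfolding img(3) using cim(1) by blast+
      then obtain u where u: "t3 \<le> u" "u \<le> t4" "z = g u" by auto
      then have "g u = g t1 \<or> g u = g t4" using gW(1)[of u] zc o by auto
      then have "u = t4" using gi[of u t1] gi[of u t4] u o by auto
      then show "z \<in> {pathstart ?r}" using u(3) by simp
    qed
  qed (use c in simp)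
  have crim: "path_image (c +++ ?r) = path_image c \<union> g ` {t3..t4}" using c img(3) by (simp add: path_image_join)
  have lcr: "arc (?l +++ c +++ ?r)"
  proof (rule arc_join[OF arcs(2) cr])
    show "path_image ?l \<inter> path_image (c +++ ?r) \<subseteq> {pathstart (c +++ ?r)}"
    proof
      fix z assume z: "z \<in> path_image ?l \<inter> path_image (c +++ ?r)"
      then have "z \<in> g ` {t1..t2}" and zc: "z \<in> path_image c \<union> g ` {t3..t4}" unfolding crim img by blast+
      then obtain u where u: "t1 \<le> u" "u \<le> t2" "z = g u" by auto
      have "g u \<notin> g ` {t3..t4}"
      proof
        assume "g u \<in> g ` {t3..t4}"
        then obtain v where "g u = g v" "t3 \<le> v" "v \<le> t4" by auto
        then show False using gi[of u v] u o by auto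
      qed
      then have "g u \<in> W1 \<union> {g t1, g t4}" using u(3) zc cim(1) by blast
      then have "g u = g t1 \<or> g u = g t4" using gW(1)[of u] o u by auto
      then have "u = t1" using gi[of u t1] gi[of u t4] u o by auto
      then show "z \<in> {pathstart (c +++ ?r)}" using u(3) c by simp
    qed
  qed (use c in simp)
  have lcrim: "path_image (?l +++ c +++ ?r) = g ` {t1..t2} \<union> (path_image c \<union> g ` {t3..t4})"
    using c crim img(2) by (simp add: path_image_join)
  have in14: "g ` {t2..t3} \<union> (g ` {t1..t2} \<union> (path_image c \<union> g ` {t3..t4})) \<subseteq> W1 \<union> g ` {t1..t4}"
  proof -
    have "g ` {t2..t3} \<subseteq> g ` {t1..t4}" "g ` {t1..t2} \<subseteq> g ` {t1..t4}" "g ` {t3..t4} \<subseteq> g ` {t1..t4}"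
      by (rule image_mono, use o in auto)+
    moreover have "g t1 \<in> g ` {t1..t4}" "g t4 \<in> g ` {t1..t4}" using o by auto
    ultimately show ?thesis using cim(1) by blast
  qed
  have g23: "g t2 \<in> g ` {t1..t4}" "g t3 \<in> g ` {t1..t4}" using o by auto
  define \<Theta> where "\<Theta> = g ` {t2..t3} \<union> path_image d \<union> (g ` {t1..t2} \<union> (path_image c \<union> g ` {t3..t4}))"
  have th: "theta (g t2) (g t3) ?c1 d (?l +++ c +++ ?r)"
    unfolding theta_def
  proof (intro conjI)
    show "path_image ?c1 \<inter> path_image d = {g t2, g t3}"
    proof -
      have "g u \<notin> W2" if "u \<in> {t2..t3}" for u using gW(2)[of u] that o by auto
      then show ?thesis unfolding img using dim o by auto
    qed
    show "path_image ?c1 \<inter> path_image (?l +++ c +++ ?r) = {g t2, g t3}"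
    proof -
      have "u = t2 \<or> u = t3" if "u \<in> {t2..t3}" "g u \<in> g ` {t1..t2} \<union> (path_image c \<union> g ` {t3..t4})" for u
      proof -
        have "g u \<notin> W1" "g u \<noteq> g t1" "g u \<noteq> g t4" using gW(1)[of u] gi[of u t1] gi[of u t4] that(1) o by auto
        then have "g u \<in> g ` {t1..t2} \<union> g ` {t3..t4}" using that(2) cim(1) by auto
        then obtain v where "g u = g v" "v \<in> {t1..t2} \<union> {t3..t4}" by auto
        then show ?thesis using gi[of u v] that(1) o by auto
      qed
      then have "g ` {t2..t3} \<inter> (g ` {t1..t2} \<union> (path_image c \<union> g ` {t3..t4})) \<subseteq> {g t2, g t3}" by blast
      moreover have "g t2 \<in> g ` {t2..t3}" "g t3 \<in> g ` {t2..t3}" "g t2 \<in> g ` {t1..t2}" "g t3 \<in> g ` {t3..t4}" using o by auto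
      ultimately show ?thesis unfolding img lcrim by blast
    qed
    show "path_image d \<inter> path_image (?l +++ c +++ ?r) = {g t2, g t3}"
    proof -
      have "z \<notin> W2" if "z \<in> g ` {t1..t2} \<union> (path_image c \<union> g ` {t3..t4})" for z
      proof -
        have "g u \<notin> W2" if "u \<in> {t1..t4}" for u using gW(2)[of u] that o by auto
        moreover have "z \<in> W1 \<or> (\<exists>u\<in>{t1..t4}. z = g u)" using that in14 by blast
        ultimately show ?thesis using W12 by auto
      qed
      moreover have "g t2 \<in> g ` {t1..t2}" "g t3 \<in> g ` {t3..t4}" using o by auto
      ultimately show ?thesis unfolding lcrim using dim by blast
    qed
  qed (use arcs lcr d c in simp_all)
  have Th: "path_image ?c1 \<union> path_image d \<union> path_image (?l +++ c +++ ?r) = \<Theta>" unfolding \<Theta>_def img lcrim ..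
  have cTh: "closed \<Theta>" unfolding Th[symmetric] using arcs lcr d by (intro closed_Un closed_arc_image) auto
  have ThW: "z \<in> \<Theta> \<Longrightarrow> z \<in> W1 \<or> z \<in> W2 \<or> (\<exists>u\<in>{t1..t4}. z = g u)" for z
    unfolding \<Theta>_def using in14 dim(1) g23 by blast
  have W3T: "W3 \<inter> \<Theta> = {}" using ThW W12 gW(3) o by fastforce
  obtain w where w: "w \<in> W3" using W(3) in_components_nonempty by blast
  define U where "U = connected_component_set (- \<Theta>) w"
  have wT: "w \<in> - \<Theta>" using w W3T by blast
  then have Uc: "U \<in> components (- \<Theta>)" unfolding U_def components_def by blast
  \<comment> \<open>A point of the edge beyond the theta. It is in the closures of \<open>W3\<close>
    and of \<open>W2\<close>, so the region \<open>U\<close> around \<open>W3\<close> contains it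
    and meets \<open>W2\<close>.\<close>
  let ?o = "g (1/10)"
  have oT: "?o \<notin> \<Theta>" using ThW[of ?o] gW[of "1/10"] gi[of "1/10"] o by fastforce
  have "connected (insert ?o W3)"
    by (rule connected_intermediate_closure[of W3]) (use W(3) cl(3) gin[of "1/10"] closure_subset in \<open>auto simp: in_components_connected\<close>)
  then have "insert ?o W3 \<subseteq> U" unfolding U_def
    by (rule connected_component_maximal[rotated]) (use w W3T oT in auto)
  then have U: "?o \<in> U" "W3 \<subseteq> U" by auto
  have oU: "open U" using Uc cTh open_components open_Compl by blast
  have "?o \<in> closure W2" using cl(2) gin[of "1/10"] by auto
  then have "U \<inter> W2 \<noteq> {}" using oU U(1) open_Int_closure_eq_empty by blast
  \<comment> \<open>\<open>W2\<close> contains the interior of \<open>d\<close>, which belongs to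
    the theta. So \<open>W2\<close> is not within \<open>U\<close> and meets the frontier of
    \<open>U\<close>; the only points of the theta in \<open>W2\<close> are those of
    \<open>d\<close>.\<close>
  moreover have "W2 - U \<noteq> {}"
  proof -
    have "path_image d - {g t2, g t3} \<noteq> {}" using arc_endless_nonempty[OF d(3)] d(4,5) by simp
    moreover have "path_image d \<subseteq> \<Theta>" by (auto simp: \<Theta>_def)
    moreover have "U \<subseteq> - \<Theta>" using Uc in_components_subset by blast
    ultimately show ?thesis using d(6) by blast
  qed
  ultimately have "W2 \<inter> frontier U \<noteq> {}" using connected_Int_frontier[of W2 U] W(2) in_components_connected by blast
  then obtain z where z: "z \<in> W2" "z \<in> frontier U" by blast
  have "z \<in> \<Theta>" using z(2) frontier_of_components_closed_complement[OF cTh Uc] by blast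
  have "z \<notin> {g t2, g t3}" "\<not> (\<exists>u\<in>{t1..t4}. z = g u)" using gW(2) z(1) o by auto
  then have "z \<in> path_image d" using \<open>z \<in> \<Theta>\<close> z(1) W12 in14 unfolding \<Theta>_def by blast
  then have cld: "closure U \<inter> (path_image d - {g t2, g t3}) \<noteq> {}" using \<open>z \<notin> _\<close> z(2) by (auto simp: frontier_def)
  have clW: "path_image g \<subseteq> closure U" using cl(3) closure_mono[OF U(2)] by blast
  show False
  proof (rule theta_face[OF th _ _ _ cld])
    show "connected U" using Uc in_components_connected by blast
    show "U \<inter> (path_image ?c1 \<union> path_image d \<union> path_image (?l +++ c +++ ?r)) = {}"
      unfolding Th using Uc in_components_subset by blast
    have "g (1/2) \<in> closure U" "g (3/10) \<in> closure U" using clW gin[of "1/2"] gin[of "3/10"] by auto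
    moreover have "g (1/2) \<in> g ` {t2..t3}" "g (3/10) \<in> g ` {t1..t2}" using o by auto
    moreover have "g (1/2) \<notin> {g t2, g t3}" "g (3/10) \<notin> {g t2, g t3}"
      using gi[of "1/2" t2] gi[of "1/2" t3] gi[of "3/10" t2] gi[of "3/10" t3] o by auto
    ultimately show "closure U \<inter> (path_image ?c1 - {g t2, g t3}) \<noteq> {}"
        "closure U \<inter> (path_image (?l +++ c +++ ?r) - {g t2, g t3}) \<noteq> {}" unfolding img lcrim by blast+
  qed
qed

text \<open>Cut at \<open>p\<close>, the edge and its two attachments become two compact sets that
  meet only in \<open>p\<close>. Neither separates two points close to \<open>p\<close>:
  \<open>P\<close> and \<open>Q\<close> stay outside a ball around \<open>p\<close>, a piece of an
  arc never separates, and the two meet in at most one point. By Janiszewski's theorem the union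
  does not separate either, so both sides of a bridge lie in one face.\<close>

lemma bridge_one_face:
  fixes g :: "real \<Rightarrow> complex"
  assumes g: "arc g" and P: "compact P" and Q: "compact Q" and PQ: "P \<inter> Q = {}"
    and Pg: "P \<inter> path_image g \<subseteq> {pathstart g}" and Qg: "Q \<inter> path_image g \<subseteq> {pathfinish g}"
    and U: "frontier U \<subseteq> P \<union> path_image g \<union> Q" "U \<inter> (P \<union> path_image g \<union> Q) = {}"
    and U2: "U2 \<inter> (P \<union> path_image g \<union> Q) = {}" "U \<inter> U2 = {}"
    and p: "p \<in> path_image g" "p \<noteq> pathstart g" "p \<noteq> pathfinish g" "p \<in> closure U" "p \<in> closure U2"
  shows False
proof -
  have inj: "inj_on g {0..1}" using g by (auto simp: arc_def)
  have g0: "g 0 = pathstart g" and g1: "g 1 = pathfinish g" by (auto simp: pathstart_def pathfinish_def)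
  have gi: "u = v" if "g u = g v" "0 \<le> u" "u \<le> 1" "0 \<le> v" "v \<le> 1" for u v
    using inj_onD[OF inj that(1)] that by simp
  obtain t where t: "0 \<le> t" "t \<le> 1" "p = g t" using p(1) by (auto simp: path_image_def)
  have "t \<noteq> 0" "t \<noteq> 1" using t(3) p(2,3) g0 g1 by auto
  then have t01: "0 < t" "t < 1" using t by auto
  have "p \<notin> P \<union> Q" using Pg Qg p by blast
  moreover have "open (- (P \<union> Q))" using P Q compact_imp_closed by blast
  ultimately obtain r where r: "r > 0" "ball p r \<subseteq> - (P \<union> Q)" using open_contains_ball by (metis ComplI)
  obtain a where a: "a \<in> U" "a \<in> ball p r" using p(4) r(1) closure_approachable by (metis mem_ball dist_commute)
  obtain b where b: "b \<in> U2" "b \<in> ball p r" using p(5) r(1) closure_approachable by (metis mem_ball dist_commute)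
  have ccP: "connected_component (- P) a b" "connected_component (- Q) a b"
    unfolding connected_component_def using a(2) b(2) r(2) connected_ball[of p r] by blast+
  define A1 where "A1 = path_image (subpath 0 t g)"
  define A2 where "A2 = path_image (subpath t 1 g)"
  have A: "A1 = g ` {0..t}" "A2 = g ` {t..1}" using t01 by (auto simp: A1_def A2_def path_image_subpath)
  have arcs: "arc (subpath 0 t g)" "arc (subpath t 1 g)" using t01 by (auto intro!: arc_subpath_arc g)
  have cA: "compact A1" "compact A2" using arcs by (simp_all add: A1_def A2_def compact_arc_image)
  have Ag: "A1 \<subseteq> path_image g" "A2 \<subseteq> path_image g" using t01 unfolding A path_image_def by (intro image_mono; auto)+
  have g0A: "g 1 \<notin> A1" "g 0 \<notin> A2"
  proof -
    have "g 1 \<noteq> g u" if "u \<in> {0..t}" for u using gi[of 1 u] that t01 by auto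
    then show "g 1 \<notin> A1" unfolding A by blast
    have "g 0 \<noteq> g u" if "u \<in> {t..1}" for u using gi[of 0 u] that t01 by auto
    then show "g 0 \<notin> A2" unfolding A by blast
  qed
  have con1: "connected (S \<inter> T)" if "S \<inter> T \<subseteq> {x}" for S T :: "complex set" and x
    using that by (metis connected_empty connected_sing subset_singletonD)
  have A12: "A1 \<inter> A2 \<subseteq> {p}"
  proof
    fix z assume z: "z \<in> A1 \<inter> A2"
    then obtain u where u: "z = g u" "u \<in> {0..t}" unfolding A by blast
    obtain v where v: "z = g v" "v \<in> {t..1}" using z unfolding A by blast
    have "u = v" using gi[of u v] u v t01 by auto
    then show "z \<in> {p}" using u v t by auto
  qed
  have ng: "a \<notin> path_image g" "b \<notin> path_image g" using a b U U2 by blast+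
  have ccA: "connected_component (- A1) a b" "connected_component (- A2) a b"
    unfolding connected_component_def
    using connected_arc_complement[OF arcs(1)] connected_arc_complement[OF arcs(2)] ng Ag unfolding A1_def A2_def by auto
  have "A1 \<inter> P \<subseteq> {g 0}" "A2 \<inter> Q \<subseteq> {g 1}" using Pg Qg Ag unfolding g0 g1 by blast+
  then have cc1: "connected_component (- (A1 \<union> P)) a b" "connected_component (- (A2 \<union> Q)) a b"
    using Janiszewski[OF cA(1) compact_imp_closed[OF P] con1 ccA(1) ccP(1)]
      Janiszewski[OF cA(2) compact_imp_closed[OF Q] con1 ccA(2) ccP(2)] by simp_all
  have "(A1 \<union> P) \<inter> (A2 \<union> Q) \<subseteq> {p}" using A12 PQ Pg Qg Ag g0A unfolding g0 g1 by blast
  then have "connected_component (- ((A1 \<union> P) \<union> (A2 \<union> Q))) a b"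
    using Janiszewski[OF compact_Un[OF cA(1) P] compact_imp_closed[OF compact_Un[OF cA(2) Q]] con1 cc1] by simp
  moreover have "A1 \<union> A2 = path_image g"
  proof -
    have "{0..t} \<union> {t..1} = {0..1}" using t01 by auto
    then show ?thesis unfolding A path_image_def by (metis image_Un)
  qed
  ultimately have "connected_component (- (P \<union> path_image g \<union> Q)) a b" by (metis sup_assoc sup_commute)
  then obtain Z where Z: "connected Z" "Z \<subseteq> - (P \<union> path_image g \<union> Q)" "a \<in> Z" "b \<in> Z"
    unfolding connected_component_def by blast
  have "Z \<inter> frontier U \<noteq> {}" by (rule connected_Int_frontier[OF Z(1)]) (use Z a b U2 in blast)+
  then show False using U(1) Z(2) by blast
qed

text \<open>The arc \<open>c\<close> in \<open>K\<close> and the crosscut \<open>e\<close> form a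
  Jordan curve. Two points close to an interior point of \<open>e\<close>, one on each side, are
  joined within a small ball off \<open>K\<close>, but the curve separates them.\<close>

lemma crosscut_separates:
  fixes K :: "complex set"
  assumes K: "closed K" and c: "arc c" "path_image c \<subseteq> K" "pathstart c = u" "pathfinish c = w"
    and e: "arc e" "pathstart e = u" "pathfinish e = w" "path_image e \<inter> K \<subseteq> {u,w}"
  obtains x y where "connected_component (- K) x y" "x \<notin> K \<union> path_image e" "y \<notin> K \<union> path_image e"
     "\<not> connected_component (- (K \<union> path_image e)) x y"
proof -
  let ?J = "path_image c \<union> path_image e"
  have "u \<in> path_image c" "w \<in> path_image c" "u \<in> path_image e" "w \<in> path_image e"
    using pathstart_in_path_image[of c] pathfinish_in_path_image[of c] pathstart_in_path_image[of e] pathfinish_in_path_image[of e] c e by auto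
  then have "path_image c \<inter> path_image e = {u,w}" using c(2) e(4) by blast
  note J = jordan_two_arcs[OF c(1) e(1) c(3,4) e(2,3) this]
  obtain p where p: "p \<in> path_image e" "p \<noteq> u" "p \<noteq> w" using arc_endless_nonempty[OF e(1)] e(2,3) by blast
  then have "p \<notin> K" using e(4) by blast
  then obtain r where r: "r > 0" "ball p r \<subseteq> - K" using K open_contains_ball[of "-K"] by blast
  have "p \<in> closure (inside ?J)" "p \<in> closure (outside ?J)" using J(7,8) p(1) by (auto simp: frontier_def)
  then obtain x y where x: "x \<in> inside ?J" "x \<in> ball p r" and y: "y \<in> outside ?J" "y \<in> ball p r"
    using r(1) closure_approachable by (metis mem_ball dist_commute)
  have 1: "connected_component (- K) x y" unfolding connected_component_def using x y r(2) connected_ball by blast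
  have 2: "x \<notin> K \<union> path_image e" "y \<notin> K \<union> path_image e" using x y r(2) J(9) by blast+
  have "\<not> connected_component (- (K \<union> path_image e)) x y"
  proof
    assume "connected_component (- (K \<union> path_image e)) x y"
    then obtain Z where Z: "connected Z" "Z \<subseteq> - (K \<union> path_image e)" "x \<in> Z" "y \<in> Z"
      unfolding connected_component_def by blast
    have "Z \<subseteq> inside ?J \<or> Z \<subseteq> outside ?J"
      by (rule connected_subset_disjoint_opens[OF Z(1) J(1,4,10)]) (use J(9) Z(2) c(2) in blast)
    then show False using Z x y J(10) by blast
  qed
  with 1 2 show ?thesis using that by blast
qed

text \<open>Each component of the smaller open set lies in a component of \<open>- K\<close>, and
  every component of \<open>- K\<close> arises in this way since \<open>A\<close> has empty
  interior. Two points separated by \<open>A\<close> alone show that the map \<open>h\<close> is not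
  injective.\<close>

lemma components_remove_closed:
  fixes K A :: "complex set"
  assumes K: "closed K" and A: "closed A" "interior A = {}" and fin: "finite (components (- (K \<union> A)))"
  shows "finite (components (- K))" "card (components (- K)) \<le> card (components (- (K \<union> A)))"
    "connected_component (- K) x y \<Longrightarrow> x \<notin> K \<union> A \<Longrightarrow> y \<notin> K \<union> A \<Longrightarrow> \<not> connected_component (- (K \<union> A)) x y
      \<Longrightarrow> card (components (- K)) < card (components (- (K \<union> A)))"
proof -
  define h where "h C = connected_component_set (- K) (SOME z. z \<in> C)" for C
  have h: "h (connected_component_set (- (K \<union> A)) z) = connected_component_set (- K) z" if "z \<notin> K \<union> A" for z
  proof -
    let ?C = "connected_component_set (- (K \<union> A)) z"
    have "z \<in> ?C" using that by simp
    then have "(SOME z. z \<in> ?C) \<in> ?C" by (metis someI)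
    then have "connected_component (- K) z (SOME z. z \<in> ?C)"
      by (metis mem_Collect_eq connected_component_of_subset Un_upper1 Compl_anti_mono)
    then show ?thesis unfolding h_def by (metis connected_component_eq mem_Collect_eq)
  qed
  have sur: "components (- K) \<subseteq> h ` components (- (K \<union> A))"
  proof
    fix D assume D: "D \<in> components (- K)"
    then have "open D" using K open_components open_Compl by blast
    moreover have "D \<noteq> {}" using D in_components_nonempty by blast
    ultimately have "\<not> D \<subseteq> A" using A(2) interior_maximal by blast
    then obtain z where z: "z \<in> D" "z \<notin> A" by blast
    have "D \<subseteq> - K" using D in_components_subset by blast
    then have "z \<notin> K \<union> A" using z by blast
    moreover have "D = connected_component_set (- K) z"
    proof -
      obtain x where "D = connected_component_set (- K) x" using D unfolding components_def by blast
      then show ?thesis using z(1) connected_component_eq[of z "- K" x] by simp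
    qed
    ultimately have "D = h (connected_component_set (- (K \<union> A)) z)" using h by simp
    then show "D \<in> h ` components (- (K \<union> A))" using \<open>z \<notin> K \<union> A\<close> unfolding components_def by blast
  qed
  show "finite (components (- K))" using sur fin finite_surj by blast
  show le: "card (components (- K)) \<le> card (components (- (K \<union> A)))" using sur fin surj_card_le by blast
  assume xy: "connected_component (- K) x y" "x \<notin> K \<union> A" "y \<notin> K \<union> A" "\<not> connected_component (- (K \<union> A)) x y"
  let ?Cx = "connected_component_set (- (K \<union> A)) x" and ?Cy = "connected_component_set (- (K \<union> A)) y"
  have c: "?Cx \<in> components (- (K \<union> A))" "?Cy \<in> components (- (K \<union> A))" using xy(2,3) unfolding components_def by blast+
  have ne: "?Cx \<noteq> ?Cy" using xy(3,4) by (metis Compl_iff connected_component_refl mem_Collect_eq)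
  have "h ?Cx = h ?Cy" using h[OF xy(2)] h[OF xy(3)] xy(1) by (metis connected_component_eq mem_Collect_eq)
  then have "h ` components (- (K \<union> A)) \<subseteq> h ` (components (- (K \<union> A)) - {?Cx})" using c ne by auto
  then have "components (- K) \<subseteq> h ` (components (- (K \<union> A)) - {?Cx})" using sur by (rule order_trans[rotated])
  then have "card (components (- K)) \<le> card (components (- (K \<union> A)) - {?Cx})" using fin by (intro surj_card_le) auto
  also have "\<dots> < card (components (- (K \<union> A)))" using fin c(1) by (rule card_Diff1_less)
  finally show "card (components (- K)) < card (components (- (K \<union> A)))" .
qed

section \<open>Transfer to locally finite plane graphs\<close>

abbreviation skel :: "curve set \<Rightarrow> complex set" where "skel E \<equiv> \<Union>e\<in>E. path_image e"

lemma closed_skel: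
  assumes pg: "plane_graph V E" and lf: "locally_finite_pg E" and F: "F \<subseteq> E"
  shows "closed (skel F)"
proof -
  have "\<exists>T. open T \<and> x \<in> T \<and> T \<subseteq> - skel F" if x: "x \<in> - skel F" for x
  proof -
  obtain U where U: "open U" "x \<in> U" "finite {e\<in>E. path_image e \<inter> U \<noteq> {}}"
    using lf unfolding locally_finite_pg_def by blast
  let ?F = "{e\<in>F. path_image e \<inter> U \<noteq> {}}"
  have "finite ?F" by (rule finite_subset[OF _ U(3)]) (use F in auto)
  moreover have "closed (path_image e)" if "e \<in> ?F" for e
    using pg F that unfolding plane_graph_def by (intro closed_arc_image) auto
  ultimately have "closed (\<Union>e\<in>?F. path_image e)" by blast
  then have "open (U - (\<Union>e\<in>?F. path_image e))" using U(1) by (rule open_Diff[rotated])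
  moreover have "x \<in> U - (\<Union>e\<in>?F. path_image e)" using x U(2) by auto
  moreover have "U - (\<Union>e\<in>?F. path_image e) \<subseteq> - skel F" by auto
  ultimately show "\<exists>T. open T \<and> x \<in> T \<and> T \<subseteq> - skel F" by blast
  qed
  then show ?thesis unfolding closed_def by (subst open_subopen) blast
qed

lemma edge_Int_skel:
  assumes "plane_graph V E" "e \<in> E" "F \<subseteq> E" "e \<notin> F"
  shows "path_image e \<inter> skel F \<subseteq> {pathstart e, pathfinish e}"
proof -
  have "\<forall>e\<in>E. \<forall>e'\<in>E. e \<noteq> e' \<longrightarrow> path_image e \<inter> path_image e' \<subseteq> ends e \<inter> ends e'"
    using assms(1) by (simp add: plane_graph_def)
  then have "path_image e \<inter> path_image e' \<subseteq> ends e" if "e' \<in> F" for e'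
    using assms(2-4) that by (metis in_mono le_inf_iff)
  then show ?thesis unfolding ends_def by blast
qed

context
  fixes V E
  assumes pg: "plane_graph V E" and lf: "locally_finite_pg E"
begin

lemma skel_remove: "e \<in> E \<Longrightarrow> skel E = skel (E - {e}) \<union> path_image e" by blast

lemma pg_edge_subset_closure:
  assumes e: "e \<in> E" and U: "U \<in> components (- skel E)"
    and p: "p \<in> path_image e" "p \<notin> ends e" "p \<in> closure U"
  shows "path_image e \<subseteq> closure U"
proof (rule edge_subset_closure)
  show "closed (skel (E - {e}))" using closed_skel[OF pg lf] by blast
  show "arc e" using pg e by (simp add: plane_graph_def)
  show "path_image e \<inter> skel (E - {e}) \<subseteq> {pathstart e, pathfinish e}" using edge_Int_skel[OF pg e] by blast
  show "U \<in> components (- (skel (E - {e}) \<union> path_image e))" using U skel_remove[OF e] by simp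
qed (use p in \<open>auto simp: ends_def\<close>)

lemma pg_edge_two_faces:
  assumes e: "e \<in> E" and U: "U1 \<in> components (- skel E)" "U2 \<in> components (- skel E)" "U3 \<in> components (- skel E)"
   and ne: "U1 \<noteq> U2" "U1 \<noteq> U3" "U2 \<noteq> U3"
    and cl: "path_image e \<subseteq> closure U1" "path_image e \<subseteq> closure U2" "path_image e \<subseteq> closure U3"
  shows False
proof (rule edge_two_faces[OF _ _ _ _ _ _ ne cl])
  show "closed (skel (E - {e}))" using closed_skel[OF pg lf] by blast
  show "arc e" using pg e by (simp add: plane_graph_def)
  show "path_image e \<inter> skel (E - {e}) \<subseteq> {pathstart e, pathfinish e}" using edge_Int_skel[OF pg e] by blast
qed (use U skel_remove[OF e] in simp_all)

text \<open>An open component is disjoint from the closure of every other one. Hence faces, which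
  are closures, can be counted as components.\<close>

lemma faces_inj: "inj_on closure (components (- skel E))"
proof (rule inj_onI, rule ccontr)
  fix A B assume AB: "A \<in> components (- skel E)" "B \<in> components (- skel E)" "closure A = closure B" "A \<noteq> B"
  have "open A" using AB(1) closed_skel[OF pg lf subset_refl] open_components open_Compl by blast
  moreover have "A \<inter> B = {}" using AB components_nonoverlap by blast
  ultimately have "A \<inter> closure B = {}" using open_Int_closure_eq_empty by blast
  then show False using AB(1,3) closure_subset in_components_nonempty by blast
qed

end

section \<open>Closed walks in finite graphs\<close>

text \<open>The start is kept apart from the list: for a closed walk the list then records every
  visit once, and its length is the number of edges.\<close>

primrec walk :: "('a \<Rightarrow> 'a \<Rightarrow> bool) \<Rightarrow> 'a \<Rightarrow> 'a list \<Rightarrow> 'a \<Rightarrow> bool" where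
  "walk R a [] b \<longleftrightarrow> a = b"
| "walk R a (x # xs) b \<longleftrightarrow> R a x \<and> walk R x xs b"

lemma walk_append: "walk R a (xs @ ys) c \<longleftrightarrow> (\<exists>b. walk R a xs b \<and> walk R b ys c)"
  by (induction xs arbitrary: a) auto

lemma walk_last: "walk R a xs b \<Longrightarrow> last (a # xs) = b"
  by (induction xs arbitrary: a) auto

lemma walk_iff_nth: "walk R a xs b \<longleftrightarrow> last (a # xs) = b \<and> (\<forall>i < length xs. R ((a # xs) ! i) ((a # xs) ! Suc i))"
proof (induction xs arbitrary: a)
  case (Cons x xs)
  have "(\<forall>i < length (x # xs). R ((a # x # xs) ! i) ((a # x # xs) ! Suc i)) \<longleftrightarrow>
     R a x \<and> (\<forall>i < length xs. R ((x # xs) ! i) ((x # xs) ! Suc i))"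
    by (auto simp: less_Suc_eq_0_disj)
  then show ?case using Cons.IH[of x] by auto
qed auto

lemma walk_successively: "walk R a xs b \<longleftrightarrow> last (a # xs) = b \<and> successively R (a # xs)"
  by (induction xs arbitrary: a) auto

section \<open>Components of induced subgraphs and visits of closed walks\<close>

definition reach :: "('a \<Rightarrow> 'a \<Rightarrow> bool) \<Rightarrow> 'a set \<Rightarrow> ('a \<times> 'a) set" where
  "reach R T = {(a, b). R a b \<and> a \<in> T \<and> b \<in> T}\<^sup>*"

text \<open>\<open>reach R T\<close> is reflexive also outside \<open>T\<close>, hence the explicit
  restriction to \<open>T\<close>.\<close>

definition comp_of :: "('a \<Rightarrow> 'a \<Rightarrow> bool) \<Rightarrow> 'a set \<Rightarrow> 'a \<Rightarrow> 'a set" where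
  "comp_of R T a = {b \<in> T. (a, b) \<in> reach R T}"

definition comps :: "('a \<Rightarrow> 'a \<Rightarrow> bool) \<Rightarrow> 'a set \<Rightarrow> 'a set set" where
  "comps R T = comp_of R T ` T"

definition conn :: "('a \<Rightarrow> 'a \<Rightarrow> bool) \<Rightarrow> 'a set \<Rightarrow> bool" where
  "conn R T \<longleftrightarrow> (\<forall>a\<in>T. \<forall>b\<in>T. (a, b) \<in> reach R T)"

lemma reach_refl[simp]: "(a, a) \<in> reach R T" by (simp add: reach_def)

lemma reach_trans: "(a, b) \<in> reach R T \<Longrightarrow> (b, c) \<in> reach R T \<Longrightarrow> (a, c) \<in> reach R T"
  unfolding reach_def by (rule rtrancl_trans)

lemma reach_step: "R a b \<Longrightarrow> a \<in> T \<Longrightarrow> b \<in> T \<Longrightarrow> (a, b) \<in> reach R T"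
  unfolding reach_def by blast

lemma reach_sym:
  assumes "symp R" "(a, b) \<in> reach R T"
  shows "(b, a) \<in> reach R T"
  using assms(2) unfolding reach_def
proof (induction rule: rtrancl_induct)
  case (step y z)
  then have "(z, y) \<in> {(a, b). R a b \<and> a \<in> T \<and> b \<in> T}" using assms(1) by (auto dest: sympD)
  then show ?case using step.IH by (rule converse_rtrancl_into_rtrancl)
qed simp

lemma reach_closed:
  assumes "(a, b) \<in> reach R T" "a \<in> C" "\<And>x y. x \<in> C \<Longrightarrow> R x y \<Longrightarrow> x \<in> T \<Longrightarrow> y \<in> T \<Longrightarrow> y \<in> C"
  shows "b \<in> C"
  using assms(1,2) unfolding reach_def by (induction rule: rtrancl_induct) (use assms(3) in auto)

text \<open>A step may collapse to a point, as it does under the retraction of a graph onto one side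
  of a cut vertex.\<close>

lemma reach_map:
  assumes "\<And>a b. R a b \<Longrightarrow> a \<in> T \<Longrightarrow> b \<in> T \<Longrightarrow> r a = r b \<or> R (r a) (r b) \<and> r a \<in> T' \<and> r b \<in> T'"
    and "(a, b) \<in> reach R T"
  shows "(r a, r b) \<in> reach R T'"
  using assms(2) unfolding reach_def
proof (induction rule: rtrancl_induct)
  case (step y z)
  then show ?case using assms(1)[of y z] by (auto intro: rtrancl_into_rtrancl)
qed simp

lemma reach_mono: "T \<subseteq> T' \<Longrightarrow> (a, b) \<in> reach R T \<Longrightarrow> (a, b) \<in> reach R T'"
  using reach_map[of R T id T' a b] by auto

lemma comp_of_eq:
  assumes "symp R" "b \<in> comp_of R T a"
  shows "comp_of R T b = comp_of R T a"
proof -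
  have ab: "(a, b) \<in> reach R T" using assms(2) by (simp add: comp_of_def)
  note ba = reach_sym[OF assms(1) ab]
  show ?thesis unfolding comp_of_def using reach_trans[OF ab] reach_trans[OF ba] by blast
qed

lemma comps_disjoint:
  assumes "symp R" "C \<in> comps R T" "D \<in> comps R T" "x \<in> C" "x \<in> D"
  shows "C = D"
  using assms comp_of_eq[OF assms(1)] unfolding comps_def by blast

lemma comps_step:
  assumes "C \<in> comps R T" "x \<in> C" "R x y" "y \<in> T"
  shows "y \<in> C"
  using assms reach_step[of R x y T] reach_trans unfolding comps_def comp_of_def by fastforce

lemma in_comps: "C \<in> comps R T \<Longrightarrow> C \<noteq> {} \<and> C \<subseteq> T"
  unfolding comps_def comp_of_def using reach_refl by fastforce

lemma finite_comps: "finite T \<Longrightarrow> finite (comps R T)" by (simp add: comps_def)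

lemma comps_pos: "finite T \<Longrightarrow> T \<noteq> {} \<Longrightarrow> 0 < card (comps R T)"
  by (simp add: card_gt_0_iff finite_comps) (simp add: comps_def)

lemma count_list_card: "count_list ys v = card {i. i < length ys \<and> ys ! i = v}"
  by (simp add: count_list_eq_length_filter length_filter_conv_card eq_commute[of v])

lemma first_exit:
  assumes "j \<le> k" "xs ! j \<in> C" "xs ! k \<notin> C"
  obtains i where "j \<le> i" "i < k" "xs ! i \<in> C" "xs ! Suc i \<notin> C"
proof -
  have "\<exists>i. j \<le> i \<and> i < k \<and> xs ! i \<in> C \<and> xs ! Suc i \<notin> C"
    using assms
  proof (induction k)
    case (Suc k)
    then show ?case
    proof (cases "xs ! k \<in> C")
      case True
      then have "j \<le> k" using Suc.prems by (metis le_SucE)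
      then show ?thesis using True Suc.prems by blast
    next
      case False
      then have "j \<le> k" using Suc.prems by (metis le_SucE)
      then show ?thesis using Suc.IH[OF _ Suc.prems(2) False] by auto
    qed
  qed simp
  then show ?thesis using that by blast
qed

text \<open>A walk that leaves a component of \<open>S - {v}\<close> can do so only into
  \<open>v\<close>, and different components give different moments of arrival at
  \<open>v\<close>.\<close>

lemma closed_walk_visits:
  assumes sym: "symp R" and fin: "finite S" and w: "walk R a xs a" and S: "set (a # xs) = S" and v: "v \<in> S"
  shows "card (comps R (S - {v})) \<le> count_list xs v"
proof -
  let ?ys = "a # xs"
  define I where "I = {i. i < length xs \<and> xs ! i = v}"
  have step: "R (?ys ! i) (?ys ! Suc i)" if "i < length xs" for i using w that unfolding walk_iff_nth by blast
  have la: "?ys ! length xs = a" using walk_last[OF w] by (metis diff_Suc_1 last_conv_nth length_Cons list.distinct(1))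
  have ex: "\<exists>i\<in>I. ?ys ! i \<in> C" if C: "C \<in> comps R (S - {v})" for C
  proof -
    have CS: "C \<noteq> {}" "C \<subseteq> S - {v}" using in_comps[OF C] by auto
    obtain c where "c \<in> C" using CS by blast
    then obtain j where j: "j \<le> length xs" "?ys ! j \<in> C"
      using CS S by (metis Diff_iff in_set_conv_nth length_Cons less_Suc_eq_le subsetD)
    obtain k where k: "k \<le> length xs" "?ys ! k = v"
      using v S by (metis in_set_conv_nth length_Cons less_Suc_eq_le)
    have exit: "\<exists>i\<in>I. ?ys ! i \<in> C" if jk: "j \<le> k" "k \<le> length xs" "?ys ! j \<in> C" "?ys ! k \<notin> C" for j k
    proof -
      obtain i where i: "j \<le> i" "i < k" "?ys ! i \<in> C" "?ys ! Suc i \<notin> C"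
        by (rule first_exit[OF jk(1,3,4)])
      have il: "i < length xs" using i jk by simp
      then have "?ys ! Suc i \<in> S" using S by (metis length_Cons nth_mem Suc_less_eq)
      then have "?ys ! Suc i = v" using comps_step[OF C i(3) step[OF il]] i(4) by blast
      then show ?thesis using i il by (auto simp: I_def)
    qed
    show ?thesis
    proof (cases "\<exists>k. j \<le> k \<and> k \<le> length xs \<and> ?ys ! k \<notin> C")
      case True
      then show ?thesis using exit j by blast
    next
      case False
      \<comment> \<open>The walk stays in \<open>C\<close> up to its end, which is also its
        beginning; so an exit occurs between index 0 and a visit of \<open>v\<close>.\<close>
      then have "?ys ! 0 \<in> C" using la j by auto
      then show ?thesis using exit[of 0 k] k CS by auto
    qed
  qed
  then obtain h where h: "\<And>C. C \<in> comps R (S - {v}) \<Longrightarrow> h C \<in> I \<and> ?ys ! h C \<in> C" by metis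
  have "inj_on h (comps R (S - {v}))"
    by (rule inj_onI) (metis h comps_disjoint[OF sym])
  moreover have "finite I" by (simp add: I_def)
  ultimately have "card (comps R (S - {v})) \<le> card I" using h by (metis card_inj_on_le image_subsetI)
  then show ?thesis by (simp add: count_list_card I_def)
qed

lemma comps_neighbour:
  assumes sym: "symp R" and c: "conn R S" and v: "v \<in> S" and C: "C \<in> comps R (S - {v})"
  obtains x where "x \<in> C" "R v x"
proof -
  obtain c where c0: "c \<in> C" using in_comps[OF C] by blast
  have CS: "C \<subseteq> S - {v}" using in_comps[OF C] by blast
  have "\<exists>x\<in>C. R x v"
  proof (rule ccontr)
    assume n: "\<not> ?thesis"
    have "(c, v) \<in> reach R S" using c c0 CS v unfolding conn_def by blast
    then have "v \<in> C"
    proof (rule reach_closed[OF _ c0])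
      fix x y assume "x \<in> C" "R x y" "x \<in> S" "y \<in> S"
      moreover then have "y \<noteq> v" using n by blast
      ultimately show "y \<in> C" using comps_step[OF C] by blast
    qed
    then show False using CS by blast
  qed
  then show ?thesis using that sym by (metis sympD)
qed

lemma walk_rotate:
  assumes "walk R a xs a" "v \<in> set xs"
  obtains ys where "walk R v ys v" "set ys = set xs" "\<And>w. count_list ys w = count_list xs w"
proof -
  obtain us zs where u: "xs = us @ v # zs" using split_list[OF assms(2)] by blast
  then have "walk R a (us @ [v]) v" "walk R v zs a" using assms(1) by (auto simp: walk_append)
  then have "walk R v (zs @ us @ [v]) v" by (auto simp: walk_append)
  then show ?thesis by (rule that) (simp_all add: u Un_commute)
qed

section \<open>Paths, cycles and theta subgraphs\<close>

definition vpath :: "('a \<Rightarrow> 'a \<Rightarrow> bool) \<Rightarrow> 'a \<Rightarrow> 'a \<Rightarrow> 'a list \<Rightarrow> bool" where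
  "vpath R x z p \<longleftrightarrow> p \<noteq> [] \<and> hd p = x \<and> last p = z \<and> distinct p \<and> successively R p"

text \<open>Two of the paths could coincide only as the single edge from \<open>x\<close> to
  \<open>z\<close>; the inequalities between the lists exclude this.\<close>

definition gtheta :: "('a \<Rightarrow> 'a \<Rightarrow> bool) \<Rightarrow> 'a set \<Rightarrow> 'a \<Rightarrow> 'a \<Rightarrow> 'a list \<Rightarrow> 'a list \<Rightarrow> 'a list \<Rightarrow> bool" where
  "gtheta R S x z p q r \<longleftrightarrow> x \<noteq> z \<and> vpath R x z p \<and> vpath R x z q \<and> vpath R x z r \<and>
     set p \<subseteq> S \<and> set q \<subseteq> S \<and> set r \<subseteq> S \<and> p \<noteq> q \<and> p \<noteq> r \<and> q \<noteq> r \<and>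
     set p \<inter> set q = {x, z} \<and> set p \<inter> set r = {x, z} \<and> set q \<inter> set r = {x, z}"

lemma gtheta_mono: "gtheta R T x z p q r \<Longrightarrow> T \<subseteq> S \<Longrightarrow> gtheta R S x z p q r"
  unfolding gtheta_def by auto

lemma count_list_distinct: "distinct xs \<Longrightarrow> count_list xs x \<le> 1"
  by (induction xs) (auto simp: count_list_0_iff)

text \<open>Induction along the connection; if the new first vertex already lies on the path, the
  path is cut there to stay simple.\<close>

lemma first_hit_path:
  assumes "(y, w) \<in> reach R T" "w \<in> P" "y \<notin> P" "y \<in> T"
  shows "\<exists>q. q \<noteq> [] \<and> hd q = y \<and> last q \<in> P \<and> set (butlast q) \<inter> P = {} \<and> set q \<subseteq> T \<and> distinct q \<and> successively R q"
  using assms(1,3,4) unfolding reach_def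
proof (induction rule: converse_rtrancl_induct)
  case base
  then show ?case using assms(2) by blast
next
  case (step y y')
  then have yy: "R y y'" "y \<in> T" "y' \<in> T" by auto
  show ?case
  proof (cases "y' \<in> P")
    case True
    then show ?thesis using yy step.prems by (intro exI[of _ "[y, y']"]) auto
  next
    case False
    then obtain q where q: "q \<noteq> []" "hd q = y'" "last q \<in> P" "set (butlast q) \<inter> P = {}" "set q \<subseteq> T" "distinct q" "successively R q"
      using step.IH yy by blast
    show ?thesis
    proof (cases "y \<in> set q")
      case True
      then obtain us vs where u: "q = us @ y # vs" using split_list[OF True] by blast
      show ?thesis
        using q u by (intro exI[of _ "y # vs"]) (auto simp: butlast_append successively_append_iff split: if_splits)
    next
      case False
      then show ?thesis using q yy step.prems
        by (intro exI[of _ "y # q"]) (auto simp: successively_Cons)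
    qed
  qed
qed

definition vcycle :: "('a \<Rightarrow> 'a \<Rightarrow> bool) \<Rightarrow> 'a list \<Rightarrow> bool" where
  "vcycle R p \<longleftrightarrow> 3 \<le> length p \<and> distinct p \<and> successively R p \<and> R (last p) (hd p)"

lemma vcycle_rotate:
  assumes "vcycle R p" "x \<in> set p"
  obtains q where "vcycle R q" "set q = set p" "length q = length p" "hd q = x"
proof -
  obtain us vs where u: "p = us @ x # vs" using split_list[OF assms(2)] by blast
  have "vcycle R (x # vs @ us)"
    using assms(1) unfolding vcycle_def u
    by (cases us; cases vs rule: rev_cases) (auto simp: successively_append_iff successively_Cons hd_append)
  then show ?thesis using that[of "x # vs @ us"] u by auto
qed

lemma conn_neighbour:
  assumes "conn R T" "v \<in> T" "w \<in> T" "v \<noteq> w"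
  shows "\<exists>x\<in>T. R v x"
proof -
  have "(v, w) \<in> reach R T" using assms unfolding conn_def by blast
  then show ?thesis unfolding reach_def using assms(4)
    by (cases rule: converse_rtranclE) auto
qed

text \<open>Leave the cycle at \<open>x\<close> towards a vertex \<open>y\<close> off it. Since
  \<open>S - {x}\<close> is connected, a path leads from \<open>y\<close> back to the cycle and
  first meets it at some \<open>z\<close> different from \<open>x\<close>. This ear and the two
  halves of the cycle between \<open>x\<close> and \<open>z\<close> form the theta.\<close>

lemma ear_theta:
  assumes sym: "symp R" and p: "vcycle R p" "set p \<subseteq> S" and ne: "set p \<noteq> S"
    and c: "conn R S" and c': "\<And>v. v \<in> S \<Longrightarrow> conn R (S - {v})"
    and irr: "\<And>a b. R a b \<Longrightarrow> a \<noteq> b"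
  shows "\<exists>x z p q r. gtheta R S x z p q r"
proof -
  obtain y0 where y0: "y0 \<in> S" "y0 \<notin> set p" using p(2) ne by blast
  have "p \<noteq> []" using p(1) by (auto simp: vcycle_def)
  then have hp: "hd p \<in> set p" by simp
  have "\<exists>x y. x \<in> set p \<and> y \<in> S \<and> y \<notin> set p \<and> R x y"
  proof (rule ccontr)
    assume n: "\<not> ?thesis"
    have "(hd p, y0) \<in> reach R S" using c hp p(2) y0 unfolding conn_def by blast
    then have "y0 \<in> set p" using hp by (rule reach_closed) (use n in blast)
    then show False using y0 by blast
  qed
  then obtain x y where x: "x \<in> set p" and y: "y \<in> S" "y \<notin> set p" "R x y" by blast
  obtain q where q: "vcycle R q" "set q = set p" "length q = length p" "hd q = x" by (rule vcycle_rotate[OF p(1) x])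
  then obtain q' where q'1: "q = x # q'" by (cases q) (auto simp: vcycle_def)
  have "q' \<noteq> []" using q(1) q'1 by (auto simp: vcycle_def)
  with q'1 have q': "q = x # q'" "q' \<noteq> []" by auto
  obtain w where w: "w \<in> set q'" using q'(2) by (cases q') auto
  have xq': "x \<notin> set q'" using q(1) q' by (auto simp: vcycle_def)
  have "(y, w) \<in> reach R (S - {x})"
    using c'[of x] x p(2) y w q(2) q'(1) xq' unfolding conn_def by auto
  then obtain r where r: "r \<noteq> []" "hd r = y" "last r \<in> set q'" "set (butlast r) \<inter> set q' = {}" "set r \<subseteq> S - {x}" "distinct r" "successively R r"
    using first_hit_path[of y w R "S - {x}" "set q'"] w y q(2) q'(1) x by auto
  define z where "z = last r"
  \<comment> \<open>\<open>us\<close> and \<open>vs\<close> are the two open halves of the cycle;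
    one of them is nonempty because a cycle has at least three vertices, and this keeps the two
    halves distinct.\<close>
  obtain us vs where uv: "q' = us @ z # vs" unfolding z_def using split_list[OF r(3)] by blast
  have ne3: "us \<noteq> [] \<or> vs \<noteq> []" using q(1) uv q'(1) by (auto simp: vcycle_def)
  have d: "distinct (x # us @ z # vs)" and s: "successively R (x # us @ z # vs)" and cl: "R (last (x # us @ z # vs)) x"
    using q(1) unfolding vcycle_def q'(1) uv by auto
  let ?p1 = "x # us @ [z]" and ?p2 = "x # rev vs @ [z]" and ?p3 = "x # r"
  have sym': "R a b \<Longrightarrow> R b a" for a b using sym by (simp add: sympD)
  have v1: "vpath R x z ?p1" using d s successively_append_iff[of R ?p1 vs] unfolding vpath_def by auto
  have v2: "vpath R x z ?p2"
  proof -
    have "successively R (z # vs)" using s by (auto simp: successively_append_iff successively_Cons split: if_splits)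
    then have "successively (\<lambda>a b. R b a) (z # vs)" by (rule successively_mono) (rule sym')
    then have "successively R (rev (z # vs))" by (subst successively_rev)
    moreover have "R x (last (z # vs))" using cl sym' by (simp split: if_splits)
    ultimately have "successively R (x # rev (z # vs))" by (subst successively_Cons) (auto simp: hd_rev hd_append last_rev)
    then show ?thesis using d unfolding vpath_def by auto
  qed
  have v3: "vpath R x z ?p3" using r y(3) unfolding vpath_def z_def by (auto simp: successively_Cons)
  have r': "set r = insert z (set (butlast r))" using r(1) unfolding z_def by (metis append_butlast_last_id rotate1.simps(2) set_rotate1 list.simps(15))
  have yp: "y \<notin> set q" "y \<in> set r" using y q r by auto
  have sq: "set q = insert x (insert z (set us \<union> set vs))" using q' uv by auto
  have "gtheta R S x z ?p1 ?p2 ?p3"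
    unfolding gtheta_def
  proof (intro conjI v1 v2 v3)
    show "x \<noteq> z" using d by auto
    show "set ?p1 \<subseteq> S" "set ?p2 \<subseteq> S" using q(2) sq p(2) by auto
    show "set ?p3 \<subseteq> S" using r(5) x p(2) by auto
    have "?p1 \<noteq> ?p2"
    proof
      assume "?p1 = ?p2"
      then have "set us = set vs" by (metis append_same_eq list.inject set_rev)
      then show False using ne3 d by auto
    qed
    then show "?p1 \<noteq> ?p2" .
    have "y \<notin> set ?p1" "y \<notin> set ?p2" "y \<in> set ?p3" using yp sq by auto
    then show "?p1 \<noteq> ?p3" "?p2 \<noteq> ?p3" by metis+
    show "set ?p1 \<inter> set ?p2 = {x, z}" using d by auto
    have "set us \<inter> set r = {}" "set vs \<inter> set r = {}" using r' r(4) uv d by auto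
    moreover have "z \<in> set r" "x \<notin> set r" using r' r(5) by auto
    ultimately show "set ?p1 \<inter> set ?p3 = {x, z}" "set ?p2 \<inter> set ?p3 = {x, z}" using d by auto
  qed
  then show ?thesis by blast
qed

text \<open>An edge \<open>u v\<close> continues to some \<open>w\<close> because
  \<open>S - {u}\<close> is connected, and a path from \<open>w\<close> to \<open>u\<close> in
  \<open>S - {v}\<close> closes the cycle.\<close>

lemma exists_vcycle:
  assumes sym: "symp R" and S: "finite S" "3 \<le> card S"
    and c: "conn R S" and c': "\<And>v. v \<in> S \<Longrightarrow> conn R (S - {v})"
    and irr: "\<And>a b. R a b \<Longrightarrow> a \<noteq> b"
  shows "\<exists>p. vcycle R p \<and> set p \<subseteq> S"
proof -
  have big: "\<exists>x\<in>S. x \<noteq> a \<and> x \<noteq> b" for a b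
  proof (rule ccontr)
    assume "\<not> ?thesis"
    then have "S \<subseteq> {a, b}" by blast
    then have "card S \<le> card {a, b}" by (intro card_mono) auto
    also have "\<dots> \<le> 2" by (simp add: card_insert_if)
    finally show False using S(2) by simp
  qed
  obtain u where u: "u \<in> S" using big by blast
  obtain u' where u': "u' \<in> S" "u' \<noteq> u" using big by blast
  obtain v where v: "v \<in> S" "R u v" using conn_neighbour[OF c u u'(1)] u'(2) by blast
  obtain t where t: "t \<in> S" "t \<noteq> u" "t \<noteq> v" using big by blast
  have uv: "v \<noteq> u" using irr[OF v(2)] by blast
  obtain w where w: "w \<in> S" "w \<noteq> u" "R v w"
    using conn_neighbour[OF c'[OF u], of v t] v t uv by blast
  have wv: "w \<noteq> v" using irr[OF w(3)] by blast
  have "(w, u) \<in> reach R (S - {v})" using c'[OF v(1)] w u uv wv unfolding conn_def by blast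
  then obtain q where q: "q \<noteq> []" "hd q = w" "last q = u" "set q \<subseteq> S - {v}" "distinct q" "successively R q"
    using first_hit_path[of w u R "S - {v}" "{u}"] w wv by auto
  have "2 \<le> length q"
  proof (rule ccontr)
    assume "\<not> 2 \<le> length q"
    then obtain z where "q = [z]" using q(1) by (cases q; cases "tl q") auto
    then show False using q w(2) by simp
  qed
  then have "vcycle R (v # q)" using q w v(2) unfolding vcycle_def by (auto simp: successively_Cons)
  then show ?thesis using q(4) v(1) by (intro exI[of _ "v # q"]) auto
qed

lemma hamilton_vcycle:
  assumes sym: "symp R" and S: "finite S" "3 \<le> card S"
    and c: "conn R S" and c': "\<And>v. v \<in> S \<Longrightarrow> conn R (S - {v})"
    and irr: "\<And>a b. R a b \<Longrightarrow> a \<noteq> b"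
    and nt: "\<not> (\<exists>x z p q r. gtheta R S x z p q r)"
  shows "\<exists>p. vcycle R p \<and> set p = S"
  using exists_vcycle[OF sym S c c' irr] ear_theta[OF sym _ _ _ c c' irr] nt by blast

lemma reach_Un:
  assumes sym: "symp R" and nAB: "\<And>a b. a \<in> A \<Longrightarrow> b \<in> B \<Longrightarrow> \<not> R a b" and a: "a \<in> A" and r: "(a, b) \<in> reach R (A \<union> B)"
  shows "b \<in> A" "(a, b) \<in> reach R A"
proof -
  have "b \<in> A \<and> (a, b) \<in> reach R A"
    using r unfolding reach_def
  proof (induction rule: rtrancl_induct)
    case (step y z)
    then show ?case using nAB by (auto intro: rtrancl_into_rtrancl)
  qed (use a in simp)
  then show "b \<in> A" "(a, b) \<in> reach R A" by auto
qed

lemma card_comps_Un: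
  assumes sym: "symp R" and nAB: "\<And>a b. a \<in> A \<Longrightarrow> b \<in> B \<Longrightarrow> \<not> R a b" and fin: "finite A" "finite B" and dis: "A \<inter> B = {}"
  shows "card (comps R (A \<union> B)) = card (comps R A) + card (comps R B)"
proof -
  have nBA: "\<And>b a. b \<in> B \<Longrightarrow> a \<in> A \<Longrightarrow> \<not> R b a" using nAB sym by (metis sympD)
  have 1: "comp_of R (A \<union> B) a = comp_of R A a" if "a \<in> A" for a
    using reach_Un[of R A B, OF sym nAB that] reach_mono[of A "A \<union> B" a _ R] unfolding comp_of_def by blast
  have 2: "comp_of R (A \<union> B) a = comp_of R B a" if "a \<in> B" for a
    using reach_Un[of R B A, OF sym nBA that] reach_mono[of B "B \<union> A" a _ R]
    unfolding comp_of_def Un_commute[of A B] by blast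
  have "comps R (A \<union> B) = comps R A \<union> comps R B"
    unfolding comps_def image_Un using 1 2 by auto
  moreover have "comps R A \<inter> comps R B = {}" using in_comps[of _ R A] in_comps[of _ R B] dis by blast
  ultimately show ?thesis using fin by (simp add: card_Un_disjoint finite_comps)
qed

text \<open>Without theta subgraphs every block is a cycle or an edge, so one closed walk can attain at all
  vertices simultaneously the number of visits forced by the components hanging at them.\<close>

lemma optimal_tour:
  assumes sym: "symp R" and irr: "\<And>a b. R a b \<Longrightarrow> a \<noteq> b"
  shows "finite S \<Longrightarrow> 2 \<le> card S \<Longrightarrow> conn R S \<Longrightarrow> \<not> (\<exists>x z p q r. gtheta R S x z p q r) \<Longrightarrow>
    \<exists>a xs. walk R a xs a \<and> set xs = S \<and> (\<forall>v\<in>S. count_list xs v \<le> card (comps R (S - {v})))"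
proof (induction "card S" arbitrary: S rule: less_induct)
  case less
  note fin = less.prems(1) and c2 = less.prems(2) and con = less.prems(3) and nt = less.prems(4)
  have pos: "1 \<le> card (comps R (S - {v}))" for v
  proof -
    have "S - {v} \<noteq> {}"
    proof
      assume "S - {v} = {}"
      then have "card S \<le> card {v}" by (intro card_mono) auto
      then show False using c2 by simp
    qed
    then show ?thesis using comps_pos[of "S - {v}" R] fin by simp
  qed
  show ?case
  proof (cases "\<forall>v\<in>S. conn R (S - {v})")
    case False
    then obtain v a b where v: "v \<in> S" and a: "a \<in> S - {v}" "b \<in> S - {v}" "(a, b) \<notin> reach R (S - {v})"
      unfolding conn_def by blast
    \<comment> \<open>At a cut vertex \<open>v\<close> the tours of the two sides, both based at
      \<open>v\<close>, are concatenated. Their visits of \<open>v\<close> add up, and so do the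
      components of \<open>S - {v}\<close>.\<close>
    define A where "A = comp_of R (S - {v}) a"
    define B where "B = S - {v} - A"
    have Ac: "A \<in> comps R (S - {v})" using a by (auto simp: A_def comps_def)
    have AS: "A \<subseteq> S - {v}" using in_comps[OF Ac] by blast
    have aA: "a \<in> A" and bB: "b \<in> B" using a by (auto simp: A_def B_def comp_of_def)
    have SAB: "S - {v} = A \<union> B" "A \<inter> B = {}" using AS by (auto simp: B_def)
    have nAB: "\<not> R x y" if "x \<in> A" "y \<in> B" for x y
      using comps_step[OF Ac that(1)] that(2) by (auto simp: B_def)
    have nBA: "\<not> R y x" if "x \<in> A" "y \<in> B" for x y using nAB[OF that] sym by (metis sympD)
    have fAB: "finite A" "finite B" using fin AS by (auto simp: B_def intro: finite_subset)
    have half: "\<exists>xs. walk R v xs v \<and> set xs = insert v X \<and> (\<forall>w\<in>X. count_list xs w \<le> card (comps R (S - {w}))) \<and>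
          count_list xs v \<le> card (comps R X)"
      if X: "X \<union> Y = S - {v}" "X \<inter> Y = {}" "X \<noteq> {}" "Y \<noteq> {}" and nXY: "\<And>x y. x \<in> X \<Longrightarrow> y \<in> Y \<Longrightarrow> \<not> R x y \<and> \<not> R y x" for X Y
    proof -
      define S1 where "S1 = insert v X"
      have S1S: "S1 \<subset> S" using X v by (auto simp: S1_def)
      then have fS1: "finite S1" and lt: "card S1 < card S" using fin by (auto intro: finite_subset psubset_card_mono)
      have vX: "v \<notin> X" using X by blast
      have "finite X" using fS1 by (simp add: S1_def)
      then have "2 \<le> card S1" using X(3) vX unfolding S1_def by (simp add: Suc_le_eq card_gt_0_iff)
      \<comment> \<open>Retracting the other side onto \<open>v\<close> preserves connections:
        \<open>S1\<close> is connected, and points of \<open>S1\<close> joined in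
        \<open>S - {w}\<close> are joined in \<open>S1 - {w}\<close>.\<close>
      define r where "r x = (if x \<in> Y then v else x)" for x
      have rm: "r p = r q \<or> R (r p) (r q) \<and> r p \<in> S1 - W \<and> r q \<in> S1 - W" if "R p q" "p \<in> S - W" "q \<in> S - W" "v \<notin> W" for p q W
        using that X nXY[of p q] nXY[of q p] unfolding r_def S1_def by (auto split: if_splits)
      have rr: "(r p, r q) \<in> reach R (S1 - W)" if "(p, q) \<in> reach R (S - W)" "v \<notin> W" for p q W
        by (rule reach_map[OF _ that(1)]) (rule rm[OF _ _ _ that(2)])
      have rid: "r p = p" if "p \<in> S1" for p using that X by (auto simp: r_def S1_def)
      have con1: "conn R S1"
        unfolding conn_def
      proof (intro ballI)
        fix p q assume pq: "p \<in> S1" "q \<in> S1"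
        then have "(p, q) \<in> reach R (S - {})" using con S1S unfolding conn_def by auto
        from rr[OF this] show "(p, q) \<in> reach R S1" using rid pq by simp
      qed
      have nt1: "\<not> (\<exists>x z p q r. gtheta R S1 x z p q r)" using nt gtheta_mono[OF _ psubset_imp_subset[OF S1S]] by blast
      obtain a0 xs where xs: "walk R a0 xs a0" "set xs = S1" "\<forall>w\<in>S1. count_list xs w \<le> card (comps R (S1 - {w}))"
        using less.hyps[OF lt fS1 \<open>2 \<le> card S1\<close> con1 nt1] by blast
      obtain ys where ys: "walk R v ys v" "set ys = set xs" "\<And>w. count_list ys w = count_list xs w"
        by (rule walk_rotate[OF xs(1), of v]) (use xs(2) in \<open>auto simp: S1_def\<close>)
      have le: "card (comps R (S1 - {w})) \<le> card (comps R (S - {w}))" if "w \<in> X" for w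
      proof (rule surj_card_le)
        show "finite (comps R (S - {w}))" using fin by (simp add: finite_comps)
        show "comps R (S1 - {w}) \<subseteq> (\<lambda>C. C \<inter> S1) ` comps R (S - {w})"
        proof
          fix C assume "C \<in> comps R (S1 - {w})"
          then obtain p where p: "p \<in> S1 - {w}" "C = comp_of R (S1 - {w}) p" by (auto simp: comps_def)
          have vw: "v \<notin> {w}" using that vX by blast
          have "q \<in> comp_of R (S - {w}) p \<inter> S1 \<longleftrightarrow> q \<in> C" for q
          proof -
            have "(p, q) \<in> reach R (S1 - {w})" if "(p, q) \<in> reach R (S - {w})" "q \<in> S1"
              using rr[OF that(1) vw] rid p(1) that(2) by simp
            moreover have "(p, q) \<in> reach R (S - {w})" if "(p, q) \<in> reach R (S1 - {w})"
              using reach_mono[of "S1 - {w}" "S - {w}"] that S1S by blast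
            ultimately show ?thesis unfolding p(2) comp_of_def using S1S by blast
          qed
          then have "C = comp_of R (S - {w}) p \<inter> S1" by blast
          moreover have "comp_of R (S - {w}) p \<in> comps R (S - {w})" using p S1S by (auto simp: comps_def)
          ultimately show "C \<in> (\<lambda>C. C \<inter> S1) ` comps R (S - {w})" by blast
        qed
      qed
      have "S1 - {v} = X" using vX by (auto simp: S1_def)
      then show ?thesis using ys xs le by (intro exI[of _ ys]) (fastforce simp: S1_def)
    qed
    obtain xs where xs: "walk R v xs v" "set xs = insert v A" "\<forall>w\<in>A. count_list xs w \<le> card (comps R (S - {w}))"
       "count_list xs v \<le> card (comps R A)"
      using half[of A B] SAB aA bB nAB nBA by auto
    obtain ys where ys: "walk R v ys v" "set ys = insert v B" "\<forall>w\<in>B. count_list ys w \<le> card (comps R (S - {w}))"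
       "count_list ys v \<le> card (comps R B)"
      using half[of B A] SAB aA bB nAB nBA by (auto simp: Un_commute Int_commute)
    have "count_list (xs @ ys) w \<le> card (comps R (S - {w}))" if "w \<in> S" for w
    proof -
      consider "w = v" | "w \<in> A" | "w \<in> B" using SAB \<open>w \<in> S\<close> by blast
      then show ?thesis
      proof cases
        case 1
        then show ?thesis using xs(4) ys(4) card_comps_Un[OF sym nAB fAB SAB(2)] SAB(1) by simp
      next
        case 2
        then have "w \<notin> set ys" using ys(2) SAB by auto
        then show ?thesis using 2 xs(3) by (simp add: count_list_0_iff)
      next
        case 3
        then have "w \<notin> set xs" using xs(2) SAB by auto
        then show ?thesis using 3 ys(3) by (simp add: count_list_0_iff)
      qed
    qed
    moreover have "walk R v (xs @ ys) v" using xs ys by (auto simp: walk_append)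
    moreover have "set (xs @ ys) = S" using xs ys SAB v by auto
    ultimately show ?thesis by blast
  next
    case True
    show ?thesis
    proof (cases "3 \<le> card S")
      case True
      obtain p where p: "vcycle R p" "set p = S"
        using hamilton_vcycle[OF sym fin True con _ irr nt] \<open>\<forall>v\<in>S. conn R (S - {v})\<close> by blast
      then obtain x q where q: "p = x # q" by (cases p) (auto simp: vcycle_def)
      \<comment> \<open>A graph without cut vertices and without theta is a Hamilton cycle; the tour
        visits each vertex once, and at least one component remains when a vertex is
        removed.\<close>
      have "walk R x (q @ [x]) x" using p(1) successively_append_iff[of R "x # q" "[x]"] unfolding q vcycle_def walk_successively by auto
      moreover have "count_list (q @ [x]) w \<le> card (comps R (S - {w}))" for w
      proof -
        have "distinct (q @ [x])" using p(1) unfolding q vcycle_def by auto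
        then have "count_list (q @ [x]) w \<le> 1" by (rule count_list_distinct)
        then show ?thesis using pos[of w] by linarith
      qed
      moreover have "set (q @ [x]) = S" using p(2) q by auto
      ultimately show ?thesis by blast
    next
      case False
      then have "card S = 2" using c2 by simp
      then obtain a b where ab: "S = {a, b}" "a \<noteq> b" by (meson card_2_iff)
      then obtain x where "x \<in> S" "R a x" using conn_neighbour[OF con, of a b] by blast
      then have "R a b" using irr ab by blast
      then have "walk R a [b, a] a" using sym by (simp add: sympD)
      moreover have "count_list [b, a] w \<le> card (comps R (S - {w}))" for w using pos[of w] ab(2) by auto
      ultimately show ?thesis using ab by (intro exI[of _ a] exI[of _ "[b, a]"]) auto
    qed
  qed
qed

section \<open>Finite plane graphs\<close>

lemma plane_graph_subset: "plane_graph V E \<Longrightarrow> F \<subseteq> E \<Longrightarrow> plane_graph V F"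
  unfolding plane_graph_def by (meson subsetD)

lemma simple_pg_subset: "simple_pg E \<Longrightarrow> F \<subseteq> E \<Longrightarrow> simple_pg F"
  unfolding simple_pg_def by (meson subsetD)

lemma finite_locally_finite: "finite E \<Longrightarrow> locally_finite_pg E"
  unfolding locally_finite_pg_def by (intro allI exI[of _ UNIV]) simp

lemma plane_graphD:
  assumes "plane_graph V E" "e \<in> E"
  shows "arc e" "ends e \<subseteq> V" "V \<inter> path_image e \<subseteq> ends e" "ends e \<subseteq> path_image e"
    "e' \<in> E \<Longrightarrow> e \<noteq> e' \<Longrightarrow> path_image e \<inter> path_image e' \<subseteq> ends e \<inter> ends e'"
proof -
  show "arc e" "ends e \<subseteq> V" using assms by (auto simp: plane_graph_def ends_def)
  show "V \<inter> path_image e \<subseteq> ends e" using assms unfolding plane_graph_def by blast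
  show "ends e \<subseteq> path_image e"
    using pathstart_in_path_image[of e] pathfinish_in_path_image[of e] by (simp add: ends_def)
  show "e' \<in> E \<Longrightarrow> e \<noteq> e' \<Longrightarrow> path_image e \<inter> path_image e' \<subseteq> ends e \<inter> ends e'"
    using assms unfolding plane_graph_def by blast
qed

lemma edge_path_component:
  assumes "arc e" "e \<in> F" "ends e = {a, b}"
  shows "path_component (skel F) a b"
proof -
  have "path_connected (path_image e)" using assms(1) by (simp add: path_connected_path_image arc_imp_path)
  moreover have "a \<in> path_image e" "b \<in> path_image e" using assms(3) by (auto simp: ends_def doubleton_eq_iff)
  ultimately have "path_component (path_image e) a b" by (simp add: path_connected_component)
  then show ?thesis by (rule path_component_of_subset[rotated]) (use assms(2) in blast)
qed

text \<open>The condition \<open>a \<noteq> b\<close> matters because an isolated vertex does not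
  lie on the union of the edges.\<close>

lemma reach_path_component:
  assumes "\<And>e. e \<in> E \<Longrightarrow> arc e" "(a, b) \<in> {(a, b). adj E a b}\<^sup>*" "a \<noteq> b"
  shows "path_component (skel E) a b"
proof -
  have "a = b \<or> path_component (skel E) a b"
    using assms(2)
  proof (induction rule: rtrancl_induct)
    case (step y z)
    then obtain e where "e \<in> E" "ends e = {y, z}" by (auto simp: adj_def)
    then have "path_component (skel E) y z" using edge_path_component assms(1) by blast
    then show ?case using step.IH path_component_trans by blast
  qed simp
  then show ?thesis using assms(3) by blast
qed

lemma path_component_arc:
  fixes S :: "complex set"
  assumes "path_component S a b" "a \<noteq> b"
  obtains c where "arc c" "path_image c \<subseteq> S" "pathstart c = a" "pathfinish c = b"
proof -
  obtain p where p: "path p" "path_image p \<subseteq> S" "pathstart p = a" "pathfinish p = b"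
    using assms(1) unfolding path_component_def by blast
  show ?thesis by (rule path_contains_arc[OF p(1,3,4) assms(2)]) (use p(2) that in blast)
qed

subsection \<open>Faces\<close>

text \<open>An edge touched at an interior point lies in the face as a whole. This is what makes the
  frontier a combinatorial object.\<close>

lemma frontier_face:
  assumes pg: "plane_graph V E" and lf: "locally_finite_pg E" and U: "U \<in> components (- skel E)"
  shows "frontier U \<subseteq> (V \<inter> closure U) \<union> \<Union>(path_image ` {e\<in>E. path_image e \<subseteq> closure U})"
proof
  fix p assume p: "p \<in> frontier U"
  have "p \<in> skel E" using frontier_of_components_closed_complement[OF closed_skel[OF pg lf subset_refl] U] p by blast
  then obtain e where e: "e \<in> E" "p \<in> path_image e" by blast
  have cl: "p \<in> closure U" using p by (simp add: frontier_def)
  show "p \<in> (V \<inter> closure U) \<union> \<Union>(path_image ` {e\<in>E. path_image e \<subseteq> closure U})"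
  proof (cases "p \<in> ends e")
    case True
    then show ?thesis using plane_graphD(2)[OF pg e(1)] cl by blast
  next
    case False
    then have "path_image e \<subseteq> closure U" using pg_edge_subset_closure[OF pg lf e(1) U e(2)] cl by blast
    then show ?thesis using e by blast
  qed
qed

text \<open>Otherwise the frontier of \<open>U\<close> consists of finitely many vertices. Their
  complement is connected, so \<open>U\<close> would be all of it and contain interior points of
  edges.\<close>

lemma face_has_edge:
  assumes pg: "plane_graph V E" and fin: "finite E" and ne: "E \<noteq> {}" and U: "U \<in> components (- skel E)"
  shows "\<exists>e\<in>E. path_image e \<subseteq> closure U"
proof (rule ccontr)
  assume n: "\<not> ?thesis"
  note lf = finite_locally_finite[OF fin]
  define N where "N = \<Union>(ends ` E)"
  have "finite N" using fin by (auto simp: N_def ends_def)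
  then have cN: "connected (- N)"
    by (intro path_connected_imp_connected path_connected_complement_countable) (auto simp: countable_finite)
  have NV: "N \<subseteq> V" using plane_graphD(2)[OF pg] by (auto simp: N_def)
  have Usk: "U \<subseteq> - skel E" using U in_components_subset by blast
  have Nsk: "N \<subseteq> skel E" using plane_graphD(4)[OF pg] by (auto simp: N_def)
  have "frontier U \<subseteq> N"
  proof
    fix p assume p: "p \<in> frontier U"
    have "p \<in> skel E" using frontier_of_components_closed_complement[OF closed_skel[OF pg lf subset_refl] U] p by blast
    then obtain e where e: "e \<in> E" "p \<in> path_image e" by blast
    have "p \<in> V" using frontier_face[OF pg lf U] p n by blast
    then show "p \<in> N" using plane_graphD(3)[OF pg e(1)] e by (auto simp: N_def)
  qed
  moreover have "- N \<inter> U \<noteq> {}" using Usk Nsk in_components_nonempty[OF U] by blast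
  moreover have "- N - U \<noteq> {}"
  proof -
    obtain e where e: "e \<in> E" using ne by blast
    obtain p where p: "p \<in> path_image e" "p \<notin> ends e"
      using arc_endless_nonempty[OF plane_graphD(1)[OF pg e]] by (auto simp: ends_def)
    then have "p \<notin> N" using NV plane_graphD(3)[OF pg e] by blast
    moreover have "p \<notin> U" using p(1) e Usk by blast
    ultimately show ?thesis by blast
  qed
  ultimately show False using connected_Int_frontier[OF cN] by blast
qed

lemma edge_face_comps:
  assumes pg: "plane_graph V E" and lf: "locally_finite_pg E" and e: "e \<in> E"
  shows "finite {U \<in> components (- skel E). path_image e \<subseteq> closure U}"
    "card {U \<in> components (- skel E). path_image e \<subseteq> closure U} \<le> 2"
proof -
  let ?A = "{U \<in> components (- skel E). path_image e \<subseteq> closure U}"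
  have "\<not> (\<exists>T. T \<subseteq> ?A \<and> card T = 3)"
  proof
    assume "\<exists>T. T \<subseteq> ?A \<and> card T = 3"
    then obtain T where T: "T \<subseteq> ?A" "card T = 3" by blast
    then obtain U1 U2 U3 where U: "T = {U1, U2, U3}" "U1 \<noteq> U2" "U1 \<noteq> U3" "U2 \<noteq> U3"
      unfolding card_3_iff by metis
    then have "U1 \<in> ?A" "U2 \<in> ?A" "U3 \<in> ?A" using T(1) by auto
    then show False using pg_edge_two_faces[OF pg lf e, of U1 U2 U3] U(2-4) by blast
  qed
  note no3 = this
  show "finite ?A"
  proof (rule ccontr)
    assume "infinite ?A"
    then obtain T where "finite T" "card T = 3" "T \<subseteq> ?A" using infinite_arbitrarily_large by blast
    then show False using no3 by blast
  qed
  show "card ?A \<le> 2"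
  proof (rule ccontr)
    assume "\<not> card ?A \<le> 2"
    then have "3 \<le> card ?A" by simp
    then obtain T where "T \<subseteq> ?A" "card T = 3" by (rule obtain_subset_with_card_n)
    then show False using no3 by blast
  qed
qed

text \<open>Each face contains an edge, and each edge lies in at most two faces.\<close>

lemma finite_components_skel:
  assumes pg: "plane_graph V E" and fin: "finite E"
  shows "finite (components (- skel E))"
proof (cases "E = {}")
  case True
  then show ?thesis by (simp add: components_eq_sing_iff[THEN iffD2, of UNIV] connected_UNIV)
next
  case False
  have "components (- skel E) \<subseteq> (\<Union>e\<in>E. {U \<in> components (- skel E). path_image e \<subseteq> closure U})"
    using face_has_edge[OF pg fin False] by blast
  moreover have "finite (\<Union>e\<in>E. {U \<in> components (- skel E). path_image e \<subseteq> closure U})"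
    using fin edge_face_comps(1)[OF pg finite_locally_finite[OF fin]] by blast
  ultimately show ?thesis by (rule finite_subset)
qed

subsection \<open>Euler's inequality\<close>

lemma symp_adj: "symp (adj E)"
  by (auto simp: symp_def adj_def insert_commute)

text \<open>The counterpart of \<open>components_remove_closed\<close>: \<open>h\<close> sends a
  component to the component of the larger relation that contains it. It is onto, and it identifies
  the components of \<open>u\<close> and \<open>w\<close> once these are connected.\<close>

lemma comps_relation_mono:
  assumes sym: "symp R'" and R: "\<And>a b. R a b \<Longrightarrow> R' a b" and fin: "finite V"
  shows "card (comps R' V) \<le> card (comps R V)"
    "u \<in> V \<Longrightarrow> w \<in> V \<Longrightarrow> symp R \<Longrightarrow> (u, w) \<notin> reach R V \<Longrightarrow> (u, w) \<in> reach R' V \<Longrightarrow> card (comps R' V) < card (comps R V)"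
proof -
  define h where "h C = (\<Union>x\<in>C. comp_of R' V x)" for C
  have sub: "(a, b) \<in> reach R' V" if "(a, b) \<in> reach R V" for a b
    using that unfolding reach_def by (rule rtrancl_mono[THEN subsetD, rotated]) (use R in auto)
  have h: "h (comp_of R V a) = comp_of R' V a" if "a \<in> V" for a
  proof -
    have "comp_of R' V x = comp_of R' V a" if "x \<in> comp_of R V a" for x
      by (rule comp_of_eq[OF sym]) (use that sub in \<open>auto simp: comp_of_def\<close>)
    moreover have "a \<in> comp_of R V a" using that by (simp add: comp_of_def)
    ultimately show ?thesis unfolding h_def by blast
  qed
  have sur: "comps R' V \<subseteq> h ` comps R V"
    unfolding comps_def using h by force
  show "card (comps R' V) \<le> card (comps R V)" by (rule surj_card_le[OF finite_comps[OF fin] sur])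
  assume uw: "u \<in> V" "w \<in> V" "symp R" "(u, w) \<notin> reach R V" "(u, w) \<in> reach R' V"
  let ?Cu = "comp_of R V u" and ?Cw = "comp_of R V w"
  have c: "?Cu \<in> comps R V" "?Cw \<in> comps R V" using uw by (auto simp: comps_def)
  have "w \<in> ?Cw" "w \<notin> ?Cu" using uw by (auto simp: comp_of_def)
  then have ne: "?Cw \<in> comps R V - {?Cu}" using c by blast
  have "comp_of R' V w = comp_of R' V u" by (rule comp_of_eq[OF sym]) (use uw in \<open>simp add: comp_of_def\<close>)
  then have hh: "h ?Cu = h ?Cw" using h uw by simp
  have "h ` comps R V \<subseteq> h ` (comps R V - {?Cu})"
  proof
    fix D assume "D \<in> h ` comps R V"
    then obtain C where C: "C \<in> comps R V" "D = h C" by blast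
    show "D \<in> h ` (comps R V - {?Cu})"
      using C ne hh by (cases "C = ?Cu") auto
  qed
  then have "comps R' V \<subseteq> h ` (comps R V - {?Cu})" using sur by (rule order_trans[rotated])
  then have "card (comps R' V) \<le> card (comps R V - {?Cu})" by (rule surj_card_le[rotated]) (simp add: finite_comps fin)
  also have "\<dots> < card (comps R V)" by (rule card_Diff1_less[OF finite_comps[OF fin] c(1)])
  finally show "card (comps R' V) < card (comps R V)" .
qed

text \<open>Adding an edge between connected vertices closes a crosscut and raises the number of faces;
  any other edge lowers the number of components of the graph.\<close>

lemma euler_inequality:
  assumes fV: "finite V"
  shows "finite E \<Longrightarrow> plane_graph V E \<Longrightarrow> simple_pg E \<Longrightarrow>
     card E + card (comps (adj E) V) + 1 \<le> card (components (- skel E)) + card V"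
proof (induction E rule: finite_induct)
  case empty
  have "card (comps (adj {}) V) \<le> card V" unfolding comps_def using fV by (rule card_image_le)
  moreover have "components (- skel {}) = {UNIV :: complex set}" by (simp add: components_eq_sing_iff)
  ultimately show ?case by simp
next
  case (insert e E)
  note pg' = insert.prems(1) and sp' = insert.prems(2)
  have pg: "plane_graph V E" by (rule plane_graph_subset[OF pg']) blast
  have sp: "simple_pg E" by (rule simple_pg_subset[OF sp']) blast
  have fin': "finite (insert e E)" using insert.hyps by simp
  have sk: "skel (insert e E) = skel E \<union> path_image e" by blast
  note IH = insert.IH[OF pg sp]
  define u where "u = pathstart e"
  define w where "w = pathfinish e"
  have ae: "arc e" using plane_graphD(1)[OF pg'] by blast
  have uw: "ends e = {u, w}" "u \<noteq> w" "u \<in> V" "w \<in> V"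
    using sp' plane_graphD(2)[OF pg', of e] by (auto simp: u_def w_def ends_def simple_pg_def)
  have cK: "closed (skel E)" by (rule closed_skel[OF pg finite_locally_finite[OF insert.hyps(1)] subset_refl])
  have finc: "finite (components (- (skel E \<union> path_image e)))"
    using finite_components_skel[OF pg' fin'] unfolding sk .
  note cr = components_remove_closed[OF cK closed_arc_image[OF ae] interior_arc_image[OF ae] finc]
  have mono: "adj E a b \<Longrightarrow> adj (insert e E) a b" for a b by (auto simp: adj_def)
  show ?case
  proof (cases "(u, w) \<in> reach (adj E) V")
    case True
    have "{(a, b). adj E a b \<and> a \<in> V \<and> b \<in> V}\<^sup>* \<subseteq> {(a, b). adj E a b}\<^sup>*" by (rule rtrancl_mono) blast
    then have "(u, w) \<in> {(a, b). adj E a b}\<^sup>*" using True unfolding reach_def by blast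
    then have "path_component (skel E) u w"
      by (rule reach_path_component[rotated]) (use plane_graphD(1)[OF pg] uw in auto)
    then obtain c where c: "arc c" "path_image c \<subseteq> skel E" "pathstart c = u" "pathfinish c = w"
      by (rule path_component_arc[OF _ uw(2)])
    have "path_image e \<inter> skel E \<subseteq> {u, w}"
      using edge_Int_skel[OF pg', of e E] insert.hyps by (auto simp: u_def w_def)
    then obtain x y where xy: "connected_component (- skel E) x y" "x \<notin> skel E \<union> path_image e" "y \<notin> skel E \<union> path_image e"
     "\<not> connected_component (- (skel E \<union> path_image e)) x y"
      by (rule crosscut_separates[OF cK c ae u_def[symmetric] w_def[symmetric]])
    have "card (components (- skel E)) < card (components (- (skel E \<union> path_image e)))" by (rule cr(3)[OF xy])
    moreover have "card (comps (adj (insert e E)) V) \<le> card (comps (adj E) V)"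
      by (rule comps_relation_mono(1)[OF symp_adj mono fV])
    ultimately show ?thesis using IH insert.hyps unfolding sk by simp
  next
    case False
    have r: "(u, w) \<in> reach (adj (insert e E)) V"
      by (rule reach_step) (use uw in \<open>auto simp: adj_def\<close>)
    have "card (comps (adj (insert e E)) V) < card (comps (adj E) V)"
      by (rule comps_relation_mono(2)[OF symp_adj mono fV uw(3,4) symp_adj False r])
    then show ?thesis using IH insert.hyps cr(2) unfolding sk by simp
  qed
qed

subsection \<open>The boundary graph of a face\<close>

text \<open>The boundary graph of \<open>f\<close>, on the vertex set \<open>V \<inter> f\<close>;
  the finite boundary walks are closed walks in it.\<close>

definition fadj :: "curve set \<Rightarrow> complex set \<Rightarrow> complex \<Rightarrow> complex \<Rightarrow> bool" where
  "fadj E f a b \<longleftrightarrow> (\<exists>e\<in>E. ends e = {a, b} \<and> path_image e \<subseteq> f)"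

lemma symp_fadj: "symp (fadj E f)"
  by (auto simp: symp_def fadj_def insert_commute)

lemma fadj_irrefl: "simple_pg E \<Longrightarrow> fadj E f a b \<Longrightarrow> a \<noteq> b"
  by (auto simp: fadj_def simple_pg_def ends_def doubleton_eq_iff)

lemma fadj_in: "plane_graph V E \<Longrightarrow> fadj E f a b \<Longrightarrow> a \<in> V \<inter> f \<and> b \<in> V \<inter> f"
  unfolding fadj_def using plane_graphD(2,4)[of V E] by blast

lemma walk_reach:
  assumes "walk R a xs b" "\<And>x y. R x y \<Longrightarrow> x \<in> S \<and> y \<in> S" "x \<in> set (a # xs)"
  shows "(a, x) \<in> reach R S"
  using assms(1,3)
proof (induction xs arbitrary: a)
  case (Cons y xs)
  then have "R a y" "walk R y xs b" by auto
  moreover then have "(a, y) \<in> reach R S" using assms(2) by (blast intro: reach_step)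
  ultimately show ?case using Cons.IH[of y] Cons.prems(2) reach_trans[of a y R S x] by auto
qed simp

lemma walk_set:
  assumes "walk R a xs b" "\<And>x y. R x y \<Longrightarrow> x \<in> S \<and> y \<in> S"
  shows "set xs \<subseteq> S"
  using assms(1) by (induction xs arbitrary: a) (use assms(2) in auto)

text \<open>A closed walk with at least one edge ends at its start, so \<open>set xs\<close> already
  contains \<open>a\<close>; and a walk along edges inside \<open>f\<close> never leaves
  \<open>V \<inter> f\<close>.\<close>

lemma fin_bwalk_iff:
  assumes pg: "plane_graph V E"
  shows "fin_bwalk V E f ys \<longleftrightarrow> (\<exists>a xs. ys = a # xs \<and> xs \<noteq> [] \<and> walk (fadj E f) a xs a \<and> set xs = V \<inter> f)"
proof
  assume w: "fin_bwalk V E f ys"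
  then have "2 \<le> length ys" by (simp add: fin_bwalk_def)
  then obtain a xs where ys: "ys = a # xs" "xs \<noteq> []" by (cases ys; cases "tl ys") auto
  have walk: "walk (fadj E f) a xs a"
    using w ys unfolding walk_iff_nth fin_bwalk_def fadj_def by auto
  have "set xs \<subseteq> V \<inter> f" by (rule walk_set[OF walk fadj_in[OF pg]])
  moreover have "a \<in> set xs" using walk_last[OF walk] ys(2) last_in_set by fastforce
  moreover have "V \<inter> f \<subseteq> set ys" using w by (simp add: fin_bwalk_def)
  ultimately have "set xs = V \<inter> f" using ys by auto
  then show "\<exists>a xs. ys = a # xs \<and> xs \<noteq> [] \<and> walk (fadj E f) a xs a \<and> set xs = V \<inter> f" using ys walk by blast
next
  assume "\<exists>a xs. ys = a # xs \<and> xs \<noteq> [] \<and> walk (fadj E f) a xs a \<and> set xs = V \<inter> f"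
  then obtain a xs where ys: "ys = a # xs" "xs \<noteq> []" "walk (fadj E f) a xs a" "set xs = V \<inter> f" by blast
  then show "fin_bwalk V E f ys"
    unfolding walk_iff_nth fin_bwalk_def fadj_def by (cases xs) auto
qed

lemma fin_bwalk_conn:
  assumes pg: "plane_graph V E" and sp: "simple_pg E" and w: "fin_bwalk V E f ys"
  shows "finite (V \<inter> f)" "conn (fadj E f) (V \<inter> f)" "2 \<le> card (V \<inter> f)"
proof -
  obtain a xs where ys: "ys = a # xs" "xs \<noteq> []" "walk (fadj E f) a xs a" "set xs = V \<inter> f"
    using w unfolding fin_bwalk_iff[OF pg] by blast
  show fin: "finite (V \<inter> f)" using ys(4) by (metis List.finite_set)
  have r: "(a, x) \<in> reach (fadj E f) (V \<inter> f)" if "x \<in> V \<inter> f" for x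
    by (rule walk_reach[OF ys(3) fadj_in[OF pg]]) (use that ys(4) in auto)
  show "conn (fadj E f) (V \<inter> f)"
    unfolding conn_def
  proof (intro ballI)
    fix x y assume "x \<in> V \<inter> f" "y \<in> V \<inter> f"
    then show "(x, y) \<in> reach (fadj E f) (V \<inter> f)"
      using reach_trans[OF reach_sym[OF symp_fadj r] r] by blast
  qed
  obtain b zs where "xs = b # zs" using ys(2) by (cases xs) auto
  then have R: "fadj E f a b" using ys(3) by simp
  then have "{a, b} \<subseteq> V \<inter> f" "a \<noteq> b" using fadj_in[OF pg R] fadj_irrefl[OF sp R] by auto
  then show "2 \<le> card (V \<inter> f)" using card_mono[OF fin, of "{a, b}"] by simp
qed

definition pedges :: "curve set \<Rightarrow> complex set \<Rightarrow> complex list \<Rightarrow> curve set" where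
  "pedges E f p = {e \<in> E. path_image e \<subseteq> f \<and> (\<exists>i. Suc i < length p \<and> ends e = {p ! i, p ! Suc i})}"

lemma vpath_arc:
  assumes pg: "plane_graph V E" and p: "vpath (fadj E f) x z p" and xz: "x \<noteq> z"
  obtains c where "arc c" "path_image c \<subseteq> skel (pedges E f p)" "pathstart c = x" "pathfinish c = z"
proof -
  have "i = 0 \<or> path_component (skel (pedges E f p)) (p ! 0) (p ! i)" if "i < length p" for i
    using that
  proof (induction i)
    case (Suc i)
    have "fadj E f (p ! i) (p ! Suc i)" using p Suc.prems unfolding vpath_def successively_conv_nth by blast
    then obtain e where e: "e \<in> E" "ends e = {p ! i, p ! Suc i}" "path_image e \<subseteq> f" unfolding fadj_def by blast
    then have "e \<in> pedges E f p" using Suc.prems by (auto simp: pedges_def)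
    then have "path_component (skel (pedges E f p)) (p ! i) (p ! Suc i)"
      using edge_path_component[OF plane_graphD(1)[OF pg e(1)] _ e(2)] by blast
    then show ?case using Suc path_component_trans by (metis Suc_lessD)
  qed simp
  moreover have "p ! 0 = x" "p ! (length p - 1) = z" "p \<noteq> []" using p by (auto simp: vpath_def hd_conv_nth last_conv_nth)
  ultimately have "path_component (skel (pedges E f p)) x z" using xz
    by (metis diff_less length_greater_0_conv less_numeral_extra(1))
  then show ?thesis by (rule path_component_arc[OF _ xz]) (rule that)
qed

lemma pedges_ends: "e \<in> pedges E f p \<Longrightarrow> ends e \<subseteq> set p"
  by (auto simp: pedges_def)

lemma vpath_short:
  assumes p: "vpath R x z p" and i: "Suc i < length p" "{p ! i, p ! Suc i} \<subseteq> {x, z}"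
  shows "p = [x, z]"
proof -
  have d: "distinct p" "p ! 0 = x" "p ! (length p - 1) = z" using p by (auto simp: vpath_def hd_conv_nth last_conv_nth)
  have ix: "j = 0 \<or> j = length p - 1" if "j < length p" "p ! j \<in> {x, z}" for j
  proof -
    have l: "0 < length p" "length p - 1 < length p" using that(1) by auto
    have "p ! j = p ! 0 \<or> p ! j = p ! (length p - 1)" using that(2) unfolding d(2,3) by blast
    then show ?thesis
      unfolding nth_eq_iff_index_eq[OF d(1) that(1) l(1)] nth_eq_iff_index_eq[OF d(1) that(1) l(2)] .
  qed
  have "i = 0 \<or> i = length p - 1" "Suc i = 0 \<or> Suc i = length p - 1" using ix[of i] ix[of "Suc i"] i by auto
  then have "length p = 2" using i by auto
  then show ?thesis using d by (cases p; cases "tl p") auto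
qed

text \<open>An edge used by both paths has its ends in \<open>{x, z}\<close>, which makes both paths
  this one edge.\<close>

lemma pedges_Int:
  assumes pg: "plane_graph V E" and p: "vpath (fadj E f) x z p" and q: "vpath (fadj E f) x z q"
    and ne: "p \<noteq> q" and pq: "set p \<inter> set q = {x, z}"
  shows "skel (pedges E f p) \<inter> skel (pedges E f q) \<subseteq> {x, z}"
proof
  fix y assume "y \<in> skel (pedges E f p) \<inter> skel (pedges E f q)"
  then obtain e e' where e: "e \<in> pedges E f p" "y \<in> path_image e" and e': "e' \<in> pedges E f q" "y \<in> path_image e'" by blast
  have E: "e \<in> E" "e' \<in> E" using e e' by (auto simp: pedges_def)
  show "y \<in> {x, z}"
  proof (cases "e = e'")
    case False
    then have "y \<in> ends e \<inter> ends e'" using plane_graphD(5)[OF pg E False] e e' by blast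
    then show ?thesis using pedges_ends[OF e(1)] pedges_ends[OF e'(1)] pq by blast
  next
    case True
    then have sub: "ends e \<subseteq> {x, z}" using pedges_ends[OF e(1)] pedges_ends[OF e'(1)] pq by blast
    obtain i where i: "Suc i < length p" "ends e = {p ! i, p ! Suc i}" using e(1) by (auto simp: pedges_def)
    obtain j where j: "Suc j < length q" "ends e = {q ! j, q ! Suc j}" using e'(1) True by (auto simp: pedges_def)
    have "p = [x, z]" by (rule vpath_short[OF p i(1)]) (use i sub in simp)
    moreover have "q = [x, z]" by (rule vpath_short[OF q j(1)]) (use j sub in simp)
    ultimately show ?thesis using ne by simp
  qed
qed

text \<open>The three vertex paths would give a plane theta made of edges inside the face; the face
  touches all three arcs, against \<open>theta_face\<close>.\<close>

lemma face_no_gtheta: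
  assumes pg: "plane_graph V E" and U: "U \<in> components (- skel E)"
  shows "\<not> gtheta (fadj E (closure U)) S x z p q r"
proof
  let ?f = "closure U"
  assume g: "gtheta (fadj E ?f) S x z p q r"
  then have xz: "x \<noteq> z" and v: "vpath (fadj E ?f) x z p" "vpath (fadj E ?f) x z q" "vpath (fadj E ?f) x z r"
    and ne: "p \<noteq> q" "p \<noteq> r" "q \<noteq> r" and i: "set p \<inter> set q = {x, z}" "set p \<inter> set r = {x, z}" "set q \<inter> set r = {x, z}"
    unfolding gtheta_def by auto
  obtain c1 where c1: "arc c1" "path_image c1 \<subseteq> skel (pedges E ?f p)" "pathstart c1 = x" "pathfinish c1 = z"
    by (rule vpath_arc[OF pg v(1) xz])
  obtain c2 where c2: "arc c2" "path_image c2 \<subseteq> skel (pedges E ?f q)" "pathstart c2 = x" "pathfinish c2 = z"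
    by (rule vpath_arc[OF pg v(2) xz])
  obtain c3 where c3: "arc c3" "path_image c3 \<subseteq> skel (pedges E ?f r)" "pathstart c3 = x" "pathfinish c3 = z"
    by (rule vpath_arc[OF pg v(3) xz])
  have xzin: "x \<in> path_image c1" "z \<in> path_image c1" "x \<in> path_image c2" "z \<in> path_image c2" "x \<in> path_image c3" "z \<in> path_image c3"
    using c1 c2 c3 by (metis pathstart_in_path_image pathfinish_in_path_image)+
  have Int: "A \<inter> B = {x, z}" if "A \<subseteq> A'" "B \<subseteq> B'" "A' \<inter> B' \<subseteq> {x, z}" "x \<in> A" "z \<in> A" "x \<in> B" "z \<in> B" for A B A' B'
    using that by blast
  have "path_image c1 \<inter> path_image c2 = {x, z}" "path_image c1 \<inter> path_image c3 = {x, z}" "path_image c2 \<inter> path_image c3 = {x, z}"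
    using Int[OF c1(2) c2(2) pedges_Int[OF pg v(1,2) ne(1) i(1)]] Int[OF c1(2) c3(2) pedges_Int[OF pg v(1,3) ne(2) i(2)]]
      Int[OF c2(2) c3(2) pedges_Int[OF pg v(2,3) ne(3) i(3)]] xzin by simp_all
  then have th: "theta x z c1 c2 c3" using c1 c2 c3 by (simp add: theta_def)
  have sub: "skel (pedges E ?f l) \<subseteq> skel E" "skel (pedges E ?f l) \<subseteq> ?f" for l by (auto simp: pedges_def)
  have Usk: "U \<inter> skel E = {}" using U in_components_subset by blast
  show False
  proof (rule theta_face[OF th])
    show "connected U" using U in_components_connected by blast
    show "U \<inter> (path_image c1 \<union> path_image c2 \<union> path_image c3) = {}"
    proof -
      have "path_image c1 \<union> path_image c2 \<union> path_image c3 \<subseteq> skel E"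
        using order_trans[OF c1(2) sub(1)] order_trans[OF c2(2) sub(1)] order_trans[OF c3(2) sub(1)] by simp
      then show ?thesis using Usk by blast
    qed
    have m: "?f \<inter> (path_image c - {x, z}) \<noteq> {}" if "arc c" "path_image c \<subseteq> skel (pedges E ?f l)" "pathstart c = x" "pathfinish c = z" for c l
      using arc_endless_nonempty[OF that(1)] that(2-4) sub(2)[of l] by blast
    show "?f \<inter> (path_image c1 - {x, z}) \<noteq> {}" "?f \<inter> (path_image c2 - {x, z}) \<noteq> {}" "?f \<inter> (path_image c3 - {x, z}) \<noteq> {}"
      using m[OF c1] m[OF c2] m[OF c3] by auto
  qed
qed

text \<open>The components at a vertex bound its visits by any boundary walk from below, and the
  optimal tour attains all these bounds together. The length of a closed walk is its total number of
  visits, so the multiplicities of the corners of a face add up to its length.\<close>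

lemma face_numbers:
  assumes pg: "plane_graph V E" and sp: "simple_pg E" and f: "f \<in> faces E"
    and fin: "finite (V \<inter> f)" and con: "conn (fadj E f) (V \<inter> f)" and c2: "2 \<le> card (V \<inter> f)"
  shows "\<exists>ys. fin_bwalk V E f ys"
    "v \<in> V \<inter> f \<Longrightarrow> corner_mult V E v f = card (comps (fadj E f) (V \<inter> f - {v}))"
    "face_len V E f = (\<Sum>v\<in>V \<inter> f. card (comps (fadj E f) (V \<inter> f - {v})))"
proof -
  let ?S = "V \<inter> f" and ?R = "fadj E f"
  obtain U where U: "U \<in> components (- skel E)" "f = closure U" using f by (auto simp: faces_def)
  have nt: "\<not> (\<exists>x z p q r. gtheta ?R ?S x z p q r)" using face_no_gtheta[OF pg U(1)] unfolding U(2) by blast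
  have "\<exists>a xs. walk ?R a xs a \<and> set xs = ?S \<and> (\<forall>v\<in>?S. count_list xs v \<le> card (comps ?R (?S - {v})))"
    by (rule optimal_tour[OF symp_fadj _ fin c2 con nt]) (rule fadj_irrefl[OF sp])
  then obtain a xs where xs: "walk ?R a xs a" "set xs = ?S" "\<And>v. v \<in> ?S \<Longrightarrow> count_list xs v \<le> card (comps ?R (?S - {v}))"
    by blast
  have "xs \<noteq> []" using xs(2) c2 by auto
  have bw: "fin_bwalk V E f (a # xs)" unfolding fin_bwalk_iff[OF pg] using xs \<open>xs \<noteq> []\<close> by blast
  then show "\<exists>ys. fin_bwalk V E f ys" by blast
  have low: "card (comps ?R (?S - {v})) \<le> count_list (tl ys) v" "length ys = Suc (\<Sum>v\<in>?S. count_list (tl ys) v)"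
    if w: "fin_bwalk V E f ys" and v: "v \<in> ?S" for ys v
  proof -
    obtain b zs where z: "ys = b # zs" "zs \<noteq> []" "walk ?R b zs b" "set zs = ?S"
      using w unfolding fin_bwalk_iff[OF pg] by blast
    have "b \<in> set zs" using walk_last[OF z(3)] z(2) last_in_set by fastforce
    then have "set (b # zs) = ?S" using z(4) by auto
    then show "card (comps ?R (?S - {v})) \<le> count_list (tl ys) v"
      using closed_walk_visits[OF symp_fadj fin z(3) _ v] z(1) by simp
    show "length ys = Suc (\<Sum>v\<in>?S. count_list (tl ys) v)"
      using sum_count_set[of zs ?S] z fin by simp
  qed
  have eq: "count_list xs v = card (comps ?R (?S - {v}))" if "v \<in> ?S" for v
    using low(1)[OF bw that] xs(3)[OF that] by simp
  show "corner_mult V E v f = card (comps ?R (?S - {v}))" if v: "v \<in> ?S"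
    unfolding corner_mult_def
  proof (rule Least_equality)
    show "\<exists>ys. fin_bwalk V E f ys \<and> count_list (tl ys) v = card (comps ?R (?S - {v}))" using bw eq[OF v] by (metis list.sel(3))
  qed (use low(1)[OF _ v] in blast)
  have "?S \<noteq> {}" using c2 by auto
  then obtain v0 where v0: "v0 \<in> ?S" by blast
  show "face_len V E f = (\<Sum>v\<in>?S. card (comps ?R (?S - {v})))"
    unfolding face_len_def
  proof (rule Least_equality)
    have "length (a # xs) = Suc (\<Sum>v\<in>?S. card (comps ?R (?S - {v})))"
      using low(2)[OF bw v0] eq by simp
    then show "\<exists>ys. fin_bwalk V E f ys \<and> length ys = Suc (\<Sum>v\<in>?S. card (comps ?R (?S - {v})))" using bw by blast
  next
    fix n assume "\<exists>ys. fin_bwalk V E f ys \<and> length ys = Suc n"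
    then obtain ys where ys: "fin_bwalk V E f ys" "length ys = Suc n" by blast
    then have n: "n = (\<Sum>v\<in>?S. count_list (tl ys) v)" using low(2)[OF ys(1) v0] by simp
    show "(\<Sum>v\<in>?S. card (comps ?R (?S - {v}))) \<le> n" unfolding n by (rule sum_mono[OF low(1)[OF ys(1)]])
  qed
qed

section \<open>Curvature\<close>

lemma skel_connected:
  assumes pg: "plane_graph V E" and cg: "connected_graph V E"
  shows "connected (skel E)"
proof -
  have "path_component (skel E) x y" if xy: "x \<in> skel E" "y \<in> skel E" for x y
  proof -
    have st: "path_component (skel E) x (pathstart e)" if e: "e \<in> E" "x \<in> path_image e" for x e
    proof -
      have "path_connected (path_image e)"
        using plane_graphD(1)[OF pg e(1)] by (simp add: path_connected_path_image arc_imp_path)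
      then have "path_component (path_image e) x (pathstart e)"
        using e(2) pathstart_in_path_image unfolding path_connected_component by blast
      then show ?thesis by (rule path_component_of_subset[rotated]) (use e(1) in blast)
    qed
    obtain e e' where e: "e \<in> E" "x \<in> path_image e" and e': "e' \<in> E" "y \<in> path_image e'" using xy by blast
    have V: "pathstart e \<in> V" "pathstart e' \<in> V" using pg e e' by (auto simp: plane_graph_def)
    have "path_component (skel E) (pathstart e) (pathstart e')"
    proof (cases "pathstart e = pathstart e'")
      case True
      then show ?thesis using st[OF e] path_component_sym path_component_trans by metis
    next
      case False
      have "(pathstart e, pathstart e') \<in> {(a, b). adj E a b}\<^sup>*" using cg V by (simp add: connected_graph_def)
      from reach_path_component[OF plane_graphD(1)[OF pg] this False] show ?thesis by blast
    qed
    then show ?thesis using st[OF e] path_component_sym[OF st[OF e']] path_component_trans by metis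
  qed
  then show ?thesis by (simp add: path_connected_component path_connected_imp_connected)
qed

lemma vertex_has_edge:
  assumes pg: "plane_graph V E" and cg: "connected_graph V E" and v: "v \<in> V" and V: "V \<noteq> {v}"
  shows "\<exists>e\<in>E. v \<in> ends e"
proof -
  obtain w where w: "w \<in> V" "w \<noteq> v" using V v by blast
  have "(v, w) \<in> {(a, b). adj E a b}\<^sup>*" using cg v w by (simp add: connected_graph_def)
  then obtain x where "adj E v x" using w(2) by (cases rule: converse_rtranclE) auto
  then show ?thesis by (auto simp: adj_def)
qed

lemma closed_edges:
  assumes "plane_graph V E" "finite F" "F \<subseteq> E"
  shows "compact (skel F)"
  using assms plane_graphD(1)[OF assms(1)] by (intro compact_UN compact_arc_image) auto

text \<open>The frontier of a complementary component of a connected set is connected. A boundary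
  graph that falls into two parts without joining edges would split this frontier into two disjoint
  closed sets.\<close>

lemma finite_face_connected:
  assumes pg: "plane_graph V E" and cg: "connected_graph V E" and fV: "finite V" and fE: "finite E"
    and ne: "E \<noteq> {}" and sp: "simple_pg E" and f: "f \<in> faces E"
  shows "conn (fadj E f) (V \<inter> f)" "2 \<le> card (V \<inter> f)"
proof -
  note lf = finite_locally_finite[OF fE]
  obtain U where U: "U \<in> components (- skel E)" "f = closure U" using f by (auto simp: faces_def)
  obtain e0 where e0: "e0 \<in> E" using ne by blast
  have "ends e0 \<subseteq> V" "\<exists>a b. ends e0 = {a, b} \<and> a \<noteq> b"
    using plane_graphD(2)[OF pg e0] sp e0 by (auto simp: simple_pg_def ends_def)
  then have Vne: "V \<noteq> {v}" for v by auto
  have Usk: "U \<inter> skel E = {}" using U(1) in_components_subset by blast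
  have cfr: "connected (frontier U)"
    by (rule connected_frontier_component_complement[OF skel_connected[OF pg cg] U(1)])
  let ?S = "V \<inter> f" and ?R = "fadj E f"
  show "conn ?R ?S"
    unfolding conn_def
  proof (intro ballI, rule ccontr)
    fix a b assume a: "a \<in> ?S" and b: "b \<in> ?S" and n: "(a, b) \<notin> reach ?R ?S"
    define A where "A = comp_of ?R ?S a"
    have A: "a \<in> A" "b \<in> ?S - A" "A \<subseteq> ?S" using a b n by (auto simp: A_def comp_of_def)
    have Ac: "A \<in> comps ?R ?S" using a by (auto simp: A_def comps_def)
    define EA where "EA = {e\<in>E. path_image e \<subseteq> f \<and> ends e \<subseteq> A}"
    define EB where "EB = {e\<in>E. path_image e \<subseteq> f \<and> ends e \<inter> A = {}}"
    define FA where "FA = A \<union> skel EA"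
    define FB where "FB = (?S - A) \<union> skel EB"
    have fin: "finite EA" "finite EB" "finite A" "finite ?S" using fE fV A(3) by (auto simp: EA_def EB_def intro: finite_subset)
    have cE: "compact (skel EA)" "compact (skel EB)"
      by (rule closed_edges[OF pg fin(1)], simp add: EA_def, rule closed_edges[OF pg fin(2)], simp add: EB_def)
    have "compact A" "compact (?S - A)" using fin by (simp_all add: finite_imp_compact)
    with cE have cl: "closed FA" "closed FB" unfolding FA_def FB_def by (metis closed_Un compact_imp_closed)+
    have split: "e \<in> EA \<union> EB" if e: "e \<in> E" "path_image e \<subseteq> f" for e
    proof -
      obtain x y where xy: "ends e = {x, y}" by (auto simp: ends_def)
      then have R: "?R x y" "?R y x" using e by (auto simp: fadj_def insert_commute)
      have "x \<in> ?S" "y \<in> ?S" using fadj_in[OF pg R(1)] by auto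
      then have "x \<in> A \<longleftrightarrow> y \<in> A" using comps_step[OF Ac _ R(1)] comps_step[OF Ac _ R(2)] by blast
      then show ?thesis using e xy by (auto simp: EA_def EB_def)
    qed
    have "frontier U \<subseteq> FA \<union> FB"
    proof
      fix p assume "p \<in> frontier U"
      then have "p \<in> ?S \<union> \<Union>(path_image ` {e\<in>E. path_image e \<subseteq> f})"
        using frontier_face[OF pg lf U(1)] U(2) by blast
      then show "p \<in> FA \<union> FB" using split unfolding FA_def FB_def by blast
    qed
    moreover have "FA \<inter> FB \<inter> frontier U = {}"
    proof -
      have False if p: "p \<in> FA" "p \<in> FB" for p
      proof (cases "p \<in> V")
        case True
        then have "p \<in> A" using p(1) plane_graphD(3)[OF pg] unfolding FA_def EA_def by blast
        moreover have "p \<notin> A" using p(2) True plane_graphD(3)[OF pg] unfolding FB_def EB_def by blast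
        ultimately show False by blast
      next
        case False
        then obtain e e' where e: "e \<in> EA" "p \<in> path_image e" and e': "e' \<in> EB" "p \<in> path_image e'"
          using p A(3) unfolding FA_def FB_def by blast
        have E: "e \<in> E" "e' \<in> E" using e e' by (auto simp: EA_def EB_def)
        have "e \<noteq> e'" using e(1) e'(1) by (auto simp: EA_def EB_def ends_def)
        then have "p \<in> ends e" using plane_graphD(5)[OF pg E] e e' by blast
        then show False using False plane_graphD(2)[OF pg E(1)] by blast
      qed
      then show ?thesis by blast
    qed
    moreover have "v \<in> frontier U" if v: "v \<in> ?S" for v
    proof -
      obtain e where "e \<in> E" "v \<in> ends e" using vertex_has_edge[OF pg cg _ Vne] v by blast
      then have "v \<in> skel E" using plane_graphD(4)[OF pg] by blast
      then have "v \<notin> U" using Usk by blast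
      moreover have "open U" using U(1) closed_skel[OF pg lf subset_refl] open_components open_Compl by blast
      ultimately show ?thesis using v U(2) by (simp add: frontier_def interior_open)
    qed
    then have "FA \<inter> frontier U \<noteq> {}" "FB \<inter> frontier U \<noteq> {}" using a b A unfolding FA_def FB_def by blast+
    ultimately show False using cfr cl unfolding connected_closed by blast
  qed
  obtain e where e: "e \<in> E" "path_image e \<subseteq> f" using face_has_edge[OF pg fE ne U(1)] U(2) by blast
  then have "ends e \<subseteq> ?S" using plane_graphD(2,4)[OF pg e(1)] by blast
  moreover have "card (ends e) = 2" using sp e(1) by (auto simp: simple_pg_def ends_def)
  ultimately show "2 \<le> card ?S" using card_mono[of ?S "ends e"] fV by simp
qed

section \<open>Total curvature of finite graphs\<close>

lemma corner_term_nonneg: "0 \<le> corner_term V E v f"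
  by (simp add: corner_term_def)

lemma corner_term_eq:
  assumes pg: "plane_graph V E" and sp: "simple_pg E" and f: "f \<in> faces E"
    and w: "fin_bwalk V E f ys" and v: "v \<in> V \<inter> f"
  shows "corner_term V E v f = real (card (comps (fadj E f) (V \<inter> f - {v}))) / real (\<Sum>v\<in>V \<inter> f. card (comps (fadj E f) (V \<inter> f - {v})))"
  using face_numbers[OF pg sp f fin_bwalk_conn[OF pg sp w]] v w unfolding corner_term_def by auto

lemma face_total_pos:
  assumes "2 \<le> card S" "finite S" "v \<in> S"
  shows "0 < card (comps R (S - {v}))"
proof (rule comps_pos)
  show "S - {v} \<noteq> {}"
  proof
    assume "S - {v} = {}"
    then have "card S \<le> card {v}" by (intro card_mono) auto
    then show False using assms(1) by simp
  qed
qed (use assms in simp)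

lemma sum_degrees:
  assumes pg: "plane_graph V E" and sp: "simple_pg E" and fV: "finite V" and fE: "finite E"
  shows "(\<Sum>v\<in>V. deg E v) = 2 * card E"
proof -
  have "(\<Sum>v\<in>V. deg E v) = (\<Sum>v\<in>V. \<Sum>e\<in>{e\<in>E. v \<in> ends e}. 1)" by (simp add: deg_def)
  also have "\<dots> = (\<Sum>e\<in>E. \<Sum>v\<in>{v\<in>V. v \<in> ends e}. 1)" by (rule sum.swap_restrict[OF fV fE])
  also have "\<dots> = (\<Sum>e\<in>E. 2)"
  proof (rule sum.cong[OF refl])
    fix e assume e: "e \<in> E"
    have "{v\<in>V. v \<in> ends e} = ends e" using plane_graphD(2)[OF pg e] by blast
    then show "(\<Sum>v\<in>{v\<in>V. v \<in> ends e}. 1) = (2::nat)" using sp e by (auto simp: simple_pg_def ends_def)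
  qed
  finally show ?thesis by simp
qed

text \<open>Since the multiplicities in a face add up to its length, every face contributes exactly
  1, and the total is the number of vertices minus edges plus faces. Euler's inequality makes this
  positive.\<close>

lemma total_curvature_pos:
  assumes pg: "plane_graph V E" and cg: "connected_graph V E" and fV: "finite V" and fE: "finite E"
    and ne: "E \<noteq> {}" and sp: "simple_pg E"
  shows "0 < (\<Sum>v\<in>V. kappaV V E v)"
proof -
  have fF: "finite (faces E)" unfolding faces_def using finite_components_skel[OF pg fE] by simp
  have cF: "card (faces E) = card (components (- skel E))"
    unfolding faces_def by (rule card_image[OF faces_inj[OF pg finite_locally_finite[OF fE]]])
  have one: "(\<Sum>v\<in>{v\<in>V. v \<in> f}. corner_term V E v f) = 1" if f: "f \<in> faces E" for f
  proof -
    let ?S = "V \<inter> f"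
    have fin: "finite ?S" using fV by simp
    note c = finite_face_connected[OF pg cg fV fE ne sp f]
    obtain ys where ys: "fin_bwalk V E f ys" using face_numbers(1)[OF pg sp f fin c] by blast
    let ?m = "\<lambda>v. card (comps (fadj E f) (?S - {v}))"
    have "?S \<noteq> {}" using c(2) by auto
    then have "0 < sum ?m ?S" using face_total_pos[OF c(2) fin] by (intro sum_pos fin) auto
    then have pos: "0 < real (sum ?m ?S)" by (simp only: of_nat_0_less_iff)
    have "{v\<in>V. v \<in> f} = ?S" by blast
    then have "(\<Sum>v\<in>{v\<in>V. v \<in> f}. corner_term V E v f) = (\<Sum>v\<in>?S. real (?m v) / real (sum ?m ?S))"
      using corner_term_eq[OF pg sp f ys] by (auto intro: sum.cong)
    also have "\<dots> = real (sum ?m ?S) / real (sum ?m ?S)" by (simp only: sum_divide_distrib of_nat_sum)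
    finally show ?thesis using pos by simp
  qed
  have "(\<Sum>v\<in>V. kappaV V E v) = (\<Sum>v\<in>V. 1 - real (deg E v) / 2) + (\<Sum>v\<in>V. \<Sum>f\<in>{f\<in>faces E. v \<in> f}. corner_term V E v f)"
    by (simp add: kappaV_def sum.distrib)
  also have "(\<Sum>v\<in>V. \<Sum>f\<in>{f\<in>faces E. v \<in> f}. corner_term V E v f) = (\<Sum>f\<in>faces E. \<Sum>v\<in>{v\<in>V. v \<in> f}. corner_term V E v f)"
    by (rule sum.swap_restrict[OF fV fF])
  also have "\<dots> = card (faces E)" using one by simp
  also have "(\<Sum>v\<in>V. 1 - real (deg E v) / 2) = card V - real (\<Sum>v\<in>V. deg E v) / 2"
    by (simp add: sum_subtractf sum_divide_distrib)
  also have "\<dots> = card V - real (card E)" unfolding sum_degrees[OF pg sp fV fE] by simp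
  finally have k: "(\<Sum>v\<in>V. kappaV V E v) = card V - real (card E) + card (faces E)" .
  have "card E + card (comps (adj E) V) + 1 \<le> card (faces E) + card V"
    using euler_inequality[OF fV fE pg sp] cF by simp
  then show ?thesis using k by linarith
qed

section \<open>Curvature bounds at a single vertex\<close>

lemma ends_other:
  assumes "v \<in> ends e"
  obtains w where "ends e = {v, w}"
  using assms that[of "pathstart e"] that[of "pathfinish e"] by (auto simp: ends_def)

lemma finite_edges_at:
  assumes pg: "plane_graph V E" and lf: "locally_finite_pg E"
  shows "finite {e\<in>E. v \<in> ends e}"
proof -
  obtain U where U: "open U" "v \<in> U" "finite {e\<in>E. path_image e \<inter> U \<noteq> {}}"
    using lf unfolding locally_finite_pg_def by blast
  show ?thesis by (rule finite_subset[OF _ U(3)]) (use U(2) plane_graphD(4)[OF pg] in blast)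
qed

lemma edge_unique: "simple_pg E \<Longrightarrow> e \<in> E \<Longrightarrow> e' \<in> E \<Longrightarrow> ends e = ends e' \<Longrightarrow> e = e'"
  by (auto simp: simple_pg_def)

lemma deg_eq_card_neighbours:
  assumes pg: "plane_graph V E" and sp: "simple_pg E" and lf: "locally_finite_pg E"
  shows "finite {w. adj E v w}" "card {w. adj E v w} = deg E v"
proof -
  have "bij_betw (\<lambda>w. SOME e. e \<in> E \<and> ends e = {v, w}) {w. adj E v w} {e\<in>E. v \<in> ends e}"
  proof (rule bij_betwI')
    have some: "(SOME e. e \<in> E \<and> ends e = {v, w}) \<in> E \<and> ends (SOME e. e \<in> E \<and> ends e = {v, w}) = {v, w}"
      if "adj E v w" for w
      using that someI_ex[of "\<lambda>e. e \<in> E \<and> ends e = {v, w}"] by (auto simp: adj_def)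
    show "((SOME e. e \<in> E \<and> ends e = {v, x}) = (SOME e. e \<in> E \<and> ends e = {v, y})) \<longleftrightarrow> x = y"
      if xy: "x \<in> {w. adj E v w}" "y \<in> {w. adj E v w}" for x y
    proof
      assume "(SOME e. e \<in> E \<and> ends e = {v, x}) = (SOME e. e \<in> E \<and> ends e = {v, y})"
      then have "{v, x} = {v, y}"
        using some[of x, THEN conjunct2] some[of y, THEN conjunct2] xy by (metis mem_Collect_eq)
      then show "x = y" by (auto simp: doubleton_eq_iff)
    qed simp
    show "(SOME e. e \<in> E \<and> ends e = {v, x}) \<in> {e\<in>E. v \<in> ends e}" if "x \<in> {w. adj E v w}" for x
      using some[of x] that by simp
    show "\<exists>x\<in>{w. adj E v w}. e = (SOME e. e \<in> E \<and> ends e = {v, x})" if e: "e \<in> {e\<in>E. v \<in> ends e}" for e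
    proof -
      have eE: "e \<in> E" "v \<in> ends e" using e by auto
      obtain w where w: "ends e = {v, w}" by (rule ends_other[OF eE(2)])
      have "v \<noteq> w" using sp eE(1) w by (auto simp: simple_pg_def ends_def)
      then have a: "adj E v w" using eE w by (auto simp: adj_def)
      have "e = (SOME e. e \<in> E \<and> ends e = {v, w})"
        by (rule edge_unique[OF sp eE(1)]) (use some[OF a] w in auto)
      then show ?thesis using a by blast
    qed
  qed
  then show "finite {w. adj E v w}" "card {w. adj E v w} = deg E v"
    using finite_edges_at[OF pg lf] by (simp_all add: deg_def bij_betw_finite bij_betw_same_card)
qed

text \<open>A face with only two vertices contains a single edge. Its frontier then lies on an arc,
  which does not separate the plane, so the face fills the complement of that edge and there is no
  further edge or vertex.\<close>

lemma face_card_ge_3: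
  assumes pg: "plane_graph V E" and sp: "simple_pg E" and lf: "locally_finite_pg E" and cg: "connected_graph V E"
    and big: "\<And>a b. V \<noteq> {a, b}" and f: "f \<in> faces E" and w: "fin_bwalk V E f ys"
  shows "3 \<le> card (V \<inter> f)"
proof (rule ccontr)
  assume n: "\<not> ?thesis"
  note c = fin_bwalk_conn[OF pg sp w]
  obtain U where U: "U \<in> components (- skel E)" "f = closure U" using f by (auto simp: faces_def)
  have "card (V \<inter> f) = 2" using n c(3) by simp
  then obtain a b where ab: "V \<inter> f = {a, b}" "a \<noteq> b" by (meson card_2_iff)
  obtain x where R0: "fadj E f a x" using conn_neighbour[OF c(2), of a b] ab by blast
  have "x \<in> V \<inter> f" "a \<noteq> x" using fadj_in[OF pg R0] fadj_irrefl[OF sp R0] by auto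
  then have R: "fadj E f a b" using ab R0 by auto
  then obtain e where e: "e \<in> E" "ends e = {a, b}" "path_image e \<subseteq> f" by (auto simp: fadj_def)
  have one: "e' = e" if e': "e' \<in> E" "path_image e' \<subseteq> f" for e'
  proof -
    have "ends e' \<subseteq> {a, b}" using plane_graphD(2,4)[OF pg e'(1)] e'(2) ab(1) by blast
    moreover have "pathstart e' \<noteq> pathfinish e'" using sp e'(1) by (simp add: simple_pg_def)
    ultimately have "ends e' = {a, b}" by (auto simp: ends_def)
    then show ?thesis using edge_unique[OF sp e'(1) e(1)] e(2) by simp
  qed
  have fr: "frontier U \<subseteq> path_image e"
  proof
    fix p assume "p \<in> frontier U"
    then have "p \<in> (V \<inter> f) \<union> \<Union>(path_image ` {e\<in>E. path_image e \<subseteq> f})"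
      using frontier_face[OF pg lf U(1)] U(2) by blast
    then show "p \<in> path_image e" using one ab(1) plane_graphD(4)[OF pg e(1)] e(2) by blast
  qed
  have cc: "connected (- path_image e)" using connected_arc_complement[OF plane_graphD(1)[OF pg e(1)]] by simp
  have Usk: "U \<subseteq> - skel E" using U(1) in_components_subset by blast
  have "- path_image e - U = {}"
  proof (rule ccontr)
    assume "- path_image e - U \<noteq> {}"
    moreover have "- path_image e \<inter> U \<noteq> {}" using Usk e(1) in_components_nonempty[OF U(1)] by blast
    ultimately show False using connected_Int_frontier[OF cc] fr by blast
  qed
  then have sk: "skel E \<subseteq> path_image e" using Usk by blast
  have "e' = e" if e': "e' \<in> E" for e'
  proof (rule ccontr)
    assume ne: "e' \<noteq> e"
    have "path_image e' \<subseteq> ends e'" using plane_graphD(5)[OF pg e' e(1) ne] sk e' by blast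
    then show False using arc_endless_nonempty[OF plane_graphD(1)[OF pg e']] by (auto simp: ends_def)
  qed
  then have Ee: "E = {e}" using e(1) by blast
  have "v \<in> {a, b}" if v: "v \<in> V" for v
  proof -
    have "V \<noteq> {v}" using big[of v v] by simp
    then show ?thesis using vertex_has_edge[OF pg cg v] Ee e(2) by auto
  qed
  then have "V = {a, b}" using ab(1) by blast
  then show False using big by blast
qed

text \<open>If \<open>e\<close> alone attaches \<open>C\<close> to \<open>v\<close>, it is a bridge
  of the boundary graph: the boundary falls into the part \<open>P\<close> with \<open>v\<close> and
  the part \<open>Q\<close> with \<open>C\<close>, linked only by \<open>e\<close>, and
  \<open>bridge_one_face\<close> applies.\<close>

lemma single_attachment_one_face:
  assumes pg: "plane_graph V E" and sp: "simple_pg E" and lf: "locally_finite_pg E"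
    and U: "U \<in> components (- skel E)" "f = closure U" and fin: "finite (V \<inter> f)" and con: "conn (fadj E f) (V \<inter> f)"
    and v: "v \<in> V \<inter> f" and C: "C \<in> comps (fadj E f) (V \<inter> f - {v})"
    and e: "e \<in> E" "path_image e \<subseteq> f" "ends e = {v, x}" "x \<in> C"
    and only: "\<And>e'. e' \<in> E \<Longrightarrow> path_image e' \<subseteq> f \<Longrightarrow> v \<in> ends e' \<Longrightarrow> ends e' \<inter> C \<noteq> {} \<Longrightarrow> e' = e"
    and U2: "U2 \<in> components (- skel E)" "path_image e \<subseteq> closure U2"
  shows "U2 = U"
proof (rule ccontr)
  assume ne: "U2 \<noteq> U"
  let ?S = "V \<inter> f"
  have CS: "C \<subseteq> ?S - {v}" using in_comps[OF C] by blast
  define EP where "EP = {e'\<in>E. path_image e' \<subseteq> f \<and> e' \<noteq> e \<and> ends e' \<inter> C = {}}"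
  define EQ where "EQ = {e'\<in>E. path_image e' \<subseteq> f \<and> e' \<noteq> e \<and> ends e' \<subseteq> C}"
  define P where "P = (?S - C) \<union> skel EP"
  define Q where "Q = C \<union> skel EQ"
  \<comment> \<open>In a simple graph an edge is determined by its ends, and these range over the
    finite set \<open>V \<inter> f\<close>.\<close>
  have fE: "finite {e'\<in>E. path_image e' \<subseteq> f}"
  proof (rule inj_on_finite[of ends _ "Pow ?S"])
    show "inj_on ends {e'\<in>E. path_image e' \<subseteq> f}" using edge_unique[OF sp] by (auto simp: inj_on_def)
    show "ends ` {e'\<in>E. path_image e' \<subseteq> f} \<subseteq> Pow ?S" using plane_graphD(2,4)[OF pg] by blast
    show "finite (Pow ?S)" by (rule finite_Pow_iff[THEN iffD2, OF fin])
  qed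
  have "compact (skel EP)" "compact (skel EQ)"
    by (rule closed_edges[OF pg finite_subset[OF _ fE]]; auto simp: EP_def EQ_def)+
  moreover have "compact (?S - C)" "compact C" using fin CS by (auto intro: finite_imp_compact finite_subset)
  ultimately have cP: "compact P" "compact Q" unfolding P_def Q_def by (metis compact_Un)+
  have vertP: "p \<notin> C" if "p \<in> P" "p \<in> V" for p
    using that plane_graphD(3)[OF pg] unfolding P_def EP_def by blast
  have vertQ: "p \<in> C" if "p \<in> Q" "p \<in> V" for p
    using that plane_graphD(3)[OF pg] unfolding Q_def EQ_def by blast
  have edgeP: "\<exists>e'\<in>EP. p \<in> path_image e'" if "p \<in> P" "p \<notin> V" for p using that by (auto simp: P_def)
  have edgeQ: "\<exists>e'\<in>EQ. p \<in> path_image e'" if "p \<in> Q" "p \<notin> V" for p using that CS by (auto simp: Q_def)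
  have Int: "p \<in> V" if "e1 \<in> E" "e2 \<in> E" "e1 \<noteq> e2" "p \<in> path_image e1" "p \<in> path_image e2" for p e1 e2
    using plane_graphD(5)[OF pg that(1,2,3)] plane_graphD(2)[OF pg that(1)] that(4,5) by blast
  have PQ: "P \<inter> Q = {}"
  proof -
    have False if p: "p \<in> P" "p \<in> Q" for p
    proof (cases "p \<in> V")
      case True
      then show False using vertP[OF p(1)] vertQ[OF p(2)] by blast
    next
      case False
      obtain e1 e2 where e1: "e1 \<in> EP" "p \<in> path_image e1" and e2: "e2 \<in> EQ" "p \<in> path_image e2"
        using edgeP[OF p(1) False] edgeQ[OF p(2) False] by blast
      have "e1 \<noteq> e2" using e1 e2 by (auto simp: EP_def EQ_def ends_def)
      then show False using Int[of e1 e2 p] e1 e2 False by (auto simp: EP_def EQ_def)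
    qed
    then show ?thesis by blast
  qed
  have Pe: "P \<inter> path_image e \<subseteq> {v}"
  proof
    fix p assume p: "p \<in> P \<inter> path_image e"
    have "p \<in> V"
    proof (rule ccontr)
      assume pV: "p \<notin> V"
      then obtain e1 where e1: "e1 \<in> EP" "p \<in> path_image e1" using edgeP p by blast
      then show False using Int[of e1 e p] pV p e(1) by (auto simp: EP_def)
    qed
    then have "p \<in> {v, x}" "p \<notin> C" using plane_graphD(3)[OF pg e(1)] p e(3) vertP by blast+
    then show "p \<in> {v}" using e(4) by blast
  qed
  have Qe: "Q \<inter> path_image e \<subseteq> {x}"
  proof
    fix p assume p: "p \<in> Q \<inter> path_image e"
    have "p \<in> V"
    proof (rule ccontr)
      assume pV: "p \<notin> V"
      then obtain e1 where e1: "e1 \<in> EQ" "p \<in> path_image e1" using edgeQ p by blast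
      then show False using Int[of e1 e p] pV p e(1) by (auto simp: EQ_def)
    qed
    then have "p \<in> {v, x}" "p \<in> C" using plane_graphD(3)[OF pg e(1)] p e(3) vertQ by blast+
    then show "p \<in> {x}" using CS by blast
  qed
  have split: "e' \<in> EP \<union> EQ" if e': "e' \<in> E" "path_image e' \<subseteq> f" "e' \<noteq> e" for e'
  proof (rule ccontr)
    assume n: "e' \<notin> EP \<union> EQ"
    then obtain y where y: "y \<in> ends e'" "y \<in> C" using e' by (auto simp: EP_def)
    obtain z where z: "ends e' = {y, z}" by (rule ends_other[OF y(1)])
    then have zC: "z \<notin> C" using n e' y by (auto simp: EQ_def)
    have R: "fadj E f y z" using e' z by (auto simp: fadj_def)
    have "z \<in> ?S" using fadj_in[OF pg R] by blast
    then have "z = v" using comps_step[OF C y(2) R] zC by blast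
    then show False using only[OF e'(1,2)] z y(2) e'(3) by blast
  qed
  have vx: "v \<noteq> x" "x \<in> ?S" using e(4) CS by auto
  have sub: "P \<union> path_image e \<union> Q \<subseteq> skel E"
  proof -
    have vs: "p \<in> skel E" if p: "p \<in> ?S" for p
    proof -
      obtain q where "q \<in> ?S" "p \<noteq> q" using v vx by metis
      then obtain y where "fadj E f p y" using conn_neighbour[OF con p] by blast
      then obtain e' where "e' \<in> E" "p \<in> ends e'" unfolding fadj_def by blast
      then show ?thesis using plane_graphD(4)[OF pg] by blast
    qed
    have s: "skel EP \<subseteq> skel E" "skel EQ \<subseteq> skel E" by (auto simp: EP_def EQ_def)
    have S: "?S \<subseteq> skel E" using vs by (rule subsetI)
    have "P \<subseteq> skel E" unfolding P_def by (rule Un_least[OF order_trans[OF Diff_subset S] s(1)])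
    moreover have "Q \<subseteq> skel E" unfolding Q_def by (rule Un_least[OF order_trans[OF order_trans[OF CS Diff_subset] S] s(2)])
    ultimately show ?thesis using UN_upper[OF e(1), of path_image] by simp
  qed
  have fr: "frontier U \<subseteq> P \<union> path_image e \<union> Q"
  proof
    fix p assume "p \<in> frontier U"
    then have "p \<in> ?S \<union> \<Union>(path_image ` {e\<in>E. path_image e \<subseteq> f})"
      using frontier_face[OF pg lf U(1)] U(2) by blast
    then show "p \<in> P \<union> path_image e \<union> Q" using split unfolding P_def Q_def by blast
  qed
  \<comment> \<open>The edge, oriented from the side of \<open>P\<close> to the side of
    \<open>Q\<close>.\<close>
  obtain g where g: "arc g" "path_image g = path_image e" "pathstart g = v" "pathfinish g = x"
  proof (cases "pathstart e = v")
    case True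
    then have "pathfinish e = x" using e(3) vx by (auto simp: ends_def doubleton_eq_iff)
    then show ?thesis using that[of e] True plane_graphD(1)[OF pg e(1)] by simp
  next
    case False
    then have "pathfinish e = v" "pathstart e = x" using e(3) by (auto simp: ends_def doubleton_eq_iff)
    then show ?thesis using that[of "reversepath e"] plane_graphD(1)[OF pg e(1)] by (simp add: arc_reversepath)
  qed
  obtain p where p: "p \<in> path_image g" "p \<noteq> v" "p \<noteq> x" using arc_endless_nonempty[OF g(1)] g(3,4) by blast
  have Usk: "U \<inter> skel E = {}" "U2 \<inter> skel E = {}" using U(1) U2(1) in_components_subset by blast+
  have disj: "A \<inter> X = {}" if "A \<inter> B = {}" "X \<subseteq> B" for A B X :: "complex set" using that by blast
  show False
  proof (rule bridge_one_face[OF g(1) cP PQ])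
    show "P \<inter> path_image g \<subseteq> {pathstart g}" "Q \<inter> path_image g \<subseteq> {pathfinish g}" using Pe Qe g by simp_all
    show "frontier U \<subseteq> P \<union> path_image g \<union> Q" using fr g(2) by simp
    show "U \<inter> (P \<union> path_image g \<union> Q) = {}" "U2 \<inter> (P \<union> path_image g \<union> Q) = {}"
      unfolding g(2) by (rule disj[OF Usk(1) sub], rule disj[OF Usk(2) sub])
    show "U \<inter> U2 = {}" using components_nonoverlap[OF U(1) U2(1)] ne by simp
    show "p \<in> path_image g" "p \<noteq> pathstart g" "p \<noteq> pathfinish g" using p g by simp_all
    show "p \<in> closure U" using p(1) g(2) e(2) U(2) by blast
    show "p \<in> closure U2" using p(1) g(2) U2(2) by blast
  qed
qed

text \<open>Discharging: every edge at \<open>v\<close> splits one unit equally among the at most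
  two faces that contain it. A component attached by several edges receives at least two halves; one
  attached by a single edge receives a full unit, because that edge borders only one face.\<close>

lemma corners_le_degree:
  assumes pg: "plane_graph V E" and sp: "simple_pg E" and lf: "locally_finite_pg E"
    and F: "finite F" "F \<subseteq> faces E" "\<And>f. f \<in> F \<Longrightarrow> v \<in> V \<inter> f \<and> (\<exists>ys. fin_bwalk V E f ys)"
  shows "(\<Sum>f\<in>F. card (comps (fadj E f) (V \<inter> f - {v}))) \<le> deg E v"
proof -
  let ?Ev = "{e\<in>E. v \<in> ends e}"
  define n where "n e = card {f\<in>faces E. path_image e \<subseteq> f}" for e
  have feq: "{f\<in>faces E. path_image e \<subseteq> f} = closure ` {U \<in> components (- skel E). path_image e \<subseteq> closure U}" for e
    by (auto simp: faces_def)
  have nf: "finite {f\<in>faces E. path_image e \<subseteq> f}" "n e \<le> 2" if "e \<in> E" for e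
  proof -
    show "finite {f\<in>faces E. path_image e \<subseteq> f}" unfolding feq using edge_face_comps(1)[OF pg lf that] by simp
    have "n e \<le> card {U \<in> components (- skel E). path_image e \<subseteq> closure U}"
      unfolding n_def feq by (rule card_image_le[OF edge_face_comps(1)[OF pg lf that]])
    then show "n e \<le> 2" using edge_face_comps(2)[OF pg lf that] by linarith
  qed
  have fEv: "finite ?Ev" by (rule finite_edges_at[OF pg lf])
  have face: "real (card (comps (fadj E f) (V \<inter> f - {v}))) \<le> (\<Sum>e\<in>{e\<in>?Ev. path_image e \<subseteq> f}. 1 / real (n e))" if f: "f \<in> F" for f
  proof -
    let ?S = "V \<inter> f"
    let ?Cs = "comps (fadj E f) (?S - {v})"
    have ff: "f \<in> faces E" using f F(2) by blast
    obtain U where U: "U \<in> components (- skel E)" "f = closure U" using ff by (auto simp: faces_def)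
    obtain ys where ys: "fin_bwalk V E f ys" and v: "v \<in> ?S" using F(3)[OF f] by blast
    note c = fin_bwalk_conn[OF pg sp ys]
    define X where "X C = {e\<in>?Ev. path_image e \<subseteq> f \<and> ends e \<inter> C \<noteq> {}}" for C
    have fX: "finite (X C)" for C unfolding X_def by (rule finite_subset[OF _ fEv]) blast
    have npos: "1 \<le> n e" if "e \<in> X C" for e C
    proof -
      have "f \<in> {f\<in>faces E. path_image e \<subseteq> f}" "e \<in> E" using that ff by (auto simp: X_def)
      then have "0 < card {f\<in>faces E. path_image e \<subseteq> f}" using nf(1) card_gt_0_iff by blast
      then show ?thesis by (simp add: n_def)
    qed
    have half: "1/2 \<le> 1 / real (n e)" if "e \<in> X C" for e C
    proof -
      have "e \<in> E" using that by (auto simp: X_def)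
      then show ?thesis using npos[OF that] nf(2)[of e] by (simp add: field_simps)
    qed
    have ge1: "1 \<le> (\<Sum>e\<in>X C. 1 / real (n e))" if C: "C \<in> ?Cs" for C
    proof -
      have CS: "C \<subseteq> ?S - {v}" using in_comps[OF C] by blast
      obtain x where x: "x \<in> C" "fadj E f v x" by (rule comps_neighbour[OF symp_fadj c(2) v C])
      obtain e where e: "e \<in> E" "ends e = {v, x}" "path_image e \<subseteq> f" using x(2) by (auto simp: fadj_def)
      have eX: "e \<in> X C" using e x by (auto simp: X_def)
      show ?thesis
      proof (cases "X C = {e}")
        case True
        have "{f\<in>faces E. path_image e \<subseteq> f} \<subseteq> {f}"
        proof
          fix f' assume "f' \<in> {f\<in>faces E. path_image e \<subseteq> f}"
          then obtain U2 where U2: "U2 \<in> components (- skel E)" "f' = closure U2" "path_image e \<subseteq> closure U2" by (auto simp: faces_def)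
          have "U2 = U"
          proof (rule single_attachment_one_face[OF pg sp lf U c(1,2) v C e(1,3,2) x(1) _ U2(1,3)])
            fix e' assume "e' \<in> E" "path_image e' \<subseteq> f" "v \<in> ends e'" "ends e' \<inter> C \<noteq> {}"
            then have "e' \<in> X C" by (simp add: X_def)
            then show "e' = e" using True by simp
          qed
          then show "f' \<in> {f}" using U U2 by simp
        qed
        then have "n e \<le> 1" unfolding n_def using card_mono[of "{f}"] by fastforce
        then have "n e = 1" using npos[OF eX] by simp
        then show ?thesis using True by simp
      next
        case False
        then obtain e' where e': "e' \<in> X C" "e' \<noteq> e" using eX by blast
        have "(\<Sum>e\<in>{e, e'}. 1 / real (n e)) \<le> (\<Sum>e\<in>X C. 1 / real (n e))"
          by (rule sum_mono2[OF fX]) (use e' eX in auto)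
        then show ?thesis using half[OF eX] half[OF e'(1)] e'(2) by simp
      qed
    qed
    have fC: "finite ?Cs" using c(1) by (simp add: finite_comps)
    have dis: "X C \<inter> X D = {}" if CD: "C \<in> ?Cs" "D \<in> ?Cs" "C \<noteq> D" for C D
    proof -
      have False if e: "e \<in> X C" "e \<in> X D" for e
      proof -
        have "v \<in> ends e" using e(1) by (simp add: X_def)
        then obtain w where w: "ends e = {v, w}" by (rule ends_other)
        have "v \<notin> C" "v \<notin> D" using in_comps[OF CD(1)] in_comps[OF CD(2)] by auto
        then have "w \<in> C" "w \<in> D" using e w by (auto simp: X_def)
        then show False using comps_disjoint[OF symp_fadj CD(1,2)] CD(3) by blast
      qed
      then show ?thesis by blast
    qed
    have "real (card ?Cs) = (\<Sum>C\<in>?Cs. 1)" by simp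
    also have "\<dots> \<le> (\<Sum>C\<in>?Cs. \<Sum>e\<in>X C. 1 / real (n e))" by (rule sum_mono) (rule ge1)
    also have "\<dots> = (\<Sum>e\<in>(\<Union>C\<in>?Cs. X C). 1 / real (n e))"
      by (rule sum.UNION_disjoint[symmetric, OF fC]) (use fX dis in blast)+
    also have "\<dots> \<le> (\<Sum>e\<in>{e\<in>?Ev. path_image e \<subseteq> f}. 1 / real (n e))"
    proof (rule sum_mono2)
      show "finite {e\<in>?Ev. path_image e \<subseteq> f}" by (rule finite_subset[OF _ fEv]) blast
    qed (auto simp: X_def)
    finally show ?thesis .
  qed
  have "real (\<Sum>f\<in>F. card (comps (fadj E f) (V \<inter> f - {v}))) = (\<Sum>f\<in>F. real (card (comps (fadj E f) (V \<inter> f - {v}))))" by simp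
  also have "\<dots> \<le> (\<Sum>f\<in>F. \<Sum>e\<in>{e\<in>?Ev. path_image e \<subseteq> f}. 1 / real (n e))" by (rule sum_mono) (rule face)
  also have "\<dots> = (\<Sum>e\<in>?Ev. \<Sum>f\<in>{f\<in>F. path_image e \<subseteq> f}. 1 / real (n e))" by (rule sum.swap_restrict[OF F(1) fEv])
  also have "\<dots> \<le> (\<Sum>e\<in>?Ev. 1)"
  proof (rule sum_mono)
    fix e assume e: "e \<in> ?Ev"
    have "card {f\<in>F. path_image e \<subseteq> f} \<le> n e"
      unfolding n_def by (rule card_mono) (use nf(1)[of e] e F(2) in auto)
    then show "(\<Sum>f\<in>{f\<in>F. path_image e \<subseteq> f}. 1 / real (n e)) \<le> 1" by (simp add: divide_le_eq)
  qed
  also have "\<dots> = real (deg E v)" by (simp add: deg_def)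
  finally show ?thesis by (simp only: of_nat_le_iff)
qed

text \<open>Faces have length at least 3 and the multiplicities at \<open>v\<close> add up to at
  most the degree, so the corner sum is at most a third of the degree:
  \<open>1 - d/2 + d/3\<close>.\<close>

lemma curvature_upper:
  assumes pg: "plane_graph V E" and sp: "simple_pg E" and lf: "locally_finite_pg E" and cg: "connected_graph V E"
    and big: "\<And>a b. V \<noteq> {a, b}" and v: "v \<in> V"
  shows "kappaV V E v \<le> 1 - real (deg E v) / 6"
proof -
  have "(\<Sum>f\<in>{f\<in>faces E. v \<in> f}. corner_term V E v f) \<le> real (deg E v) / 3"
  proof (cases "finite {f\<in>faces E. v \<in> f}")
    case False
    \<comment> \<open>A sum over an infinite set of faces is 0 by convention.\<close>
    then show ?thesis by simp
  next
    case True
    define F where "F = {f\<in>faces E. v \<in> f \<and> (\<exists>ys. fin_bwalk V E f ys)}"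
    have F: "finite F" "F \<subseteq> faces E" "\<And>f. f \<in> F \<Longrightarrow> v \<in> V \<inter> f \<and> (\<exists>ys. fin_bwalk V E f ys)"
      using v by (auto simp: F_def intro: finite_subset[OF _ True])
    have "(\<Sum>f\<in>{f\<in>faces E. v \<in> f}. corner_term V E v f) = (\<Sum>f\<in>F. corner_term V E v f)"
      by (rule sum.mono_neutral_right[OF True]) (auto simp: F_def corner_term_def)
    also have "\<dots> \<le> (\<Sum>f\<in>F. real (card (comps (fadj E f) (V \<inter> f - {v}))) / 3)"
    proof (rule sum_mono)
      fix f assume f: "f \<in> F"
      obtain ys where ys: "fin_bwalk V E f ys" using F(3)[OF f] by blast
      have ff: "f \<in> faces E" using f F(2) by blast
      note c = fin_bwalk_conn[OF pg sp ys]
      let ?m = "\<lambda>v. card (comps (fadj E f) (V \<inter> f - {v}))"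
      have "3 \<le> card (V \<inter> f)" by (rule face_card_ge_3[OF pg sp lf cg big ff ys])
      also have "\<dots> = (\<Sum>v\<in>V \<inter> f. 1)" by simp
      also have "\<dots> \<le> (\<Sum>v\<in>V \<inter> f. ?m v)" by (rule sum_mono) (use face_total_pos[OF c(3,1)] in \<open>simp add: Suc_le_eq\<close>)
      finally have "3 \<le> real (\<Sum>v\<in>V \<inter> f. ?m v)" by linarith
      then have "real (?m v) / real (\<Sum>v\<in>V \<inter> f. ?m v) \<le> real (?m v) / 3" by (intro divide_left_mono) auto
      then show "corner_term V E v f \<le> real (?m v) / 3"
        using corner_term_eq[OF pg sp ff ys] F(3)[OF f] by simp
    qed
    also have "\<dots> = real (\<Sum>f\<in>F. card (comps (fadj E f) (V \<inter> f - {v}))) / 3" by (simp add: sum_divide_distrib)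
    also have "\<dots> \<le> real (deg E v) / 3"
      using corners_le_degree[OF pg sp lf F] by (intro divide_right_mono) (simp_all only: of_nat_le_iff)
    finally show ?thesis .
  qed
  then show ?thesis unfolding kappaV_def by linarith
qed

lemma curvature_lower: "1 - real (deg E v) / 2 \<le> kappaV V E v"
  unfolding kappaV_def using sum_nonneg[of _ "corner_term V E v"] corner_term_nonneg by fastforce

text \<open>The component of a vertex within \<open>W\<close> has positive total curvature, so one
  of its vertices has positive curvature, and \<open>0 < 1 - d/6\<close> for its degree
  \<open>d\<close> in that component.\<close>

lemma sparse_subgraph:
  assumes pg: "plane_graph V E" and sp: "simple_pg E" and W: "finite W" "W \<noteq> {}" "W \<subseteq> V"
  shows "\<exists>v\<in>W. card {w\<in>W. adj E v w} \<le> 5"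
proof -
  obtain a where a: "a \<in> W" using W(2) by blast
  define W' where "W' = comp_of (adj E) W a"
  have aW': "a \<in> W'" and W'W: "W' \<subseteq> W" using a by (auto simp: W'_def comp_of_def)
  have W'c: "W' \<in> comps (adj E) W" using a by (auto simp: comps_def W'_def)
  have nb: "{w\<in>W. adj E v w} \<subseteq> W' - {v}" if "v \<in> W'" for v
    using comps_step[OF W'c that] by (auto simp: adj_def)
  have fW': "finite W'" using W'W W(1) finite_subset by blast
  show ?thesis
  \<comment> \<open>Up to six vertices the bound 5 is trivial; with more, the exceptional graphs on
    at most two vertices are excluded.\<close>
  proof (cases "card W' \<le> 6")
    case True
    have "card {w\<in>W. adj E a w} \<le> card (W' - {a})" by (rule card_mono) (use nb[OF aW'] fW' in auto)
    also have "\<dots> \<le> 5" using True aW' fW' by simp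
    finally show ?thesis using a by blast
  next
    case False
    define E' where "E' = {e\<in>E. ends e \<subseteq> W'}"
    have adj': "adj E' u w \<longleftrightarrow> adj E u w \<and> u \<in> W' \<and> w \<in> W'" for u w by (auto simp: adj_def E'_def)
    have pg': "plane_graph W' E'"
      using pg W'W W(3) unfolding plane_graph_def E'_def ends_def by (auto 0 3)
    have sp': "simple_pg E'" by (rule simple_pg_subset[OF sp]) (auto simp: E'_def)
    have fE': "finite E'"
    proof (rule inj_on_finite[of ends _ "Pow W'"])
      show "inj_on ends E'" using edge_unique[OF sp'] by (auto simp: inj_on_def)
    qed (use fW' in \<open>auto simp: E'_def\<close>)
    have cg': "connected_graph W' E'"
      unfolding connected_graph_def
    proof (intro conjI ballI)
      show "W' \<noteq> {}" using aW' by blast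
      have r: "(a, w) \<in> {(a, b). adj E' a b}\<^sup>*" if "w \<in> W'" for w
      proof -
        have "(a, w) \<in> reach (adj E) W" using that by (simp add: W'_def comp_of_def)
        then have "w \<in> W' \<and> (a, w) \<in> {(a, b). adj E' a b}\<^sup>*" unfolding reach_def
        proof (induction rule: rtrancl_induct)
          case (step y z)
          then have "z \<in> W'" using comps_step[OF W'c, of y z] by auto
          then have "adj E' y z" using step adj' by auto
          then show ?case using step \<open>z \<in> W'\<close> by (auto intro: rtrancl_into_rtrancl)
        qed (use aW' in simp)
        then show ?thesis by blast
      qed
      have "sym {(a, b). adj E' a b}" using symp_adj[of E'] by (auto simp: sym_def symp_def)
      then have "sym ({(a, b). adj E' a b}\<^sup>*)" by (rule sym_rtrancl)
      then show "(u, w) \<in> {(a, b). adj E' a b}\<^sup>*" if "u \<in> W'" "w \<in> W'" for u w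
        using r[OF that(1)] r[OF that(2)] by (meson rtrancl_trans symD)
    qed
    have big: "W' \<noteq> {x, y}" for x y
    proof
      assume "W' = {x, y}"
      then have "card W' \<le> 2" by (simp add: card_insert_if)
      then show False using False by simp
    qed
    have ne: "E' \<noteq> {}"
    proof -
      have "W' \<noteq> {a}" using big[of a a] by simp
      then show ?thesis using vertex_has_edge[OF pg' cg' aW'] by blast
    qed
    have lf': "locally_finite_pg E'" by (rule finite_locally_finite[OF fE'])
    have "0 < (\<Sum>v\<in>W'. kappaV W' E' v)" by (rule total_curvature_pos[OF pg' cg' fW' fE' ne sp'])
    then obtain v where v: "v \<in> W'" "0 < kappaV W' E' v" by (metis sum_nonpos not_le)
    then have "real (deg E' v) < 6" using curvature_upper[OF pg' sp' lf' cg' big v(1)] by simp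
    then have "deg E' v \<le> 5" by simp
    moreover have "{w\<in>W. adj E v w} = {w. adj E' v w}" using nb[OF v(1)] v(1) W'W adj' by blast
    ultimately have "card {w\<in>W. adj E v w} \<le> 5" using deg_eq_card_neighbours(2)[OF pg' sp' lf', of v] by simp
    then show ?thesis using v(1) W'W by blast
  qed
qed

lemma infinite_vertices:
  assumes pg: "plane_graph V E" and sp: "simple_pg E" and cg: "connected_graph V E"
    and k: "\<forall>v\<in>V. kappaV V E v \<le> 0"
  shows "infinite V"
proof
  assume fV: "finite V"
  have fE: "finite E"
  proof (rule inj_on_finite[of ends _ "Pow V"])
    show "inj_on ends E" using edge_unique[OF sp] by (auto simp: inj_on_def)
    show "ends ` E \<subseteq> Pow V" using plane_graphD(2)[OF pg] by blast
  qed (use fV in simp)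
  obtain v where v: "v \<in> V" using cg by (auto simp: connected_graph_def)
  show False
  proof (cases "E = {}")
    case True
    then have "1 \<le> kappaV V E v" using curvature_lower[of E v V] by (simp add: deg_def)
    then show False using k v by force
  next
    case False
    have "0 < (\<Sum>v\<in>V. kappaV V E v)" by (rule total_curvature_pos[OF pg cg fV fE False sp])
    moreover have "(\<Sum>v\<in>V. kappaV V E v) \<le> 0" by (rule sum_nonpos) (use k in blast)
    ultimately show False by linarith
  qed
qed

section \<open>The Hilbert space of square summable functions\<close>

text \<open>One complete space serves both weights: functions on \<open>V\<close> are those
  vanishing elsewhere, and a weight is absorbed by an isometry. The inner product is the real part
  of the complex one, so this is a real Hilbert space; complex scalars act through
  \<open>scC\<close>.\<close>

typedef 'a l2 = "{f :: 'a \<Rightarrow> complex. (\<lambda>x. (cmod (f x))\<^sup>2) summable_on UNIV}"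
  morphisms l2app Abs_l2
  by (rule exI[of _ "\<lambda>_. 0"]) simp

lemma cmod_add_sq: "(cmod (z + w))\<^sup>2 \<le> 2 * (cmod z)\<^sup>2 + 2 * (cmod w)\<^sup>2"
proof -
  have "(cmod (z + w))\<^sup>2 \<le> (cmod z + cmod w)\<^sup>2" by (intro power_mono norm_triangle_ineq) simp
  also have "\<dots> \<le> 2 * (cmod z)\<^sup>2 + 2 * (cmod w)\<^sup>2"
    using zero_le_power2[of "cmod z - cmod w"] by (simp add: power2_eq_square algebra_simps)
  finally show ?thesis .
qed

lemma l2_summable: "(\<lambda>x. (cmod (l2app f x))\<^sup>2) summable_on A"
  using l2app[of f] by (auto intro: summable_on_subset_banach)

lemma sq_summable_iff:
  "(\<lambda>x. (cmod (f x))\<^sup>2) summable_on UNIV \<longleftrightarrow> (\<exists>C. \<forall>F. finite F \<longrightarrow> (\<Sum>x\<in>F. (cmod (f x))\<^sup>2) \<le> C)"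
proof
  assume s: "(\<lambda>x. (cmod (f x))\<^sup>2) summable_on UNIV"
  show "\<exists>C. \<forall>F. finite F \<longrightarrow> (\<Sum>x\<in>F. (cmod (f x))\<^sup>2) \<le> C"
    by (rule exI) (use finite_sum_le_infsum[OF s] in auto)
next
  assume "\<exists>C. \<forall>F. finite F \<longrightarrow> (\<Sum>x\<in>F. (cmod (f x))\<^sup>2) \<le> C"
  then show "(\<lambda>x. (cmod (f x))\<^sup>2) summable_on UNIV"
    by (intro nonneg_bdd_above_summable_on) (auto simp: bdd_above_def)
qed

lemma sq_summable_add:
  assumes "(\<lambda>x. (cmod (f x))\<^sup>2) summable_on A" "(\<lambda>x. (cmod (g x))\<^sup>2) summable_on A"
  shows "(\<lambda>x. (cmod (f x + g x))\<^sup>2) summable_on A"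
proof (rule summable_on_comparison_test)
  show "(\<lambda>x. 2 * (cmod (f x))\<^sup>2 + 2 * (cmod (g x))\<^sup>2) summable_on A"
    using assms by (intro summable_on_add summable_on_cmult_right)
qed (simp_all add: cmod_add_sq)

lemma sq_summable_cmult:
  assumes "(\<lambda>x. (cmod (f x))\<^sup>2) summable_on A"
  shows "(\<lambda>x. (cmod (c * f x))\<^sup>2) summable_on A"
  using summable_on_cmult_right[OF assms, of "(cmod c)\<^sup>2"] by (simp add: norm_mult power_mult_distrib)

instantiation l2 :: (type) real_vector
begin
definition "0 = Abs_l2 (\<lambda>_. 0)"
definition "f + g = Abs_l2 (\<lambda>x. l2app f x + l2app g x)"
definition "- f = Abs_l2 (\<lambda>x. - l2app f x)"
definition "f - g = Abs_l2 (\<lambda>x. l2app f x - l2app g x)"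
definition "r *\<^sub>R f = Abs_l2 (\<lambda>x. complex_of_real r * l2app f x)"

lemma l2app_zero [simp]: "l2app 0 x = 0"
  by (simp add: zero_l2_def Abs_l2_inverse)

lemma l2app_add [simp]: "l2app (f + g) x = l2app f x + l2app g x"
  using sq_summable_add[OF l2_summable[of f UNIV] l2_summable[of g UNIV]]
  by (simp add: plus_l2_def Abs_l2_inverse)

lemma l2app_uminus [simp]: "l2app (- f) x = - l2app f x"
  using l2_summable[of f UNIV] by (simp add: uminus_l2_def Abs_l2_inverse)

lemma l2app_diff [simp]: "l2app (f - g) x = l2app f x - l2app g x"
  using sq_summable_add[OF l2_summable[of f UNIV] l2_summable[of "- g" UNIV]]
  by (simp add: minus_l2_def Abs_l2_inverse)

lemma l2app_scaleR [simp]: "l2app (r *\<^sub>R f) x = complex_of_real r * l2app f x"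
  using sq_summable_cmult[OF l2_summable[of f UNIV], of "complex_of_real r"]
  by (simp add: scaleR_l2_def Abs_l2_inverse)

lemma l2_eqI: "(\<And>x. l2app f x = l2app g x) \<Longrightarrow> f = g"
  by (metis ext l2app_inject)

instance
  by standard (auto intro!: l2_eqI simp: algebra_simps)
end

instantiation l2 :: (type) real_inner
begin
definition "inner f g = (\<Sum>\<^sub>\<infinity>x. inner (l2app f x) (l2app g x))"
definition "norm (f :: 'a l2) = sqrt (inner f f)"
definition "sgn (f :: 'a l2) = inverse (norm f) *\<^sub>R f"
definition "dist (f :: 'a l2) g = norm (f - g)"
definition "uniformity = (INF e\<in>{0<..}. principal {(f :: 'a l2, g). dist f g < e})"
definition "open (U :: 'a l2 set) \<longleftrightarrow> (\<forall>x\<in>U. eventually (\<lambda>(x', y). x' = x \<longrightarrow> y \<in> U) uniformity)"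

lemma l2_inner_summable: "(\<lambda>x. inner (l2app f x) (l2app g x)) summable_on A"
proof -
  have "(\<lambda>x. (cmod (l2app f x))\<^sup>2 + (cmod (l2app g x))\<^sup>2) summable_on A"
    by (intro summable_on_add l2_summable)
  then have "(\<lambda>x. norm (inner (l2app f x) (l2app g x))) summable_on A"
  proof (rule summable_on_comparison_test)
    fix x
    have "\<bar>inner (l2app f x) (l2app g x)\<bar> \<le> cmod (l2app f x) * cmod (l2app g x)"
      by (rule Cauchy_Schwarz_ineq2)
    also have "\<dots> \<le> (cmod (l2app f x))\<^sup>2 + (cmod (l2app g x))\<^sup>2"
    proof -
      have "a * b \<le> a\<^sup>2 + b\<^sup>2" if "0 \<le> a" "0 \<le> b" for a b :: real
        using sum_squares_bound[of a b] mult_nonneg_nonneg[OF that] unfolding mult.assoc by linarith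
      then show ?thesis by simp
    qed
    finally show "norm (inner (l2app f x) (l2app g x)) \<le> (cmod (l2app f x))\<^sup>2 + (cmod (l2app g x))\<^sup>2" by simp
  qed simp
  then show ?thesis by (rule abs_summable_summable)
qed

instance
proof
  fix f g h :: "'a l2" and r :: real
  show "inner f g = inner g f" by (simp add: inner_l2_def inner_commute)
  show "inner (f + g) h = inner f h + inner g h"
    by (simp add: inner_l2_def inner_add_left infsum_add l2_inner_summable)
  have "inner (complex_of_real r * z) w = r * inner z w" for z w by (simp add: inner_complex_def algebra_simps)
  then show "inner (r *\<^sub>R f) g = r * inner f g"
    by (simp add: inner_l2_def infsum_cmult_right')
  show pos: "0 \<le> inner f f" by (simp add: inner_l2_def infsum_nonneg)
  show "inner f f = 0 \<longleftrightarrow> f = 0"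
  proof
    assume z: "inner f f = 0"
    have "l2app f x = 0" for x
    proof -
      have "(\<Sum>x\<in>{x}. inner (l2app f x) (l2app f x)) \<le> inner f f"
        unfolding inner_l2_def by (rule finite_sum_le_infsum[OF l2_inner_summable]) auto
      then show ?thesis using z by (metis inner_ge_zero inner_eq_zero_iff order_antisym sum.insert sum.empty finite.emptyI empty_iff add.right_neutral)
    qed
    then show "f = 0" by (intro l2_eqI) simp
  qed (simp add: inner_l2_def)
qed (simp_all add: norm_l2_def sgn_l2_def dist_l2_def uniformity_l2_def open_l2_def)
end

lemma l2_norm_sq: "(norm (f :: 'a l2))\<^sup>2 = (\<Sum>\<^sub>\<infinity>x. (cmod (l2app f x))\<^sup>2)"
  by (simp add: power2_norm_eq_inner inner_l2_def)

lemma l2_finite_le: "finite F \<Longrightarrow> (\<Sum>x\<in>F. (cmod (l2app f x))\<^sup>2) \<le> (norm f)\<^sup>2"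
  unfolding l2_norm_sq by (rule finite_sum_le_infsum[OF l2_summable]) auto

lemma l2_norm_le:
  assumes "\<And>F. finite F \<Longrightarrow> (\<Sum>x\<in>F. (cmod (l2app f x))\<^sup>2) \<le> C\<^sup>2" "0 \<le> C"
  shows "norm f \<le> C"
proof -
  have "(norm f)\<^sup>2 \<le> C\<^sup>2" unfolding l2_norm_sq by (rule infsum_le_finite_sums[OF l2_summable]) (use assms in auto)
  then show ?thesis using assms(2) by (rule power2_le_imp_le)
qed

lemma l2_app_le: "cmod (l2app f x) \<le> norm f"
proof -
  have "(cmod (l2app f x))\<^sup>2 \<le> (norm f)\<^sup>2" using l2_finite_le[of "{x}" f] by simp
  then show ?thesis by (rule power2_le_imp_le) simp
qed

instance l2 :: (type) complete_space
proof
  fix X :: "nat \<Rightarrow> 'a l2" assume C: "Cauchy X"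
  have Cx: "Cauchy (\<lambda>n. l2app (X n) x)" for x
  proof (rule CauchyI)
    fix e :: real assume "0 < e"
    then obtain M where M: "\<And>m n. m \<ge> M \<Longrightarrow> n \<ge> M \<Longrightarrow> norm (X m - X n) < e" using CauchyD[OF C] by blast
    have "norm (l2app (X m) x - l2app (X n) x) < e" if "m \<ge> M" "n \<ge> M" for m n
      using l2_app_le[of "X m - X n" x] M[OF that] by simp
    then show "\<exists>M. \<forall>m\<ge>M. \<forall>n\<ge>M. norm (l2app (X m) x - l2app (X n) x) < e" by blast
  qed
  have "\<forall>x. \<exists>l. (\<lambda>n. l2app (X n) x) \<longlonglongrightarrow> l" using Cauchy_convergent[OF Cx] by (simp add: convergent_def)
  then obtain g where g: "\<And>x. (\<lambda>n. l2app (X n) x) \<longlonglongrightarrow> g x" by metis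
  \<comment> \<open>A finite partial sum passes to the limit in \<open>m\<close>; this gives both
    the square summability of \<open>g\<close> and the convergence in norm.\<close>
  have bnd: "(\<Sum>x\<in>F. (cmod (l2app (X n) x - g x))\<^sup>2) \<le> e\<^sup>2"
    if F: "finite F" and e: "\<And>m. m \<ge> M \<Longrightarrow> norm (X n - X m) \<le> e" for F n e M
  proof (rule tendsto_upperbound)
    show "(\<lambda>m. \<Sum>x\<in>F. (cmod (l2app (X n) x - l2app (X m) x))\<^sup>2) \<longlonglongrightarrow> (\<Sum>x\<in>F. (cmod (l2app (X n) x - g x))\<^sup>2)"
      by (intro tendsto_intros g)
    show "\<forall>\<^sub>F m in sequentially. (\<Sum>x\<in>F. (cmod (l2app (X n) x - l2app (X m) x))\<^sup>2) \<le> e\<^sup>2"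
      unfolding eventually_sequentially
    proof (intro exI allI impI)
      fix m assume "M \<le> m"
      have "(\<Sum>x\<in>F. (cmod (l2app (X n - X m) x))\<^sup>2) \<le> (norm (X n - X m))\<^sup>2" by (rule l2_finite_le[OF F])
      also have "\<dots> \<le> e\<^sup>2" using e[OF \<open>M \<le> m\<close>] by (intro power_mono) auto
      finally show "(\<Sum>x\<in>F. (cmod (l2app (X n) x - l2app (X m) x))\<^sup>2) \<le> e\<^sup>2" by simp
    qed
  qed simp
  have cau: "\<exists>M. \<forall>n\<ge>M. \<forall>m\<ge>M. norm (X n - X m) \<le> e" if "e > 0" for e
    using CauchyD[OF C that] by (meson less_imp_le)
  have "(\<lambda>x. (cmod (g x))\<^sup>2) summable_on UNIV"
  proof -
    obtain M where M: "\<forall>n\<ge>M. \<forall>m\<ge>M. norm (X n - X m) \<le> 1" using cau[of 1] by auto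
    have "(\<lambda>x. (cmod (l2app (X M) x - g x))\<^sup>2) summable_on UNIV"
      unfolding sq_summable_iff by (rule exI[of _ "1\<^sup>2"]) (use bnd[of _ M M 1] M in auto)
    from sq_summable_add[OF sq_summable_cmult[OF this, of "-1"] l2_summable[of "X M" UNIV]]
    show ?thesis by simp
  qed
  then have ga: "l2app (Abs_l2 g) = g" by (simp add: Abs_l2_inverse)
  have "X \<longlonglongrightarrow> Abs_l2 g"
  proof (rule LIMSEQ_I)
    fix e :: real assume e: "0 < e"
    obtain M where M: "\<forall>n\<ge>M. \<forall>m\<ge>M. norm (X n - X m) \<le> e/2" using cau[of "e/2"] e by auto
    have "norm (X n - Abs_l2 g) < e" if n: "n \<ge> M" for n
    proof -
      have "norm (X n - Abs_l2 g) \<le> e/2"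
        by (rule l2_norm_le) (use bnd[of _ M n "e/2"] M n e ga in auto)
      then show ?thesis using e by simp
    qed
    then show "\<exists>M. \<forall>n\<ge>M. norm (X n - Abs_l2 g) < e" by blast
  qed
  then show "convergent X" by (auto simp: convergent_def)
qed

text \<open>A diagonal subsequence converges at every point of the countable set, and uniformly
  small tails turn this into convergence in norm.\<close>

lemma l2_convergent_subsequence:
  fixes X :: "nat \<Rightarrow> 'a l2"
  assumes V: "countable V" and supp: "\<And>n x. x \<notin> V \<Longrightarrow> l2app (X n) x = 0"
    and M: "\<And>n. norm (X n) \<le> M"
    and tail: "\<And>e. e > 0 \<Longrightarrow> \<exists>K. finite K \<and> (\<forall>n W. finite W \<longrightarrow> W \<subseteq> V - K \<longrightarrow> (\<Sum>x\<in>W. (cmod (l2app (X n) x))\<^sup>2) \<le> e)"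
  obtains r l where "strict_mono (r :: nat \<Rightarrow> nat)" "(\<lambda>n. X (r n)) \<longlonglongrightarrow> l"
proof -
  have "norm (l2app (X n) x) \<le> M" for n x using l2_app_le[of "X n" x] M[of n] by linarith
  then obtain r where r: "strict_mono (r :: nat \<Rightarrow> nat)" "\<And>x. x \<in> V \<Longrightarrow> \<exists>l. (\<lambda>n. l2app (X (r n)) x) \<longlonglongrightarrow> l"
    using function_convergent_subsequence[OF V, of "\<lambda>n. l2app (X n)" M] by metis
  have "Cauchy (\<lambda>n. X (r n))"
  proof (rule CauchyI)
    fix e :: real assume e: "0 < e"
    \<comment> \<open>The finite part will contribute at most \<open>d\<close>, the two tails
      together at most \<open>4 * d\<close>.\<close>
    define d where "d = (e/2)\<^sup>2 / 5"
    have d: "d > 0" using e by (simp add: d_def)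
    obtain K where K: "finite K" "\<And>n W. finite W \<Longrightarrow> W \<subseteq> V - K \<Longrightarrow> (\<Sum>x\<in>W. (cmod (l2app (X n) x))\<^sup>2) \<le> d"
      using tail[OF d] by blast
    define L where "L = K \<inter> V"
    have L: "finite L" using K by (simp add: L_def)
    have "\<forall>x\<in>L. \<exists>l. (\<lambda>n. l2app (X (r n)) x) \<longlonglongrightarrow> l" using r(2) by (auto simp: L_def)
    then obtain g where g: "\<And>x. x \<in> L \<Longrightarrow> (\<lambda>n. l2app (X (r n)) x) \<longlonglongrightarrow> g x" by metis
    have "(\<lambda>n. \<Sum>x\<in>L. (cmod (l2app (X (r n)) x - g x))\<^sup>2) \<longlonglongrightarrow> (\<Sum>x\<in>L. (cmod (g x - g x))\<^sup>2)"
      by (intro tendsto_intros g)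
    then have "(\<lambda>n. \<Sum>x\<in>L. (cmod (l2app (X (r n)) x - g x))\<^sup>2) \<longlonglongrightarrow> 0" by simp
    then have "eventually (\<lambda>n. (\<Sum>x\<in>L. (cmod (l2app (X (r n)) x - g x))\<^sup>2) < d/4) sequentially"
      by (rule order_tendstoD) (use d in simp)
    then obtain N where N: "\<And>n. n \<ge> N \<Longrightarrow> (\<Sum>x\<in>L. (cmod (l2app (X (r n)) x - g x))\<^sup>2) < d/4"
      unfolding eventually_sequentially by blast
    have "norm (X (r m) - X (r n)) < e" if mn: "m \<ge> N" "n \<ge> N" for m n
    proof -
      have "norm (X (r m) - X (r n)) \<le> e/2"
      proof (rule l2_norm_le)
        fix F :: "'a set" assume F: "finite F"
        let ?h = "\<lambda>x. (cmod (l2app (X (r m) - X (r n)) x))\<^sup>2"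
        have "(\<Sum>x\<in>F. ?h x) = (\<Sum>x\<in>F \<inter> V. ?h x)"
          by (rule sum.mono_neutral_right[OF F]) (auto simp: supp)
        also have "\<dots> = (\<Sum>x\<in>F \<inter> V \<inter> K. ?h x) + (\<Sum>x\<in>F \<inter> V - K. ?h x)"
          by (rule sum.Int_Diff) (use F in simp)
        also have "(\<Sum>x\<in>F \<inter> V \<inter> K. ?h x) \<le> (\<Sum>x\<in>L. ?h x)"
          by (rule sum_mono2[OF L]) (auto simp: L_def)
        also have "(\<Sum>x\<in>L. ?h x) \<le> (\<Sum>x\<in>L. 2 * (cmod (l2app (X (r m)) x - g x))\<^sup>2 + 2 * (cmod (l2app (X (r n)) x - g x))\<^sup>2)"
          using cmod_add_sq[of "l2app (X (r m)) x - g x" "g x - l2app (X (r n)) x" for x]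
          by (intro sum_mono) (simp add: norm_minus_commute)
        also have "\<dots> \<le> d"
          using N[OF mn(1)] N[OF mn(2)] by (simp add: sum.distrib sum_distrib_left[symmetric])
        also have "(\<Sum>x\<in>F \<inter> V - K. ?h x) \<le> (\<Sum>x\<in>F \<inter> V - K. 2 * (cmod (l2app (X (r m)) x))\<^sup>2 + 2 * (cmod (l2app (X (r n)) x))\<^sup>2)"
          using cmod_add_sq[of "l2app (X (r m)) x" "- l2app (X (r n)) x" for x] by (intro sum_mono) simp
        also have "\<dots> \<le> 4 * d"
        proof -
          have "finite (F \<inter> V - K)" "F \<inter> V - K \<subseteq> V - K" using F by auto
          from K(2)[OF this, of "r m"] K(2)[OF this, of "r n"] show ?thesis
            by (simp add: sum.distrib sum_distrib_left[symmetric])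
        qed
        finally show "(\<Sum>x\<in>F. ?h x) \<le> (e/2)\<^sup>2" by (simp add: d_def)
      qed (use e in simp)
      then show ?thesis using e by simp
    qed
    then show "\<exists>M. \<forall>m\<ge>M. \<forall>n\<ge>M. norm (X (r m) - X (r n)) < e" by blast
  qed
  then obtain l where "(\<lambda>n. X (r n)) \<longlonglongrightarrow> l" using Cauchy_convergent convergent_def by metis
  then show ?thesis using that r(1) by blast
qed

lemma norm_diff_scaleR_sq:
  fixes z y :: "'a::real_inner"
  shows "(norm (z - t *\<^sub>R y))\<^sup>2 = (norm z)\<^sup>2 - 2 * t * inner z y + t\<^sup>2 * inner y y"
  unfolding power2_norm_eq_inner
  by (simp add: inner_diff_left inner_diff_right inner_commute[of y z] power2_eq_square algebra_simps)

text \<open>A minimising sequence is Cauchy by the parallelogram law, and varying the minimiser in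
  the direction \<open>y\<close> gives orthogonality.\<close>

lemma orthogonal_projection:
  fixes x :: "'a::{real_inner, complete_space}"
  assumes R: "closed R" "subspace R"
  obtains r where "r \<in> R" "\<And>y. y \<in> R \<Longrightarrow> inner (x - r) y = 0"
proof -
  define d where "d = (INF r\<in>R. norm (x - r))"
  have R0: "0 \<in> R" using R(2) by (rule subspace_0)
  have bdd: "bdd_below ((\<lambda>r. norm (x - r)) ` R)" by (auto simp: bdd_below_def intro: exI[of _ 0])
  have d: "d \<le> norm (x - r)" if "r \<in> R" for r unfolding d_def by (rule cINF_lower[OF bdd that])
  have d0: "0 \<le> d" unfolding d_def by (rule cINF_greatest) (use R0 in auto)
  have "\<exists>r\<in>R. norm (x - r) < d + e" if "e > 0" for e
  proof (rule ccontr)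
    assume n: "\<not> ?thesis"
    have "d + e \<le> d" unfolding d_def by (rule cINF_greatest) (use R0 n d_def in \<open>auto simp: not_less\<close>)
    then show False using that by simp
  qed
  then have "\<forall>n. \<exists>r\<in>R. norm (x - r) < d + 1 / real (Suc n)" by simp
  then obtain s where s: "\<And>n. s n \<in> R" "\<And>n. norm (x - s n) < d + 1 / real (Suc n)" by metis
  have lim: "(\<lambda>n. norm (x - s n)) \<longlonglongrightarrow> d"
  proof (rule tendsto_sandwich[of "\<lambda>_. d" "\<lambda>n. norm (x - s n)" sequentially "\<lambda>n. d + 1 / real (Suc n)"])
    show "(\<lambda>n. d + 1 / real (Suc n)) \<longlonglongrightarrow> d"
      using tendsto_add[OF tendsto_const LIMSEQ_Suc[OF lim_1_over_n], of d] by simp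
    show "(\<lambda>_. d) \<longlonglongrightarrow> d" by simp
    show "\<forall>\<^sub>F n in sequentially. d \<le> norm (x - s n)" using d s(1) by simp
    show "\<forall>\<^sub>F n in sequentially. norm (x - s n) \<le> d + 1 / real (Suc n)" using s(2) less_imp_le by (intro always_eventually) blast
  qed
  have par: "(norm (s m - s n))\<^sup>2 \<le> 2 * (norm (x - s m))\<^sup>2 + 2 * (norm (x - s n))\<^sup>2 - 4 * d\<^sup>2" for m n
  proof -
    let ?a = "x - s m" and ?b = "x - s n"
    have "(1/2) *\<^sub>R (s m + s n) \<in> R" using R(2) s(1) by (simp add: subspace_add subspace_scale)
    then have "d \<le> norm (x - (1/2) *\<^sub>R (s m + s n))" by (rule d)
    also have "x - (1/2) *\<^sub>R (s m + s n) = (1/2) *\<^sub>R (?a + ?b)"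
      by (simp add: algebra_simps scaleR_add_left[symmetric])
    finally have "2 * d \<le> norm (?a + ?b)" by simp
    then have "(2 * d)\<^sup>2 \<le> (norm (?a + ?b))\<^sup>2" using d0 by (intro power_mono) auto
    then have "4 * d\<^sup>2 \<le> (norm (?a + ?b))\<^sup>2" by (simp add: power_mult_distrib)
    moreover have "(norm (?a + ?b))\<^sup>2 + (norm (?a - ?b))\<^sup>2 = 2 * (norm ?a)\<^sup>2 + 2 * (norm ?b)\<^sup>2"
      by (simp add: power2_norm_eq_inner inner_add_left inner_add_right inner_diff_left inner_diff_right inner_commute)
    moreover have "?a - ?b = s n - s m" by simp
    ultimately show ?thesis by (simp add: norm_minus_commute)
  qed
  have "Cauchy s"
  proof (rule CauchyI)
    fix e :: real assume e: "0 < e"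
    have "(\<lambda>n. (norm (x - s n))\<^sup>2) \<longlonglongrightarrow> d\<^sup>2" by (intro tendsto_intros lim)
    then have "eventually (\<lambda>n. (norm (x - s n))\<^sup>2 < d\<^sup>2 + e\<^sup>2 / 4) sequentially"
      by (rule order_tendstoD) (use e in simp)
    then obtain N where N: "\<And>n. n \<ge> N \<Longrightarrow> (norm (x - s n))\<^sup>2 < d\<^sup>2 + e\<^sup>2 / 4" unfolding eventually_sequentially by blast
    have "norm (s m - s n) < e" if "m \<ge> N" "n \<ge> N" for m n
    proof -
      have "(norm (s m - s n))\<^sup>2 < e\<^sup>2" using par[of m n] N[OF that(1)] N[OF that(2)] by linarith
      then show ?thesis using e by (intro power2_less_imp_less[of _ e]) auto
    qed
    then show "\<exists>M. \<forall>m\<ge>M. \<forall>n\<ge>M. norm (s m - s n) < e" by blast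
  qed
  then obtain r where r: "s \<longlonglongrightarrow> r" using Cauchy_convergent convergent_def by metis
  have rR: "r \<in> R" using closed_sequentially[OF R(1)] s(1) r by blast
  have "(\<lambda>n. norm (x - s n)) \<longlonglongrightarrow> norm (x - r)" by (intro tendsto_intros r)
  then have nr: "norm (x - r) = d" using lim LIMSEQ_unique by blast
  have "inner (x - r) y = 0" if y: "y \<in> R" for y
  proof (cases "y = 0")
    case False
    define t where "t = inner (x - r) y / inner y y"
    have yy: "inner y y > 0" using False by simp
    have "r + t *\<^sub>R y \<in> R" using R(2) rR y by (simp add: subspace_add subspace_scale)
    then have "d \<le> norm (x - (r + t *\<^sub>R y))" by (rule d)
    then have "(norm (x - r))\<^sup>2 \<le> (norm (x - r - t *\<^sub>R y))\<^sup>2" using nr d0 by (intro power_mono) (simp_all add: algebra_simps)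
    also have "\<dots> = (norm (x - r))\<^sup>2 - 2 * t * inner (x - r) y + t\<^sup>2 * inner y y"
      by (rule norm_diff_scaleR_sq)
    finally have "2 * t * inner (x - r) y \<le> t\<^sup>2 * inner y y" by simp
    then have "2 * (inner (x - r) y)\<^sup>2 / inner y y \<le> (inner (x - r) y)\<^sup>2 / inner y y"
      using yy by (simp add: t_def power2_eq_square)
    then have "(inner (x - r) y)\<^sup>2 \<le> 0" using yy by (simp add: divide_le_cancel)
    then show ?thesis by simp
  qed simp
  then show ?thesis using that rR by blast
qed

section \<open>Bounded symmetric operators\<close>

text \<open>The operator lives on a closed subspace of the type, so that the results apply both to
  the functions supported on the vertices and to the orthogonal complement of eigenspaces.\<close>

locale bounded_symmetric =
  fixes H :: "'a::{real_inner, complete_space} set" and T :: "'a \<Rightarrow> 'a" and K :: real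
  assumes sub: "subspace H" and cl: "closed H" and maps: "\<And>x. x \<in> H \<Longrightarrow> T x \<in> H"
    and add: "\<And>x y. x \<in> H \<Longrightarrow> y \<in> H \<Longrightarrow> T (x + y) = T x + T y"
    and scale: "\<And>x c. x \<in> H \<Longrightarrow> T (c *\<^sub>R x) = c *\<^sub>R T x"
    and bound: "\<And>x. x \<in> H \<Longrightarrow> norm (T x) \<le> K * norm x" and K: "0 < K"
    and symm: "\<And>x y. x \<in> H \<Longrightarrow> y \<in> H \<Longrightarrow> inner (T x) y = inner x (T y)"

text \<open>Failure of this for \<open>T - l\<close> means that \<open>l\<close> is an approximate
  eigenvalue; for the symmetric operators below this takes the place of the spectrum.\<close>

definition bdd_below_op :: "'a::real_normed_vector set \<Rightarrow> ('a \<Rightarrow> 'a) \<Rightarrow> bool" where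
  "bdd_below_op H S \<longleftrightarrow> (\<exists>c>0. \<forall>x\<in>H. c * norm x \<le> norm (S x))"

lemma subspace_closure:
  fixes S :: "'a::real_normed_vector set"
  assumes S: "subspace S"
  shows "subspace (closure S)"
proof (rule subspaceI)
  show "0 \<in> closure S" using subspace_0[OF S] closure_subset by blast
  show "x + y \<in> closure S" if xy: "x \<in> closure S" "y \<in> closure S" for x y
  proof -
    obtain p q where "\<And>n. p n \<in> S" "p \<longlonglongrightarrow> x" "\<And>n. q n \<in> S" "q \<longlonglongrightarrow> y"
      using xy unfolding closure_sequential by blast
    then have "\<forall>n. p n + q n \<in> S" "(\<lambda>n. p n + q n) \<longlonglongrightarrow> x + y"
      using subspace_add[OF S] by (auto intro: tendsto_add)
    then show ?thesis unfolding closure_sequential by (intro exI conjI)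
  qed
  show "c *\<^sub>R x \<in> closure S" if x: "x \<in> closure S" for c x
  proof -
    obtain p where "\<And>n. p n \<in> S" "p \<longlonglongrightarrow> x" using x unfolding closure_sequential by blast
    then have "\<forall>n. c *\<^sub>R p n \<in> S" "(\<lambda>n. c *\<^sub>R p n) \<longlonglongrightarrow> c *\<^sub>R x"
      using subspace_scale[OF S] by (auto intro: tendsto_scaleR)
    then show ?thesis unfolding closure_sequential by (intro exI conjI)
  qed
qed

lemma bdd_below_op_comp:
  assumes "bdd_below_op H S" "bdd_below_op H S'" "\<And>x. x \<in> H \<Longrightarrow> S' x \<in> H"
  shows "bdd_below_op H (\<lambda>x. S (S' x))"
proof -
  obtain c c' where c: "c > 0" "\<And>x. x \<in> H \<Longrightarrow> c * norm x \<le> norm (S x)" "c' > 0" "\<And>x. x \<in> H \<Longrightarrow> c' * norm x \<le> norm (S' x)"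
    using assms(1,2) unfolding bdd_below_op_def by blast
  have "c * c' * norm x \<le> norm (S (S' x))" if "x \<in> H" for x
  proof -
    have "c * (c' * norm x) \<le> c * norm (S' x)" using c(1) c(4)[OF that] by (intro mult_left_mono) auto
    also have "\<dots> \<le> norm (S (S' x))" by (rule c(2)[OF assms(3)[OF that]])
    finally show ?thesis by (simp add: mult.assoc)
  qed
  then show ?thesis unfolding bdd_below_op_def using c(1,3) by (intro exI[of _ "c * c'"]) auto
qed

context bounded_symmetric
begin

lemma diff: "x \<in> H \<Longrightarrow> y \<in> H \<Longrightarrow> T (x - y) = T x - T y"
  using add[of x "(-1) *\<^sub>R y"] scale[of y "-1"] subspace_scale[OF sub, of y "-1"] by simp

lemma zero: "T 0 = 0"
  using scale[of 0 0] subspace_0[OF sub] by simp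

lemma symmetric_shift: "bounded_symmetric H (\<lambda>x. T x - t *\<^sub>R x) (K + \<bar>t\<bar>)"
proof unfold_locales
  fix x y :: 'a and c :: real
  assume x: "x \<in> H"
  show "T x - t *\<^sub>R x \<in> H" using x maps sub by (simp add: subspace_diff subspace_scale)
  show "T (c *\<^sub>R x) - t *\<^sub>R c *\<^sub>R x = c *\<^sub>R (T x - t *\<^sub>R x)" using x by (simp add: scale algebra_simps)
  have "norm (T x - t *\<^sub>R x) \<le> norm (T x) + norm (t *\<^sub>R x)" by (rule norm_triangle_ineq4)
  also have "\<dots> \<le> (K + \<bar>t\<bar>) * norm x" using bound[OF x] by (simp add: algebra_simps)
  finally show "norm (T x - t *\<^sub>R x) \<le> (K + \<bar>t\<bar>) * norm x" .
  assume y: "y \<in> H"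
  show "T (x + y) - t *\<^sub>R (x + y) = T x - t *\<^sub>R x + (T y - t *\<^sub>R y)" using x y by (simp add: add algebra_simps)
  show "inner (T x - t *\<^sub>R x) y = inner x (T y - t *\<^sub>R y)" using symm[OF x y] by (simp add: inner_diff_left inner_diff_right)
qed (use sub cl K in auto)

lemma symmetric_square: "bounded_symmetric H (\<lambda>x. T (T x)) (K * K)"
proof unfold_locales
  fix x y :: 'a and c :: real
  assume x: "x \<in> H"
  show "T (T x) \<in> H" using x maps by simp
  show "T (T (c *\<^sub>R x)) = c *\<^sub>R T (T x)" using x maps by (simp add: scale)
  have "norm (T (T x)) \<le> K * norm (T x)" by (rule bound[OF maps[OF x]])
  also have "\<dots> \<le> K * (K * norm x)" using bound[OF x] K by (intro mult_left_mono) auto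
  finally show "norm (T (T x)) \<le> K * K * norm x" by (simp add: mult.assoc)
  assume y: "y \<in> H"
  show "T (T (x + y)) = T (T x) + T (T y)" using x y maps by (simp add: add)
  show "inner (T (T x)) y = inner x (T (T y))" using symm x y maps by simp
qed (use sub cl K in auto)

text \<open>Positivity of the form at \<open>x - (1/K) T x\<close>; given the bound
  \<open>K\<close>, this step length is the optimal one.\<close>

lemma pos_cs:
  assumes pos: "\<And>x. x \<in> H \<Longrightarrow> 0 \<le> inner (T x) x" and x: "x \<in> H"
  shows "(norm (T x))\<^sup>2 \<le> K * inner (T x) x"
proof -
  let ?s = "1 / K"
  have y: "x - ?s *\<^sub>R T x \<in> H" using x maps sub by (simp add: subspace_diff subspace_scale)
  have Ts: "T (x - ?s *\<^sub>R T x) = T x - ?s *\<^sub>R T (T x)"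
    using x maps subspace_scale[OF sub] by (simp add: diff scale)
  have "0 \<le> inner (T (x - ?s *\<^sub>R T x)) (x - ?s *\<^sub>R T x)" by (rule pos[OF y])
  also have "\<dots> = inner (T x) x - 2 * ?s * inner (T x) (T x) + ?s\<^sup>2 * inner (T (T x)) (T x)"
    unfolding Ts using symm[OF maps[OF x] x]
    by (simp add: inner_diff_left inner_diff_right inner_commute algebra_simps power2_eq_square)
  also have "inner (T (T x)) (T x) \<le> norm (T (T x)) * norm (T x)" by (rule norm_cauchy_schwarz)
  also have "norm (T (T x)) * norm (T x) \<le> K * norm (T x) * norm (T x)"
    using bound[OF maps[OF x]] by (intro mult_right_mono) auto
  finally have "0 \<le> inner (T x) x - 2 * ?s * inner (T x) (T x) + ?s\<^sup>2 * (K * norm (T x) * norm (T x))"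
    by (simp add: mult_left_mono)
  also have "?s\<^sup>2 * (K * norm (T x) * norm (T x)) = ?s * inner (T x) (T x)"
    using K by (simp add: power2_eq_square dot_square_norm)
  finally have "?s * inner (T x) (T x) \<le> inner (T x) x" by simp
  then show ?thesis using K by (simp add: dot_square_norm field_simps)
qed

text \<open>For an extremal \<open>c\<close> the form of \<open>T\<^sup>2 - c\<^sup>2\<close> is semidefinite, so by Cauchy-Schwarz nearly extremal vectors
  are nearly annihilated by \<open>T\<^sup>2 - c\<^sup>2 = (T - c) (T + c)\<close>.\<close>

lemma extremal:
  assumes sg: "\<sigma> = 1 \<or> \<sigma> = (-1::real)" and c: "0 \<le> c"
    and pos: "\<And>x. x \<in> H \<Longrightarrow> 0 \<le> \<sigma> * ((norm (T x))\<^sup>2 - c\<^sup>2 * (norm x)\<^sup>2)"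
    and app: "\<And>e. e > 0 \<Longrightarrow> \<exists>x\<in>H. norm x = 1 \<and> \<bar>(norm (T x))\<^sup>2 - c\<^sup>2\<bar> < e"
  shows "\<not> (bdd_below_op H (\<lambda>x. T x - c *\<^sub>R x) \<and> bdd_below_op H (\<lambda>x. T x - (- c) *\<^sub>R x))"
proof
  assume bb: "bdd_below_op H (\<lambda>x. T x - c *\<^sub>R x) \<and> bdd_below_op H (\<lambda>x. T x - (- c) *\<^sub>R x)"
  \<comment> \<open>The sign makes the form of \<open>S\<close> nonnegative both at a supremum
    (\<open>-1\<close>) and at an infimum (\<open>1\<close>) of \<open>norm (T x)\<close>.\<close>
  define S where "S x = \<sigma> *\<^sub>R (T (T x) - c\<^sup>2 *\<^sub>R x)" for x
  interpret sq: bounded_symmetric H "\<lambda>x. T (T x)" "K * K" by (rule symmetric_square)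
  interpret sh: bounded_symmetric H "\<lambda>x. T (T x) - c\<^sup>2 *\<^sub>R x" "K * K + \<bar>c\<^sup>2\<bar>" by (rule sq.symmetric_shift)
  interpret S: bounded_symmetric H S "K * K + \<bar>c\<^sup>2\<bar>"
  proof unfold_locales
    fix x y :: 'a and r :: real
    assume x: "x \<in> H"
    show "S x \<in> H" unfolding S_def using sh.maps[OF x] subspace_scale[OF sub] by blast
    show "S (r *\<^sub>R x) = r *\<^sub>R S x" unfolding S_def using sh.scale[OF x, of r] by simp
    have "norm (S x) = norm (T (T x) - c\<^sup>2 *\<^sub>R x)" unfolding S_def using sg by auto
    then show "norm (S x) \<le> (K * K + \<bar>c\<^sup>2\<bar>) * norm x" using sh.bound[OF x] by simp
    assume y: "y \<in> H"
    show "S (x + y) = S x + S y" unfolding S_def using sh.add[OF x y] by (simp add: scaleR_add_right[symmetric])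
    show "inner (S x) y = inner x (S y)" unfolding S_def using sh.symm[OF x y] by simp
  qed (use sub cl sh.K in auto)
  have form: "inner (S x) x = \<sigma> * ((norm (T x))\<^sup>2 - c\<^sup>2 * (norm x)\<^sup>2)" if x: "x \<in> H" for x
    unfolding S_def using symm[OF maps[OF x] x] by (simp add: inner_diff_left dot_square_norm)
  have cs: "(norm (S x))\<^sup>2 \<le> (K * K + \<bar>c\<^sup>2\<bar>) * inner (S x) x" if "x \<in> H" for x
    by (rule S.pos_cs[OF _ that]) (use form pos in auto)
  have "bdd_below_op H (\<lambda>x. (\<lambda>x. T x - c *\<^sub>R x) ((\<lambda>x. T x - (- c) *\<^sub>R x) x))"
    by (rule bdd_below_op_comp) (use bb maps sub in \<open>auto simp: subspace_add subspace_scale\<close>)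
  then obtain d where d: "d > 0" "\<And>x. x \<in> H \<Longrightarrow> d * norm x \<le> norm (T (T x - (- c) *\<^sub>R x) - c *\<^sub>R (T x - (- c) *\<^sub>R x))"
    unfolding bdd_below_op_def by blast
  have dS: "d * norm x \<le> norm (S x)" if x: "x \<in> H" for x
  proof -
    have "T (T x - (- c) *\<^sub>R x) = T (T x) + c *\<^sub>R T x"
      using add[OF maps[OF x] subspace_scale[OF sub x, of c]] scale[OF x, of c] by simp
    then have "T (T x - (- c) *\<^sub>R x) - c *\<^sub>R (T x - (- c) *\<^sub>R x) = T (T x) - c\<^sup>2 *\<^sub>R x"
      by (simp add: algebra_simps power2_eq_square)
    then show ?thesis using d(2)[OF x] sg by (auto simp: S_def)
  qed
  \<comment> \<open>With this \<open>e\<close> a nearly extremal unit vector satisfies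
    \<open>d\<^sup>2 \<le> (norm (S x))\<^sup>2 < d\<^sup>2\<close>.\<close>
  define e where "e = d\<^sup>2 / (K * K + \<bar>c\<^sup>2\<bar>)"
  have "e > 0" using d(1) sh.K by (simp add: e_def)
  then obtain x where x: "x \<in> H" "norm x = 1" "\<bar>(norm (T x))\<^sup>2 - c\<^sup>2\<bar> < e" using app by blast
  have "d\<^sup>2 \<le> (norm (S x))\<^sup>2" using dS[OF x(1)] x(2) d(1) by (intro power_mono) auto
  also have "\<dots> \<le> (K * K + \<bar>c\<^sup>2\<bar>) * inner (S x) x" by (rule cs[OF x(1)])
  also have "inner (S x) x < e" using form[OF x(1)] x(2,3) sg by auto
  then have "(K * K + \<bar>c\<^sup>2\<bar>) * inner (S x) x < (K * K + \<bar>c\<^sup>2\<bar>) * e" using sh.K by (rule mult_strict_left_mono)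
  also have "\<dots> = d\<^sup>2" using sh.K by (simp add: e_def)
  finally show False by simp
qed

text \<open>The supremum \<open>s\<close> of \<open>norm (T x)\<close> on the unit sphere is
  extremal, so \<open>s\<close> or \<open>- s\<close> is an approximate eigenvalue; the vector
  \<open>x0\<close> shows \<open>r < s\<close>.\<close>

lemma sup_spectrum:
  assumes r: "0 \<le> r" and x0: "x0 \<in> H" "r * norm x0 < norm (T x0)"
  obtains l where "r < \<bar>l\<bar>" "\<not> bdd_below_op H (\<lambda>x. T x - l *\<^sub>R x)"
proof -
  define s where "s = (SUP x\<in>{x\<in>H. norm x = 1}. norm (T x))"
  have nz: "x0 \<noteq> 0" using x0(2) zero by auto
  define u where "u = (1 / norm x0) *\<^sub>R x0"
  have u: "u \<in> H" "norm u = 1" using x0(1) nz subspace_scale[OF sub] by (auto simp: u_def)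
  have bdd: "bdd_above ((\<lambda>x. norm (T x)) ` {x\<in>H. norm x = 1})"
  proof (rule bdd_aboveI2)
    show "norm (T x) \<le> K" if "x \<in> {x\<in>H. norm x = 1}" for x using bound[of x] that by simp
  qed
  have le1: "norm (T x) \<le> s" if "x \<in> H" "norm x = 1" for x
    unfolding s_def by (rule cSUP_upper[OF _ bdd]) (use that in simp)
  have Tu: "norm (T u) = norm (T x0) / norm x0" using scale[OF x0(1), of "1 / norm x0"] by (simp add: u_def)
  have "r < norm (T u)" using x0(2) nz unfolding Tu by (simp add: field_simps)
  then have rs: "r < s" using le1[OF u] by simp
  have s0: "0 \<le> s" using rs r by simp
  have le: "norm (T x) \<le> s * norm x" if x: "x \<in> H" for x
  proof (cases "x = 0")
    case False
    have "norm (T ((1 / norm x) *\<^sub>R x)) \<le> s" by (rule le1) (use x False subspace_scale[OF sub] in auto)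
    then show ?thesis using scale[OF x, of "1 / norm x"] False by (simp add: field_simps)
  qed (simp add: zero)
  have "\<not> (bdd_below_op H (\<lambda>x. T x - s *\<^sub>R x) \<and> bdd_below_op H (\<lambda>x. T x - (- s) *\<^sub>R x))"
  proof (rule extremal[of "-1"])
    show "0 \<le> -1 * ((norm (T x))\<^sup>2 - s\<^sup>2 * (norm x)\<^sup>2)" if "x \<in> H" for x
      using power_mono[OF le[OF that], of 2] by (simp add: power_mult_distrib)
    fix e :: real assume e: "e > 0"
    \<comment> \<open>A norm within \<open>d\<close> below \<open>s\<close> has its square within
      \<open>2 * s * d < e\<close> of \<open>s\<^sup>2\<close>.\<close>
    define d where "d = min (s - r) (e / (2 * s + 1))"
    have d: "0 < d" "d \<le> e / (2 * s + 1)" "d \<le> s" using rs r e s0 by (auto simp: d_def)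
    have "\<exists>x\<in>{x\<in>H. norm x = 1}. s - d < norm (T x)"
      unfolding s_def using u d(1) bdd by (intro less_cSUP_iff[THEN iffD1, OF _ bdd]) (auto simp: s_def)
    then obtain x where x: "x \<in> H" "norm x = 1" "s - d < norm (T x)" by blast
    have "norm (T x) \<le> s" by (rule le1[OF x(1,2)])
    then have "(norm (T x))\<^sup>2 \<le> s\<^sup>2" by (intro power_mono) auto
    moreover have "(s - d)\<^sup>2 \<le> (norm (T x))\<^sup>2" using x(3) d(3) by (intro power_mono) auto
    then have "s\<^sup>2 - 2 * s * d \<le> (norm (T x))\<^sup>2" using zero_le_power2[of d] unfolding power2_diff by linarith
    moreover have "2 * s * d < e"
    proof -
      have "2 * s * d < (2 * s + 1) * d" using d(1) by (simp add: algebra_simps)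
      also have "\<dots> \<le> e" using d(2) s0 by (simp add: field_simps)
      finally show ?thesis .
    qed
    ultimately show "\<exists>x\<in>H. norm x = 1 \<and> \<bar>(norm (T x))\<^sup>2 - s\<^sup>2\<bar> < e" using x(1,2) by (intro bexI[of _ x]) auto
  qed (use s0 in auto)
  then show ?thesis using that[of s] that[of "-s"] rs r by auto
qed

text \<open>Otherwise the infimum \<open>c\<close> of \<open>norm (T x)\<close> on the unit sphere
  is below \<open>d\<close>, and \<open>c\<close> or \<open>- c\<close> is an approximate eigenvalue
  inside the gap.\<close>

lemma inf_spectrum:
  assumes d: "0 < d" and gap: "\<And>l. \<bar>l\<bar> < d \<Longrightarrow> bdd_below_op H (\<lambda>x. T x - l *\<^sub>R x)" and x: "x \<in> H"
  shows "d * norm x \<le> norm (T x)"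
proof (rule ccontr)
  assume n: "\<not> ?thesis"
  define c where "c = (INF x\<in>{x\<in>H. norm x = 1}. norm (T x))"
  have nz: "x \<noteq> 0" using n zero by auto
  define u where "u = (1 / norm x) *\<^sub>R x"
  have u: "u \<in> H" "norm u = 1" using x nz subspace_scale[OF sub] by (auto simp: u_def)
  have bdd: "bdd_below ((\<lambda>x. norm (T x)) ` {x\<in>H. norm x = 1})"
    by (auto simp: bdd_below_def intro!: exI[of _ 0])
  have ge1: "c \<le> norm (T x)" if "x \<in> H" "norm x = 1" for x
    unfolding c_def by (rule cINF_lower[OF bdd]) (use that in simp)
  have c0: "0 \<le> c" unfolding c_def by (rule cINF_greatest) (use u in auto)
  have Tu: "norm (T u) = norm (T x) / norm x" using scale[OF x, of "1 / norm x"] by (simp add: u_def)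
  have "norm (T u) < d" using n nz unfolding Tu by (simp add: field_simps)
  then have cd: "c < d" using ge1[OF u] by simp
  have ge: "c * norm y \<le> norm (T y)" if y: "y \<in> H" for y
  proof (cases "y = 0")
    case False
    have "c \<le> norm (T ((1 / norm y) *\<^sub>R y))" by (rule ge1) (use y False subspace_scale[OF sub] in auto)
    then show ?thesis using scale[OF y, of "1 / norm y"] False by (simp add: field_simps)
  qed simp
  have "\<not> (bdd_below_op H (\<lambda>x. T x - c *\<^sub>R x) \<and> bdd_below_op H (\<lambda>x. T x - (- c) *\<^sub>R x))"
  proof (rule extremal[of 1])
    show "0 \<le> 1 * ((norm (T y))\<^sup>2 - c\<^sup>2 * (norm y)\<^sup>2)" if "y \<in> H" for y
      using power_mono[OF ge[OF that], of 2] c0 by (simp add: power_mult_distrib)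
    fix e :: real assume e: "e > 0"
    define h where "h = min 1 (e / (2 * c + 2))"
    have h: "0 < h" "h \<le> e / (2 * c + 2)" "h \<le> 1" using e c0 by (auto simp: h_def)
    have "\<exists>x\<in>{x\<in>H. norm x = 1}. norm (T x) < c + h"
      unfolding c_def using u h(1) by (intro cINF_less_iff[THEN iffD1, OF _ bdd]) (auto simp: c_def)
    then obtain y where y: "y \<in> H" "norm y = 1" "norm (T y) < c + h" by blast
    have "c \<le> norm (T y)" by (rule ge1[OF y(1,2)])
    then have "c\<^sup>2 \<le> (norm (T y))\<^sup>2" using c0 by (intro power_mono) auto
    moreover have "(norm (T y))\<^sup>2 \<le> (c + h)\<^sup>2" using y(3) by (intro power_mono) auto
    moreover have "(c + h)\<^sup>2 < c\<^sup>2 + e"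
    proof -
      have "(c + h)\<^sup>2 = c\<^sup>2 + 2 * c * h + h * h" by (simp add: power2_eq_square algebra_simps)
      also have "h * h \<le> 1 * h" using h by (intro mult_right_mono) auto
      finally have "(c + h)\<^sup>2 \<le> c\<^sup>2 + (2 * c + 1) * h" by (simp add: algebra_simps)
      also have "(2 * c + 1) * h < (2 * c + 2) * h" using h(1) by simp
      also have "\<dots> \<le> e" using h(2) c0 by (simp add: field_simps)
      finally show ?thesis by simp
    qed
    ultimately show "\<exists>x\<in>H. norm x = 1 \<and> \<bar>(norm (T x))\<^sup>2 - c\<^sup>2\<bar> < e" using y(1,2) by (intro bexI[of _ y]) auto
  qed (use c0 in auto)
  then show False using gap[of c] gap[of "-c"] cd c0 by simp
qed

text \<open>By the gap around 0, \<open>T\<^sup>2\<close> has no approximate eigenvalue strictly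
  between 0 and \<open>d\<^sup>2\<close>. Hence \<open>T\<^sup>2 - s\<close>, with \<open>s\<close>
  the midpoint, is bounded below by \<open>s\<close>, and expanding the square gives
  \<open>d * norm (T y) \<le> norm (T (T y))\<close>. This bound passes to the closure of the range,
  which contains every vector orthogonal to the kernel.\<close>

lemma isolated_bdd_below_op:
  assumes d: "0 < d" and gap: "\<And>t. 0 < \<bar>t\<bar> \<Longrightarrow> \<bar>t\<bar> < d \<Longrightarrow> bdd_below_op H (\<lambda>x. T x - t *\<^sub>R x)"
    and x: "x \<in> H" and orth: "\<And>y. y \<in> H \<Longrightarrow> T y = 0 \<Longrightarrow> inner x y = 0"
  shows "d * norm x \<le> norm (T x)"
proof -
  define s where "s = d\<^sup>2 / 2"
  have s: "s > 0" using d by (simp add: s_def)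
  interpret sq: bounded_symmetric H "\<lambda>x. T (T x)" "K * K" by (rule symmetric_square)
  interpret sh: bounded_symmetric H "\<lambda>x. T (T x) - s *\<^sub>R x" "K * K + \<bar>s\<bar>" by (rule sq.symmetric_shift)
  have bbT: "bdd_below_op H (\<lambda>x. T (T x) - t *\<^sub>R x)" if t: "0 < t" "t < d\<^sup>2" for t
  proof -
    define q where "q = sqrt t"
    have q: "0 < q" "q < d" "q * q = t" using t d by (auto simp: q_def real_less_lsqrt)
    have "bdd_below_op H (\<lambda>x. (\<lambda>x. T x - q *\<^sub>R x) ((\<lambda>x. T x - (- q) *\<^sub>R x) x))"
      by (rule bdd_below_op_comp) (use gap[of q] gap[of "-q"] q maps sub in \<open>auto simp: subspace_add subspace_scale\<close>)
    moreover have "T (T x - (- q) *\<^sub>R x) - q *\<^sub>R (T x - (- q) *\<^sub>R x) = T (T x) - t *\<^sub>R x" if x: "x \<in> H" for x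
    proof -
      have "T (T x - (- q) *\<^sub>R x) = T (T x) + q *\<^sub>R T x"
        using add[OF maps[OF x] subspace_scale[OF sub x, of q]] scale[OF x, of q] by simp
      then show ?thesis by (simp add: algebra_simps q(3)[symmetric])
    qed
    ultimately show ?thesis unfolding bdd_below_op_def by simp
  qed
  have gap2: "s * norm y \<le> norm (T (T y) - s *\<^sub>R y)" if "y \<in> H" for y
  proof (rule sh.inf_spectrum[OF s _ that])
    fix l :: real assume l: "\<bar>l\<bar> < s"
    have "bdd_below_op H (\<lambda>x. T (T x) - (s + l) *\<^sub>R x)" by (rule bbT) (use l in \<open>auto simp: s_def\<close>)
    then show "bdd_below_op H (\<lambda>x. T (T x) - s *\<^sub>R x - l *\<^sub>R x)" by (simp add: algebra_simps)
  qed
  have TT: "d * norm (T y) \<le> norm (T (T y))" if y: "y \<in> H" for y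
  proof -
    have "(s * norm y)\<^sup>2 \<le> (norm (T (T y) - s *\<^sub>R y))\<^sup>2" using gap2[OF y] s by (intro power_mono) auto
    also have "\<dots> = (norm (T (T y)))\<^sup>2 - 2 * s * inner (T (T y)) y + s\<^sup>2 * inner y y" by (rule norm_diff_scaleR_sq)
    also have "inner (T (T y)) y = (norm (T y))\<^sup>2" using symm[OF maps[OF y] y] by (simp add: dot_square_norm)
    finally have "2 * s * (norm (T y))\<^sup>2 \<le> (norm (T (T y)))\<^sup>2" by (simp add: power_mult_distrib dot_square_norm)
    then have "(d * norm (T y))\<^sup>2 \<le> (norm (T (T y)))\<^sup>2" by (simp add: s_def power_mult_distrib)
    then show ?thesis by (rule power2_le_imp_le) simp
  qed
  define R where "R = closure (T ` H)"
  have subR: "subspace R" unfolding R_def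
  proof (rule subspace_closure)
    show "subspace (T ` H)"
    proof (rule subspaceI)
      show "0 \<in> T ` H" using zero subspace_0[OF sub] by force
      show "a + b \<in> T ` H" if ab: "a \<in> T ` H" "b \<in> T ` H" for a b
      proof -
        obtain p q where "p \<in> H" "q \<in> H" "a = T p" "b = T q" using ab by blast
        then show ?thesis using add[of p q] subspace_add[OF sub, of p q] by (metis imageI)
      qed
      show "c *\<^sub>R a \<in> T ` H" if a: "a \<in> T ` H" for a c
      proof -
        obtain p where "p \<in> H" "a = T p" using a by blast
        then show ?thesis using scale[of p c] subspace_scale[OF sub, of p c] by (metis imageI)
      qed
    qed
  qed
  have RH: "R \<subseteq> H" unfolding R_def by (rule closure_minimal[OF _ cl]) (use maps in auto)
  have Rb: "d * norm r \<le> norm (T r)" if r: "r \<in> R" for r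
  proof -
    obtain q where q: "\<And>n. q n \<in> T ` H" "q \<longlonglongrightarrow> r" using r unfolding R_def closure_sequential by blast
    have qH: "q n \<in> H" for n using q(1)[of n] maps by auto
    have lim: "(\<lambda>n. T (q n)) \<longlonglongrightarrow> T r"
    proof (rule LIM_zero_cancel, rule Lim_null_comparison)
      show "\<forall>\<^sub>F n in sequentially. norm (T (q n) - T r) \<le> K * norm (q n - r)"
        using bound[OF subspace_diff[OF sub qH]] diff[OF qH] r RH by (intro always_eventually) auto
      have "(\<lambda>n. K * norm (q n - r)) \<longlonglongrightarrow> K * norm (r - r)" by (intro tendsto_intros q)
      then show "(\<lambda>n. K * norm (q n - r)) \<longlonglongrightarrow> 0" by simp
    qed
    show ?thesis
    proof (rule LIMSEQ_le)
      show "(\<lambda>n. d * norm (q n)) \<longlonglongrightarrow> d * norm r" by (intro tendsto_intros q)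
      show "(\<lambda>n. norm (T (q n))) \<longlonglongrightarrow> norm (T r)" by (intro tendsto_intros lim)
      have "d * norm (q n) \<le> norm (T (q n))" for n
      proof -
        obtain y where "y \<in> H" "q n = T y" using q(1)[of n] by blast
        then show ?thesis using TT[of y] by simp
      qed
      then show "\<exists>N. \<forall>n\<ge>N. d * norm (q n) \<le> norm (T (q n))" by blast
    qed
  qed
  obtain r where r: "r \<in> R" "\<And>y. y \<in> R \<Longrightarrow> inner (x - r) y = 0"
    using orthogonal_projection[of R x] subR by (metis R_def closed_closure)
  \<comment> \<open>\<open>x - r\<close> is orthogonal to \<open>T (T (x - r))\<close>, so
    \<open>T\<close> annihilates it. It is then orthogonal to \<open>x\<close> by hypothesis and to
    \<open>r\<close> by projection, hence zero.\<close>
  have eH: "x - r \<in> H" using x r(1) RH subspace_diff[OF sub] by blast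
  have "T (T (x - r)) \<in> R" unfolding R_def using imageI[OF maps[OF eH], of T] closure_subset[of "T ` H"] by (rule rev_subsetD)
  then have "inner (x - r) (T (T (x - r))) = 0" by (rule r(2))
  then have "inner (T (x - r)) (T (x - r)) = 0" using symm[OF eH maps[OF eH]] by simp
  then have "inner x (x - r) = 0" using orth[OF eH] by simp
  moreover have "inner r (x - r) = 0" using r(2)[OF r(1)] by (simp add: inner_commute)
  ultimately have "inner (x - r) (x - r) = 0" by (simp add: inner_diff_left)
  then have "x = r" by simp
  then show ?thesis using Rb r(1) by simp
qed

end

text \<open>\<open>a n\<close> is the orthogonal projection of \<open>e n\<close> onto the span; its
  finitely many coefficients tend to 0 by weak convergence.\<close>

lemma orthonormal_approx:
  fixes e :: "nat \<Rightarrow> 'a::real_inner"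
  assumes F: "finite F" and wk: "\<And>y. (\<lambda>n. inner y (e n)) \<longlonglongrightarrow> 0"
  obtains a where "\<And>n. a n \<in> span F" "\<And>n y. y \<in> span F \<Longrightarrow> inner (e n - a n) y = 0" "a \<longlonglongrightarrow> 0"
proof -
  obtain C where C: "finite C" "span C = span F" "pairwise orthogonal C" using basis_orthogonal[OF F] by blast
  define a where "a n = (\<Sum>b\<in>C. (inner b (e n) / inner b b) *\<^sub>R b)" for n
  show ?thesis
  proof
    show "a n \<in> span F" for n unfolding a_def C(2)[symmetric] by (intro span_sum span_scale span_base)
    have orth: "inner (e n - a n) b = 0" if b: "b \<in> C" for n b
    proof -
      have "inner (a n) b = (\<Sum>c\<in>C. (inner c (e n) / inner c c) * inner c b)" by (simp add: a_def inner_sum_left)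
      also have "\<dots> = (\<Sum>c\<in>C. if c = b then inner b (e n) else 0)"
        by (rule sum.cong) (use C(3) b in \<open>auto simp: pairwise_def orthogonal_def\<close>)
      also have "\<dots> = inner b (e n)" using C(1) b by simp
      finally show ?thesis by (simp add: inner_diff_left inner_commute[of "e n" b])
    qed
    show "inner (e n - a n) y = 0" if "y \<in> span F" for n y
      using that[folded C(2)]
    proof (induction rule: span_induct_alt)
      case (step c x z)
      then show ?case using orth by (simp add: inner_add_right)
    qed simp
    have "(\<lambda>n. \<Sum>b\<in>C. (inner b (e n) / inner b b) *\<^sub>R b) \<longlonglongrightarrow> (\<Sum>b\<in>C. (0 / inner b b) *\<^sub>R b)"
      by (intro tendsto_sum tendsto_scaleR tendsto_const, unfold divide_inverse) (intro tendsto_mult wk tendsto_const)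
    then show "a \<longlonglongrightarrow> 0" by (simp add: a_def[abs_def])
  qed
qed

text \<open>Riesz' theorem: take a finite net of the unit ball with mesh 1/2. A unit vector
  orthogonal to the span of the net would have distance at least 1 from all its points.\<close>

lemma compact_ball_finite_span:
  fixes S :: "'a::real_inner set"
  assumes S: "subspace S"
    and seq: "\<And>X :: nat \<Rightarrow> 'a. (\<And>n. X n \<in> S \<and> norm (X n) \<le> 1) \<Longrightarrow> \<exists>r l. strict_mono (r :: nat \<Rightarrow> nat) \<and> l \<in> S \<and> (\<lambda>n. X (r n)) \<longlonglongrightarrow> l"
  obtains B where "finite B" "B \<subseteq> S" "S \<subseteq> span B"
proof -
  define U where "U = S \<inter> cball 0 1"
  have "seq_compact U"
    unfolding seq_compact_def
  proof (intro allI impI)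
    fix X :: "nat \<Rightarrow> 'a" assume X: "\<forall>n. X n \<in> U"
    then obtain r l where r: "strict_mono (r :: nat \<Rightarrow> nat)" "l \<in> S" "(\<lambda>n. X (r n)) \<longlonglongrightarrow> l"
      using seq[of X] by (auto simp: U_def)
    have "norm l \<le> 1" by (rule LIMSEQ_le_const2[OF tendsto_norm[OF r(3)]]) (use X in \<open>auto simp: U_def\<close>)
    then show "\<exists>l\<in>U. \<exists>r. strict_mono r \<and> (X \<circ> r) \<longlonglongrightarrow> l" using r by (auto simp: U_def comp_def)
  qed
  then have "\<exists>k. finite k \<and> k \<subseteq> U \<and> U \<subseteq> (\<Union>x\<in>k. ball x (1/2))" by (rule seq_compact_imp_totally_bounded[rule_format]) simp
  then obtain k where k: "finite k" "k \<subseteq> U" "U \<subseteq> (\<Union>x\<in>k. ball x (1/2))" by blast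
  have "S \<subseteq> span k"
  proof
    fix x assume x: "x \<in> S"
    obtain C where C: "finite C" "span C = span k" "pairwise orthogonal C" using basis_orthogonal[OF k(1)] by blast
    define p where "p = (\<Sum>b\<in>C. (inner b x / inner b b) *\<^sub>R b)"
    have pk: "p \<in> span k" unfolding p_def C(2)[symmetric] by (intro span_sum span_scale span_base)
    have "span k \<subseteq> S" by (rule span_minimal[OF _ S]) (use k(2) in \<open>auto simp: U_def\<close>)
    then have zS: "x - p \<in> S" using pk x subspace_diff[OF S] by blast
    have orth: "inner (x - p) y = 0" if "y \<in> span k" for y
    proof -
      have o: "inner (x - p) b = 0" if b: "b \<in> C" for b
      proof -
        have "inner p b = (\<Sum>c\<in>C. (inner c x / inner c c) * inner c b)" by (simp add: p_def inner_sum_left)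
        also have "\<dots> = (\<Sum>c\<in>C. if c = b then inner b x else 0)"
          by (rule sum.cong) (use C(3) b in \<open>auto simp: pairwise_def orthogonal_def\<close>)
        also have "\<dots> = inner b x" using C(1) b by simp
        finally show ?thesis by (simp add: inner_diff_left inner_commute[of x b])
      qed
      show ?thesis using that[folded C(2)]
      proof (induction rule: span_induct_alt)
        case (step c x z)
        then show ?case using o by (simp add: inner_add_right)
      qed simp
    qed
    have "x - p = 0"
    proof (rule ccontr)
      assume nz: "x - p \<noteq> 0"
      define u where "u = (1 / norm (x - p)) *\<^sub>R (x - p)"
      have u: "u \<in> U" "norm u = 1" using nz zS subspace_scale[OF S] by (auto simp: U_def u_def)
      then obtain y where y: "y \<in> k" "dist y u < 1/2" using k(3) by auto
      have "inner u y = 0" using orth[OF span_base[OF y(1)]] by (simp add: u_def)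
      then have "(norm (u - y))\<^sup>2 = 1 + (norm y)\<^sup>2"
        using u(2) norm_diff_scaleR_sq[of u 1 y] by (simp add: dot_square_norm)
      then have "1 \<le> (norm (u - y))\<^sup>2" by simp
      moreover have "(norm (u - y))\<^sup>2 < (1/2)\<^sup>2" using y(2) by (intro power_strict_mono) (auto simp: dist_norm norm_minus_commute)
      ultimately show False by (simp add: power2_eq_square)
    qed
    then show "x \<in> span k" using pk by simp
  qed
  then show ?thesis using that k by (auto simp: U_def)
qed

section \<open>Self-adjoint operators on weighted spaces\<close>

definition scC :: "complex \<Rightarrow> 'a l2 \<Rightarrow> 'a l2" where
  "scC c f = Abs_l2 (\<lambda>x. c * l2app f x)"

lemma l2app_scC [simp]: "l2app (scC c f) x = c * l2app f x"
  using sq_summable_cmult[OF l2_summable[of f UNIV], of c] by (simp add: scC_def Abs_l2_inverse)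

lemma scC_of_real: "scC (complex_of_real r) f = r *\<^sub>R f"
  by (rule l2_eqI) simp

lemma scC_scC: "scC c (scC d f) = scC (c * d) f"
  by (rule l2_eqI) simp

lemma scC_zero [simp]: "scC c 0 = 0"
  by (rule l2_eqI) simp

lemma scC_diff: "scC c (f - g) = scC c f - scC c g"
  by (rule l2_eqI) (simp add: algebra_simps)

lemma inner_scC: "inner (scC c f) g = inner f (scC (cnj c) g)"
  unfolding inner_l2_def by (rule infsum_cong) (simp add: inner_complex_def algebra_simps)

lemma norm_scC: "norm (scC c f) = cmod c * norm f"
proof -
  have "(norm (scC c f))\<^sup>2 = inner f (scC (cnj c * c) f)"
    unfolding power2_norm_eq_inner by (subst inner_scC) (simp add: scC_scC)
  also have "cnj c * c = complex_of_real ((cmod c)\<^sup>2)" by (simp add: complex_norm_square[symmetric] mult.commute)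
  finally have "(norm (scC c f))\<^sup>2 = (cmod c * norm f)\<^sup>2"
    unfolding scC_of_real by (simp add: power_mult_distrib dot_square_norm)
  then show ?thesis by (simp add: power2_eq_iff_nonneg)
qed

lemma tendsto_scC: "(f \<longlongrightarrow> l) F \<Longrightarrow> ((\<lambda>n. scC c (f n)) \<longlongrightarrow> scC c l) F"
proof -
  assume f: "(f \<longlongrightarrow> l) F"
  have "((\<lambda>n. scC c (f n) - scC c l) \<longlongrightarrow> 0) F"
  proof (rule tendsto_norm_zero_cancel)
    have "((\<lambda>n. cmod c * norm (f n - l)) \<longlongrightarrow> cmod c * norm (l - l)) F" by (intro tendsto_intros f)
    then show "((\<lambda>n. norm (scC c (f n) - scC c l)) \<longlongrightarrow> 0) F" by (simp add: scC_diff[symmetric] norm_scC)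
  qed
  then show ?thesis by (rule LIM_zero_cancel)
qed

lemma tendsto_l2app: "(f \<longlongrightarrow> l) F \<Longrightarrow> ((\<lambda>n. l2app (f n) x) \<longlongrightarrow> l2app l x) F"
proof -
  assume f: "(f \<longlongrightarrow> l) F"
  have "((\<lambda>n. l2app (f n) x - l2app l x) \<longlongrightarrow> 0) F"
  proof (rule Lim_null_comparison)
    show "\<forall>\<^sub>F n in F. norm (l2app (f n) x - l2app l x) \<le> norm (f n - l)"
      using l2_app_le[of "f n - l" x for n] by (intro always_eventually) simp
    have "((\<lambda>n. norm (f n - l)) \<longlongrightarrow> norm (l - l)) F" by (intro tendsto_intros f)
    then show "((\<lambda>n. norm (f n - l)) \<longlongrightarrow> 0) F" by simp
  qed
  then show ?thesis by (rule LIM_zero_cancel)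
qed

section \<open>Weighted spaces as closed subspaces of \<open>l2\<close>\<close>

locale weighted =
  fixes m :: "complex \<Rightarrow> real" and V :: "complex set"
  assumes mpos: "\<And>x. x \<in> V \<Longrightarrow> 0 < m x"
begin

text \<open>Multiplication by the square root of the weight maps \<open>ell2 m V\<close>
  isometrically onto the functions that vanish outside \<open>V\<close>.\<close>

definition J :: "(complex \<Rightarrow> complex) \<Rightarrow> complex l2" where
  "J \<phi> = Abs_l2 (\<lambda>x. if x \<in> V then complex_of_real (sqrt (m x)) * \<phi> x else 0)"

lemma cmod_weight: "x \<in> V \<Longrightarrow> (cmod (complex_of_real (sqrt (m x)) * z))\<^sup>2 = m x * (cmod z)\<^sup>2"
  using mpos[of x] by (simp add: norm_mult power_mult_distrib)

lemma ell2_iff: "\<phi> \<in> ell2 m V \<longleftrightarrow> (\<forall>x. x \<notin> V \<longrightarrow> \<phi> x = 0) \<and>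
   (\<lambda>x. (cmod (if x \<in> V then complex_of_real (sqrt (m x)) * \<phi> x else 0))\<^sup>2) summable_on UNIV"
proof -
  have "(\<lambda>x. m x * (cmod (\<phi> x))\<^sup>2) summable_on V \<longleftrightarrow>
    (\<lambda>x. (cmod (if x \<in> V then complex_of_real (sqrt (m x)) * \<phi> x else 0))\<^sup>2) summable_on UNIV"
    by (rule summable_on_cong_neutral) (use cmod_weight in auto)
  then show ?thesis by (simp add: ell2_def)
qed

lemma l2app_J: "\<phi> \<in> ell2 m V \<Longrightarrow> l2app (J \<phi>) x = (if x \<in> V then complex_of_real (sqrt (m x)) * \<phi> x else 0)"
  by (simp add: J_def Abs_l2_inverse ell2_iff)

lemma J_outside: "\<phi> \<in> ell2 m V \<Longrightarrow> x \<notin> V \<Longrightarrow> l2app (J \<phi>) x = 0"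
  by (simp add: l2app_J)

lemma nrm_J: "\<phi> \<in> ell2 m V \<Longrightarrow> nrm m V \<phi> = norm (J \<phi>)"
proof -
  assume p: "\<phi> \<in> ell2 m V"
  have "infsum (\<lambda>x. m x * (cmod (\<phi> x))\<^sup>2) V = (\<Sum>\<^sub>\<infinity>x. (cmod (l2app (J \<phi>) x))\<^sup>2)"
    by (rule infsum_cong_neutral) (use cmod_weight in \<open>auto simp: l2app_J[OF p]\<close>)
  then have "infsum (\<lambda>x. m x * (cmod (\<phi> x))\<^sup>2) V = (norm (J \<phi>))\<^sup>2" by (simp add: l2_norm_sq)
  then show ?thesis by (simp add: nrm_def)
qed

lemma J_inj: "\<phi> \<in> ell2 m V \<Longrightarrow> \<psi> \<in> ell2 m V \<Longrightarrow> J \<phi> = J \<psi> \<Longrightarrow> \<phi> = \<psi>"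
proof
  fix x assume p: "\<phi> \<in> ell2 m V" "\<psi> \<in> ell2 m V" and e: "J \<phi> = J \<psi>"
  have "l2app (J \<phi>) x = l2app (J \<psi>) x" using e by simp
  then show "\<phi> x = \<psi> x" using p mpos[of x] by (auto simp: l2app_J ell2_iff split: if_splits)
qed

lemma J_surj:
  assumes "\<And>x. x \<notin> V \<Longrightarrow> l2app f x = 0"
  obtains \<phi> where "\<phi> \<in> ell2 m V" "J \<phi> = f"
proof -
  define \<phi> where "\<phi> x = (if x \<in> V then l2app f x / complex_of_real (sqrt (m x)) else 0)" for x
  have e: "(if x \<in> V then complex_of_real (sqrt (m x)) * \<phi> x else 0) = l2app f x" for x
    using assms mpos[of x] by (auto simp: \<phi>_def)
  have p: "\<phi> \<in> ell2 m V" unfolding ell2_iff e using l2_summable by (simp add: \<phi>_def)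
  moreover have "J \<phi> = f" by (rule l2_eqI) (simp only: l2app_J[OF p] e)
  ultimately show ?thesis by (rule that)
qed

lemma ell2_comb:
  assumes "\<phi> \<in> ell2 m V" "\<psi> \<in> ell2 m V"
  shows "(\<lambda>x. \<phi> x + c * \<psi> x) \<in> ell2 m V" "J (\<lambda>x. \<phi> x + c * \<psi> x) = J \<phi> + scC c (J \<psi>)"
proof -
  obtain \<eta> where n: "\<eta> \<in> ell2 m V" "J \<eta> = J \<phi> + scC c (J \<psi>)"
    by (rule J_surj[of "J \<phi> + scC c (J \<psi>)"]) (use assms in \<open>auto simp: J_outside\<close>)
  have "\<eta> x = \<phi> x + c * \<psi> x" for x
  proof (cases "x \<in> V")
    case True
    have "l2app (J \<eta>) x = l2app (J \<phi> + scC c (J \<psi>)) x" using n by simp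
    then have "complex_of_real (sqrt (m x)) * \<eta> x = complex_of_real (sqrt (m x)) * (\<phi> x + c * \<psi> x)"
      using True assms n(1) by (simp add: l2app_J algebra_simps)
    then show ?thesis using mpos[OF True] by simp
  qed (use assms n(1) in \<open>simp add: ell2_iff\<close>)
  then have "\<eta> = (\<lambda>x. \<phi> x + c * \<psi> x)" by blast
  then show "(\<lambda>x. \<phi> x + c * \<psi> x) \<in> ell2 m V" "J (\<lambda>x. \<phi> x + c * \<psi> x) = J \<phi> + scC c (J \<psi>)" using n by auto
qed

lemma ell2_zero: "(\<lambda>_. 0) \<in> ell2 m V" and J_zero: "J (\<lambda>_. 0) = 0"
proof -
  show z: "(\<lambda>_. 0) \<in> ell2 m V" by (simp add: ell2_def)
  show "J (\<lambda>_. 0) = 0" by (rule l2_eqI) (simp add: l2app_J[OF z])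
qed

lemma ell2_scale:
  assumes "\<phi> \<in> ell2 m V"
  shows "(\<lambda>x. c * \<phi> x) \<in> ell2 m V" "J (\<lambda>x. c * \<phi> x) = scC c (J \<phi>)"
  using ell2_comb[OF ell2_zero assms, of c] by (auto simp: J_zero)

lemma ell2_diff:
  assumes "\<phi> \<in> ell2 m V" "\<psi> \<in> ell2 m V"
  shows "(\<lambda>x. \<phi> x - \<psi> x) \<in> ell2 m V" "J (\<lambda>x. \<phi> x - \<psi> x) = J \<phi> - J \<psi>"
  using ell2_comb[OF assms, of "-1"] scC_of_real[of "-1" "J \<psi>"] by (auto simp: )

text \<open>The imaginary part of a complex inner product is its real part after multiplying the
  second argument by \<open>- \<i>\<close>.\<close>

lemma ip_J:
  assumes "\<phi> \<in> ell2 m V" "\<psi> \<in> ell2 m V"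
  shows "ip m V \<phi> \<psi> = Complex (inner (J \<phi>) (J \<psi>)) (inner (J \<phi>) (scC (- \<i>) (J \<psi>)))"
proof -
  let ?a = "l2app (J \<phi>)" and ?b = "l2app (J \<psi>)"
  have t: "cnj z * w = complex_of_real (inner z w) + \<i> * complex_of_real (inner z (- \<i> * w))" for z w
    by (simp add: complex_eq_iff inner_complex_def)
  have "ip m V \<phi> \<psi> = (\<Sum>\<^sub>\<infinity>x. cnj (?a x) * ?b x)"
    unfolding ip_def
  proof (rule infsum_cong_neutral)
    fix x assume "x \<in> V \<inter> UNIV"
    then have x: "x \<in> V" by simp
    have "complex_of_real (m x) = complex_of_real (sqrt (m x)) * complex_of_real (sqrt (m x))"
      using mpos[OF x] by (simp only: of_real_mult[symmetric]) simp
    then show "complex_of_real (m x) * cnj (\<phi> x) * \<psi> x = cnj (?a x) * ?b x"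
      using x assms by (simp add: l2app_J)
  qed (use assms in \<open>auto simp: l2app_J\<close>)
  also have "\<dots> = (\<Sum>\<^sub>\<infinity>x. complex_of_real (inner (?a x) (?b x)) + \<i> * complex_of_real (inner (?a x) (l2app (scC (- \<i>) (J \<psi>)) x)))"
    by (rule infsum_cong) (subst t, simp)
  also have "\<dots> = complex_of_real (inner (J \<phi>) (J \<psi>)) + \<i> * complex_of_real (inner (J \<phi>) (scC (- \<i>) (J \<psi>)))"
  proof (rule infsumI, intro has_sum_add has_sum_cmult_right has_sum_of_real)
    show "((\<lambda>x. inner (?a x) (?b x)) has_sum inner (J \<phi>) (J \<psi>)) UNIV"
      unfolding inner_l2_def by (rule has_sum_infsum[OF l2_inner_summable])
    show "((\<lambda>x. inner (?a x) (l2app (scC (- \<i>) (J \<psi>)) x)) has_sum inner (J \<phi>) (scC (- \<i>) (J \<psi>))) UNIV"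
      unfolding inner_l2_def by (rule has_sum_infsum[OF l2_inner_summable])
  qed
  finally show ?thesis by (simp add: complex_eq_iff)
qed

definition H :: "complex l2 set" where "H = J ` ell2 m V"

lemma H_iff: "f \<in> H \<longleftrightarrow> (\<forall>x. x \<notin> V \<longrightarrow> l2app f x = 0)"
proof
  assume "f \<in> H" then show "\<forall>x. x \<notin> V \<longrightarrow> l2app f x = 0" by (auto simp: H_def J_outside)
next
  assume "\<forall>x. x \<notin> V \<longrightarrow> l2app f x = 0"
  then obtain \<phi> where "\<phi> \<in> ell2 m V" "J \<phi> = f" using J_surj[of f] by metis
  then show "f \<in> H" by (auto simp: H_def)
qed

lemma H_E:
  assumes "f \<in> H" obtains \<phi> where "\<phi> \<in> ell2 m V" "J \<phi> = f"
  using assms unfolding H_def by blast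

lemma subspace_H: "subspace H"
  unfolding subspace_def by (auto simp: H_iff)

lemma scC_H: "f \<in> H \<Longrightarrow> scC c f \<in> H" by (simp add: H_iff)

lemma H_lim: "(\<And>n. f n \<in> H) \<Longrightarrow> (f \<longlonglongrightarrow> l) \<Longrightarrow> l \<in> H"
  unfolding H_iff
proof (intro allI impI)
  fix x assume f: "\<And>n :: nat. \<forall>x. x \<notin> V \<longrightarrow> l2app (f n) x = 0" "f \<longlonglongrightarrow> l" and x: "x \<notin> V"
  have "(\<lambda>n. l2app (f n) x) \<longlonglongrightarrow> l2app l x" by (rule tendsto_l2app[OF f(2)])
  then have "(\<lambda>n. 0) \<longlonglongrightarrow> l2app l x" using f(1) x by simp
  then show "l2app l x = 0" by (simp add: LIMSEQ_const_iff)
qed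

lemma closed_H: "closed H"
  unfolding closed_sequential_limits using H_lim by blast

end

section \<open>Self-adjoint operators and approximate eigenvectors\<close>

locale sa_op = weighted +
  fixes D A
  assumes sa: "self_adjoint_op m V D A"
begin

lemma D_ell2: "\<phi> \<in> D \<Longrightarrow> \<phi> \<in> ell2 m V" and D_zero: "(\<lambda>_. 0) \<in> D"
  and D_comb: "\<phi> \<in> D \<Longrightarrow> \<psi> \<in> D \<Longrightarrow> (\<lambda>x. \<phi> x + c * \<psi> x) \<in> D"
  and A_comb: "\<phi> \<in> D \<Longrightarrow> \<psi> \<in> D \<Longrightarrow> A (\<lambda>x. \<phi> x + c * \<psi> x) = (\<lambda>x. A \<phi> x + c * A \<psi> x)"
  and A_ell2: "\<phi> \<in> D \<Longrightarrow> A \<phi> \<in> ell2 m V"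
  using sa unfolding self_adjoint_op_def by blast+

lemma A_zero: "A (\<lambda>_. 0) = (\<lambda>_. 0)"
  using A_comb[OF D_zero D_zero, of "-1"] by simp

lemma D_scale: "\<phi> \<in> D \<Longrightarrow> (\<lambda>x. c * \<phi> x) \<in> D" and A_scale: "\<phi> \<in> D \<Longrightarrow> A (\<lambda>x. c * \<phi> x) = (\<lambda>x. c * A \<phi> x)"
  using D_comb[OF D_zero, of \<phi> c] A_comb[OF D_zero, of \<phi> c] by (simp_all add: A_zero)

lemma D_diff: "\<phi> \<in> D \<Longrightarrow> \<psi> \<in> D \<Longrightarrow> (\<lambda>x. \<phi> x - \<psi> x) \<in> D"
  and A_diff: "\<phi> \<in> D \<Longrightarrow> \<psi> \<in> D \<Longrightarrow> A (\<lambda>x. \<phi> x - \<psi> x) = (\<lambda>x. A \<phi> x - A \<psi> x)"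
  using D_comb[of \<phi> \<psi> "-1"] A_comb[of \<phi> \<psi> "-1"] by simp_all

lemma D_dense:
  assumes "f \<in> H" "e > 0"
  obtains \<psi> where "\<psi> \<in> D" "norm (f - J \<psi>) < e"
proof -
  obtain \<phi> where p: "\<phi> \<in> ell2 m V" "J \<phi> = f" using assms(1) by (rule H_E)
  have "\<forall>\<phi>\<in>ell2 m V. \<forall>\<epsilon>>0. \<exists>\<psi>\<in>D. nrm m V (\<lambda>x. \<phi> x - \<psi> x) < \<epsilon>" using sa unfolding self_adjoint_op_def by blast
  then obtain \<psi> where "\<psi> \<in> D" "nrm m V (\<lambda>x. \<phi> x - \<psi> x) < e" using p(1) assms(2) by blast
  then show ?thesis using that[of \<psi>] ell2_diff[OF p(1) D_ell2] nrm_J p(2) by simp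
qed

lemma A_sym:
  assumes "\<phi> \<in> D" "\<psi> \<in> D"
  shows "inner (J (A \<phi>)) (J \<psi>) = inner (J \<phi>) (J (A \<psi>))"
proof -
  have "ip m V (A \<phi>) \<psi> = ip m V \<phi> (A \<psi>)" using sa assms unfolding self_adjoint_op_def by blast
  then show ?thesis using assms by (simp add: ip_J D_ell2 A_ell2)
qed

text \<open>Testing with \<open>\<i> * \<phi>\<close> as well turns the real identity into the
  complex one, so \<open>\<psi>\<close> is in the domain of the adjoint. Density of \<open>D\<close>
  then determines its image.\<close>

lemma adjoint:
  assumes p: "\<psi> \<in> ell2 m V" and n: "\<eta> \<in> ell2 m V"
    and eq: "\<And>\<phi>. \<phi> \<in> D \<Longrightarrow> inner (J (A \<phi>)) (J \<psi>) = inner (J \<phi>) (J \<eta>)"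
  shows "\<psi> \<in> D \<and> A \<psi> = \<eta>"
proof -
  have "ip m V (A \<phi>) \<psi> = ip m V \<phi> \<eta>" if f: "\<phi> \<in> D" for \<phi>
  proof -
    have "inner (J (A \<phi>)) (scC (- \<i>) (J \<psi>)) = inner (J (A (\<lambda>x. \<i> * \<phi> x))) (J \<psi>)"
      using f by (simp add: A_scale ell2_scale A_ell2 inner_scC)
    also have "\<dots> = inner (J (\<lambda>x. \<i> * \<phi> x)) (J \<eta>)" by (rule eq[OF D_scale[OF f]])
    also have "\<dots> = inner (J \<phi>) (scC (- \<i>) (J \<eta>))" using f by (simp add: ell2_scale D_ell2 inner_scC)
    finally show ?thesis using f p n eq[OF f] by (simp add: ip_J A_ell2 D_ell2)
  qed
  then have pD: "\<psi> \<in> D" using sa p n unfolding self_adjoint_op_def by blast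
  define f where "f = J (A \<psi>) - J \<eta>"
  have fH: "f \<in> H" unfolding f_def using A_ell2[OF pD] n by (intro subspace_diff[OF subspace_H]) (auto simp: H_def)
  have o: "inner (J \<phi>) f = 0" if "\<phi> \<in> D" for \<phi>
    using eq[OF that] A_sym[OF that pD] by (simp add: f_def inner_diff_right)
  have "norm f \<le> 0"
  proof (rule field_le_epsilon)
    fix e :: real assume e: "e > 0"
    obtain \<phi> where \<phi>: "\<phi> \<in> D" "norm (f - J \<phi>) < e" by (rule D_dense[OF fH e])
    have "norm f * norm f = inner (f - J \<phi>) f" using o[OF \<phi>(1)] by (simp add: inner_diff_left dot_square_norm power2_eq_square)
    also have "\<dots> \<le> norm (f - J \<phi>) * norm f" by (rule norm_cauchy_schwarz)
    finally have "norm f \<le> norm (f - J \<phi>) \<or> norm f = 0" by (auto simp: mult_le_cancel_right)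
    then show "norm f \<le> 0 + e" using \<phi>(2) e by auto
  qed
  then have "J (A \<psi>) = J \<eta>" by (simp add: f_def)
  then show ?thesis using pD J_inj[OF A_ell2[OF pD] n] by blast
qed

lemma closed_graph:
  assumes D: "\<And>n :: nat. \<phi> n \<in> D" and f: "(\<lambda>n. J (\<phi> n)) \<longlonglongrightarrow> f" and g: "(\<lambda>n. J (A (\<phi> n))) \<longlonglongrightarrow> g"
  obtains \<psi> where "\<psi> \<in> D" "J \<psi> = f" "J (A \<psi>) = g"
proof -
  have "f \<in> H" by (rule H_lim[OF _ f]) (use D D_ell2 in \<open>auto simp: H_def\<close>)
  then obtain \<psi> where p: "\<psi> \<in> ell2 m V" "J \<psi> = f" by (rule H_E)
  have "g \<in> H" by (rule H_lim[OF _ g]) (use D A_ell2 in \<open>auto simp: H_def\<close>)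
  then obtain \<eta> where n: "\<eta> \<in> ell2 m V" "J \<eta> = g" by (rule H_E)
  have "\<psi> \<in> D \<and> A \<psi> = \<eta>"
  proof (rule adjoint[OF p(1) n(1)])
    fix \<theta> assume t: "\<theta> \<in> D"
    have 1: "(\<lambda>n. inner (J (A \<theta>)) (J (\<phi> n))) \<longlonglongrightarrow> inner (J (A \<theta>)) f" by (intro tendsto_intros f)
    have 2: "(\<lambda>n. inner (J \<theta>) (J (A (\<phi> n)))) \<longlonglongrightarrow> inner (J \<theta>) g" by (intro tendsto_intros g)
    have "(\<lambda>n. inner (J (A \<theta>)) (J (\<phi> n))) = (\<lambda>n. inner (J \<theta>) (J (A (\<phi> n))))" using A_sym[OF t D] by simp
    then show "inner (J (A \<theta>)) (J \<psi>) = inner (J \<theta>) (J \<eta>)" using 1 2 LIMSEQ_unique p n by metis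
  qed
  then show ?thesis using that p n by blast
qed

lemma J_shift:
  assumes "\<phi> \<in> D"
  shows "(\<lambda>x. A \<phi> x - z * \<phi> x) \<in> ell2 m V" "J (\<lambda>x. A \<phi> x - z * \<phi> x) = J (A \<phi>) - scC z (J \<phi>)"
  using ell2_diff[OF A_ell2[OF assms] ell2_scale(1)[OF D_ell2[OF assms]]] ell2_scale(2)[OF D_ell2[OF assms]] by simp_all

text \<open>The lower bound makes the range of \<open>A - z\<close> closed. A vector orthogonal to
  the range is an eigenvector for \<open>cnj z\<close>, which \<open>ker\<close> excludes, so the
  range is everything.\<close>

lemma in_resolvent:
  assumes c: "c > 0" and bb: "\<And>\<phi>. \<phi> \<in> D \<Longrightarrow> c * norm (J \<phi>) \<le> norm (J (A \<phi>) - scC z (J \<phi>))"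
    and ker: "\<And>\<phi>. \<phi> \<in> D \<Longrightarrow> A \<phi> = (\<lambda>x. cnj z * \<phi> x) \<Longrightarrow> J \<phi> = 0"
  shows "z \<in> resolvent_set m V D A"
  unfolding resolvent_set_def mem_Collect_eq
proof (intro conjI ballI impI)
  fix \<phi> assume p: "\<phi> \<in> D" "(\<lambda>x. A \<phi> x - z * \<phi> x) = (\<lambda>_. 0)"
  have "c * norm (J \<phi>) \<le> norm (J (\<lambda>x. A \<phi> x - z * \<phi> x))" using bb[OF p(1)] J_shift[OF p(1)] by simp
  then have "c * norm (J \<phi>) \<le> 0" unfolding p(2) J_zero by simp
  then have "J \<phi> = J (\<lambda>_. 0)" using c by (simp add: J_zero mult_le_0_iff)
  then show "\<phi> = (\<lambda>_. 0)" by (rule J_inj[OF D_ell2[OF p(1)] ell2_zero])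
next
  define R where "R = {J (A \<phi>) - scC z (J \<phi>) | \<phi>. \<phi> \<in> D}"
  have RI: "J (A \<phi>) - scC z (J \<phi>) \<in> R" if "\<phi> \<in> D" for \<phi> using that by (auto simp: R_def)
  have sR: "subspace R"
  proof (rule subspaceI)
    show "0 \<in> R" using RI[OF D_zero] by (simp add: A_zero J_zero)
    show "a + b \<in> R" if ab: "a \<in> R" "b \<in> R" for a b
    proof -
      obtain p q where pq: "p \<in> D" "q \<in> D" "a = J (A p) - scC z (J p)" "b = J (A q) - scC z (J q)" using ab by (auto simp: R_def)
      have "a + b = J (A (\<lambda>x. p x + 1 * q x)) - scC z (J (\<lambda>x. p x + 1 * q x))"
        unfolding A_comb[OF pq(1,2)] ell2_comb(2)[OF D_ell2[OF pq(1)] D_ell2[OF pq(2)]] ell2_comb(2)[OF A_ell2[OF pq(1)] A_ell2[OF pq(2)]]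
        by (rule l2_eqI) (simp add: pq algebra_simps)
      then show ?thesis using RI[OF D_comb[OF pq(1,2), of 1]] by simp
    qed
    show "r *\<^sub>R a \<in> R" if a: "a \<in> R" for r a
    proof -
      obtain p where p: "p \<in> D" "a = J (A p) - scC z (J p)" using a by (auto simp: R_def)
      have "r *\<^sub>R a = J (A (\<lambda>x. complex_of_real r * p x)) - scC z (J (\<lambda>x. complex_of_real r * p x))"
        unfolding A_scale[OF p(1)] ell2_scale(2)[OF D_ell2[OF p(1)]] ell2_scale(2)[OF A_ell2[OF p(1)]]
        by (rule l2_eqI) (simp add: p algebra_simps)
      then show ?thesis using RI[OF D_scale[OF p(1)]] by simp
    qed
  qed
  have cR: "closed R"
    unfolding closed_sequential_limits
  proof (intro allI impI, elim conjE)
    fix y l assume y: "\<forall>n. y n \<in> R" "y \<longlonglongrightarrow> l"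
    then obtain \<phi> where \<phi>: "\<And>n. \<phi> n \<in> D" "\<And>n. y n = J (A (\<phi> n)) - scC z (J (\<phi> n))" unfolding R_def mem_Collect_eq by metis
    have dif: "c * norm (J (\<phi> k) - J (\<phi> n)) \<le> norm (y k - y n)" for k n
    proof -
      have "c * norm (J (\<lambda>x. \<phi> k x - \<phi> n x)) \<le> norm (J (A (\<lambda>x. \<phi> k x - \<phi> n x)) - scC z (J (\<lambda>x. \<phi> k x - \<phi> n x)))"
        by (rule bb[OF D_diff[OF \<phi>(1) \<phi>(1)]])
      also have "J (A (\<lambda>x. \<phi> k x - \<phi> n x)) - scC z (J (\<lambda>x. \<phi> k x - \<phi> n x)) = y k - y n"
        unfolding A_diff[OF \<phi>(1) \<phi>(1)] ell2_diff(2)[OF D_ell2[OF \<phi>(1)] D_ell2[OF \<phi>(1)]] ell2_diff(2)[OF A_ell2[OF \<phi>(1)] A_ell2[OF \<phi>(1)]] \<phi>(2)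
        by (simp add: scC_diff)
      finally show ?thesis using ell2_diff(2)[OF D_ell2[OF \<phi>(1)] D_ell2[OF \<phi>(1)]] by simp
    qed
    have "Cauchy (\<lambda>n. J (\<phi> n))"
    proof (rule CauchyI)
      fix e :: real assume e: "0 < e"
      have "Cauchy y" using y(2) by (rule LIMSEQ_imp_Cauchy)
      then obtain M where M: "\<And>k n. k \<ge> M \<Longrightarrow> n \<ge> M \<Longrightarrow> norm (y k - y n) < c * e" using CauchyD[of y "c * e"] c e by auto
      have "norm (J (\<phi> k) - J (\<phi> n)) < e" if "k \<ge> M" "n \<ge> M" for k n
        using dif[of k n] M[OF that] c by (metis le_less_trans mult_less_cancel_left_pos)
      then show "\<exists>M. \<forall>k\<ge>M. \<forall>n\<ge>M. norm (J (\<phi> k) - J (\<phi> n)) < e" by blast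
    qed
    then obtain f where f: "(\<lambda>n. J (\<phi> n)) \<longlonglongrightarrow> f" using Cauchy_convergent convergent_def by blast
    have "(\<lambda>n. y n + scC z (J (\<phi> n))) \<longlonglongrightarrow> l + scC z f" by (intro tendsto_add y tendsto_scC f)
    then have g: "(\<lambda>n. J (A (\<phi> n))) \<longlonglongrightarrow> l + scC z f" by (simp add: \<phi>(2))
    obtain \<psi> where "\<psi> \<in> D" "J \<psi> = f" "J (A \<psi>) = l + scC z f" by (rule closed_graph[OF \<phi>(1) f g])
    then show "l \<in> R" using RI[of \<psi>] by simp
  qed
  fix \<eta> assume n: "\<eta> \<in> ell2 m V"
  obtain r where r: "r \<in> R" "\<And>y. y \<in> R \<Longrightarrow> inner (J \<eta> - r) y = 0" by (rule orthogonal_projection[OF cR sR]) blast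
  obtain p where p: "p \<in> D" "r = J (A p) - scC z (J p)" using r(1) by (auto simp: R_def)
  have "r \<in> H" unfolding p(2) J_shift(2)[OF p(1), symmetric] H_def using J_shift(1)[OF p(1)] by (rule imageI)
  moreover have "J \<eta> \<in> H" unfolding H_def using n by (rule imageI)
  ultimately have "J \<eta> - r \<in> H" by (intro subspace_diff[OF subspace_H])
  then obtain \<psi> where \<psi>: "\<psi> \<in> ell2 m V" "J \<psi> = J \<eta> - r" by (rule H_E)
  have "\<psi> \<in> D \<and> A \<psi> = (\<lambda>x. cnj z * \<psi> x)"
  proof (rule adjoint[OF \<psi>(1) ell2_scale(1)[OF \<psi>(1)]])
    fix \<phi> assume f: "\<phi> \<in> D"
    have "inner (J \<psi>) (J (A \<phi>) - scC z (J \<phi>)) = 0" unfolding \<psi>(2) by (rule r(2)[OF RI[OF f]])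
    then have "inner (J (A \<phi>)) (J \<psi>) = inner (scC z (J \<phi>)) (J \<psi>)" by (simp add: inner_diff_right inner_commute)
    then show "inner (J (A \<phi>)) (J \<psi>) = inner (J \<phi>) (J (\<lambda>x. cnj z * \<psi> x))" by (simp add: inner_scC ell2_scale(2)[OF \<psi>(1)])
  qed
  then have "J \<psi> = 0" using ker by blast
  then have "J (\<lambda>x. A p x - z * p x) = J \<eta>" using \<psi>(2) p(2) J_shift(2)[OF p(1), of z] by simp
  then show "\<exists>\<phi>\<in>D. (\<lambda>x. A \<phi> x - z * \<phi> x) = \<eta>" using J_inj[OF J_shift(1)[OF p(1)] n] p(1) by blast
next
  show "\<exists>C. \<forall>\<phi>\<in>D. nrm m V \<phi> \<le> C * nrm m V (\<lambda>x. A \<phi> x - z * \<phi> x)"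
  proof (intro exI ballI)
    fix \<phi> assume p: "\<phi> \<in> D"
    have "nrm m V (\<lambda>x. A \<phi> x - z * \<phi> x) = norm (J (A \<phi>) - scC z (J \<phi>))" using J_shift[OF p, of z] nrm_J by simp
    then show "nrm m V \<phi> \<le> (1/c) * nrm m V (\<lambda>x. A \<phi> x - z * \<phi> x)"
      using bb[OF p] c nrm_J[OF D_ell2[OF p]] by (simp add: field_simps)
  qed
qed

text \<open>By symmetry \<open>(A - Re z) \<phi>\<close> and \<open>\<i> * \<phi>\<close> are
  orthogonal in the real inner product, so the imaginary part of \<open>z\<close> contributes
  separately to the norm.\<close>

lemma imaginary_bdd_below_op:
  assumes p: "\<phi> \<in> D"
  shows "\<bar>Im z\<bar> * norm (J \<phi>) \<le> norm (J (A \<phi>) - scC z (J \<phi>))"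
proof -
  define q where "q = J (A \<phi>) - Re z *\<^sub>R J \<phi>"
  have i0: "inner f (scC \<i> f) = 0" for f :: "complex l2"
  proof -
    have "inner f (scC \<i> f) = inner (scC (cnj \<i>) f) f" by (simp add: inner_scC)
    also have "scC (cnj \<i>) f = - scC \<i> f" by (rule l2_eqI) simp
    finally show ?thesis by (simp add: inner_commute)
  qed
  have "inner (J (A \<phi>)) (scC \<i> (J \<phi>)) = inner (J \<phi>) (scC \<i> (J (A \<phi>)))"
    using A_sym[OF p D_scale[OF p, of \<i>]] p by (simp add: A_scale ell2_scale D_ell2 A_ell2)
  also have "\<dots> = inner (scC (cnj \<i>) (J \<phi>)) (J (A \<phi>))" by (simp add: inner_scC)
  also have "scC (cnj \<i>) (J \<phi>) = - scC \<i> (J \<phi>)" by (rule l2_eqI) simp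
  finally have "inner (J (A \<phi>)) (scC \<i> (J \<phi>)) = 0" by (simp add: inner_commute)
  then have q0: "inner q (scC \<i> (J \<phi>)) = 0" using i0 by (simp add: q_def inner_diff_left)
  have e: "J (A \<phi>) - scC z (J \<phi>) = q - Im z *\<^sub>R scC \<i> (J \<phi>)"
    by (rule l2_eqI) (simp add: q_def, subst complex_eq[of z], simp add: algebra_simps)
  have "(norm (J (A \<phi>) - scC z (J \<phi>)))\<^sup>2 = (norm q)\<^sup>2 + (Im z)\<^sup>2 * (norm (J \<phi>))\<^sup>2"
    unfolding e norm_diff_scaleR_sq q0 by (simp add: dot_square_norm norm_scC)
  then have "(\<bar>Im z\<bar> * norm (J \<phi>))\<^sup>2 \<le> (norm (J (A \<phi>) - scC z (J \<phi>)))\<^sup>2" by (simp add: power_mult_distrib)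
  then show ?thesis by (rule power2_le_imp_le) simp
qed

text \<open>Non-real points satisfy the hypotheses of \<open>in_resolvent\<close> by
  \<open>imaginary_bdd_below_op\<close>. At a real point a lower bound also excludes eigenvectors
  for the conjugate, so no lower bound can hold at a point of the spectrum.\<close>

lemma spectrum_approx:
  assumes z: "z \<in> spectrum_op m V D A"
  shows "z = complex_of_real (Re z)" "c > 0 \<Longrightarrow> \<exists>\<phi>\<in>D. norm (J \<phi>) = 1 \<and> norm (J (A \<phi>) - Re z *\<^sub>R J \<phi>) < c"
proof -
  have nr: "z \<notin> resolvent_set m V D A" using z by (simp add: spectrum_op_def)
  have im: "Im z = 0"
  proof (rule ccontr)
    assume n: "Im z \<noteq> 0"
    have "z \<in> resolvent_set m V D A"
    proof (rule in_resolvent)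
      show "\<bar>Im z\<bar> > 0" using n by simp
      show "\<bar>Im z\<bar> * norm (J \<phi>) \<le> norm (J (A \<phi>) - scC z (J \<phi>))" if "\<phi> \<in> D" for \<phi> by (rule imaginary_bdd_below_op[OF that])
      show "J \<phi> = 0" if p: "\<phi> \<in> D" "A \<phi> = (\<lambda>x. cnj z * \<phi> x)" for \<phi>
        using imaginary_bdd_below_op[OF p(1), of "cnj z"] p(2) n ell2_scale(2)[OF D_ell2[OF p(1)]] by (simp add: mult_le_0_iff)
    qed
    then show False using nr by simp
  qed
  then show zr: "z = complex_of_real (Re z)" by (simp add: complex_eq_iff)
  have sc: "scC z f = Re z *\<^sub>R f" for f :: "complex l2" using zr scC_of_real by metis
  show "\<exists>\<phi>\<in>D. norm (J \<phi>) = 1 \<and> norm (J (A \<phi>) - Re z *\<^sub>R J \<phi>) < c" if c: "c > 0"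
  proof (rule ccontr)
    assume n: "\<not> ?thesis"
    have bb: "c * norm (J \<phi>) \<le> norm (J (A \<phi>) - scC z (J \<phi>))" if p: "\<phi> \<in> D" for \<phi>
    proof (cases "J \<phi> = 0")
      case False
      define t where "t = 1 / norm (J \<phi>)"
      have t: "t > 0" using False by (simp add: t_def)
      let ?u = "\<lambda>x. complex_of_real t * \<phi> x"
      have u: "?u \<in> D" "J ?u = t *\<^sub>R J \<phi>" "J (A ?u) = t *\<^sub>R J (A \<phi>)"
        using p by (simp_all add: D_scale A_scale ell2_scale D_ell2 A_ell2 scC_of_real)
      have "norm (J ?u) = 1" unfolding u(2) using False by (simp add: t_def)
      then have "c \<le> norm (J (A ?u) - Re z *\<^sub>R J ?u)" using n u(1) by (meson not_less)
      also have "J (A ?u) - Re z *\<^sub>R J ?u = t *\<^sub>R (J (A \<phi>) - scC z (J \<phi>))" by (simp add: u sc algebra_simps)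
      finally have "c \<le> t * norm (J (A \<phi>) - scC z (J \<phi>))" using t by simp
      then show ?thesis using False by (simp add: t_def field_simps)
    qed simp
    have "z \<in> resolvent_set m V D A"
    proof (rule in_resolvent[OF c bb])
      show "J \<phi> = 0" if p: "\<phi> \<in> D" "A \<phi> = (\<lambda>x. cnj z * \<phi> x)" for \<phi>
      proof -
        have "cnj z = z" using im by (simp add: complex_eq_iff)
        then show ?thesis using bb[OF p(1)] p(2) ell2_scale(2)[OF D_ell2[OF p(1)]] c by (simp add: mult_le_0_iff)
      qed
    qed
    then show False using nr by simp
  qed
qed

lemma approx_spectrum:
  assumes "\<And>c. c > 0 \<Longrightarrow> \<exists>\<phi>\<in>D. norm (J (A \<phi>) - t *\<^sub>R J \<phi>) < c * norm (J \<phi>)"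
  shows "complex_of_real t \<in> spectrum_op m V D A"
  unfolding spectrum_op_def
proof
  assume "complex_of_real t \<in> resolvent_set m V D A"
  then obtain C where C: "\<And>\<phi>. \<phi> \<in> D \<Longrightarrow> nrm m V \<phi> \<le> C * nrm m V (\<lambda>x. A \<phi> x - complex_of_real t * \<phi> x)"
    unfolding resolvent_set_def by blast
  define c where "c = 1 / (\<bar>C\<bar> + 1)"
  have c: "c > 0" by (simp add: c_def)
  obtain \<phi> where p: "\<phi> \<in> D" "norm (J (A \<phi>) - t *\<^sub>R J \<phi>) < c * norm (J \<phi>)" using assms[OF c] by blast
  have "norm (J \<phi>) \<le> C * norm (J (A \<phi>) - t *\<^sub>R J \<phi>)"
    using C[OF p(1)] J_shift[OF p(1), of "complex_of_real t"] nrm_J D_ell2[OF p(1)] by (simp add: scC_of_real)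
  also have "\<dots> \<le> (\<bar>C\<bar> + 1) * norm (J (A \<phi>) - t *\<^sub>R J \<phi>)" by (intro mult_right_mono) auto
  also have "\<dots> < (\<bar>C\<bar> + 1) * (c * norm (J \<phi>))" using p(2) by (intro mult_strict_left_mono) auto
  also have "\<dots> = norm (J \<phi>)" by (simp add: c_def)
  finally show False by simp
qed

lemma eigenspace_comb:
  assumes "\<phi> \<in> eigenspace_op m V D A z" "\<psi> \<in> eigenspace_op m V D A z"
  shows "(\<lambda>x. \<phi> x + c * \<psi> x) \<in> eigenspace_op m V D A z"
  using assms D_comb[of \<phi> \<psi> c] A_comb[of \<phi> \<psi> c] unfolding eigenspace_op_def by (auto simp: algebra_simps)

lemma J_eigenspace_subspace: "subspace (J ` eigenspace_op m V D A z)"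
proof (rule subspaceI)
  have E: "\<phi> \<in> ell2 m V" if "\<phi> \<in> eigenspace_op m V D A z" for \<phi> using that D_ell2 by (auto simp: eigenspace_op_def)
  have z0: "(\<lambda>_. 0) \<in> eigenspace_op m V D A z" using D_zero A_zero by (simp add: eigenspace_op_def)
  then show "0 \<in> J ` eigenspace_op m V D A z" using J_zero by force
  show "a + b \<in> J ` eigenspace_op m V D A z" if ab: "a \<in> J ` eigenspace_op m V D A z" "b \<in> J ` eigenspace_op m V D A z" for a b
  proof -
    obtain p q where pq: "p \<in> eigenspace_op m V D A z" "q \<in> eigenspace_op m V D A z" "a = J p" "b = J q" using ab by blast
    have "a + b = J (\<lambda>x. p x + 1 * q x)" using ell2_comb(2)[OF E[OF pq(1)] E[OF pq(2)], of 1] pq scC_of_real[of 1 "J q"] by simp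
    then show ?thesis using eigenspace_comb[OF pq(1,2), of 1] by blast
  qed
  show "r *\<^sub>R a \<in> J ` eigenspace_op m V D A z" if a: "a \<in> J ` eigenspace_op m V D A z" for r a
  proof -
    obtain p where p: "p \<in> eigenspace_op m V D A z" "a = J p" using a by blast
    have "r *\<^sub>R a = J (\<lambda>x. 0 + complex_of_real r * p x)" using ell2_scale(2)[OF E[OF p(1)]] p scC_of_real[of r a] by simp
    then show ?thesis using eigenspace_comb[OF z0 p(1), of "complex_of_real r"] by blast
  qed
qed

lemma J_sum:
  assumes "finite B" "B \<subseteq> ell2 m V"
  shows "(\<lambda>x. \<Sum>b\<in>B. c b * b x) \<in> ell2 m V \<and> J (\<lambda>x. \<Sum>b\<in>B. c b * b x) = (\<Sum>b\<in>B. scC (c b) (J b))"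
  using assms
proof (induction B rule: finite_induct)
  case empty
  then show ?case using ell2_zero J_zero by simp
next
  case (insert b B)
  then have IH: "(\<lambda>x. \<Sum>b\<in>B. c b * b x) \<in> ell2 m V" "J (\<lambda>x. \<Sum>b\<in>B. c b * b x) = (\<Sum>b\<in>B. scC (c b) (J b))" and b: "b \<in> ell2 m V" by auto
  have "(\<lambda>x. \<Sum>b\<in>insert b B. c b * b x) = (\<lambda>x. (\<Sum>b\<in>B. c b * b x) + c b * b x)" using insert.hyps by (simp add: add.commute)
  then show ?case using ell2_comb[OF IH(1) b, of "c b"] IH(2) insert.hyps by (simp add: add.commute)
qed

lemma finite_dim_span:
  assumes S: "S \<subseteq> ell2 m V" and B: "finite B" "B \<subseteq> J ` S" "J ` S \<subseteq> span B"
  shows "finite_dim_fs S"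
proof -
  obtain B' where B': "B' \<subseteq> S" "finite B'" "B = J ` B'" using finite_subset_image[OF B(1,2)] by blast
  have inj: "inj_on J B'" by (rule inj_onI) (use B'(1) S J_inj in blast)
  have "\<exists>c. \<phi> = (\<lambda>x. \<Sum>b\<in>B'. c b * b x)" if p: "\<phi> \<in> S" for \<phi>
  proof -
    have "J \<phi> \<in> span B" using B(3) p by blast
    then obtain u where u: "J \<phi> = (\<Sum>v\<in>B. u v *\<^sub>R v)" unfolding span_finite[OF B(1)] by blast
    define c where "c b = complex_of_real (u (J b))" for b
    have "J \<phi> = (\<Sum>b\<in>B'. scC (c b) (J b))" unfolding u B'(3) by (subst sum.reindex[OF inj]) (simp add: c_def scC_of_real)
    moreover have "(\<lambda>x. \<Sum>b\<in>B'. c b * b x) \<in> ell2 m V" "J (\<lambda>x. \<Sum>b\<in>B'. c b * b x) = (\<Sum>b\<in>B'. scC (c b) (J b))"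
      using J_sum[OF B'(2), of c] B'(1) S by auto
    ultimately have "\<phi> = (\<lambda>x. \<Sum>b\<in>B'. c b * b x)" using p S by (intro J_inj) auto
    then show ?thesis by blast
  qed
  then show ?thesis unfolding finite_dim_fs_def using B' by blast
qed

text \<open>Over the reals a complex span is generated by the given functions and their multiples by
  \<open>\<i>\<close>.\<close>

lemma finite_dim_real_span:
  assumes S: "S \<subseteq> ell2 m V" and f: "finite_dim_fs S"
  obtains F where "finite F" "F \<subseteq> H" "J ` S \<subseteq> span F"
proof -
  obtain B where B: "finite B" "B \<subseteq> S" "\<And>\<phi>. \<phi> \<in> S \<Longrightarrow> \<exists>c. \<phi> = (\<lambda>x. \<Sum>b\<in>B. c b * b x)"
    using f unfolding finite_dim_fs_def by blast
  define F where "F = J ` B \<union> (\<lambda>b. scC \<i> (J b)) ` B"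
  have "J \<phi> \<in> span F" if p: "\<phi> \<in> S" for \<phi>
  proof -
    obtain c where c: "\<phi> = (\<lambda>x. \<Sum>b\<in>B. c b * b x)" using B(3)[OF p] by blast
    have Js: "J \<phi> = (\<Sum>b\<in>B. scC (c b) (J b))" unfolding c using J_sum[OF B(1)] B(2) S by blast
    have dec: "scC z g = Re z *\<^sub>R g + Im z *\<^sub>R scC \<i> g" for z and g :: "complex l2"
      by (rule l2_eqI) (simp, subst complex_eq[of z], simp add: algebra_simps)
    have "J \<phi> = (\<Sum>b\<in>B. Re (c b) *\<^sub>R J b + Im (c b) *\<^sub>R scC \<i> (J b))"
      unfolding Js by (rule sum.cong[OF refl dec])
    also have "\<dots> \<in> span F" by (intro span_sum span_add span_scale span_base) (auto simp: F_def)
    finally show ?thesis .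
  qed
  moreover have "F \<subseteq> H" using B(2) S scC_H unfolding F_def H_def by blast
  moreover have "finite F" using B(1) by (simp add: F_def)
  ultimately show ?thesis using that by blast
qed

text \<open>The hypothesis is compactness of bounded approximate eigenvectors for parameters tending
  to \<open>t\<close>. With constant parameters it yields an eigenvector and, by Riesz' theorem,
  finite multiplicity; varying parameters are needed to show that \<open>t\<close> is
  isolated.\<close>

lemma not_in_ess_spectrum:
  assumes comp: "\<And>(\<phi> :: nat \<Rightarrow> _) s. (\<And>n. \<phi> n \<in> D) \<Longrightarrow> (\<And>n. norm (J (\<phi> n)) \<le> 1) \<Longrightarrow> s \<longlonglongrightarrow> t \<Longrightarrow>
      (\<lambda>n. J (A (\<phi> n)) - s n *\<^sub>R J (\<phi> n)) \<longlonglongrightarrow> 0 \<Longrightarrow> \<exists>r l. strict_mono (r :: nat \<Rightarrow> nat) \<and> (\<lambda>n. J (\<phi> (r n))) \<longlonglongrightarrow> l"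
  shows "complex_of_real t \<notin> ess_spectrum m V D A"
proof
  let ?z = "complex_of_real t"
  let ?E = "eigenspace_op m V D A ?z"
  assume "?z \<in> ess_spectrum m V D A"
  then have zs: "?z \<in> spectrum_op m V D A" and nd: "?z \<notin> discrete_spectrum m V D A" by (auto simp: ess_spectrum_def)
  have limit: "\<exists>r l \<psi>. strict_mono (r :: nat \<Rightarrow> nat) \<and> \<psi> \<in> ?E \<and> J \<psi> = l \<and> (\<lambda>n. J (\<phi> (r n))) \<longlonglongrightarrow> l"
    if \<phi>: "\<And>n. \<phi> n \<in> D" "\<And>n. norm (J (\<phi> n)) \<le> 1" "s \<longlonglongrightarrow> t" "(\<lambda>n. J (A (\<phi> n)) - s n *\<^sub>R J (\<phi> n)) \<longlonglongrightarrow> 0" for \<phi> :: "nat \<Rightarrow> _" and s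
  proof -
    obtain r l where r: "strict_mono (r :: nat \<Rightarrow> nat)" "(\<lambda>n. J (\<phi> (r n))) \<longlonglongrightarrow> l" using comp[OF \<phi>] by blast
    have s': "(\<lambda>n. s (r n)) \<longlonglongrightarrow> t" using LIMSEQ_subseq_LIMSEQ[OF \<phi>(3) r(1)] by (simp add: comp_def)
    have "(\<lambda>n. J (A (\<phi> (r n))) - s (r n) *\<^sub>R J (\<phi> (r n))) \<longlonglongrightarrow> 0" using LIMSEQ_subseq_LIMSEQ[OF \<phi>(4) r(1)] by (simp add: comp_def)
    from tendsto_add[OF this tendsto_scaleR[OF s' r(2)]]
    have g: "(\<lambda>n. J (A (\<phi> (r n)))) \<longlonglongrightarrow> t *\<^sub>R l" by simp
    obtain \<psi> where \<psi>: "\<psi> \<in> D" "J \<psi> = l" "J (A \<psi>) = t *\<^sub>R l" by (rule closed_graph[of "\<lambda>n. \<phi> (r n)", OF \<phi>(1) r(2) g])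
    have "J (A \<psi>) = J (\<lambda>x. ?z * \<psi> x)" using \<psi> ell2_scale(2)[OF D_ell2[OF \<psi>(1)], of ?z] by (simp add: scC_of_real)
    then have "A \<psi> = (\<lambda>x. ?z * \<psi> x)" using J_inj[OF A_ell2[OF \<psi>(1)] ell2_scale(1)[OF D_ell2[OF \<psi>(1)]]] by blast
    then have "\<psi> \<in> ?E" using \<psi>(1) by (simp add: eigenspace_op_def)
    then show ?thesis using r \<psi>(2) by blast
  qed
  have small: "(\<lambda>n. 1 / real (Suc n)) \<longlonglongrightarrow> 0" using LIMSEQ_Suc[OF lim_1_over_n] by simp
  have "?E \<noteq> {(\<lambda>_. 0)}"
  proof -
    have "\<forall>n. \<exists>\<phi>. \<phi> \<in> D \<and> norm (J \<phi>) = 1 \<and> norm (J (A \<phi>) - t *\<^sub>R J \<phi>) < 1 / real (Suc n)"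
      using spectrum_approx(2)[OF zs] by (metis Re_complex_of_real of_nat_0_less_iff zero_less_Suc zero_less_divide_1_iff)
    then obtain \<phi> where \<phi>: "\<And>n. \<phi> n \<in> D" "\<And>n. norm (J (\<phi> n)) = 1" "\<And>n. norm (J (A (\<phi> n)) - t *\<^sub>R J (\<phi> n)) < 1 / real (Suc n)" by metis
    have "(\<lambda>n. J (A (\<phi> n)) - t *\<^sub>R J (\<phi> n)) \<longlonglongrightarrow> 0"
      by (rule Lim_null_comparison[OF _ small]) (use \<phi>(3) less_imp_le in \<open>intro always_eventually; blast\<close>)
    then obtain r l \<psi> where r: "strict_mono (r :: nat \<Rightarrow> nat)" "\<psi> \<in> ?E" "J \<psi> = l" "(\<lambda>n. J (\<phi> (r n))) \<longlonglongrightarrow> l"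
      using limit[OF \<phi>(1) _ tendsto_const, of] \<phi>(2) by fastforce
    have "(\<lambda>n. norm (J (\<phi> (r n)))) \<longlonglongrightarrow> norm l" by (intro tendsto_intros r)
    then have "norm l = 1" using \<phi>(2) by (simp add: LIMSEQ_const_iff)
    then have "\<psi> \<noteq> (\<lambda>_. 0)" using r(3) J_zero by auto
    then show ?thesis using r(2) by blast
  qed
  moreover have "finite_dim_fs ?E"
  proof -
    have ED: "\<phi> \<in> D" "J (A \<phi>) = t *\<^sub>R J \<phi>" if "\<phi> \<in> ?E" for \<phi>
    proof -
      show d: "\<phi> \<in> D" using that by (simp add: eigenspace_op_def)
      have "A \<phi> = (\<lambda>x. ?z * \<phi> x)" using that by (simp add: eigenspace_op_def)
      then show "J (A \<phi>) = t *\<^sub>R J \<phi>" using ell2_scale(2)[OF D_ell2[OF d], of ?z] by (simp add: scC_of_real)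
    qed
    obtain B where "finite B" "B \<subseteq> J ` ?E" "J ` ?E \<subseteq> span B"
    proof (rule compact_ball_finite_span[OF J_eigenspace_subspace])
      fix X :: "nat \<Rightarrow> _" assume X: "\<And>n. X n \<in> J ` ?E \<and> norm (X n) \<le> 1"
      then have "\<forall>n. \<exists>\<phi>. \<phi> \<in> ?E \<and> X n = J \<phi>" by blast
      then obtain \<phi> where \<phi>: "\<And>n. \<phi> n \<in> ?E" "\<And>n. X n = J (\<phi> n)" by metis
      have n1: "norm (J (\<phi> n)) \<le> 1" for n using X[of n] \<phi>(2)[of n] by simp
      have z: "(\<lambda>n. J (A (\<phi> n)) - (\<lambda>_. t) n *\<^sub>R J (\<phi> n)) \<longlonglongrightarrow> 0" using ED(2)[OF \<phi>(1)] by simp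
      obtain r l \<psi> where r: "strict_mono (r :: nat \<Rightarrow> nat)" "\<psi> \<in> ?E" "J \<psi> = l" "(\<lambda>n. J (\<phi> (r n))) \<longlonglongrightarrow> l"
        using limit[of \<phi> "\<lambda>_. t", OF ED(1)[OF \<phi>(1)] n1 tendsto_const z] by blast
      then show "\<exists>r l. strict_mono (r :: nat \<Rightarrow> nat) \<and> l \<in> J ` ?E \<and> (\<lambda>n. X (r n)) \<longlonglongrightarrow> l" unfolding \<phi>(2) by blast
    qed
    then show ?thesis by (rule finite_dim_span[rotated]) (use ED(1) D_ell2 in blast)
  qed
  moreover have "\<not> ?z islimpt spectrum_op m V D A"
  proof
    assume lim: "?z islimpt spectrum_op m V D A"
    then obtain y where y: "\<And>n :: nat. y n \<in> spectrum_op m V D A - {?z}" "y \<longlonglongrightarrow> ?z" unfolding islimpt_sequential by blast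
    define s where "s n = Re (y n)" for n
    have ys: "y n = complex_of_real (s n)" for n using spectrum_approx(1)[of "y n"] y(1)[of n] by (simp add: s_def)
    have st: "s n \<noteq> t" for n using y(1)[of n] ys[of n] by auto
    have sl: "s \<longlonglongrightarrow> t" using tendsto_Re[OF y(2)] by (simp add: s_def[abs_def])
    \<comment> \<open>The error is small even relative to the distance of \<open>s n\<close> from
      \<open>t\<close>. This makes the approximate eigenvectors asymptotically orthogonal to every
      eigenvector for \<open>t\<close>, although a subsequence converges to one of norm 1.\<close>
    have "\<forall>n. \<exists>\<phi>. \<phi> \<in> D \<and> norm (J \<phi>) = 1 \<and> norm (J (A \<phi>) - s n *\<^sub>R J \<phi>) < \<bar>s n - t\<bar> / real (Suc n)"
    proof
      fix n
      have "0 < \<bar>s n - t\<bar> / real (Suc n)" using st[of n] by simp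
      then show "\<exists>\<phi>. \<phi> \<in> D \<and> norm (J \<phi>) = 1 \<and> norm (J (A \<phi>) - s n *\<^sub>R J \<phi>) < \<bar>s n - t\<bar> / real (Suc n)"
        using spectrum_approx(2)[of "y n"] y(1)[of n] unfolding s_def by blast
    qed
    then obtain \<phi> where \<phi>: "\<And>n. \<phi> n \<in> D" "\<And>n. norm (J (\<phi> n)) = 1" "\<And>n. norm (J (A (\<phi> n)) - s n *\<^sub>R J (\<phi> n)) < \<bar>s n - t\<bar> / real (Suc n)" by metis
    have z: "(\<lambda>n. J (A (\<phi> n)) - s n *\<^sub>R J (\<phi> n)) \<longlonglongrightarrow> 0"
    proof (rule Lim_null_comparison)
      show "\<forall>\<^sub>F n in sequentially. norm (J (A (\<phi> n)) - s n *\<^sub>R J (\<phi> n)) \<le> \<bar>s n - t\<bar> * (1 / real (Suc n))"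
        using \<phi>(3) less_imp_le by (intro always_eventually) fastforce
      have "(\<lambda>n. \<bar>s n - t\<bar> * (1 / real (Suc n))) \<longlonglongrightarrow> \<bar>t - t\<bar> * 0" by (intro tendsto_intros sl small)
      then show "(\<lambda>n. \<bar>s n - t\<bar> * (1 / real (Suc n))) \<longlonglongrightarrow> 0" by simp
    qed
    have n1: "norm (J (\<phi> n)) \<le> 1" for n using \<phi>(2)[of n] by simp
    obtain r l \<psi> where r: "strict_mono (r :: nat \<Rightarrow> nat)" "\<psi> \<in> ?E" "J \<psi> = l" "(\<lambda>n. J (\<phi> (r n))) \<longlonglongrightarrow> l"
      using limit[OF \<phi>(1) n1 sl z] by blast
    have \<psi>D: "\<psi> \<in> D" and Al: "J (A \<psi>) = t *\<^sub>R l"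
      using r(2,3) ell2_scale(2)[OF D_ell2, of \<psi> ?z] by (auto simp: eigenspace_op_def scC_of_real)
    have "(\<lambda>n. norm (J (\<phi> (r n)))) \<longlonglongrightarrow> norm l" by (intro tendsto_intros r)
    then have l1: "norm l = 1" using \<phi>(2) by (simp add: LIMSEQ_const_iff)
    have le: "\<bar>inner (J (\<phi> n)) l\<bar> \<le> 1 / real (Suc n)" for n
    proof -
      have "inner (J (A (\<phi> n)) - s n *\<^sub>R J (\<phi> n)) l = (t - s n) * inner (J (\<phi> n)) l"
        using A_sym[OF \<phi>(1)[of n] \<psi>D] r(3) Al by (simp add: inner_diff_left algebra_simps)
      then have "\<bar>t - s n\<bar> * \<bar>inner (J (\<phi> n)) l\<bar> = \<bar>inner (J (A (\<phi> n)) - s n *\<^sub>R J (\<phi> n)) l\<bar>" by (simp add: abs_mult)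
      also have "\<dots> \<le> norm (J (A (\<phi> n)) - s n *\<^sub>R J (\<phi> n)) * norm l" by (rule Cauchy_Schwarz_ineq2)
      also have "\<dots> \<le> \<bar>s n - t\<bar> * (1 / real (Suc n))" using \<phi>(3)[of n] l1 by simp
      finally have "\<bar>s n - t\<bar> * \<bar>inner (J (\<phi> n)) l\<bar> \<le> \<bar>s n - t\<bar> * (1 / real (Suc n))" by (simp add: abs_minus_commute)
      then show ?thesis by (rule mult_left_le_imp_le) (use st[of n] in simp)
    qed
    have "(\<lambda>n. inner (J (\<phi> n)) l) \<longlonglongrightarrow> 0"
      by (rule Lim_null_comparison[OF _ small]) (use le in \<open>intro always_eventually; simp\<close>)
    then have "(\<lambda>n. inner (J (\<phi> (r n))) l) \<longlonglongrightarrow> 0" using LIMSEQ_subseq_LIMSEQ[OF _ r(1)] by (force simp: comp_def)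
    moreover have "(\<lambda>n. inner (J (\<phi> (r n))) l) \<longlonglongrightarrow> inner l l" by (intro tendsto_intros r)
    ultimately have "inner l l = 0" using LIMSEQ_unique by blast
    then show False using l1 by simp
  qed
  ultimately have "?z \<in> discrete_spectrum m V D A" using zs by (simp add: discrete_spectrum_def)
  then show False using nd by simp
qed

lemma ess_spectrum_real: "z \<in> ess_spectrum m V D A \<Longrightarrow> z = complex_of_real (Re z)"
  using spectrum_approx(1) by (auto simp: ess_spectrum_def)

end

section \<open>The Laplacian\<close>

text \<open>The coefficient is arbitrary because the real inner product detects a complex value only
  through all complex multiples of a point mass.\<close>

definition delta :: "complex \<Rightarrow> complex \<Rightarrow> complex \<Rightarrow> complex" where
  "delta v c = (\<lambda>x. if x = v then c else 0)"

context weighted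
begin

lemma fin_supp_ell2: "\<phi> \<in> fin_supp V \<Longrightarrow> \<phi> \<in> ell2 m V"
proof -
  assume p: "\<phi> \<in> fin_supp V"
  let ?f = "\<lambda>x. (cmod (if x \<in> V then complex_of_real (sqrt (m x)) * \<phi> x else 0))\<^sup>2"
  have "?f summable_on UNIV \<longleftrightarrow> ?f summable_on {x. \<phi> x \<noteq> 0}"
    by (rule summable_on_cong_neutral) auto
  then show ?thesis using p unfolding ell2_iff fin_supp_def by auto
qed

lemma delta_fin_supp: "v \<in> V \<Longrightarrow> delta v c \<in> fin_supp V"
  unfolding fin_supp_def delta_def by (auto intro: finite_subset[of _ "{v}"])

lemma inner_finite:
  assumes p: "\<phi> \<in> ell2 m V" "\<psi> \<in> ell2 m V" and W: "finite W" "W \<subseteq> V" "\<And>x. x \<notin> W \<Longrightarrow> \<psi> x = 0"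
  shows "inner (J \<phi>) (J \<psi>) = (\<Sum>x\<in>W. m x * inner (\<phi> x) (\<psi> x))"
proof -
  have "inner (J \<phi>) (J \<psi>) = (\<Sum>\<^sub>\<infinity>x\<in>W. m x * inner (\<phi> x) (\<psi> x))"
    unfolding inner_l2_def
  proof (rule infsum_cong_neutral)
    fix x assume "x \<in> UNIV - W"
    then show "inner (l2app (J \<phi>) x) (l2app (J \<psi>) x) = 0" using W(3) p by (simp add: l2app_J)
  next
    fix x assume "x \<in> UNIV \<inter> W"
    then have x: "x \<in> V" using W(2) by blast
    have "inner (complex_of_real s * z) (complex_of_real s * w) = s * s * inner z w" for s z w
      by (simp add: inner_complex_def algebra_simps)
    then show "inner (l2app (J \<phi>) x) (l2app (J \<psi>) x) = m x * inner (\<phi> x) (\<psi> x)"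
      using x mpos[OF x] p by (simp add: l2app_J)
  qed simp
  then show ?thesis using W(1) by simp
qed

lemma inner_delta:
  assumes "\<phi> \<in> ell2 m V" "v \<in> V"
  shows "inner (J \<phi>) (J (delta v c)) = m v * inner (\<phi> v) c"
  using inner_finite[OF assms(1) fin_supp_ell2[OF delta_fin_supp[OF assms(2)]], of "{v}" c] assms(2)
  by (simp add: delta_def)

lemma norm_delta: "v \<in> V \<Longrightarrow> norm (J (delta v c)) = sqrt (m v) * cmod c"
  using inner_delta[OF fin_supp_ell2[OF delta_fin_supp], of v v c c] mpos[of v]
  by (simp add: norm_eq_sqrt_inner delta_def real_sqrt_mult)

text \<open>A vector of \<open>H\<close> orthogonal to all point masses vanishes.\<close>

lemma delta_total:
  assumes Q: "closed Q" "subspace Q" "Q \<subseteq> H" and d: "\<And>v c. v \<in> V \<Longrightarrow> J (delta v c) \<in> Q"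
  shows "Q = H"
proof
  show "H \<subseteq> Q"
  proof
    fix g assume g: "g \<in> H"
    obtain r where r: "r \<in> Q" "\<And>y. y \<in> Q \<Longrightarrow> inner (g - r) y = 0" by (rule orthogonal_projection[OF Q(1,2)]) blast
    have "g - r \<in> H" using g r(1) Q(3) subspace_diff[OF subspace_H] by blast
    then obtain \<phi> where p: "\<phi> \<in> ell2 m V" "J \<phi> = g - r" by (rule H_E)
    have "\<phi> v = 0" for v
    proof (cases "v \<in> V")
      case True
      have "inner (J \<phi>) (J (delta v (\<phi> v))) = 0" unfolding p(2) by (rule r(2)[OF d[OF True]])
      then show ?thesis using inner_delta[OF p(1) True] mpos[OF True] by simp
    qed (use p(1) in \<open>simp add: ell2_def\<close>)
    then have "\<phi> = (\<lambda>_. 0)" by blast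
    then have "g = r" using p(2) J_zero by simp
    then show "g \<in> Q" using r(1) by simp
  qed
qed (rule Q(3))

lemma l2app_inj_tendsto_0:
  assumes v: "inj v"
  shows "(\<lambda>n :: nat. l2app f (v n)) \<longlonglongrightarrow> 0"
proof -
  have "summable (\<lambda>n. (cmod (l2app f (v n)))\<^sup>2)"
  proof (rule summableI_nonneg_bounded)
    fix n
    have "(\<Sum>i<n. (cmod (l2app f (v i)))\<^sup>2) = (\<Sum>x\<in>v ` {..<n}. (cmod (l2app f x))\<^sup>2)"
      by (subst sum.reindex) (use v in \<open>auto simp: inj_on_def\<close>)
    also have "\<dots> \<le> (norm f)\<^sup>2" by (rule l2_finite_le) simp
    finally show "(\<Sum>i<n. (cmod (l2app f (v i)))\<^sup>2) \<le> (norm f)\<^sup>2" .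
  qed simp
  then have "(\<lambda>n. (cmod (l2app f (v n)))\<^sup>2) \<longlonglongrightarrow> 0" by (rule summable_LIMSEQ_zero)
  then have "(\<lambda>n. sqrt ((cmod (l2app f (v n)))\<^sup>2)) \<longlonglongrightarrow> sqrt 0" by (rule tendsto_real_sqrt)
  then show ?thesis by (simp add: tendsto_norm_zero_iff)
qed

lemma inner_J_delta:
  assumes v: "v \<in> V"
  shows "inner f (J (delta v c)) = sqrt (m v) * inner (l2app f v) c"
proof -
  have p: "delta v c \<in> ell2 m V" by (rule fin_supp_ell2[OF delta_fin_supp[OF v]])
  have "inner f (J (delta v c)) = (\<Sum>\<^sub>\<infinity>x\<in>{v}. inner (l2app f x) (l2app (J (delta v c)) x))"
    unfolding inner_l2_def by (rule infsum_cong_neutral) (use p in \<open>auto simp: l2app_J delta_def\<close>)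
  moreover have "inner z (complex_of_real s * w) = s * inner z w" for s z w by (simp add: inner_complex_def algebra_simps)
  ultimately show ?thesis using p v by (simp add: l2app_J delta_def)
qed

lemma delta_weakly_null:
  assumes v: "inj v" "\<And>n :: nat. v n \<in> V" and c: "\<And>n. sqrt (m (v n)) * cmod (c n) \<le> 1"
  shows "(\<lambda>n. inner f (J (delta (v n) (c n)))) \<longlonglongrightarrow> 0"
proof (rule Lim_null_comparison)
  show "\<forall>\<^sub>F n in sequentially. norm (inner f (J (delta (v n) (c n)))) \<le> cmod (l2app f (v n))"
  proof (intro always_eventually allI)
    fix n
    have "\<bar>inner f (J (delta (v n) (c n)))\<bar> = sqrt (m (v n)) * \<bar>inner (l2app f (v n)) (c n)\<bar>"
      using mpos[OF v(2)[of n]] by (simp add: inner_J_delta[OF v(2)] abs_mult)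
    also have "\<dots> \<le> sqrt (m (v n)) * (cmod (l2app f (v n)) * cmod (c n))"
      using mpos[OF v(2)[of n]] by (intro mult_left_mono Cauchy_Schwarz_ineq2) auto
    also have "\<dots> = cmod (l2app f (v n)) * (sqrt (m (v n)) * cmod (c n))" by simp
    also have "\<dots> \<le> cmod (l2app f (v n)) * 1" using c[of n] by (intro mult_left_mono) auto
    finally show "norm (inner f (J (delta (v n) (c n)))) \<le> cmod (l2app f (v n))" by simp
  qed
  show "(\<lambda>n. cmod (l2app f (v n))) \<longlonglongrightarrow> 0" using tendsto_norm_zero[OF l2app_inj_tendsto_0[OF v(1), of f]] .
qed

end

text \<open>The nonpositive curvature assumed in the theorem enters as \<open>inf\<close>.\<close>

locale plane_net =
  fixes V :: "complex set" and E :: "curve set"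
  assumes pg: "plane_graph V E" and sp: "simple_pg E" and lf: "locally_finite_pg E"
    and cg: "connected_graph V E" and inf: "infinite V"
begin

definition nb :: "complex \<Rightarrow> complex set" where "nb v = {w. adj E v w}"

lemma finite_nb: "finite (nb v)" and card_nb: "card (nb v) = deg E v"
  using deg_eq_card_neighbours[OF pg sp lf] by (auto simp: nb_def)

lemma nb_sym: "w \<in> nb v \<longleftrightarrow> v \<in> nb w"
  using symp_adj[of E] by (auto simp: nb_def symp_def)

lemma nb_in: "w \<in> nb v \<Longrightarrow> v \<in> V \<and> w \<in> V"
  using plane_graphD(2)[OF pg] by (auto simp: nb_def adj_def)

lemma nb_irrefl: "v \<notin> nb v"
  by (auto simp: nb_def adj_def)

lemma deg_pos:
  assumes v: "v \<in> V"
  shows "0 < deg E v"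
proof -
  have "infinite (V - {v})" using inf by simp
  then obtain w where w: "w \<in> V" "w \<noteq> v" using infinite_imp_nonempty by blast
  have "(v, w) \<in> {(a, b). adj E a b}\<^sup>*" using cg v w by (simp add: connected_graph_def)
  then obtain x where "adj E v x" using w(2) by (cases rule: converse_rtranclE) auto
  then have "nb v \<noteq> {}" by (auto simp: nb_def)
  then show ?thesis using finite_nb card_nb by (metis card_gt_0_iff)
qed

text \<open>A connected graph with finite degrees is the union of its finite balls around a vertex.
  Countability is what diagonal subsequences require.\<close>

lemma countable_V: "countable V"
proof -
  obtain a where a: "a \<in> V" using cg by (auto simp: connected_graph_def)
  define B where "B n = ((\<lambda>S. S \<union> (\<Union>x\<in>S. nb x)) ^^ n) {a}" for n :: nat
  have fB: "finite (B n)" for n by (induction n) (auto simp: B_def finite_nb)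
  have "\<exists>n. w \<in> B n" if w: "w \<in> V" for w
  proof -
    have "(a, w) \<in> {(a, b). adj E a b}\<^sup>*" using cg a w by (simp add: connected_graph_def)
    then show ?thesis
    proof (induction rule: rtrancl_induct)
      case base
      then show ?case by (intro exI[of _ 0]) (simp add: B_def)
    next
      case (step y z)
      then obtain n where "y \<in> B n" by blast
      then have "z \<in> B (Suc n)" using step.hyps(2) by (auto simp: B_def nb_def)
      then show ?case by blast
    qed
  qed
  then have "V \<subseteq> (\<Union>n. B n)" by blast
  moreover have "countable (\<Union>n. B n)" using fB by (auto intro: countable_finite)
  ultimately show ?thesis by (rule countable_subset)
qed

section \<open>Bounds for the adjacency form\<close>

definition edge_ind :: "complex \<Rightarrow> complex \<Rightarrow> real" where "edge_ind u v = (if v \<in> nb u then 1 else 0)"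

lemma edge_ind_sym: "edge_ind u v = edge_ind v u" and edge_ind_irrefl: "edge_ind u u = 0" and edge_ind_nonneg: "0 \<le> edge_ind u v"
  using nb_sym[of v u] nb_irrefl by (auto simp: edge_ind_def)

lemma sum_nb:
  assumes "finite X" "nb v \<subseteq> X"
  shows "(\<Sum>w\<in>nb v. g w) = (\<Sum>w\<in>X. edge_ind v w * (g w :: real))"
  by (rule sum.mono_neutral_cong_left) (use assms in \<open>auto simp: edge_ind_def\<close>)

lemma sum_edge_ind_le_deg: "finite X \<Longrightarrow> (\<Sum>w\<in>X. edge_ind v w) \<le> real (deg E v)"
proof -
  assume X: "finite X"
  have "(\<Sum>w\<in>X. edge_ind v w) = real (card (X \<inter> nb v))" unfolding edge_ind_def using X by (simp add: sum.If_cases Int_def)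
  also have "\<dots> \<le> real (card (nb v))" using card_mono[OF finite_nb, of "X \<inter> nb v" v] by simp
  finally show ?thesis by (simp add: card_nb)
qed

text \<open>Remove a vertex \<open>v\<close> with at most five neighbours in \<open>W\<close> and
  estimate \<open>2 f(v) f(u)\<close> unevenly: the weight \<open>l\<close> falls on
  \<open>f(v)\<close>, for at most five edges, and \<open>1/l\<close> on the other end. In total a
  vertex pays \<open>5 * l\<close> when it is removed and \<open>1/l\<close> at most once for each
  of its edges.\<close>

lemma quad_bound:
  fixes f :: "complex \<Rightarrow> real"
  assumes l: "0 < l"
  shows "finite W \<Longrightarrow> W \<subseteq> V \<Longrightarrow> (\<Sum>u\<in>W. \<Sum>v\<in>W. edge_ind u v * (f u * f v)) \<le>
     5 * l * (\<Sum>u\<in>W. (f u)\<^sup>2) + (1 / l) * (\<Sum>u\<in>W. (\<Sum>v\<in>W. edge_ind u v) * (f u)\<^sup>2)"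
proof (induction "card W" arbitrary: W)
  case 0
  then show ?case by simp
next
  case (Suc n)
  then have "W \<noteq> {}" by auto
  then obtain v where v: "v \<in> W" "card {w\<in>W. adj E v w} \<le> 5" using sparse_subgraph[OF pg sp Suc.prems(1) _ Suc.prems(2)] by blast
  define X where "X = W - {v}"
  have W: "W = insert v X" "v \<notin> X" "finite X" "X \<subseteq> V" using v(1) Suc.prems by (auto simp: X_def)
  have IH: "(\<Sum>u\<in>X. \<Sum>w\<in>X. edge_ind u w * (f u * f w)) \<le> 5 * l * (\<Sum>u\<in>X. (f u)\<^sup>2) + (1 / l) * (\<Sum>u\<in>X. (\<Sum>w\<in>X. edge_ind u w) * (f u)\<^sup>2)"
    by (rule Suc.hyps(1)) (use Suc.hyps(2) W in auto)
  have d5: "(\<Sum>w\<in>X. edge_ind v w) \<le> 5"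
  proof -
    have "(\<Sum>w\<in>X. edge_ind v w) = real (card (X \<inter> nb v))" unfolding edge_ind_def using W(3) by (simp add: sum.If_cases Int_def)
    also have "card (X \<inter> nb v) \<le> card {w\<in>W. adj E v w}" by (rule card_mono) (use Suc.prems(1) in \<open>auto simp: X_def nb_def\<close>)
    finally show ?thesis using v(2) by linarith
  qed
  have am: "2 * (f v * f u) \<le> l * (f v)\<^sup>2 + (1 / l) * (f u)\<^sup>2" for u
  proof -
    have "0 \<le> (l * f v - f u)\<^sup>2 / l" using l by simp
    also have "\<dots> = l * (f v)\<^sup>2 + (1 / l) * (f u)\<^sup>2 - 2 * (f v * f u)" using l by (simp add: power2_eq_square field_simps)
    finally show ?thesis by simp
  qed
  have s: "(\<Sum>u\<in>X. edge_ind u v * (f u * f v)) = (\<Sum>u\<in>X. edge_ind v u * (f v * f u))"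
    by (rule sum.cong[OF refl]) (metis edge_ind_sym mult.commute)
  have "(\<Sum>u\<in>W. \<Sum>w\<in>W. edge_ind u w * (f u * f w)) = 2 * (\<Sum>u\<in>X. edge_ind v u * (f v * f u)) + (\<Sum>u\<in>X. \<Sum>w\<in>X. edge_ind u w * (f u * f w))"
    unfolding W(1) using W(2,3) by (simp add: edge_ind_irrefl sum.distrib s)
  also have "2 * (\<Sum>u\<in>X. edge_ind v u * (f v * f u)) \<le> (\<Sum>u\<in>X. edge_ind v u * (l * (f v)\<^sup>2 + (1 / l) * (f u)\<^sup>2))"
    unfolding sum_distrib_left by (rule sum_mono) (use mult_left_mono[OF am edge_ind_nonneg] in \<open>simp add: algebra_simps\<close>)
  also have "\<dots> = l * (f v)\<^sup>2 * (\<Sum>u\<in>X. edge_ind v u) + (1 / l) * (\<Sum>u\<in>X. edge_ind v u * (f u)\<^sup>2)"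
    by (simp add: sum.distrib sum_distrib_left sum_distrib_right algebra_simps)
  also have "l * (f v)\<^sup>2 * (\<Sum>u\<in>X. edge_ind v u) \<le> l * (f v)\<^sup>2 * 5" using d5 l by (intro mult_left_mono) auto
  finally have 1: "(\<Sum>u\<in>W. \<Sum>w\<in>W. edge_ind u w * (f u * f w)) \<le> 5 * l * (f v)\<^sup>2 + (1 / l) * (\<Sum>u\<in>X. edge_ind v u * (f u)\<^sup>2) +
      (5 * l * (\<Sum>u\<in>X. (f u)\<^sup>2) + (1 / l) * (\<Sum>u\<in>X. (\<Sum>w\<in>X. edge_ind u w) * (f u)\<^sup>2))" using IH by linarith
  have "(\<Sum>u\<in>W. (\<Sum>w\<in>W. edge_ind u w) * (f u)\<^sup>2) = (\<Sum>u\<in>X. edge_ind v u) * (f v)\<^sup>2 + ((\<Sum>u\<in>X. edge_ind v u * (f u)\<^sup>2) + (\<Sum>u\<in>X. (\<Sum>w\<in>X. edge_ind u w) * (f u)\<^sup>2))"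
    unfolding W(1) using W(2,3) by (simp add: edge_ind_irrefl sum.distrib edge_ind_sym[of _ v] distrib_right)
  moreover have "0 \<le> (\<Sum>u\<in>X. edge_ind v u) * (f v)\<^sup>2" by (intro mult_nonneg_nonneg sum_nonneg edge_ind_nonneg) simp
  ultimately have "(\<Sum>u\<in>X. edge_ind v u * (f u)\<^sup>2) + (\<Sum>u\<in>X. (\<Sum>w\<in>X. edge_ind u w) * (f u)\<^sup>2) \<le> (\<Sum>u\<in>W. (\<Sum>w\<in>W. edge_ind u w) * (f u)\<^sup>2)" by simp
  then have "(1 / l) * ((\<Sum>u\<in>X. edge_ind v u * (f u)\<^sup>2) + (\<Sum>u\<in>X. (\<Sum>w\<in>X. edge_ind u w) * (f u)\<^sup>2)) \<le> (1 / l) * (\<Sum>u\<in>W. (\<Sum>w\<in>W. edge_ind u w) * (f u)\<^sup>2)"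
    using l by (intro mult_left_mono) auto
  moreover have "(\<Sum>u\<in>W. (f u)\<^sup>2) = (f v)\<^sup>2 + (\<Sum>u\<in>X. (f u)\<^sup>2)" unfolding W(1) using W(2,3) by simp
  ultimately show ?case using 1 by (simp only: distrib_left)
qed

lemma quad_bound_deg:
  fixes f :: "complex \<Rightarrow> real"
  assumes l: "0 < l" and W: "finite W" "W \<subseteq> V"
  shows "(\<Sum>u\<in>W. \<Sum>v\<in>W. edge_ind u v * (f u * f v)) \<le>
     5 * l * (\<Sum>u\<in>W. (f u)\<^sup>2) + (1 / l) * (\<Sum>u\<in>W. real (deg E u) * (f u)\<^sup>2)"
proof -
  have "(\<Sum>u\<in>W. (\<Sum>v\<in>W. edge_ind u v) * (f u)\<^sup>2) \<le> (\<Sum>u\<in>W. real (deg E u) * (f u)\<^sup>2)"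
    by (intro sum_mono mult_right_mono sum_edge_ind_le_deg W) simp
  then have "(1 / l) * (\<Sum>u\<in>W. (\<Sum>v\<in>W. edge_ind u v) * (f u)\<^sup>2) \<le> (1 / l) * (\<Sum>u\<in>W. real (deg E u) * (f u)\<^sup>2)"
    using l by (intro mult_left_mono) auto
  then show ?thesis using quad_bound[OF l W, of f] by linarith
qed

lemma lap_eq: "v \<in> V \<Longrightarrow> lap V E \<phi> v = of_nat (deg E v) * \<phi> v - (\<Sum>w\<in>nb v. \<phi> w)"
  by (simp add: lap_def nb_def[symmetric] sum_subtractf card_nb)

lemma lap_delta:
  assumes v: "v \<in> V"
  shows "lap V E (delta v c) = (\<lambda>x. if x = v then of_nat (deg E v) * c else if x \<in> nb v then - c else 0)"
proof
  fix x
  have "(\<Sum>w\<in>nb x. delta v c w) = (if v \<in> nb x then c else 0)" using finite_nb by (simp add: delta_def)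
  then show "lap V E (delta v c) x = (if x = v then of_nat (deg E v) * c else if x \<in> nb v then - c else 0)"
    using v nb_irrefl[of v] nb_sym[of x v] nb_in[of x v] lap_eq[of x "delta v c"] by (cases "x \<in> V") (auto simp: delta_def lap_def)
qed

end

section \<open>The self-adjoint Laplacian on its domain\<close>

locale sa_laplacian = plane_net +
  fixes D :: "(complex \<Rightarrow> complex) set" and A
  assumes laplacian: "laplacian_sa V E D A"
begin

sublocale sa_op "\<lambda>_. 1" V D A
  by unfold_locales (use laplacian in \<open>auto simp: laplacian_sa_def\<close>)

lemma core: "\<phi> \<in> fin_supp V \<Longrightarrow> \<phi> \<in> D" and A_core: "\<phi> \<in> fin_supp V \<Longrightarrow> A \<phi> = lap V E \<phi>"
  using laplacian by (auto simp: laplacian_sa_def)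

lemma app_J: "\<phi> \<in> ell2 (\<lambda>_. 1) V \<Longrightarrow> l2app (J \<phi>) x = \<phi> x"
  by (simp add: l2app_J) (simp add: ell2_def)

text \<open>Moves the operator from the point mass to an arbitrary square summable
  \<open>\<phi>\<close>, where it acts as the formal Laplacian.\<close>

lemma inner_A_delta:
  assumes v: "v \<in> V" and p: "\<phi> \<in> ell2 (\<lambda>_. 1) V"
  shows "inner (J \<phi>) (J (A (delta v c))) = inner (lap V E \<phi> v) c"
proof -
  have d: "delta v c \<in> fin_supp V" by (rule delta_fin_supp[OF v])
  have "inner (J \<phi>) (J (A (delta v c))) = (\<Sum>x\<in>insert v (nb v). 1 * inner (\<phi> x) (A (delta v c) x))"
  proof (rule inner_finite[OF p A_ell2[OF core[OF d]]])
    show "insert v (nb v) \<subseteq> V" using v nb_in by blast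
    show "A (delta v c) x = 0" if "x \<notin> insert v (nb v)" for x
      unfolding A_core[OF d] lap_delta[OF v] using that by simp
  qed (simp add: finite_nb)
  also have "\<dots> = inner (\<phi> v) (of_nat (deg E v) * c) + (\<Sum>x\<in>nb v. inner (\<phi> x) (- c))"
    unfolding A_core[OF d] lap_delta[OF v] using finite_nb nb_irrefl[of v] by (auto intro!: sum.cong)
  also have "inner (\<phi> v) (of_nat (deg E v) * c) = inner (of_nat (deg E v) * \<phi> v) c"
    by (simp add: inner_complex_def)
  finally show ?thesis by (simp add: lap_eq[OF v] inner_diff_left inner_sum_left sum_negf)
qed

text \<open>The extension is not explicit on \<open>D\<close>; testing against point masses and
  using symmetry identifies its values.\<close>

lemma A_eq_lap:
  assumes p: "\<phi> \<in> D" and v: "v \<in> V"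
  shows "A \<phi> v = lap V E \<phi> v"
proof -
  let ?c = "A \<phi> v - lap V E \<phi> v"
  have d: "delta v ?c \<in> fin_supp V" by (rule delta_fin_supp[OF v])
  have "inner (A \<phi> v) ?c = inner (J (A \<phi>)) (J (delta v ?c))" using inner_delta[OF A_ell2[OF p] v] by simp
  also have "\<dots> = inner (J \<phi>) (J (A (delta v ?c)))" by (rule A_sym[OF p core[OF d]])
  also have "\<dots> = inner (lap V E \<phi> v) ?c" by (rule inner_A_delta[OF v D_ell2[OF p]])
  finally have "inner ?c ?c = 0" by (simp add: inner_diff_left)
  then show ?thesis by simp
qed

text \<open>Essential self-adjointness: at a vertex where \<open>|\<phi>|\<close> is maximal the equation is violated.\<close>

lemma lap_plus_one_injective:
  assumes p: "\<phi> \<in> ell2 (\<lambda>_. 1) V" and eq: "\<And>v. v \<in> V \<Longrightarrow> lap V E \<phi> v + \<phi> v = 0"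
  shows "\<phi> = (\<lambda>_. 0)"
proof (rule ccontr)
  assume "\<phi> \<noteq> (\<lambda>_. 0)"
  then obtain v0 where v0: "\<phi> v0 \<noteq> 0" by blast
  \<comment> \<open>Square summability makes this set finite, so the maximum of the absolute value
    over \<open>V\<close> is attained.\<close>
  define X where "X = {v\<in>V. cmod (\<phi> v0) \<le> cmod (\<phi> v)}"
  have v0X: "v0 \<in> X" using v0 p by (auto simp: X_def ell2_def)
  have c: "0 < (cmod (\<phi> v0))\<^sup>2" using v0 by simp
  have fX: "finite X"
  proof (rule ccontr)
    assume iX: "infinite X"
    define n where "n = nat \<lceil>(norm (J \<phi>))\<^sup>2 / (cmod (\<phi> v0))\<^sup>2\<rceil> + 1"
    obtain Y where Y: "Y \<subseteq> X" "finite Y" "card Y = n" using infinite_arbitrarily_large[OF iX] by blast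
    have "real n * (cmod (\<phi> v0))\<^sup>2 = (\<Sum>y\<in>Y. (cmod (\<phi> v0))\<^sup>2)" using Y by simp
    also have "\<dots> \<le> (\<Sum>y\<in>Y. (cmod (l2app (J \<phi>) y))\<^sup>2)"
      by (rule sum_mono) (use Y(1) in \<open>auto simp: app_J[OF p] X_def intro!: power_mono\<close>)
    also have "\<dots> \<le> (norm (J \<phi>))\<^sup>2" by (rule l2_finite_le[OF Y(2)])
    finally have "real n \<le> (norm (J \<phi>))\<^sup>2 / (cmod (\<phi> v0))\<^sup>2" using c by (simp add: field_simps)
    then show False unfolding n_def by linarith
  qed
  define M where "M = Max ((\<lambda>v. cmod (\<phi> v)) ` X)"
  have "M \<in> (\<lambda>v. cmod (\<phi> v)) ` X" unfolding M_def by (rule Max_in) (use fX v0X in auto)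
  then obtain v where v: "v \<in> X" "M = cmod (\<phi> v)" by blast
  have Mge: "cmod (\<phi> w) \<le> M" if "w \<in> X" for w unfolding M_def by (rule Max_ge) (use fX that in auto)
  have M0: "0 < M" using Mge[OF v0X] v0 by (meson less_le_trans zero_less_norm_iff)
  have all: "cmod (\<phi> w) \<le> M" if "w \<in> V" for w
    using Mge[of w] Mge[OF v0X] that by (cases "w \<in> X") (auto simp: X_def)
  have vV: "v \<in> V" using v(1) by (simp add: X_def)
  have "(of_nat (deg E v) + 1) * \<phi> v = (\<Sum>w\<in>nb v. \<phi> w)" using eq[OF vV] lap_eq[OF vV, of \<phi>] by (simp add: algebra_simps)
  then have "cmod ((of_nat (deg E v) + 1) * \<phi> v) = cmod (\<Sum>w\<in>nb v. \<phi> w)" by simp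
  moreover have "cmod ((of_nat (deg E v) + 1) * \<phi> v) = (real (deg E v) + 1) * M"
    unfolding norm_mult v(2) by (metis norm_of_nat of_nat_Suc add.commute)
  moreover have "cmod (\<Sum>w\<in>nb v. \<phi> w) \<le> (\<Sum>w\<in>nb v. M)"
    by (rule order_trans[OF norm_sum sum_mono]) (use all nb_in in blast)
  moreover have "(\<Sum>w\<in>nb v. M) = real (deg E v) * M" by (simp add: card_nb)
  ultimately have "(real (deg E v) + 1) * M \<le> real (deg E v) * M" by linarith
  then show False using M0 by (simp add: algebra_simps)
qed

text \<open>The mixed terms are replaced by their absolute values. \<open>W\<close> may exceed the
  support, since the additional terms vanish.\<close>

lemma form_lower:
  assumes f: "\<phi> \<in> fin_supp V" and W: "finite W" "W \<subseteq> V" "\<And>x. x \<notin> W \<Longrightarrow> \<phi> x = 0"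
  shows "(\<Sum>x\<in>W. real (deg E x) * (cmod (\<phi> x))\<^sup>2) - (\<Sum>x\<in>W. \<Sum>w\<in>W. edge_ind x w * (cmod (\<phi> x) * cmod (\<phi> w))) \<le> inner (J (A \<phi>)) (J \<phi>)"
proof -
  have p: "\<phi> \<in> ell2 (\<lambda>_. 1) V" by (rule fin_supp_ell2[OF f])
  have "inner (J (A \<phi>)) (J \<phi>) = (\<Sum>x\<in>W. 1 * inner (A \<phi> x) (\<phi> x))"
    by (rule inner_finite[OF A_ell2[OF core[OF f]] p W])
  moreover have "real (deg E x) * (cmod (\<phi> x))\<^sup>2 - (\<Sum>w\<in>W. edge_ind x w * (cmod (\<phi> x) * cmod (\<phi> w))) \<le> inner (A \<phi> x) (\<phi> x)" if x: "x \<in> W" for x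
  proof -
    have xV: "x \<in> V" using x W(2) by blast
    have "inner (\<Sum>w\<in>nb x. \<phi> w) (\<phi> x) = (\<Sum>w\<in>nb x. inner (\<phi> w) (\<phi> x))" by (rule inner_sum_left)
    also have "\<dots> \<le> (\<Sum>w\<in>nb x. cmod (\<phi> x) * cmod (\<phi> w))"
      by (rule sum_mono) (metis mult.commute norm_cauchy_schwarz)
    also have "\<dots> = (\<Sum>w\<in>nb x \<union> W. edge_ind x w * (cmod (\<phi> x) * cmod (\<phi> w)))" by (rule sum_nb) (use finite_nb W in auto)
    also have "\<dots> = (\<Sum>w\<in>W. edge_ind x w * (cmod (\<phi> x) * cmod (\<phi> w)))"
      by (rule sum.mono_neutral_right) (use finite_nb W in auto)
    finally have "inner (\<Sum>w\<in>nb x. \<phi> w) (\<phi> x) \<le> (\<Sum>w\<in>W. edge_ind x w * (cmod (\<phi> x) * cmod (\<phi> w)))" .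
    moreover have "inner (of_nat (deg E x) * \<phi> x) (\<phi> x) = real (deg E x) * (cmod (\<phi> x))\<^sup>2"
      by (simp add: inner_complex_def cmod_power2) (simp add: power2_eq_square algebra_simps)
    ultimately show ?thesis unfolding A_core[OF f] lap_eq[OF xV] inner_diff_left by linarith
  qed
  ultimately show ?thesis by (simp add: sum_subtractf[symmetric] sum_mono)
qed

lemma form_nonneg:
  assumes f: "\<phi> \<in> fin_supp V"
  shows "0 \<le> inner (J (A \<phi>)) (J \<phi>)"
proof -
  let ?W = "{x. \<phi> x \<noteq> 0}"
  have W: "finite ?W" "?W \<subseteq> V" using f by (auto simp: fin_supp_def)
  have "(\<Sum>x\<in>?W. \<Sum>w\<in>?W. edge_ind x w * (cmod (\<phi> x) * cmod (\<phi> w))) \<le> (\<Sum>x\<in>?W. \<Sum>w\<in>?W. edge_ind x w * ((cmod (\<phi> x))\<^sup>2 / 2 + (cmod (\<phi> w))\<^sup>2 / 2))"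
  proof (intro sum_mono mult_left_mono edge_ind_nonneg)
    fix x w show "cmod (\<phi> x) * cmod (\<phi> w) \<le> (cmod (\<phi> x))\<^sup>2 / 2 + (cmod (\<phi> w))\<^sup>2 / 2"
      using sum_squares_bound[of "cmod (\<phi> x)" "cmod (\<phi> w)"] by simp
  qed
  also have "\<dots> = (\<Sum>x\<in>?W. \<Sum>w\<in>?W. edge_ind x w * ((cmod (\<phi> x))\<^sup>2 / 2)) + (\<Sum>x\<in>?W. \<Sum>w\<in>?W. edge_ind x w * ((cmod (\<phi> w))\<^sup>2 / 2))"
    by (simp add: distrib_left sum.distrib)
  also have "(\<Sum>x\<in>?W. \<Sum>w\<in>?W. edge_ind x w * ((cmod (\<phi> w))\<^sup>2 / 2)) = (\<Sum>w\<in>?W. \<Sum>x\<in>?W. edge_ind w x * ((cmod (\<phi> w))\<^sup>2 / 2))"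
    by (subst sum.swap) (simp add: edge_ind_sym)
  also have "(\<Sum>x\<in>?W. \<Sum>w\<in>?W. edge_ind x w * ((cmod (\<phi> x))\<^sup>2 / 2)) + (\<Sum>w\<in>?W. \<Sum>x\<in>?W. edge_ind w x * ((cmod (\<phi> w))\<^sup>2 / 2)) =
      (\<Sum>x\<in>?W. (\<Sum>w\<in>?W. edge_ind x w) * (cmod (\<phi> x))\<^sup>2)"
    by (simp add: sum_distrib_right[symmetric] sum.distrib[symmetric])
  also have "\<dots> \<le> (\<Sum>x\<in>?W. real (deg E x) * (cmod (\<phi> x))\<^sup>2)"
    by (intro sum_mono mult_right_mono sum_edge_ind_le_deg W) simp
  finally show ?thesis using form_lower[OF f W] by simp
qed

text \<open>\<open>quad_bound_deg\<close> with \<open>l = 2\<close> costs half of the degree sum and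
  \<open>10 * (norm (J \<phi>))\<^sup>2\<close>; absorbing the half doubles the rest.\<close>

lemma form_deg:
  assumes f: "\<phi> \<in> fin_supp V" and F: "finite F" "F \<subseteq> V"
  shows "(\<Sum>x\<in>F. real (deg E x) * (cmod (\<phi> x))\<^sup>2) \<le> 2 * inner (J (A \<phi>)) (J \<phi>) + 20 * (norm (J \<phi>))\<^sup>2"
proof -
  let ?W = "{x. \<phi> x \<noteq> 0} \<union> F"
  have W: "finite ?W" "?W \<subseteq> V" using f F by (auto simp: fin_supp_def)
  have p: "\<phi> \<in> ell2 (\<lambda>_. 1) V" by (rule fin_supp_ell2[OF f])
  have "(\<Sum>x\<in>F. real (deg E x) * (cmod (\<phi> x))\<^sup>2) \<le> (\<Sum>x\<in>?W. real (deg E x) * (cmod (\<phi> x))\<^sup>2)"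
    by (rule sum_mono2[OF W(1)]) auto
  moreover have "(\<Sum>x\<in>?W. real (deg E x) * (cmod (\<phi> x))\<^sup>2) - (\<Sum>x\<in>?W. \<Sum>w\<in>?W. edge_ind x w * (cmod (\<phi> x) * cmod (\<phi> w))) \<le> inner (J (A \<phi>)) (J \<phi>)"
    by (rule form_lower[OF f W]) auto
  moreover have "(\<Sum>x\<in>?W. \<Sum>w\<in>?W. edge_ind x w * (cmod (\<phi> x) * cmod (\<phi> w))) \<le>
     5 * 2 * (\<Sum>u\<in>?W. (cmod (\<phi> u))\<^sup>2) + (1 / 2) * (\<Sum>u\<in>?W. real (deg E u) * (cmod (\<phi> u))\<^sup>2)"
    by (rule quad_bound_deg[OF _ W]) simp
  moreover have "(\<Sum>u\<in>?W. (cmod (\<phi> u))\<^sup>2) \<le> (norm (J \<phi>))\<^sup>2" using l2_finite_le[OF W(1), of "J \<phi>"] by (simp add: app_J[OF p])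
  ultimately show ?thesis by linarith
qed

text \<open>Finitely supported functions form a core. By \<open>lap_plus_one_injective\<close> their
  images under \<open>A + 1\<close> are dense, and nonnegativity of the form makes
  \<open>A + 1\<close> norm-increasing on them, so preimages of a convergent sequence converge. The
  limit and \<open>\<phi>\<close> have the same image, hence agree by the same lemma.\<close>

lemma core_approx:
  assumes p: "\<phi> \<in> D"
  obtains f where "\<And>n :: nat. f n \<in> fin_supp V" "(\<lambda>n. J (f n)) \<longlonglongrightarrow> J \<phi>" "(\<lambda>n. J (A (f n))) \<longlonglongrightarrow> J (A \<phi>)"
proof -
  define R where "R = (\<lambda>f. J (A f) + J f) ` fin_supp V"
  have fs_comb: "(\<lambda>x. f x + c * g x) \<in> fin_supp V" if "f \<in> fin_supp V" "g \<in> fin_supp V" for f g and c :: complex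
  proof -
    have "{x. f x + c * g x \<noteq> 0} \<subseteq> {x. f x \<noteq> 0} \<union> {x. g x \<noteq> 0}" by auto
    then show ?thesis using that unfolding fin_supp_def by (auto intro: finite_subset)
  qed
  have J_comb: "J (A (\<lambda>x. f x + c * g x)) + J (\<lambda>x. f x + c * g x) = (J (A f) + J f) + scC c (J (A g) + J g)"
    if "f \<in> fin_supp V" "g \<in> fin_supp V" for f g and c :: complex
  proof -
    note fg = core[OF that(1)] core[OF that(2)]
    show ?thesis unfolding A_comb[OF fg] ell2_comb(2)[OF D_ell2[OF fg(1)] D_ell2[OF fg(2)]] ell2_comb(2)[OF A_ell2[OF fg(1)] A_ell2[OF fg(2)]]
      by (rule l2_eqI) (simp add: algebra_simps)
  qed
  have zero: "(\<lambda>_. 0) \<in> fin_supp V" by (simp add: fin_supp_def)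
  have sR: "subspace R"
  proof (rule subspaceI)
    show "0 \<in> R" unfolding R_def by (rule image_eqI[OF _ zero]) (simp add: A_zero J_zero)
    show "a + b \<in> R" if ab: "a \<in> R" "b \<in> R" for a b
    proof -
      obtain f g where fg: "f \<in> fin_supp V" "g \<in> fin_supp V" "a = J (A f) + J f" "b = J (A g) + J g" using ab unfolding R_def by blast
      have "a + b = J (A (\<lambda>x. f x + 1 * g x)) + J (\<lambda>x. f x + 1 * g x)"
        unfolding J_comb[OF fg(1,2)] using fg(3,4) scC_of_real[of 1 b] by simp
      then show ?thesis unfolding R_def by (rule image_eqI[OF _ fs_comb[OF fg(1,2)]])
    qed
    show "r *\<^sub>R a \<in> R" if a: "a \<in> R" for r a
    proof -
      obtain f where f: "f \<in> fin_supp V" "a = J (A f) + J f" using a unfolding R_def by blast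
      have "r *\<^sub>R a = J (A (\<lambda>x. 0 + complex_of_real r * f x)) + J (\<lambda>x. 0 + complex_of_real r * f x)"
        unfolding J_comb[OF zero f(1)] using f(2) scC_of_real[of r a] by (simp add: A_zero J_zero)
      then show ?thesis unfolding R_def by (rule image_eqI[OF _ fs_comb[OF zero f(1)]])
    qed
  qed
  have RH: "R \<subseteq> H"
    unfolding R_def H_def using subspace_add[OF subspace_H] A_ell2[OF core] D_ell2[OF core] by (auto simp: H_def)
  have cRH: "closure R \<subseteq> H" by (rule closure_minimal[OF RH closed_H])
  have dense: "H \<subseteq> closure R"
  proof
    fix g assume g: "g \<in> H"
    obtain r where r: "r \<in> closure R" "\<And>y. y \<in> closure R \<Longrightarrow> inner (g - r) y = 0"
      by (rule orthogonal_projection[OF closed_closure subspace_closure[OF sR]]) blast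
    have "g - r \<in> H" using g r(1) cRH subspace_diff[OF subspace_H] by blast
    then obtain \<psi> where ps: "\<psi> \<in> ell2 (\<lambda>_. 1) V" "J \<psi> = g - r" by (rule H_E)
    have "lap V E \<psi> v + \<psi> v = 0" if v: "v \<in> V" for v
    proof -
      let ?c = "lap V E \<psi> v + \<psi> v"
      have "J (A (delta v ?c)) + J (delta v ?c) \<in> closure R"
        using closure_subset[of R] delta_fin_supp[OF v] unfolding R_def by blast
      then have "inner (J \<psi>) (J (A (delta v ?c)) + J (delta v ?c)) = 0" unfolding ps(2) by (rule r(2))
      then have "inner ?c ?c = 0" using inner_A_delta[OF v ps(1)] inner_delta[OF ps(1) v] by (simp add: inner_add_right inner_add_left)
      then show ?thesis by simp
    qed
    then have "\<psi> = (\<lambda>_. 0)" by (rule lap_plus_one_injective[OF ps(1)])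
    then have "g = r" using ps(2) J_zero by simp
    then show "g \<in> closure R" using r(1) by simp
  qed
  have "J (A \<phi>) + J \<phi> \<in> H" using subspace_add[OF subspace_H] A_ell2[OF p] D_ell2[OF p] by (auto simp: H_def)
  then have "J (A \<phi>) + J \<phi> \<in> closure R" using dense by blast
  then obtain y where y: "\<And>n. y n \<in> R" "y \<longlonglongrightarrow> J (A \<phi>) + J \<phi>" unfolding closure_sequential by blast
  have "\<forall>n. \<exists>f. f \<in> fin_supp V \<and> y n = J (A f) + J f" using y(1) unfolding R_def by blast
  then obtain f where f: "\<And>n. f n \<in> fin_supp V" "\<And>n. y n = J (A (f n)) + J (f n)" by metis
  have le: "norm (J (f k) - J (f n)) \<le> norm (y k - y n)" for k n
  proof -
    let ?h = "\<lambda>x. f k x + (-1) * f n x"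
    have h: "?h \<in> fin_supp V" by (rule fs_comb[OF f(1) f(1)])
    have Jh: "J ?h = J (f k) - J (f n)" using ell2_comb(2)[OF D_ell2[OF core[OF f(1)]] D_ell2[OF core[OF f(1)]], of k "-1" n] scC_of_real[of "-1" "J (f n)"] by simp
    have yh: "y k - y n = J (A ?h) + J ?h" unfolding J_comb[OF f(1) f(1)] f(2) using scC_of_real[of "-1" "J (A (f n)) + J (f n)"] by simp
    have "norm (J ?h) * norm (J ?h) \<le> inner (J (A ?h)) (J ?h) + inner (J ?h) (J ?h)"
      using form_nonneg[OF h] by (simp add: dot_square_norm power2_eq_square)
    also have "\<dots> = inner (y k - y n) (J ?h)" unfolding yh by (simp add: inner_add_left)
    also have "\<dots> \<le> norm (y k - y n) * norm (J ?h)" by (rule norm_cauchy_schwarz)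
    finally have "norm (J ?h) \<le> norm (y k - y n) \<or> norm (J ?h) = 0" by (auto simp: mult_le_cancel_right)
    then show ?thesis unfolding Jh by auto
  qed
  have "Cauchy (\<lambda>n. J (f n))"
  proof (rule CauchyI)
    fix e :: real assume e: "0 < e"
    obtain M where M: "\<And>k n. k \<ge> M \<Longrightarrow> n \<ge> M \<Longrightarrow> norm (y k - y n) < e" using CauchyD[OF LIMSEQ_imp_Cauchy[OF y(2)] e] by blast
    have "norm (J (f k) - J (f n)) < e" if "k \<ge> M" "n \<ge> M" for k n using le[of k n] M[OF that] by linarith
    then show "\<exists>M. \<forall>k\<ge>M. \<forall>n\<ge>M. norm (J (f k) - J (f n)) < e" by blast
  qed
  then obtain l where l: "(\<lambda>n. J (f n)) \<longlonglongrightarrow> l" using Cauchy_convergent convergent_def by blast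
  have "(\<lambda>n. y n - J (f n)) \<longlonglongrightarrow> (J (A \<phi>) + J \<phi>) - l" by (intro tendsto_diff y l)
  then have g: "(\<lambda>n. J (A (f n))) \<longlonglongrightarrow> (J (A \<phi>) + J \<phi>) - l" by (simp add: f(2))
  obtain \<psi> where ps: "\<psi> \<in> D" "J \<psi> = l" "J (A \<psi>) = (J (A \<phi>) + J \<phi>) - l" by (rule closed_graph[OF core[OF f(1)] l g])
  let ?d = "\<lambda>x. \<psi> x - \<phi> x"
  have dD: "?d \<in> D" by (rule D_diff[OF ps(1) p])
  have "J (A ?d) + J ?d = 0"
    unfolding A_diff[OF ps(1) p] ell2_diff(2)[OF D_ell2[OF ps(1)] D_ell2[OF p]] ell2_diff(2)[OF A_ell2[OF ps(1)] A_ell2[OF p]]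
    using ps by simp
  then have e0: "l2app (J (A ?d) + J ?d) v = 0" for v by simp
  have "lap V E ?d v + ?d v = 0" if v: "v \<in> V" for v
    using e0[of v] A_eq_lap[OF dD v] by (simp add: app_J A_ell2[OF dD] D_ell2[OF dD])
  then have "?d = (\<lambda>_. 0)" by (rule lap_plus_one_injective[OF D_ell2[OF dD]])
  then have "\<psi> x = \<phi> x" for x by (metis eq_iff_diff_eq_0)
  then have "\<psi> = \<phi>" by blast
  then show ?thesis using that[of f] f(1) l g ps by simp
qed

text \<open>For a finite \<open>F\<close> both sides of \<open>form_deg\<close> pass to the limit in
  the graph norm.\<close>

lemma domain_deg:
  assumes p: "\<phi> \<in> D" and F: "finite F" "F \<subseteq> V"
  shows "(\<Sum>x\<in>F. real (deg E x) * (cmod (\<phi> x))\<^sup>2) \<le> 2 * inner (J (A \<phi>)) (J \<phi>) + 20 * (norm (J \<phi>))\<^sup>2"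
proof -
  obtain f where f: "\<And>n :: nat. f n \<in> fin_supp V" "(\<lambda>n. J (f n)) \<longlonglongrightarrow> J \<phi>" "(\<lambda>n. J (A (f n))) \<longlonglongrightarrow> J (A \<phi>)"
    by (rule core_approx[OF p]) blast
  show ?thesis
  proof (rule LIMSEQ_le)
    have "(\<lambda>n. f n x) \<longlonglongrightarrow> \<phi> x" for x
      using tendsto_l2app[OF f(2), of x] by (simp add: app_J D_ell2[OF p] D_ell2[OF core[OF f(1)]])
    then show "(\<lambda>n. \<Sum>x\<in>F. real (deg E x) * (cmod (f n x))\<^sup>2) \<longlonglongrightarrow> (\<Sum>x\<in>F. real (deg E x) * (cmod (\<phi> x))\<^sup>2)"
      by (intro tendsto_intros)
    show "(\<lambda>n. 2 * inner (J (A (f n))) (J (f n)) + 20 * (norm (J (f n)))\<^sup>2) \<longlonglongrightarrow> 2 * inner (J (A \<phi>)) (J \<phi>) + 20 * (norm (J \<phi>))\<^sup>2"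
      by (intro tendsto_intros f)
    show "\<exists>N. \<forall>n\<ge>N. (\<Sum>x\<in>F. real (deg E x) * (cmod (f n x))\<^sup>2) \<le> 2 * inner (J (A (f n))) (J (f n)) + 20 * (norm (J (f n)))\<^sup>2"
      using form_deg[OF f(1) F] by blast
  qed
qed

text \<open>Bounded approximate eigenvectors have bounded degree sums. As the degrees are at least
  \<open>N\<close> off a finite set, the tails are at most \<open>C / N\<close>, uniformly in
  \<open>n\<close>.\<close>

lemma ess_spectrum_empty:
  assumes dinf: "\<And>N. finite {v\<in>V. deg E v < N}"
  shows "ess_spectrum (\<lambda>_. 1) V D A = {}"
proof -
  have "complex_of_real t \<notin> ess_spectrum (\<lambda>_. 1) V D A" for t
  proof (rule not_in_ess_spectrum)
    fix \<phi> :: "nat \<Rightarrow> complex \<Rightarrow> complex" and s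
    assume \<phi>: "\<And>n. \<phi> n \<in> D" "\<And>n. norm (J (\<phi> n)) \<le> 1" and s: "s \<longlonglongrightarrow> t" "(\<lambda>n. J (A (\<phi> n)) - s n *\<^sub>R J (\<phi> n)) \<longlonglongrightarrow> 0"
    obtain M1 where M1: "\<And>n. norm (s n) \<le> M1" using convergent_imp_Bseq[OF convergentI[OF s(1)]] unfolding Bseq_def by blast
    obtain M2 where M2: "\<And>n. norm (J (A (\<phi> n)) - s n *\<^sub>R J (\<phi> n)) \<le> M2" using convergent_imp_Bseq[OF convergentI[OF s(2)]] unfolding Bseq_def by blast
    \<comment> \<open>\<open>M1 + M2\<close> bounds the images under \<open>A\<close>, hence the
      form; the factors are those of \<open>domain_deg\<close>.\<close>
    define C where "C = 2 * (M1 + M2) + 20"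
    have M1p: "0 \<le> M1" using M1[of 0] norm_ge_zero order_trans by blast
    have M2p: "0 \<le> M2" using M2[of 0] norm_ge_zero order_trans by blast
    have C: "C > 0" using M1p M2p by (simp add: C_def)
    have NA: "norm (J (A (\<phi> n))) \<le> M1 + M2" for n
    proof -
      have "norm (J (A (\<phi> n))) \<le> norm (J (A (\<phi> n)) - s n *\<^sub>R J (\<phi> n)) + norm (s n *\<^sub>R J (\<phi> n))"
        using norm_triangle_ineq[of "J (A (\<phi> n)) - s n *\<^sub>R J (\<phi> n)" "s n *\<^sub>R J (\<phi> n)"] by simp
      also have "norm (s n *\<^sub>R J (\<phi> n)) \<le> M1 * 1" unfolding norm_scaleR
        using M1[of n] \<phi>(2)[of n] M1p by (intro mult_mono) auto
      finally show ?thesis using M2[of n] by simp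
    qed
    have deg: "(\<Sum>x\<in>F. real (deg E x) * (cmod (\<phi> n x))\<^sup>2) \<le> C" if F: "finite F" "F \<subseteq> V" for F n
    proof -
      have "inner (J (A (\<phi> n))) (J (\<phi> n)) \<le> norm (J (A (\<phi> n))) * norm (J (\<phi> n))" by (rule norm_cauchy_schwarz)
      also have "\<dots> \<le> (M1 + M2) * 1" using NA[of n] \<phi>(2)[of n] M1p M2p by (intro mult_mono) auto
      finally have "inner (J (A (\<phi> n))) (J (\<phi> n)) \<le> M1 + M2" by simp
      moreover have "(norm (J (\<phi> n)))\<^sup>2 \<le> 1" using \<phi>(2)[of n] by (simp add: power_le_one)
      ultimately show ?thesis using domain_deg[OF \<phi>(1) F, of n] by (simp add: C_def)
    qed
    obtain r l where "strict_mono (r :: nat \<Rightarrow> nat)" "(\<lambda>n. J (\<phi> (r n))) \<longlonglongrightarrow> l"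
    proof (rule l2_convergent_subsequence[OF countable_V])
      show "l2app (J (\<phi> n)) x = 0" if "x \<notin> V" for n x by (rule J_outside[OF D_ell2[OF \<phi>(1)] that])
      show "norm (J (\<phi> n)) \<le> 1" for n by (rule \<phi>(2))
      fix e :: real assume e: "e > 0"
      define N where "N = nat \<lceil>C / e\<rceil> + 1"
      have N: "C / e \<le> real N" "0 < real N" unfolding N_def by linarith+
      show "\<exists>K. finite K \<and> (\<forall>n W. finite W \<longrightarrow> W \<subseteq> V - K \<longrightarrow> (\<Sum>x\<in>W. (cmod (l2app (J (\<phi> n)) x))\<^sup>2) \<le> e)"
      proof (intro exI[of _ "{v\<in>V. deg E v < N}"] conjI allI impI)
        fix n W assume W: "finite W" "W \<subseteq> V - {v \<in> V. deg E v < N}"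
        have "real N * (\<Sum>x\<in>W. (cmod (l2app (J (\<phi> n)) x))\<^sup>2) = (\<Sum>x\<in>W. real N * (cmod (\<phi> n x))\<^sup>2)"
          by (simp add: sum_distrib_left app_J D_ell2[OF \<phi>(1)])
        also have "\<dots> \<le> (\<Sum>x\<in>W. real (deg E x) * (cmod (\<phi> n x))\<^sup>2)"
          by (intro sum_mono mult_right_mono) (use W(2) in auto)
        also have "\<dots> \<le> C" by (rule deg) (use W in auto)
        also have "C \<le> real N * e" using N(1) e by (simp add: field_simps)
        finally show "(\<Sum>x\<in>W. (cmod (l2app (J (\<phi> n)) x))\<^sup>2) \<le> e" using N(2) by (rule mult_left_le_imp_le)
      qed (rule dinf)
    qed
    then show "\<exists>r l. strict_mono (r :: nat \<Rightarrow> nat) \<and> (\<lambda>n. J (\<phi> (r n))) \<longlonglongrightarrow> l" by blast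
  qed
  then show ?thesis using ess_spectrum_real by (metis all_not_in_conv)
qed

end

section \<open>Existence of essential spectrum\<close>

lemma not_islimpt_ball:
  fixes z :: complex
  assumes "\<not> z islimpt S"
  obtains d where "d > 0" "\<And>y. y \<in> S \<Longrightarrow> y \<noteq> z \<Longrightarrow> d \<le> dist y z"
  using assms unfolding islimpt_approachable by (auto simp: not_less)

context sa_op
begin

lemma eigenspace_iff: "\<phi> \<in> eigenspace_op m V D A (complex_of_real t) \<longleftrightarrow> \<phi> \<in> D \<and> J (A \<phi>) = t *\<^sub>R J \<phi>"
proof -
  have "A \<phi> = (\<lambda>x. complex_of_real t * \<phi> x) \<longleftrightarrow> J (A \<phi>) = t *\<^sub>R J \<phi>" if p: "\<phi> \<in> D"
    using J_inj[OF A_ell2[OF p] ell2_scale(1)[OF D_ell2[OF p]], of "complex_of_real t"]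
      ell2_scale(2)[OF D_ell2[OF p], of "complex_of_real t"] by (auto simp: scC_of_real)
  then show ?thesis by (auto simp: eigenspace_op_def)
qed

text \<open>The lower bound at a resolvent point persists nearby: an approximate eigenvector for
  some \<open>y\<close> within \<open>1 / (2 * K)\<close> of \<open>z\<close> would violate it at
  \<open>z\<close>.\<close>

lemma spectrum_closed:
  assumes z: "z islimpt spectrum_op m V D A"
  shows "z \<in> spectrum_op m V D A"
proof (rule ccontr)
  assume "z \<notin> spectrum_op m V D A"
  then have "z \<in> resolvent_set m V D A" by (simp add: spectrum_op_def)
  then obtain C where C: "\<And>\<phi>. \<phi> \<in> D \<Longrightarrow> nrm m V \<phi> \<le> C * nrm m V (\<lambda>x. A \<phi> x - z * \<phi> x)"
    unfolding resolvent_set_def by blast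
  define K where "K = \<bar>C\<bar> + 1"
  have K: "K > 0" by (simp add: K_def)
  have bb: "norm (J \<phi>) \<le> K * norm (J (A \<phi>) - scC z (J \<phi>))" if p: "\<phi> \<in> D" for \<phi>
  proof -
    have "norm (J \<phi>) \<le> C * norm (J (A \<phi>) - scC z (J \<phi>))"
      using C[OF p] J_shift[OF p, of z] nrm_J D_ell2[OF p] by simp
    also have "\<dots> \<le> K * norm (J (A \<phi>) - scC z (J \<phi>))" by (intro mult_right_mono) (auto simp: K_def)
    finally show ?thesis .
  qed
  have K2: "1 / (2 * K) > 0" using K by simp
  obtain y where y: "y \<in> spectrum_op m V D A" "dist y z < 1 / (2 * K)"
    using z[unfolded islimpt_approachable, rule_format, OF K2] by blast
  obtain \<phi> where p: "\<phi> \<in> D" "norm (J \<phi>) = 1" "norm (J (A \<phi>) - Re y *\<^sub>R J \<phi>) < 1 / (2 * K)"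
    using spectrum_approx(2)[OF y(1) K2] by blast
  have yr: "scC y (J \<phi>) = Re y *\<^sub>R J \<phi>" using spectrum_approx(1)[OF y(1)] scC_of_real by metis
  have e: "J (A \<phi>) - scC z (J \<phi>) = (J (A \<phi>) - Re y *\<^sub>R J \<phi>) + scC (y - z) (J \<phi>)"
    unfolding yr[symmetric] by (rule l2_eqI) (simp add: algebra_simps)
  have "norm (J (A \<phi>) - scC z (J \<phi>)) \<le> norm (J (A \<phi>) - Re y *\<^sub>R J \<phi>) + cmod (y - z) * 1"
    unfolding e using norm_triangle_ineq[of "J (A \<phi>) - Re y *\<^sub>R J \<phi>" "scC (y - z) (J \<phi>)"] p(2) by (simp add: norm_scC)
  also have "\<dots> < 1 / (2 * K) + 1 / (2 * K)" using p(3) y(2) by (simp add: dist_norm)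
  also have "\<dots> = 1 / K" using K by (simp add: field_simps)
  finally have "K * norm (J (A \<phi>) - scC z (J \<phi>)) < 1" using K by (simp add: field_simps)
  then show False using bb[OF p(1)] p(2) by simp
qed

text \<open>If all spectrum were discrete, the resolvent at a real point outside the spectrum would be compact,
  but it maps the bounded sequence \<open>(A - x0) \<psi> n\<close> to the orthonormal-like sequence \<open>\<psi> n\<close>.\<close>

lemma ess_spectrum_nonempty:
  assumes \<psi>: "\<And>n :: nat. \<psi> n \<in> D" "\<And>n. norm (J (\<psi> n)) = 1" "\<And>n. norm (J (A (\<psi> n))) \<le> C"
    and wk: "\<And>y. (\<lambda>n. inner y (J (\<psi> n))) \<longlonglongrightarrow> 0"
  shows "ess_spectrum m V D A \<noteq> {}"
proof
  let ?\<sigma> = "spectrum_op m V D A"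
  assume "ess_spectrum m V D A = {}"
  then have disc: "\<not> z islimpt ?\<sigma>" "finite_dim_fs (eigenspace_op m V D A z)" if "z \<in> ?\<sigma>" for z
    using that by (auto simp: ess_spectrum_def discrete_spectrum_def)
  have nolim: "\<not> z islimpt ?\<sigma>" for z using spectrum_closed[of z] disc(1) by blast
  obtain d0 where d0: "d0 > 0" "\<And>y. y \<in> ?\<sigma> \<Longrightarrow> y \<noteq> 0 \<Longrightarrow> d0 \<le> dist y 0" by (rule not_islimpt_ball[OF nolim[of 0]]) blast
  \<comment> \<open>The spectrum has no limit point, so a punctured disc around 0 is free of it;
    half of its radius is a real point of the resolvent set.\<close>
  define x0 where "x0 = d0 / 2"
  have x0: "complex_of_real x0 \<notin> ?\<sigma>" using d0(2)[of "complex_of_real x0"] d0(1) by (auto simp: x0_def)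
  then have res: "complex_of_real x0 \<in> resolvent_set m V D A" by (simp add: spectrum_op_def)
  define B where "B \<phi> = J (A \<phi>) - x0 *\<^sub>R J \<phi>" for \<phi>
  have JB: "J (\<lambda>x. A \<phi> x - complex_of_real x0 * \<phi> x) = B \<phi>" "(\<lambda>x. A \<phi> x - complex_of_real x0 * \<phi> x) \<in> ell2 m V" if "\<phi> \<in> D" for \<phi>
    using J_shift[OF that, of "complex_of_real x0"] by (simp_all add: B_def scC_of_real)
  obtain C0 where C0: "\<And>\<phi>. \<phi> \<in> D \<Longrightarrow> nrm m V \<phi> \<le> C0 * nrm m V (\<lambda>x. A \<phi> x - complex_of_real x0 * \<phi> x)"
    using res unfolding resolvent_set_def by blast
  define K where "K = \<bar>C0\<bar> + 1"
  have K: "K > 0" by (simp add: K_def)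
  have Bb: "norm (J \<phi>) \<le> K * norm (B \<phi>)" if p: "\<phi> \<in> D" for \<phi>
  proof -
    have "norm (J \<phi>) \<le> C0 * norm (B \<phi>)" using C0[OF p] JB[OF p] nrm_J D_ell2[OF p] by simp
    also have "\<dots> \<le> K * norm (B \<phi>)" by (intro mult_right_mono) (auto simp: K_def)
    finally show ?thesis .
  qed
  have B_comb: "B (\<lambda>x. \<phi> x + complex_of_real c * \<theta> x) = B \<phi> + c *\<^sub>R B \<theta>" if "\<phi> \<in> D" "\<theta> \<in> D" for \<phi> \<theta> c
    unfolding B_def A_comb[OF that] ell2_comb(2)[OF D_ell2[OF that(1)] D_ell2[OF that(2)]] ell2_comb(2)[OF A_ell2[OF that(1)] A_ell2[OF that(2)]]
    by (simp add: scC_of_real algebra_simps)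
  have J_comb: "J (\<lambda>x. \<phi> x + complex_of_real c * \<theta> x) = J \<phi> + c *\<^sub>R J \<theta>" if "\<phi> \<in> D" "\<theta> \<in> D" for \<phi> \<theta> c
    using ell2_comb(2)[OF D_ell2[OF that(1)] D_ell2[OF that(2)]] by (simp add: scC_of_real)
  have ex: "\<exists>\<phi>\<in>D. B \<phi> = f" if f: "f \<in> H" for f
  proof -
    obtain \<eta> where n: "\<eta> \<in> ell2 m V" "J \<eta> = f" using f by (rule H_E)
    then obtain \<phi> where "\<phi> \<in> D" "(\<lambda>x. A \<phi> x - complex_of_real x0 * \<phi> x) = \<eta>" using res unfolding resolvent_set_def by blast
    then show ?thesis using JB n(2) by auto
  qed
  define R where "R f = (SOME \<phi>. \<phi> \<in> D \<and> B \<phi> = f)" for f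
  have R: "R f \<in> D" "B (R f) = f" if "f \<in> H" for f
    using someI_ex[of "\<lambda>\<phi>. \<phi> \<in> D \<and> B \<phi> = f"] ex[OF that] unfolding R_def by blast+
  have uniq: "J \<phi> = J \<theta>" if "\<phi> \<in> D" "\<theta> \<in> D" "B \<phi> = B \<theta>" for \<phi> \<theta>
  proof -
    let ?h = "\<lambda>x. \<phi> x + complex_of_real (-1) * \<theta> x"
    have "norm (J ?h) \<le> K * norm (B ?h)" by (rule Bb[OF D_comb[OF that(1,2)]])
    then show ?thesis unfolding B_comb[OF that(1,2)] J_comb[OF that(1,2)] using that(3) by simp
  qed
  \<comment> \<open>The resolvent at \<open>x0\<close>, carried over to \<open>l2\<close>; it is
    bounded by \<open>K\<close> and inherits its symmetry from \<open>A - x0\<close>.\<close>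
  define T where "T f = J (R f)" for f
  have TB: "T (B \<phi>) = J \<phi>" if p: "\<phi> \<in> D" for \<phi>
  proof -
    have "B \<phi> \<in> H" unfolding JB(1)[OF p, symmetric] H_def using JB(2)[OF p] by (rule imageI)
    from R[OF this] show ?thesis unfolding T_def using uniq[OF _ p] by blast
  qed
  have BH: "B \<phi> \<in> H" if p: "\<phi> \<in> D" for \<phi>
    unfolding JB(1)[OF p, symmetric] H_def using JB(2)[OF p] by (rule imageI)
  interpret T: bounded_symmetric H T K
  proof unfold_locales
    show "subspace H" "closed H" by (rule subspace_H, rule closed_H)
    fix f g assume f: "f \<in> H"
    show "T f \<in> H" unfolding T_def H_def using D_ell2[OF R(1)[OF f]] by (rule imageI)
    have zero: "B (\<lambda>_. 0) = 0" by (simp add: B_def A_zero J_zero)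
    show "T (c *\<^sub>R f) = c *\<^sub>R T f" for c
    proof -
      have "c *\<^sub>R f = B (\<lambda>x. 0 + complex_of_real c * R f x)"
        unfolding B_comb[OF D_zero R(1)[OF f]] R(2)[OF f] zero by simp
      then have "T (c *\<^sub>R f) = J (\<lambda>x. 0 + complex_of_real c * R f x)" using TB[OF D_comb[OF D_zero R(1)[OF f]]] by simp
      then show ?thesis unfolding J_comb[OF D_zero R(1)[OF f]] by (simp add: J_zero T_def)
    qed
    show "norm (T f) \<le> K * norm f" using Bb[OF R(1)[OF f]] R(2)[OF f] by (simp add: T_def)
    assume g: "g \<in> H"
    show "T (f + g) = T f + T g"
    proof -
      have "f + g = B (\<lambda>x. R f x + complex_of_real 1 * R g x)"
        unfolding B_comb[OF R(1)[OF f] R(1)[OF g]] R(2)[OF f] R(2)[OF g] by simp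
      then have "T (f + g) = J (\<lambda>x. R f x + complex_of_real 1 * R g x)" by (simp only: TB[OF D_comb[OF R(1)[OF f] R(1)[OF g]]])
      then show ?thesis unfolding J_comb[OF R(1)[OF f] R(1)[OF g]] by (simp add: T_def)
    qed
    have "inner (J (R f)) (B (R g)) = inner (B (R f)) (J (R g))"
      using A_sym[OF R(1)[OF f] R(1)[OF g]] by (simp add: B_def inner_diff_left inner_diff_right)
    then show "inner (T f) g = inner f (T g)" using R(2)[OF f] R(2)[OF g] by (simp add: T_def)
  qed (rule K)
  \<comment> \<open>Spectral mapping: if \<open>f\<close> is an approximate eigenvector of
    \<open>T\<close> for \<open>l\<close>, then \<open>R f\<close> is one of \<open>A\<close> for
    \<open>x0 + 1 / l\<close>.\<close>
  have T_spec: "complex_of_real (x0 + 1 / l) \<in> ?\<sigma>" if l: "l \<noteq> 0" and nb: "\<not> bdd_below_op H (\<lambda>f. T f - l *\<^sub>R f)" for l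
  proof (rule approx_spectrum)
    fix c :: real assume c: "c > 0"
    \<comment> \<open>The first bound keeps \<open>norm (T f)\<close> at least
      \<open>\<bar>l\<bar> / 2 * norm f\<close>, the second turns the error into
      \<open>c\<close>.\<close>
    define c' where "c' = min (\<bar>l\<bar> / 2) (c * l\<^sup>2 / 2)"
    have c': "c' > 0" "c' \<le> \<bar>l\<bar> / 2" "c' \<le> c * l\<^sup>2 / 2" using c l by (auto simp: c'_def)
    obtain f where f: "f \<in> H" "norm (T f - l *\<^sub>R f) < c' * norm f" using nb c'(1) unfolding bdd_below_op_def by (meson not_less)
    have nf: "0 < norm f" using f(2) c'(1) norm_ge_zero by (metis le_less_trans mult_zero_right norm_zero not_less_iff_gr_or_eq zero_less_norm_iff)
    let ?\<phi> = "R f"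
    have "J (A ?\<phi>) - (x0 + 1 / l) *\<^sub>R J ?\<phi> = B ?\<phi> - (1 / l) *\<^sub>R J ?\<phi>" by (simp add: B_def algebra_simps)
    also have "\<dots> = (- 1 / l) *\<^sub>R (T f - l *\<^sub>R f)" using l R(2)[OF f(1)] by (simp add: T_def algebra_simps)
    finally have "norm (J (A ?\<phi>) - (x0 + 1 / l) *\<^sub>R J ?\<phi>) = norm (T f - l *\<^sub>R f) / \<bar>l\<bar>" by simp
    also have "\<dots> < c' * norm f / \<bar>l\<bar>" using f(2) l by (simp add: divide_strict_right_mono)
    finally have 1: "norm (J (A ?\<phi>) - (x0 + 1 / l) *\<^sub>R J ?\<phi>) < c' * norm f / \<bar>l\<bar>" .
    have "\<bar>l\<bar> * norm f - norm (T f) \<le> norm (T f - l *\<^sub>R f)" using norm_triangle_ineq3[of "T f" "l *\<^sub>R f"] by simp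
    also have "\<dots> \<le> \<bar>l\<bar> / 2 * norm f" using f(2) mult_right_mono[OF c'(2), of "norm f"] by simp
    finally have 2: "\<bar>l\<bar> / 2 * norm f \<le> norm (J ?\<phi>)" by (simp add: T_def field_simps)
    have "c' * norm f / \<bar>l\<bar> \<le> (c * l\<^sup>2 / 2) * norm f / \<bar>l\<bar>" using c'(3) by (intro divide_right_mono mult_right_mono) auto
    also have "\<dots> = c * (\<bar>l\<bar> / 2 * norm f)" using l by (simp add: power2_eq_square field_simps abs_if)
    also have "\<dots> \<le> c * norm (J ?\<phi>)" using 2 c by (intro mult_left_mono) auto
    finally show "\<exists>\<phi>\<in>D. norm (J (A \<phi>) - (x0 + 1 / l) *\<^sub>R J \<phi>) < c * norm (J \<phi>)"
      using 1 R(1)[OF f(1)] by (intro bexI[of _ ?\<phi>]) auto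
  qed
  define C1 where "C1 = \<bar>C\<bar> + \<bar>x0\<bar> + 1"
  have C1: "C1 > 0" by (simp add: C1_def)
  have gb: "norm (B (\<psi> n)) \<le> C1" for n
  proof -
    have "norm (B (\<psi> n)) \<le> norm (J (A (\<psi> n))) + norm (x0 *\<^sub>R J (\<psi> n))" unfolding B_def by (rule norm_triangle_ineq4)
    then show ?thesis using \<psi>(2,3)[of n] by (simp add: C1_def)
  qed
  \<comment> \<open>Values of \<open>T\<close> above \<open>r\<close> in modulus belong to spectral
    points within \<open>1 / r\<close> of \<open>x0\<close>. The factor 2 will give
    \<open>r * C1 = 1/2\<close>.\<close>
  define r where "r = 1 / (2 * C1)"
  have r: "r > 0" using C1 by (simp add: r_def)
  define X where "X = {z \<in> ?\<sigma>. dist z (complex_of_real x0) \<le> 1 / r}"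
  have fX: "finite X"
  proof (rule ccontr)
    assume iX: "infinite X"
    have "bounded X" by (rule bounded_subset[OF bounded_cball[of "complex_of_real x0" "1 / r"]]) (auto simp: X_def dist_commute)
    then obtain z where "z islimpt X" using bounded_infinite_imp_islimpt[of X X] iX by auto
    then have "z islimpt ?\<sigma>" by (rule islimpt_subset) (auto simp: X_def)
    then show False using nolim by blast
  qed
  define EV where "EV = (\<Union>z\<in>X. J ` eigenspace_op m V D A z)"
  have "\<forall>z\<in>X. \<exists>F. finite F \<and> F \<subseteq> H \<and> J ` eigenspace_op m V D A z \<subseteq> span F"
  proof
    fix z assume "z \<in> X"
    then have "finite_dim_fs (eigenspace_op m V D A z)" using disc(2) by (simp add: X_def)
    moreover have "eigenspace_op m V D A z \<subseteq> ell2 m V" using D_ell2 by (auto simp: eigenspace_op_def)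
    ultimately show "\<exists>F. finite F \<and> F \<subseteq> H \<and> J ` eigenspace_op m V D A z \<subseteq> span F" by (metis finite_dim_real_span)
  qed
  then obtain FF where FF: "\<And>z. z \<in> X \<Longrightarrow> finite (FF z) \<and> FF z \<subseteq> H \<and> J ` eigenspace_op m V D A z \<subseteq> span (FF z)" by metis
  define F where "F = (\<Union>z\<in>X. FF z)"
  have F: "finite F" "F \<subseteq> H" using FF fX by (auto simp: F_def)
  have EVF: "EV \<subseteq> span F"
  proof -
    have "J ` eigenspace_op m V D A z \<subseteq> span F" if z: "z \<in> X" for z
      using FF[OF z] span_mono[of "FF z" F] z unfolding F_def by blast
    then show ?thesis by (auto simp: EV_def)
  qed
  \<comment> \<open>The complement of the eigenvectors for the finitely many spectral points in
    \<open>X\<close>; on it the resolvent has norm at most \<open>r\<close>.\<close>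
  define N where "N = {f\<in>H. \<forall>y\<in>EV. inner f y = 0}"
  have EVT: "T y \<in> EV \<or> T y = 0 \<or> (\<exists>c. T y = c *\<^sub>R y)" if yE: "y \<in> EV" for y
  proof -
    obtain z \<phi> where z: "z \<in> X" "\<phi> \<in> eigenspace_op m V D A z" "y = J \<phi>" using yE unfolding EV_def by blast
    define t where "t = Re z"
    have zt: "z = complex_of_real t" using spectrum_approx(1)[of z] z(1) by (simp add: X_def t_def)
    have p: "\<phi> \<in> D" "J (A \<phi>) = t *\<^sub>R J \<phi>" using z(2) unfolding zt eigenspace_iff by auto
    have tx: "t - x0 \<noteq> 0" using x0 z(1) zt by (auto simp: X_def)
    have Bp: "B \<phi> = (t - x0) *\<^sub>R y" unfolding B_def p(2) z(3) by (simp add: algebra_simps)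
    have yH: "y \<in> H" unfolding z(3) H_def using D_ell2[OF p(1)] by (rule imageI)
    have "y = (t - x0) *\<^sub>R T y" using TB[OF p(1)] T.scale[OF yH, of "t - x0"] unfolding Bp z(3) by simp
    then have "T y = (1 / (t - x0)) *\<^sub>R y" using tx by (metis divideR_right divide_inverse inverse_eq_divide mult_1 scaleR_scaleR)
    then show ?thesis by blast
  qed
  have sN: "subspace N" unfolding N_def subspace_def using subspace_H by (auto simp: subspace_def inner_add_left)
  have cN: "closed N"
  proof -
    have "N = H \<inter> (\<Inter>y\<in>EV. {f. inner f y = 0})" by (auto simp: N_def)
    moreover have "closed {f. inner f y = 0}" for y :: "complex l2" by (intro closed_Collect_eq continuous_intros)
    ultimately show ?thesis using closed_H by auto
  qed
  interpret N: bounded_symmetric N T K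
  proof unfold_locales
    show "T f \<in> N" if f: "f \<in> N" for f
    proof -
      have fH: "f \<in> H" using f by (simp add: N_def)
      have "inner (T f) y = 0" if y: "y \<in> EV" for y
      proof -
        have yH: "y \<in> H" using y D_ell2 by (auto simp: EV_def H_def eigenspace_op_def)
        have "inner (T f) y = inner f (T y)" by (rule T.symm[OF fH yH])
        then show ?thesis using EVT[OF y] f y by (auto simp: N_def)
      qed
      then show ?thesis using T.maps[OF fH] by (simp add: N_def)
    qed
  qed (use sN cN T.add T.scale T.bound T.symm K in \<open>auto simp: N_def\<close>)
  \<comment> \<open>A larger norm would give an approximate eigenvalue \<open>l\<close> of
    \<open>T\<close> on \<open>N\<close> with \<open>r < \<bar>l\<bar>\<close>. Then
    \<open>x0 + 1 / l\<close> is in \<open>X\<close> and isolated, so \<open>T - l\<close> is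
    bounded below off its kernel. The kernel lies in the span of \<open>EV\<close>, so this includes
    all of \<open>N\<close>.\<close>
  have Nr: "norm (T f) \<le> r * norm f" if f: "f \<in> N" for f
  proof (rule ccontr)
    assume "\<not> ?thesis"
    then have "r * norm f < norm (T f)" by simp
    then obtain l where l: "r < \<bar>l\<bar>" "\<not> bdd_below_op N (\<lambda>x. T x - l *\<^sub>R x)"
      by (rule N.sup_spectrum[OF less_imp_le[OF r] f]) blast
    have l0: "l \<noteq> 0" using l(1) r by auto
    have NH: "N \<subseteq> H" by (auto simp: N_def)
    have "\<not> bdd_below_op H (\<lambda>x. T x - l *\<^sub>R x)" using l(2) NH unfolding bdd_below_op_def by blast
    then have xs: "complex_of_real (x0 + 1 / l) \<in> ?\<sigma>" by (rule T_spec[OF l0])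
    have "\<bar>1 / l\<bar> \<le> 1 / r" using l(1) r by (simp add: frac_le)
    then have xX: "complex_of_real (x0 + 1 / l) \<in> X" using xs by (simp add: X_def dist_norm norm_divide)
    obtain \<delta> where \<delta>: "\<delta> > 0" "\<And>y. y \<in> ?\<sigma> \<Longrightarrow> y \<noteq> complex_of_real (x0 + 1 / l) \<Longrightarrow> \<delta> \<le> dist y (complex_of_real (x0 + 1 / l))"
      by (rule not_islimpt_ball[OF nolim]) blast
    interpret S: bounded_symmetric H "\<lambda>x. T x - l *\<^sub>R x" "K + \<bar>l\<bar>" by (rule T.symmetric_shift)
    \<comment> \<open>Chosen so that \<open>l + t\<close> stays away from 0 and
      \<open>x0 + 1 / (l + t)\<close> stays within \<open>\<delta>\<close> of
      \<open>x0 + 1 / l\<close>.\<close>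
    define d where "d = min (\<bar>l\<bar> / 2) (\<delta> * l\<^sup>2 / 2)"
    have d: "d > 0" "d \<le> \<bar>l\<bar> / 2" "d \<le> \<delta> * l\<^sup>2 / 2" using l0 \<delta>(1) by (auto simp: d_def)
    have gap: "bdd_below_op H (\<lambda>x. T x - l *\<^sub>R x - t *\<^sub>R x)" if t: "0 < \<bar>t\<bar>" "\<bar>t\<bar> < d" for t
    proof (rule ccontr)
      assume "\<not> bdd_below_op H (\<lambda>x. T x - l *\<^sub>R x - t *\<^sub>R x)"
      then have nb: "\<not> bdd_below_op H (\<lambda>x. T x - (l + t) *\<^sub>R x)" by (simp add: algebra_simps)
      have lt: "\<bar>l\<bar> / 2 < \<bar>l + t\<bar>" using t(2) d(2) by linarith
      then have lt0: "l + t \<noteq> 0" using l0 by auto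
      have s: "complex_of_real (x0 + 1 / (l + t)) \<in> ?\<sigma>" by (rule T_spec[OF lt0 nb])
      have ne: "1 / (l + t) \<noteq> 1 / l" using l0 lt0 t(1) by (simp add: field_simps)
      then have "\<delta> \<le> dist (complex_of_real (x0 + 1 / (l + t))) (complex_of_real (x0 + 1 / l))"
        by (intro \<delta>(2)[OF s]) (simp only: of_real_eq_iff add_left_cancel not_False_eq_True)
      also have "\<dots> = \<bar>1 / (l + t) - 1 / l\<bar>" by (simp only: dist_of_real dist_real_def add_diff_cancel_left)
      also have "1 / (l + t) - 1 / l = - t / (l * (l + t))" using l0 lt0 by (simp add: field_simps)
      also have "\<bar>- t / (l * (l + t))\<bar> = \<bar>t\<bar> / (\<bar>l\<bar> * \<bar>l + t\<bar>)" by (simp add: abs_mult)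
      also have "\<dots> \<le> \<bar>t\<bar> / (\<bar>l\<bar> * (\<bar>l\<bar> / 2))" using lt l0 lt0 by (intro divide_left_mono mult_left_mono mult_pos_pos) auto
      also have "\<dots> = 2 * \<bar>t\<bar> / l\<^sup>2" using l0 by (simp add: power2_eq_square field_simps)
      finally have "\<delta> * l\<^sup>2 \<le> 2 * \<bar>t\<bar>" using l0 by (simp add: field_simps)
      then show False using t(2) d(3) by linarith
    qed
    have "d * norm g \<le> norm (T g - l *\<^sub>R g)" if g: "g \<in> N" for g
    proof (rule S.isolated_bdd_below_op[OF d(1) gap])
      show gH: "g \<in> H" using g NH by blast
      fix y assume y: "y \<in> H" "T y - l *\<^sub>R y = 0"
      have Ry: "R y \<in> D" "B (R y) = y" "J (R y) = l *\<^sub>R y" using R[OF y(1)] y(2) by (auto simp: T_def)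
      have yJ: "y = (1 / l) *\<^sub>R J (R y)" using Ry(3) l0 by simp
      have "J (A (R y)) = y + x0 *\<^sub>R J (R y)" using Ry(2) by (simp add: B_def algebra_simps)
      then have "J (A (R y)) = (x0 + 1 / l) *\<^sub>R J (R y)" using yJ by (metis add.commute scaleR_add_left)
      then have "R y \<in> eigenspace_op m V D A (complex_of_real (x0 + 1 / l))" using Ry(1) unfolding eigenspace_iff by blast
      then have "J (R y) \<in> EV" using xX by (auto simp: EV_def)
      then have "inner g (J (R y)) = 0" using g by (simp add: N_def)
      then show "inner g y = 0" by (subst yJ) simp
    qed
    then show False using l(2) d(1) unfolding bdd_below_op_def by blast
  qed
  obtain a where a: "\<And>n. a n \<in> span F" "\<And>n y. y \<in> span F \<Longrightarrow> inner (J (\<psi> n) - a n) y = 0" "a \<longlonglongrightarrow> 0"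
    using orthonormal_approx[OF F(1) wk] by metis
  have "span F \<subseteq> H" using F(2) subspace_H by (rule span_minimal)
  then have xN: "J (\<psi> n) - a n \<in> N" for n
    using a(1)[of n] a(2) EVF D_ell2[OF \<psi>(1)[of n]] subspace_diff[OF subspace_H] unfolding N_def H_def by blast
  \<comment> \<open>The part \<open>x\<close> of \<open>\<psi> n\<close> in \<open>N\<close>
    satisfies \<open>inner x (J (\<psi> n)) \<le> norm x / 2\<close>, because \<open>T\<close>
    undoes \<open>A - x0\<close>; yet this product is nearly 1 if \<open>a n\<close> is small. The
    number 1/3 solves \<open>1 - s = (1 + s) / 2\<close>.\<close>
  have low: "1 / 3 \<le> norm (a n)" for n
  proof -
    let ?x = "J (\<psi> n) - a n"
    have xH: "?x \<in> H" using xN[of n] by (simp add: N_def)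
    have "inner ?x (J (\<psi> n)) = inner (T ?x) (B (\<psi> n))" using T.symm[OF xH BH[OF \<psi>(1)]] TB[OF \<psi>(1)] by simp
    also have "\<dots> \<le> norm (T ?x) * norm (B (\<psi> n))" by (rule norm_cauchy_schwarz)
    also have "\<dots> \<le> (r * norm ?x) * C1" using Nr[OF xN] gb C1 r by (intro mult_mono) auto
    also have "\<dots> = norm ?x / 2" using C1 by (simp add: r_def)
    also have "norm ?x \<le> 1 + norm (a n)" using norm_triangle_ineq4[of "J (\<psi> n)" "a n"] \<psi>(2)[of n] by simp
    finally have "inner ?x (J (\<psi> n)) \<le> (1 + norm (a n)) / 2" by simp
    moreover have "1 - norm (a n) \<le> inner ?x (J (\<psi> n))"
      using \<psi>(2)[of n] norm_cauchy_schwarz[of "a n" "J (\<psi> n)"] by (simp add: inner_diff_left dot_square_norm)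
    ultimately have "1 - norm (a n) \<le> (1 + norm (a n)) / 2" by (rule order_trans[rotated])
    then show ?thesis by (simp add: field_simps)
  qed
  have "(\<lambda>n. norm (a n)) \<longlonglongrightarrow> 0" using tendsto_norm_zero[OF a(3)] .
  then have "1 / 3 \<le> (0::real)" using low by (intro LIMSEQ_le_const) auto
  then show False by simp
qed

end

context sa_laplacian
begin

lemma ess_spectrum_bounded_degrees:
  assumes Z: "infinite {v\<in>V. deg E v < N}"
  shows "ess_spectrum (\<lambda>_. 1) V D A \<noteq> {}"
proof -
  obtain v :: "nat \<Rightarrow> complex" where v: "inj v" "range v \<subseteq> {v\<in>V. deg E v < N}" using infinite_countable_subset[OF Z] by blast
  have vV: "v n \<in> V" "deg E (v n) < N" for n using v(2) by auto
  have d: "delta (v n) 1 \<in> fin_supp V" for n by (rule delta_fin_supp[OF vV(1)])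
  show ?thesis
  \<comment> \<open>The image of a point mass at a vertex of degree \<open>d\<close> has squared
    norm \<open>d\<^sup>2 + d\<close>, which is at most \<open>(N + N)\<^sup>2\<close>.\<close>
  proof (rule ess_spectrum_nonempty[where \<psi> = "\<lambda>n. delta (v n) 1" and C = "real N + real N"])
    show "delta (v n) 1 \<in> D" for n by (rule core[OF d])
    show "norm (J (delta (v n) 1)) = 1" for n using norm_delta[OF vV(1)] by simp
    show "(\<lambda>n. inner y (J (delta (v n) 1))) \<longlonglongrightarrow> 0" for y by (rule delta_weakly_null[OF v(1) vV(1)]) simp
    fix n
    show "norm (J (A (delta (v n) 1))) \<le> real N + real N"
    proof (rule l2_norm_le)
      fix F :: "complex set" assume F: "finite F"
      let ?g = "\<lambda>x. (cmod (lap V E (delta (v n) 1) x))\<^sup>2"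
      let ?X = "insert (v n) (nb (v n))"
      have "(\<Sum>x\<in>F. (cmod (l2app (J (A (delta (v n) 1))) x))\<^sup>2) = (\<Sum>x\<in>F. ?g x)"
        by (rule sum.cong[OF refl], subst app_J[OF A_ell2[OF core[OF d]]]) (simp add: A_core[OF d])
      also have "\<dots> = (\<Sum>x\<in>F \<inter> ?X. ?g x)"
        by (rule sum.mono_neutral_right[OF F]) (auto simp: lap_delta[OF vV(1)])
      also have "\<dots> \<le> (\<Sum>x\<in>?X. ?g x)" by (rule sum_mono2) (auto simp: finite_nb)
      also have "\<dots> = ?g (v n) + (\<Sum>x\<in>nb (v n). ?g x)" using finite_nb nb_irrefl by simp
      also have "(\<Sum>x\<in>nb (v n). ?g x) = (\<Sum>x\<in>nb (v n). 1)"
        by (rule sum.cong[OF refl]) (use nb_irrefl[of "v n"] in \<open>auto simp: lap_delta[OF vV(1)]\<close>)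
      also have "?g (v n) = (real (deg E (v n)))\<^sup>2" by (simp add: lap_delta[OF vV(1)])
      finally have "(\<Sum>x\<in>F. (cmod (l2app (J (A (delta (v n) 1))) x))\<^sup>2) \<le> (real (deg E (v n)))\<^sup>2 + real (deg E (v n))"
        by (simp add: card_nb)
      also have "\<dots> \<le> (real N)\<^sup>2 + real N" using vV(2)[of n] by (intro add_mono power_mono) auto
      also have "\<dots> \<le> (real N + real N)\<^sup>2"
      proof -
        have "real N \<le> (real N)\<^sup>2" unfolding of_nat_power[symmetric] of_nat_le_iff by (cases N) (auto simp: power2_eq_square)
        then show ?thesis by (simp add: power2_eq_square algebra_simps)
      qed
      finally show "(\<Sum>x\<in>F. (cmod (l2app (J (A (delta (v n) 1))) x))\<^sup>2) \<le> (real N + real N)\<^sup>2" .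
    qed simp
  qed
qed

end

section \<open>The normalized Laplacian\<close>

context plane_net
begin

sublocale wt: weighted "\<lambda>v. real (deg E v)" V
  by unfold_locales (use deg_pos in simp)

abbreviation L :: "(complex \<Rightarrow> complex) set" where "L \<equiv> ell2 (\<lambda>v. real (deg E v)) V"

definition avg :: "(complex \<Rightarrow> complex) \<Rightarrow> complex \<Rightarrow> complex" where
  "avg \<phi> v = (if v \<in> V then (\<Sum>w\<in>nb v. \<phi> w) / of_nat (deg E v) else 0)"

lemma nlap_eq: "\<phi> \<in> L \<Longrightarrow> nlap V E \<phi> = (\<lambda>v. \<phi> v - avg \<phi> v)"
proof
  fix v assume p: "\<phi> \<in> L"
  show "nlap V E \<phi> v = \<phi> v - avg \<phi> v"
  proof (cases "v \<in> V")
    case True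
    then show ?thesis using deg_pos[OF True]
      by (simp add: nlap_def avg_def nb_def[symmetric] sum_subtractf card_nb diff_divide_distrib)
  qed (use p in \<open>simp add: nlap_def avg_def ell2_def\<close>)
qed

lemma avg_comb: "avg (\<lambda>x. \<phi> x + c * \<psi> x) = (\<lambda>x. avg \<phi> x + c * avg \<psi> x)"
  by (rule ext) (simp add: avg_def sum.distrib sum_distrib_left add_divide_distrib)

lemma avg_diff: "avg (\<lambda>x. \<phi> x - \<psi> x) = (\<lambda>x. avg \<phi> x - avg \<psi> x)"
  using avg_comb[of \<phi> "-1" \<psi>] by simp

lemma avg_sq:
  assumes v: "v \<in> V"
  shows "real (deg E v) * (cmod (avg \<phi> v))\<^sup>2 \<le> (\<Sum>w\<in>nb v. (cmod (\<phi> w))\<^sup>2)"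
proof -
  have "(cmod (\<Sum>w\<in>nb v. \<phi> w))\<^sup>2 \<le> (\<Sum>w\<in>nb v. 1 * cmod (\<phi> w))\<^sup>2"
    using norm_sum[of \<phi> "nb v"] by (intro power_mono) auto
  also have "\<dots> \<le> (\<Sum>w\<in>nb v. 1\<^sup>2) * (\<Sum>w\<in>nb v. (cmod (\<phi> w))\<^sup>2)" by (rule Cauchy_Schwarz_ineq_sum)
  finally have "(cmod (\<Sum>w\<in>nb v. \<phi> w))\<^sup>2 \<le> real (deg E v) * (\<Sum>w\<in>nb v. (cmod (\<phi> w))\<^sup>2)" by (simp add: card_nb)
  then show ?thesis using v deg_pos[OF v]
    by (simp add: avg_def norm_divide power_divide power2_eq_square field_simps)
qed

definition nbhd :: "complex set \<Rightarrow> complex set" where "nbhd W = W \<union> (\<Union>v\<in>W. nb v)"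

lemma finite_nbhd: "finite W \<Longrightarrow> finite (nbhd W)" and nbhd_V: "W \<subseteq> V \<Longrightarrow> nbhd W \<subseteq> V"
  and nbhd_sup: "W \<subseteq> nbhd W" and nbhd_nb: "v \<in> W \<Longrightarrow> nb v \<subseteq> nbhd W"
  using finite_nb nb_in by (auto simp: nbhd_def)

text \<open>Cauchy-Schwarz at each vertex and double counting of edges: averaging is a contraction.
  The right side runs over \<open>nbhd W\<close> because averages involve the neighbours.\<close>

lemma avg_sum:
  assumes W: "finite W" "W \<subseteq> V"
  shows "(\<Sum>v\<in>W. real (deg E v) * (cmod (avg \<phi> v))\<^sup>2) \<le> (\<Sum>v\<in>nbhd W. real (deg E v) * (cmod (\<phi> v))\<^sup>2)"
proof -
  have "(\<Sum>v\<in>W. real (deg E v) * (cmod (avg \<phi> v))\<^sup>2) \<le> (\<Sum>v\<in>W. \<Sum>w\<in>nb v. (cmod (\<phi> w))\<^sup>2)"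
    by (intro sum_mono avg_sq) (use W in auto)
  also have "\<dots> = (\<Sum>v\<in>W. \<Sum>w\<in>nbhd W. edge_ind v w * (cmod (\<phi> w))\<^sup>2)"
    by (intro sum.cong[OF refl] sum_nb finite_nbhd W nbhd_nb)
  also have "\<dots> \<le> (\<Sum>v\<in>nbhd W. \<Sum>w\<in>nbhd W. edge_ind v w * (cmod (\<phi> w))\<^sup>2)"
    by (intro sum_mono2 finite_nbhd W nbhd_sup sum_nonneg mult_nonneg_nonneg edge_ind_nonneg) simp
  also have "\<dots> = (\<Sum>w\<in>nbhd W. \<Sum>v\<in>nbhd W. edge_ind w v * (cmod (\<phi> w))\<^sup>2)"
    by (subst sum.swap) (simp add: edge_ind_sym)
  also have "\<dots> = (\<Sum>w\<in>nbhd W. (\<Sum>v\<in>nbhd W. edge_ind w v) * (cmod (\<phi> w))\<^sup>2)" by (simp add: sum_distrib_right)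
  also have "\<dots> \<le> (\<Sum>v\<in>nbhd W. real (deg E v) * (cmod (\<phi> v))\<^sup>2)"
    by (intro sum_mono mult_right_mono sum_edge_ind_le_deg finite_nbhd W) simp
  finally show ?thesis .
qed

lemma sum_le_norm:
  assumes p: "\<phi> \<in> L" and W: "finite W" "W \<subseteq> V"
  shows "(\<Sum>v\<in>W. real (deg E v) * (cmod (\<phi> v))\<^sup>2) \<le> (norm (wt.J \<phi>))\<^sup>2"
proof -
  have "(\<Sum>v\<in>W. real (deg E v) * (cmod (\<phi> v))\<^sup>2) = (\<Sum>v\<in>W. (cmod (l2app (wt.J \<phi>) v))\<^sup>2)"
  proof (rule sum.cong[OF refl])
    fix v assume "v \<in> W"
    then have "v \<in> V" using W by blast
    then show "real (deg E v) * (cmod (\<phi> v))\<^sup>2 = (cmod (l2app (wt.J \<phi>) v))\<^sup>2"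
      using wt.cmod_weight[of v "\<phi> v"] by (simp only: wt.l2app_J[OF p] if_True)
  qed
  also have "\<dots> \<le> (norm (wt.J \<phi>))\<^sup>2" by (rule l2_finite_le[OF W(1)])
  finally show ?thesis .
qed

lemma avg_ell2: "\<phi> \<in> L \<Longrightarrow> avg \<phi> \<in> L" and norm_avg: "\<phi> \<in> L \<Longrightarrow> norm (wt.J (avg \<phi>)) \<le> norm (wt.J \<phi>)"
proof -
  assume p: "\<phi> \<in> L"
  let ?f = "\<lambda>x. if x \<in> V then complex_of_real (sqrt (real (deg E x))) * avg \<phi> x else 0"
  have le: "(\<Sum>x\<in>F. (cmod (?f x))\<^sup>2) \<le> (norm (wt.J \<phi>))\<^sup>2" if F: "finite F" for F
  proof -
    have "(\<Sum>x\<in>F. (cmod (?f x))\<^sup>2) = (\<Sum>x\<in>F \<inter> V. (cmod (?f x))\<^sup>2)"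
      by (rule sum.mono_neutral_right[OF F]) auto
    also have "\<dots> = (\<Sum>x\<in>F \<inter> V. real (deg E x) * (cmod (avg \<phi> x))\<^sup>2)"
      by (rule sum.cong[OF refl]) (use wt.cmod_weight in simp)
    also have "\<dots> \<le> (\<Sum>v\<in>nbhd (F \<inter> V). real (deg E v) * (cmod (\<phi> v))\<^sup>2)" by (rule avg_sum) (use F in auto)
    also have "\<dots> \<le> (norm (wt.J \<phi>))\<^sup>2" by (intro sum_le_norm p finite_nbhd nbhd_V) (use F in auto)
    finally show ?thesis .
  qed
  show a: "avg \<phi> \<in> L"
    unfolding wt.ell2_iff sq_summable_iff using le by (auto simp: avg_def)
  show "norm (wt.J (avg \<phi>)) \<le> norm (wt.J \<phi>)"
    by (rule l2_norm_le) (use le in \<open>simp_all only: wt.l2app_J[OF a] norm_ge_zero\<close>)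
qed

text \<open>For a point mass both sides are computed directly. The admissible right arguments form a
  subspace that is closed because averaging is a contraction, so \<open>delta_total\<close>
  applies.\<close>

lemma avg_symmetric:
  assumes p: "\<phi> \<in> L" and q: "\<psi> \<in> L"
  shows "inner (wt.J (avg \<phi>)) (wt.J \<psi>) = inner (wt.J \<phi>) (wt.J (avg \<psi>))"
proof -
  define Q where "Q = wt.J ` {\<psi>\<in>L. inner (wt.J (avg \<phi>)) (wt.J \<psi>) = inner (wt.J \<phi>) (wt.J (avg \<psi>))}"
  have comb: "wt.J (avg (\<lambda>x. \<eta> x + c * \<theta> x)) = wt.J (avg \<eta>) + scC c (wt.J (avg \<theta>))" if "\<eta> \<in> L" "\<theta> \<in> L" for \<eta> \<theta> c
    unfolding avg_comb by (rule wt.ell2_comb(2)[OF avg_ell2 avg_ell2]) (rule that)+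
  have avg0: "avg (\<lambda>_. 0) = (\<lambda>_. 0)" by (rule ext) (simp add: avg_def)
  have QI: "wt.J \<eta> \<in> Q" if "\<eta> \<in> L" "inner (wt.J (avg \<phi>)) (wt.J \<eta>) = inner (wt.J \<phi>) (wt.J (avg \<eta>))" for \<eta>
    unfolding Q_def using that by blast
  have QE: "\<exists>\<eta>\<in>L. f = wt.J \<eta> \<and> inner (wt.J (avg \<phi>)) (wt.J \<eta>) = inner (wt.J \<phi>) (wt.J (avg \<eta>))" if "f \<in> Q" for f
    using that unfolding Q_def by blast
  have "Q = wt.H"
  proof (rule wt.delta_total)
    show "Q \<subseteq> wt.H" unfolding Q_def wt.H_def by blast
    show "subspace Q"
    proof (rule subspaceI)
      show "0 \<in> Q" using QI[OF wt.ell2_zero] by (simp add: avg0 wt.J_zero)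
      show "a + b \<in> Q" if ab: "a \<in> Q" "b \<in> Q" for a b
      proof -
        obtain \<eta> where e: "\<eta> \<in> L" "a = wt.J \<eta>" "inner (wt.J (avg \<phi>)) (wt.J \<eta>) = inner (wt.J \<phi>) (wt.J (avg \<eta>))" using QE[OF ab(1)] by blast
        obtain \<theta> where t: "\<theta> \<in> L" "b = wt.J \<theta>" "inner (wt.J (avg \<phi>)) (wt.J \<theta>) = inner (wt.J \<phi>) (wt.J (avg \<theta>))" using QE[OF ab(2)] by blast
        have s1: "scC 1 f = f" for f :: "complex l2" by (rule l2_eqI) simp
        have ab': "a + b = wt.J (\<lambda>x. \<eta> x + 1 * \<theta> x)" unfolding wt.ell2_comb(2)[OF e(1) t(1)] e(2) t(2) s1 ..
        show ?thesis unfolding ab'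
          by (rule QI[OF wt.ell2_comb(1)[OF e(1) t(1)]])
            (simp only: wt.ell2_comb(2)[OF e(1) t(1)] comb[OF e(1) t(1)] s1 inner_add_right e(3) t(3))
      qed
      show "r *\<^sub>R a \<in> Q" if a: "a \<in> Q" for r a
      proof -
        obtain \<eta> where e: "\<eta> \<in> L" "a = wt.J \<eta>" "inner (wt.J (avg \<phi>)) (wt.J \<eta>) = inner (wt.J \<phi>) (wt.J (avg \<eta>))" using QE[OF a] by blast
        have ra: "r *\<^sub>R a = wt.J (\<lambda>x. 0 + complex_of_real r * \<eta> x)"
          unfolding wt.ell2_comb(2)[OF wt.ell2_zero e(1)] wt.J_zero e(2) scC_of_real by simp
        show ?thesis unfolding ra
          by (rule QI[OF wt.ell2_comb(1)[OF wt.ell2_zero e(1)]])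
            (simp only: wt.ell2_comb(2)[OF wt.ell2_zero e(1)] comb[OF wt.ell2_zero e(1)] avg0 wt.J_zero scC_of_real inner_add_right inner_zero_right inner_scaleR_right e(3))
      qed
    qed
    show "closed Q"
      unfolding closed_sequential_limits
    proof (intro allI impI, elim conjE)
      fix f l assume f: "\<forall>n. f n \<in> Q" "f \<longlonglongrightarrow> l"
      have "\<forall>n. \<exists>\<eta>. \<eta> \<in> L \<and> f n = wt.J \<eta> \<and> inner (wt.J (avg \<phi>)) (wt.J \<eta>) = inner (wt.J \<phi>) (wt.J (avg \<eta>))"
        using f(1) QE by blast
      then obtain \<eta> where e: "\<And>n. \<eta> n \<in> L" "\<And>n. f n = wt.J (\<eta> n)"
        "\<And>n. inner (wt.J (avg \<phi>)) (wt.J (\<eta> n)) = inner (wt.J \<phi>) (wt.J (avg (\<eta> n)))" by metis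
      have "l \<in> wt.H" by (rule wt.H_lim[OF _ f(2)]) (use e(1,2) in \<open>auto simp: wt.H_def\<close>)
      then obtain \<theta> where t: "\<theta> \<in> L" "wt.J \<theta> = l" by (rule wt.H_E)
      have "(\<lambda>n. wt.J (avg (\<eta> n))) \<longlonglongrightarrow> wt.J (avg \<theta>)"
      proof (rule LIM_zero_cancel, rule Lim_null_comparison)
        show "\<forall>\<^sub>F n in sequentially. norm (wt.J (avg (\<eta> n)) - wt.J (avg \<theta>)) \<le> norm (f n - l)"
        proof (intro always_eventually allI)
          fix n
          have "wt.J (avg (\<eta> n)) - wt.J (avg \<theta>) = wt.J (avg (\<lambda>x. \<eta> n x - \<theta> x))"
            unfolding avg_diff by (rule wt.ell2_diff(2)[OF avg_ell2[OF e(1)] avg_ell2[OF t(1)], symmetric])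
          then show "norm (wt.J (avg (\<eta> n)) - wt.J (avg \<theta>)) \<le> norm (f n - l)"
            using norm_avg[OF wt.ell2_diff(1)[OF e(1)[of n] t(1)]] wt.ell2_diff(2)[OF e(1)[of n] t(1)] e(2) t(2) by simp
        qed
        show "(\<lambda>n. norm (f n - l)) \<longlonglongrightarrow> 0" by (rule tendsto_norm_zero[OF LIM_zero[OF f(2)]])
      qed
      then have 1: "(\<lambda>n. inner (wt.J \<phi>) (wt.J (avg (\<eta> n)))) \<longlonglongrightarrow> inner (wt.J \<phi>) (wt.J (avg \<theta>))" by (intro tendsto_intros)
      have "(\<lambda>n. inner (wt.J (avg \<phi>)) (f n)) \<longlonglongrightarrow> inner (wt.J (avg \<phi>)) l" by (intro tendsto_intros f(2))
      then have "(\<lambda>n. inner (wt.J \<phi>) (wt.J (avg (\<eta> n)))) \<longlonglongrightarrow> inner (wt.J (avg \<phi>)) l" unfolding e(2) e(3) .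
      then have "inner (wt.J (avg \<phi>)) (wt.J \<theta>) = inner (wt.J \<phi>) (wt.J (avg \<theta>))" unfolding t(2) using 1 by (rule LIMSEQ_unique)
      then show "l \<in> Q" unfolding t(2)[symmetric] by (rule QI[OF t(1)])
    qed
    fix v and c :: complex assume v: "v \<in> V"
    have d: "delta v c \<in> L" by (rule wt.fin_supp_ell2[OF wt.delta_fin_supp[OF v]])
    have ad: "avg (delta v c) w = (if w \<in> nb v then c / of_nat (deg E w) else 0)" for w
      using nb_sym[of w v] nb_in[of w v] finite_nb[of w] by (auto simp: avg_def delta_def)
    have "inner (wt.J \<phi>) (wt.J (avg (delta v c))) = (\<Sum>w\<in>nb v. real (deg E w) * inner (\<phi> w) (avg (delta v c) w))"
      by (rule wt.inner_finite[OF p avg_ell2[OF d] finite_nb]) (use nb_in ad in auto)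
    also have "\<dots> = (\<Sum>w\<in>nb v. inner (\<phi> w) c)"
    proof (rule sum.cong[OF refl])
      fix w assume w: "w \<in> nb v"
      have "c / of_nat (deg E w) = (1 / real (deg E w)) *\<^sub>R c" by (simp add: scaleR_conv_of_real)
      then show "real (deg E w) * inner (\<phi> w) (avg (delta v c) w) = inner (\<phi> w) c"
        using w deg_pos[of w] nb_in[OF w] by (simp add: ad)
    qed
    also have "\<dots> = real (deg E v) * inner (avg \<phi> v) c"
    proof -
      have "avg \<phi> v = (1 / real (deg E v)) *\<^sub>R (\<Sum>w\<in>nb v. \<phi> w)" using v by (simp add: avg_def scaleR_conv_of_real)
      then show ?thesis using deg_pos[OF v] by (simp add: inner_sum_left)
    qed
    finally have "inner (wt.J (avg \<phi>)) (wt.J (delta v c)) = inner (wt.J \<phi>) (wt.J (avg (delta v c)))"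
      by (simp add: wt.inner_delta[OF avg_ell2[OF p] v])
    then show "wt.J (delta v c) \<in> Q" by (rule QI[OF d])
  qed
  then have "wt.J \<psi> \<in> Q" using q by (auto simp: wt.H_def)
  then obtain \<eta> where e: "\<eta> \<in> L" "wt.J \<psi> = wt.J \<eta>" "inner (wt.J (avg \<phi>)) (wt.J \<eta>) = inner (wt.J \<phi>) (wt.J (avg \<eta>))" using QE by blast
  have "\<psi> = \<eta>" by (rule wt.J_inj[OF q e(1,2)])
  then show ?thesis using e(3) by simp
qed

lemma nlap_ell2: "\<phi> \<in> L \<Longrightarrow> nlap V E \<phi> \<in> L"
  and J_nlap: "\<phi> \<in> L \<Longrightarrow> wt.J (nlap V E \<phi>) = wt.J \<phi> - wt.J (avg \<phi>)"
  using wt.ell2_diff[OF _ avg_ell2] by (auto simp: nlap_eq)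

lemma nlap_comb: "nlap V E (\<lambda>x. \<phi> x + c * \<psi> x) = (\<lambda>x. nlap V E \<phi> x + c * nlap V E \<psi> x)"
proof
  fix v
  have "(\<Sum>w\<in>nb v. (\<phi> v + c * \<psi> v) - (\<phi> w + c * \<psi> w)) = (\<Sum>w\<in>nb v. \<phi> v - \<phi> w) + c * (\<Sum>w\<in>nb v. \<psi> v - \<psi> w)"
    by (simp add: sum_distrib_left sum.distrib[symmetric] algebra_simps)
  then show "nlap V E (\<lambda>x. \<phi> x + c * \<psi> x) v = nlap V E \<phi> v + c * nlap V E \<psi> v"
    by (simp add: nlap_def nb_def[symmetric] add_divide_distrib)
qed

lemma self_adjoint_nlap: "self_adjoint_op (\<lambda>v. real (deg E v)) V L (nlap V E)"
  unfolding self_adjoint_op_def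
proof (intro conjI ballI allI impI)
  show "(\<lambda>_. 0) \<in> L" by (rule wt.ell2_zero)
next
  fix \<phi> \<psi> and c :: complex assume p: "\<phi> \<in> L" "\<psi> \<in> L"
  show "(\<lambda>x. \<phi> x + c * \<psi> x) \<in> L" by (rule wt.ell2_comb(1)[OF p])
  show "nlap V E (\<lambda>x. \<phi> x + c * \<psi> x) = (\<lambda>x. nlap V E \<phi> x + c * nlap V E \<psi> x)" by (rule nlap_comb)
next
  fix \<phi> assume p: "\<phi> \<in> L"
  show "nlap V E \<phi> \<in> L" by (rule nlap_ell2[OF p])
  fix e :: real assume "e > 0"
  then show "\<exists>\<psi>\<in>L. nrm (\<lambda>v. real (deg E v)) V (\<lambda>x. \<phi> x - \<psi> x) < e"
    by (intro bexI[OF _ p]) (simp add: nrm_def)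
next
  fix \<phi> \<psi> assume p: "\<phi> \<in> L" and q: "\<psi> \<in> L"
  have s: "inner (wt.J (nlap V E \<phi>)) (wt.J \<theta>) = inner (wt.J \<phi>) (wt.J (nlap V E \<theta>))" if t: "\<theta> \<in> L" for \<theta>
    using avg_symmetric[OF p t] by (simp add: J_nlap[OF p] J_nlap[OF t] inner_diff_left inner_diff_right)
  have "nlap V E (\<lambda>x. - \<i> * \<psi> x) = (\<lambda>x. - \<i> * nlap V E \<psi> x)"
    using nlap_comb[of "\<lambda>_. 0" "- \<i>" \<psi>] by (simp add: nlap_def fun_eq_iff)
  then have i: "wt.J (nlap V E (\<lambda>x. - \<i> * \<psi> x)) = scC (- \<i>) (wt.J (nlap V E \<psi>))"
    using wt.ell2_scale(2)[OF nlap_ell2[OF q], of "- \<i>"] by simp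
  show "ip (\<lambda>v. real (deg E v)) V (nlap V E \<phi>) \<psi> = ip (\<lambda>v. real (deg E v)) V \<phi> (nlap V E \<psi>)"
    unfolding wt.ip_J[OF nlap_ell2[OF p] q] wt.ip_J[OF p nlap_ell2[OF q]] s[OF q]
    using s[OF wt.ell2_scale(1)[OF q, of "- \<i>"], unfolded i wt.ell2_scale(2)[OF q]] by simp
qed auto

sublocale nl: sa_op "\<lambda>v. real (deg E v)" V L "nlap V E"
  by unfold_locales (rule self_adjoint_nlap)

text \<open>Let \<open>h\<close> be the modulus of the average on \<open>W\<close> and
  \<open>f\<close> that of \<open>\<phi>\<close>. On \<open>W\<close> the degree times
  \<open>h\<close> is at most the sum of \<open>f\<close> over the neighbours, so \<open>G\<close>
  is at most the mixed adjacency form of \<open>h\<close> and \<open>f\<close>, and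
  \<open>2 * G\<close> at most the form of \<open>h + f\<close>. The form bound, with
  \<open>N\<close> turning the unweighted sum into a weighted one, returns \<open>G + 1\<close> with
  a coefficient that can be made small.\<close>

lemma avg_tail:
  fixes \<phi> :: "complex \<Rightarrow> complex"
  assumes W: "finite W" "W \<subseteq> V" and l: "0 < l" and N: "0 < N" "\<And>x. x \<in> nbhd W \<Longrightarrow> N \<le> real (deg E x)"
    and p: "(\<Sum>v\<in>nbhd W. real (deg E v) * (cmod (\<phi> v))\<^sup>2) \<le> 1"
  defines "G \<equiv> (\<Sum>v\<in>W. real (deg E v) * (cmod (avg \<phi> v))\<^sup>2)"
  shows "G \<le> (5 * l / N + 1 / l) * (G + 1)"
proof -
  define X where "X = nbhd W"
  define h where "h v = (if v \<in> W then cmod (avg \<phi> v) else 0)" for v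
  define f where "f v = cmod (\<phi> v)" for v
  define S where "S g = (\<Sum>v\<in>X. real (deg E v) * (g v)\<^sup>2)" for g :: "complex \<Rightarrow> real"
  have X: "finite X" "X \<subseteq> V" "W \<subseteq> X" unfolding X_def using W finite_nbhd nbhd_V nbhd_sup by auto
  have h0: "0 \<le> h v" and f0: "0 \<le> f v" for v by (auto simp: h_def f_def)
  have Gh: "G = S h" unfolding G_def S_def by (rule sum.mono_neutral_cong_left) (use X in \<open>auto simp: h_def\<close>)
  have "real (deg E v) * (h v)\<^sup>2 \<le> (\<Sum>w\<in>X. edge_ind v w * (h v * f w))" if v: "v \<in> X" for v
  proof (cases "v \<in> W")
    case True
    have vV: "v \<in> V" using True W by blast
    have "real (deg E v) * h v = cmod (\<Sum>w\<in>nb v. \<phi> w)" using True vV deg_pos[OF vV] by (simp add: h_def avg_def norm_divide)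
    also have "\<dots> \<le> (\<Sum>w\<in>nb v. f w)" unfolding f_def by (rule norm_sum)
    also have "\<dots> = (\<Sum>w\<in>X. edge_ind v w * f w)" by (rule sum_nb) (use X nbhd_nb[OF True] in \<open>auto simp: X_def\<close>)
    finally have "real (deg E v) * h v * h v \<le> (\<Sum>w\<in>X. edge_ind v w * f w) * h v" by (rule mult_right_mono) (rule h0)
    then show ?thesis by (simp add: sum_distrib_left power2_eq_square algebra_simps)
  qed (simp add: h_def)
  then have 1: "S h \<le> (\<Sum>v\<in>X. \<Sum>w\<in>X. edge_ind v w * (h v * f w))" unfolding S_def by (rule sum_mono)
  have sw: "(\<Sum>v\<in>X. \<Sum>w\<in>X. edge_ind v w * (f v * h w)) = (\<Sum>v\<in>X. \<Sum>w\<in>X. edge_ind v w * (h v * f w))"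
    by (subst sum.swap) (simp add: edge_ind_sym mult.commute)
  have "(\<Sum>v\<in>X. \<Sum>w\<in>X. edge_ind v w * ((h v + f v) * (h w + f w))) = (\<Sum>v\<in>X. \<Sum>w\<in>X. edge_ind v w * (h v * h w)) + (\<Sum>v\<in>X. \<Sum>w\<in>X. edge_ind v w * (f v * f w))
      + (\<Sum>v\<in>X. \<Sum>w\<in>X. edge_ind v w * (h v * f w)) + (\<Sum>v\<in>X. \<Sum>w\<in>X. edge_ind v w * (f v * h w))"
    by (simp add: sum.distrib[symmetric] algebra_simps)
  moreover have "0 \<le> (\<Sum>v\<in>X. \<Sum>w\<in>X. edge_ind v w * (h v * h w))" "0 \<le> (\<Sum>v\<in>X. \<Sum>w\<in>X. edge_ind v w * (f v * f w))"
    by (intro sum_nonneg mult_nonneg_nonneg edge_ind_nonneg h0 f0)+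
  ultimately have 2: "2 * S h \<le> (\<Sum>v\<in>X. \<Sum>w\<in>X. edge_ind v w * ((h v + f v) * (h w + f w)))" using 1 sw by linarith
  also have "\<dots> \<le> 5 * l * (\<Sum>v\<in>X. (h v + f v)\<^sup>2) + (1 / l) * S (\<lambda>v. h v + f v)"
    unfolding S_def by (rule quad_bound_deg[OF l X(1,2)])
  also have "(\<Sum>v\<in>X. (h v + f v)\<^sup>2) \<le> S (\<lambda>v. h v + f v) / N"
  proof -
    have "N * (\<Sum>v\<in>X. (h v + f v)\<^sup>2) \<le> S (\<lambda>v. h v + f v)"
      unfolding S_def sum_distrib_left by (intro sum_mono mult_right_mono) (use N(2) in \<open>auto simp: X_def\<close>)
    then show ?thesis using N(1) by (simp add: field_simps)
  qed
  finally have "2 * S h \<le> 5 * l * (S (\<lambda>v. h v + f v) / N) + (1 / l) * S (\<lambda>v. h v + f v)" using l by simp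
  also have "\<dots> = (5 * l / N + 1 / l) * S (\<lambda>v. h v + f v)" by (simp add: algebra_simps)
  also have "S (\<lambda>v. h v + f v) \<le> 2 * S h + 2 * S f"
  proof -
    have "(h v + f v)\<^sup>2 \<le> 2 * (h v)\<^sup>2 + 2 * (f v)\<^sup>2" for v
      using sum_squares_bound[of "h v" "f v"] by (simp add: power2_sum)
    then have "real (deg E v) * (h v + f v)\<^sup>2 \<le> real (deg E v) * (2 * (h v)\<^sup>2 + 2 * (f v)\<^sup>2)" for v by (rule mult_left_mono) simp
    then have "S (\<lambda>v. h v + f v) \<le> (\<Sum>v\<in>X. real (deg E v) * (2 * (h v)\<^sup>2 + 2 * (f v)\<^sup>2))" unfolding S_def by (rule sum_mono)
    also have "\<dots> = 2 * S h + 2 * S f" by (simp add: S_def sum.distrib sum_distrib_left algebra_simps)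
    finally show ?thesis .
  qed
  also have "2 * S h + 2 * S f \<le> 2 * (G + 1)" using p by (simp add: Gh S_def f_def X_def)
  finally have "2 * S h \<le> (5 * l / N + 1 / l) * (2 * (G + 1))" using l N(1) by (simp add: mult_left_mono)
  then have "2 * G \<le> 2 * ((5 * l / N + 1 / l) * (G + 1))" unfolding Gh[symmetric] by (simp only: mult.left_commute[of _ 2])
  then show ?thesis by (rule mult_left_le_imp_le) simp
qed

lemma avg_compact:
  assumes dinf: "\<And>N. finite {v\<in>V. deg E v < N}"
    and \<phi>: "\<And>n :: nat. \<phi> n \<in> L" "\<And>n. norm (wt.J (\<phi> n)) \<le> 1"
  obtains r l where "strict_mono (r :: nat \<Rightarrow> nat)" "(\<lambda>n. wt.J (avg (\<phi> (r n)))) \<longlonglongrightarrow> l"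
proof (rule l2_convergent_subsequence[OF countable_V])
  show "l2app (wt.J (avg (\<phi> n))) x = 0" if "x \<notin> V" for n x by (rule wt.J_outside[OF avg_ell2[OF \<phi>(1)] that])
  show "norm (wt.J (avg (\<phi> n))) \<le> 1" for n using norm_avg[OF \<phi>(1)[of n]] \<phi>(2)[of n] by simp
  fix e :: real assume e: "e > 0"
  \<comment> \<open>\<open>G \<le> d * (G + 1)\<close> with \<open>d \<le> 1/2\<close> gives
    \<open>G \<le> 2 * d \<le> e\<close>; the choices of \<open>l\<close> and \<open>N\<close> make
    each summand of the coefficient in \<open>avg_tail\<close> at most \<open>d / 2\<close>.\<close>
  define d where "d = min (1/2) (e/2)"
  have d: "0 < d" "d \<le> 1/2" "d \<le> e/2" using e by (auto simp: d_def)
  define l where "l = 2 / d"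
  have l: "0 < l" using d(1) by (simp add: l_def)
  define N where "N = nat \<lceil>10 * l / d\<rceil> + 1"
  have N: "10 * l / d \<le> real N" "0 < real N" unfolding N_def by linarith+
  have "5 * l / real N \<le> d / 2" using N d(1) by (simp add: field_simps)
  then have ld: "5 * l / real N + 1 / l \<le> d" by (simp add: l_def)
  \<comment> \<open>Neighbours of vertices of low degree are excluded too, so that all of
    \<open>nbhd W\<close> has high degree.\<close>
  define K where "K = nbhd {v\<in>V. deg E v < N}"
  show "\<exists>K. finite K \<and> (\<forall>n W. finite W \<longrightarrow> W \<subseteq> V - K \<longrightarrow> (\<Sum>x\<in>W. (cmod (l2app (wt.J (avg (\<phi> n))) x))\<^sup>2) \<le> e)"
  proof (intro exI[of _ K] conjI allI impI)
    show "finite K" unfolding K_def by (rule finite_nbhd[OF dinf])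
    fix n W assume W: "finite W" "W \<subseteq> V - K"
    let ?G = "\<Sum>v\<in>W. real (deg E v) * (cmod (avg (\<phi> n) v))\<^sup>2"
    have WV: "W \<subseteq> V" using W(2) by blast
    have "?G \<le> (5 * l / real N + 1 / l) * (?G + 1)"
    proof (rule avg_tail[OF W(1) WV l N(2)])
      fix x assume x: "x \<in> nbhd W"
      have xV: "x \<in> V" using x nbhd_V[OF WV] by blast
      have "x \<notin> {v\<in>V. deg E v < N}"
        using x W(2) nb_sym unfolding nbhd_def K_def by blast
      then show "real N \<le> real (deg E x)" using xV by simp
    next
      have "(\<Sum>v\<in>nbhd W. real (deg E v) * (cmod (\<phi> n v))\<^sup>2) \<le> (norm (wt.J (\<phi> n)))\<^sup>2"
        by (intro sum_le_norm \<phi>(1) finite_nbhd nbhd_V W(1) WV)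
      also have "\<dots> \<le> 1" using \<phi>(2)[of n] by (simp add: power_le_one)
      finally show "(\<Sum>v\<in>nbhd W. real (deg E v) * (cmod (\<phi> n v))\<^sup>2) \<le> 1" .
    qed
    also have "\<dots> \<le> d * (?G + 1)" using ld by (intro mult_right_mono add_nonneg_nonneg sum_nonneg mult_nonneg_nonneg) auto
    also have "\<dots> \<le> ?G / 2 + d"
    proof -
      have "d * ?G \<le> 1/2 * ?G" using d(2) by (intro mult_right_mono sum_nonneg mult_nonneg_nonneg) auto
      then show ?thesis by (simp add: distrib_left)
    qed
    finally have "?G \<le> e" using d(3) by linarith
    moreover have "(\<Sum>x\<in>W. (cmod (l2app (wt.J (avg (\<phi> n))) x))\<^sup>2) = ?G"
    proof (rule sum.cong[OF refl])
      fix v assume "v \<in> W"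
      then have "v \<in> V" using WV by blast
      then show "(cmod (l2app (wt.J (avg (\<phi> n))) v))\<^sup>2 = real (deg E v) * (cmod (avg (\<phi> n) v))\<^sup>2"
        using wt.cmod_weight[of v "avg (\<phi> n) v"] by (simp only: wt.l2app_J[OF avg_ell2[OF \<phi>(1)]] if_True)
    qed
    ultimately show "(\<Sum>x\<in>W. (cmod (l2app (wt.J (avg (\<phi> n))) x))\<^sup>2) \<le> e" by simp
  qed
qed

text \<open>For an approximate eigenvector with parameter \<open>s\<close> the average is close to
  \<open>(1 - s) * \<phi>\<close>. Compactness of averaging therefore yields convergent subsequences
  away from 1, and normalised point masses show that some point of essential spectrum
  remains.\<close>

lemma ess_spectrum_nlap:
  assumes dinf: "\<And>N. finite {v\<in>V. deg E v < N}"
  shows "ess_spectrum (\<lambda>v. real (deg E v)) V L (nlap V E) = {1}"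
proof -
  let ?S = "ess_spectrum (\<lambda>v. real (deg E v)) V L (nlap V E)"
  have "complex_of_real t \<notin> ?S" if t: "t \<noteq> 1" for t
  proof (rule nl.not_in_ess_spectrum)
    fix \<phi> :: "nat \<Rightarrow> complex \<Rightarrow> complex" and s
    assume \<phi>: "\<And>n. \<phi> n \<in> L" "\<And>n. norm (wt.J (\<phi> n)) \<le> 1" and s: "s \<longlonglongrightarrow> t" "(\<lambda>n. wt.J (nlap V E (\<phi> n)) - s n *\<^sub>R wt.J (\<phi> n)) \<longlonglongrightarrow> 0"
    obtain r l where r: "strict_mono (r :: nat \<Rightarrow> nat)" "(\<lambda>n. wt.J (avg (\<phi> (r n)))) \<longlonglongrightarrow> l" by (rule avg_compact[OF dinf \<phi>])
    have sr: "(\<lambda>n. s (r n)) \<longlonglongrightarrow> t" using LIMSEQ_subseq_LIMSEQ[OF s(1) r(1)] by (simp add: comp_def)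
    have "(\<lambda>n. wt.J (nlap V E (\<phi> (r n))) - s (r n) *\<^sub>R wt.J (\<phi> (r n))) \<longlonglongrightarrow> 0"
      using LIMSEQ_subseq_LIMSEQ[OF s(2) r(1)] by (simp add: comp_def)
    from tendsto_add[OF this r(2)]
    have "(\<lambda>n. (1 - s (r n)) *\<^sub>R wt.J (\<phi> (r n))) \<longlonglongrightarrow> l" by (simp add: J_nlap[OF \<phi>(1)] algebra_simps)
    then have lim: "(\<lambda>n. inverse (1 - s (r n)) *\<^sub>R ((1 - s (r n)) *\<^sub>R wt.J (\<phi> (r n)))) \<longlonglongrightarrow> inverse (1 - t) *\<^sub>R l"
      using t by (intro tendsto_intros sr) auto
    have "\<forall>\<^sub>F n in sequentially. s (r n) \<noteq> 1" using sr t by (rule tendsto_imp_eventually_ne)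
    then have "\<forall>\<^sub>F n in sequentially. inverse (1 - s (r n)) *\<^sub>R ((1 - s (r n)) *\<^sub>R wt.J (\<phi> (r n))) = wt.J (\<phi> (r n))"
      by (rule eventually_mono) simp
    with lim have "(\<lambda>n. wt.J (\<phi> (r n))) \<longlonglongrightarrow> inverse (1 - t) *\<^sub>R l" by (rule Lim_transform_eventually)
    then show "\<exists>r l. strict_mono (r :: nat \<Rightarrow> nat) \<and> (\<lambda>n. wt.J (\<phi> (r n))) \<longlonglongrightarrow> l" using r(1) by blast
  qed
  then have "z = 1" if "z \<in> ?S" for z using nl.ess_spectrum_real[OF that] that by (metis of_real_1)
  moreover have "?S \<noteq> {}"
  proof -
    obtain v :: "nat \<Rightarrow> complex" where v: "inj v" "range v \<subseteq> V" using infinite_countable_subset[OF inf] by blast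
    have vV: "v n \<in> V" for n using v(2) by blast
    define c where "c n = complex_of_real (1 / sqrt (real (deg E (v n))))" for n
    have c: "sqrt (real (deg E (v n))) * cmod (c n) = 1" for n
      using deg_pos[OF vV[of n]] by (simp add: c_def norm_divide)
    have d: "delta (v n) (c n) \<in> L" for n by (rule wt.fin_supp_ell2[OF wt.delta_fin_supp[OF vV]])
    show ?thesis
    proof (rule nl.ess_spectrum_nonempty[where \<psi> = "\<lambda>n. delta (v n) (c n)" and C = 2])
      show n1: "norm (wt.J (delta (v n) (c n))) = 1" for n using wt.norm_delta[OF vV[of n], of "c n"] c[of n] by simp
      show "norm (wt.J (nlap V E (delta (v n) (c n)))) \<le> 2" for n
        using norm_triangle_ineq4[of "wt.J (delta (v n) (c n))" "wt.J (avg (delta (v n) (c n)))"] norm_avg[OF d[of n]] n1[of n]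
        by (simp add: J_nlap[OF d])
      show "(\<lambda>n. inner y (wt.J (delta (v n) (c n)))) \<longlonglongrightarrow> 0" for y
        by (rule wt.delta_weakly_null[OF v(1) vV]) (simp add: c)
    qed (rule d)
  qed
  ultimately show ?thesis by blast
qed

end

section \<open>Curvature and degrees at infinity\<close>

lemma curvature_divergence_iff:
  assumes pg: "plane_graph V E" and sp: "simple_pg E" and cg: "connected_graph V E"
    and lf: "locally_finite_pg E" and inf: "infinite V"
  shows "(\<forall>vs. tends_to_infty V vs \<longrightarrow> filterlim (\<lambda>n. kappaV V E (vs n)) at_bot sequentially) \<longleftrightarrow>
    (\<forall>N. finite {v\<in>V. deg E v < N})"
proof
  assume R: "\<forall>N. finite {v\<in>V. deg E v < N}"
  have big: "V \<noteq> {a, b}" for a b using inf by auto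
  show "\<forall>vs. tends_to_infty V vs \<longrightarrow> filterlim (\<lambda>n. kappaV V E (vs n)) at_bot sequentially"
  proof (intro allI impI)
    fix vs assume vs: "tends_to_infty V vs"
    show "filterlim (\<lambda>n. kappaV V E (vs n)) at_bot sequentially"
      unfolding filterlim_at_bot
    proof
      fix Z :: real
      \<comment> \<open>The degree from which on \<open>curvature_upper\<close> gives a curvature of
        at most \<open>Z\<close>.\<close>
      define N where "N = nat \<lceil>6 * (1 - Z)\<rceil>"
      have N: "6 * (1 - Z) \<le> real N" unfolding N_def by linarith
      have "\<forall>\<^sub>F n in sequentially. vs n \<notin> {v\<in>V. deg E v < N}"
        using vs R unfolding tends_to_infty_def by blast
      then show "\<forall>\<^sub>F n in sequentially. kappaV V E (vs n) \<le> Z"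
      proof (rule eventually_mono)
        fix n assume n: "vs n \<notin> {v\<in>V. deg E v < N}"
        have vV: "vs n \<in> V" using vs by (simp add: tends_to_infty_def)
        have "real N \<le> real (deg E (vs n))" using n vV by simp
        then have "1 - real (deg E (vs n)) / 6 \<le> Z" using N by simp
        then show "kappaV V E (vs n) \<le> Z" using curvature_upper[OF pg sp lf cg big vV] by (rule order_trans[rotated])
      qed
    qed
  qed
next
  assume L: "\<forall>vs. tends_to_infty V vs \<longrightarrow> filterlim (\<lambda>n. kappaV V E (vs n)) at_bot sequentially"
  show "\<forall>N. finite {v\<in>V. deg E v < N}"
  proof (rule allI, rule ccontr)
    fix N assume "infinite {v\<in>V. deg E v < N}"
    then obtain vs :: "nat \<Rightarrow> complex" where vs: "inj vs" "range vs \<subseteq> {v\<in>V. deg E v < N}"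
      using infinite_countable_subset by blast
    have vV: "vs n \<in> V" "deg E (vs n) < N" for n using vs(2) by auto
    have "\<forall>\<^sub>F n in sequentially. vs n \<notin> K" if K: "finite K" for K
    proof -
      have "finite {n. vs n \<in> K}" using finite_vimageI[OF K vs(1)] by (simp add: vimage_def)
      then show ?thesis unfolding cofinite_eq_sequentially[symmetric] eventually_cofinite by simp
    qed
    then have "tends_to_infty V vs" using vV(1) by (simp add: tends_to_infty_def)
    then have "filterlim (\<lambda>n. kappaV V E (vs n)) at_bot sequentially" using L by blast
    then have "\<forall>\<^sub>F n in sequentially. kappaV V E (vs n) \<le> - real N" unfolding filterlim_at_bot by blast
    then obtain n where "kappaV V E (vs n) \<le> - real N" unfolding eventually_sequentially by blast
    moreover have "1 - real (deg E (vs n)) / 2 \<le> kappaV V E (vs n)" by (rule curvature_lower)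
    moreover have "real (deg E (vs n)) < real N" using vV(2) by simp
    ultimately show False by linarith
  qed
qed

theorem theorem6p1:
  fixes V :: "complex set" and E :: "curve set"
  assumes "plane_graph V E" and "simple_pg E" and "connected_graph V E"
    and "locally_finite_pg E"
    and "\<forall>v\<in>V. kappaV V E v \<le> 0"
  shows "((\<forall>vs. tends_to_infty V vs \<longrightarrow> filterlim (\<lambda>n. kappaV V E (vs n)) at_bot sequentially)
            \<longrightarrow> ess_spectrum (\<lambda>v. real (deg E v)) V (ell2 (\<lambda>v. real (deg E v)) V) (nlap V E) = {1})
       \<and> (\<forall>D A. laplacian_sa V E D A \<longrightarrow>
            (ess_spectrum (\<lambda>_. 1) V D A = {} \<longleftrightarrow>
             (\<forall>vs. tends_to_infty V vs \<longrightarrow> filterlim (\<lambda>n. kappaV V E (vs n)) at_bot sequentially)))"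
proof -
  have inf: "infinite V" by (rule infinite_vertices[OF assms(1-3,5)])
  note iff = curvature_divergence_iff[OF assms(1-4) inf]
  interpret plane_net V E by unfold_locales (rule assms inf)+
  have 2: "ess_spectrum (\<lambda>_. 1) V D A = {} \<longleftrightarrow> (\<forall>N. finite {v\<in>V. deg E v < N})"
    if "laplacian_sa V E D A" for D A
  proof -
    interpret sa_laplacian V E D A by unfold_locales (rule that)
    show ?thesis using ess_spectrum_empty ess_spectrum_bounded_degrees by metis
  qed
  show ?thesis unfolding iff using ess_spectrum_nlap 2 by blast
qed

end
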